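(* Let $A$ be a symmetric $\mathcal{O}$-algebra such that $K\otimes_{\mathcal{O}}A$ is split semisimple. Let $A'$ be an $\mathcal{O}$-algebra Morita equivalent to $A$, and suppose that both $A$ and $A'$ have the projective scalar property. Let $U$ be a Knörr $A$-lattice and let $U'$ be an $A'$-lattice corresponding to $U$ through a Morita equivalence between $A$ and $A'$. Then $U'$ is a Knörr $A'$-lattice and $h(U)=h(U')$.
   Context: Let $p$ be a prime. $\mathcal{O}$ is a complete discrete valuation ring with maximal ideal $J(\mathcal{O})=\pi\mathcal{O}$, residue field $k=\mathcal{O}/J(\mathcal{O})$ of characteristic $p$, and field of fractions $K$ of characteristic $0$. An $\mathcal{O}$-algebra $A$ is symmetric if it is isomorphic to its $\mathcal{O}$-dual $A^*=\mathrm{Hom}_{\mathcal{O}}(A,\mathcal{O})$ as an $A$-$A$-bimodule (so $A$ is free of finite rank over $\mathcal{O}$). The image $s\in A^*$ of $1_A$ under a bimodule isomorphism $A\cong A^*$ is called a symmetrising form. Given a symmetrising form $s$ and an $\mathcal{O}$-basis $X$ of $A$ with dual basis $X^\vee=\{x^\vee : x\in X\}$ (that is, $s(xx^\vee)=1$ and $s(xy^\vee)=0$ for $x\ne y$ in $X$), the relative projective element of $A$ with respect to $s$ is $z_A=\sum_{x\in X}xx^\vee\in Z(A)$; it is independent of $X$. A symmetric $\mathcal{O}$-algebra $A$ has the projective scalar property if there is a symmetrising form $s$ of $A$ whose relative projective element is $z_A=\lambda1_A$ for some $\lambda\in\mathcal{O}$. Morita equivalences are $\mathcal{O}$-linear.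 An $A$-lattice is a left unital $A$-module which is free of finite rank over $\mathcal{O}$; it is irreducible if $K\otimes_{\mathcal{O}}V$ is a simple $K\otimes_{\mathcal{O}}A$-module. An indecomposable $A$-lattice $U$ is a Knörr lattice if the linear trace $\mathrm{tr}_U:\mathrm{End}_{\mathcal{O}}(U)\to\mathcal{O}$ satisfies $\mathrm{tr}_U(\alpha)\mathcal{O}\subseteq\mathrm{rk}_{\mathcal{O}}(U)\mathcal{O}$ for every $\alpha\in\mathrm{End}_A(U)$, with equality precisely when $\alpha$ is an automorphism. For a positive integer $r$, $r_p$ denotes its $p$-part (the largest power of $p$ dividing $r$). For a nonzero $A$-lattice $U$, the height $h(U)$ is the number defined by $\mathrm{rank}(U)_p=p^{m+h(U)}$, where $p^m=\min_V\{\mathrm{rank}(V)_p\}$ as $V$ ranges over all irreducible $A$-lattices. The height of an $A'$-lattice is defined in the same way with respect to $A'$. *)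

theory Defs
  imports
    "HOL-Algebra.Algebraic_Closure_Type"
    "HOL-Algebra.Free_Abelian_Groups"
    "HOL-Algebra.QuotRing"
    "HOL-Algebra.Ring_Divisibility"
    "HOL-Algebra.Module"
    "HOL-Library.FuncSet"
    "HOL-Library.Equipollence"
    "HOL-Computational_Algebra.Fraction_Field"
begin

text \<open>
  Scalar rings are types (the valuation ring is a type \<open>'o :: idom\<close> and its field of
  fractions is \<open>'o fract\<close>). Algebras and modules are records of type
  \<open>(_, _) module\<close> with an explicit carrier; as usual in HOL-Algebra, the
  multiplicative fields of such a record carry no meaning when it is used as a module.
\<close>


section \<open>The ground ring\<close>

abbreviation type_ring :: "'r::comm_ring_1 ring"
  where "type_ring \<equiv> ring_of_type_algebra"

text \<open>A principal ideal domain with exactly one maximal ideal, which is generated by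
  \<open>\<pi>\<close> and is not zero, and which is complete in its \<open>\<pi>\<close>-adic topology.\<close>

definition complete_dvr :: "'o::idom \<Rightarrow> bool" where
  "complete_dvr \<pi> \<longleftrightarrow>
     principal_domain (type_ring :: 'o ring) \<and>
     {J. maximalideal J (type_ring :: 'o ring)} = {PIdl\<^bsub>type_ring\<^esub> \<pi>} \<and>
     \<pi> \<noteq> 0 \<and>
     (\<forall>f :: nat \<Rightarrow> 'o.
        (\<forall>n. \<exists>N. \<forall>i\<ge>N. \<forall>j\<ge>N. \<pi> ^ n dvd f i - f j) \<longrightarrow>
        (\<exists>l. \<forall>n. \<exists>N. \<forall>i\<ge>N. \<pi> ^ n dvd f i - l))"

definition residue_field :: "'o::idom \<Rightarrow> 'o set ring" where
  "residue_field \<pi> = type_ring Quot (PIdl\<^bsub>type_ring\<^esub> \<pi>)"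

definition has_char :: "('a, 'm) ring_scheme \<Rightarrow> nat \<Rightarrow> bool" where
  "has_char R p \<longleftrightarrow> (\<forall>n::nat. [n] \<cdot>\<^bsub>R\<^esub> \<one>\<^bsub>R\<^esub> = \<zero>\<^bsub>R\<^esub> \<longleftrightarrow> p dvd n)"


section \<open>Algebras and modules\<close>

text \<open>The library's locale for modules requires the ring to be commutative; this is the same
  definition without that restriction.\<close>

locale left_module = R?: ring R + M?: abelian_group M
  for R :: "('a, 'r) ring_scheme" and M :: "('a, 'm) module" (structure) +
  assumes smult_closed:
      "\<lbrakk>a \<in> carrier R; x \<in> carrier M\<rbrakk> \<Longrightarrow> a \<odot>\<^bsub>M\<^esub> x \<in> carrier M"
    and smult_l_distr:
      "\<lbrakk>a \<in> carrier R; b \<in> carrier R; x \<in> carrier M\<rbrakk> \<Longrightarrow>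
         (a \<oplus>\<^bsub>R\<^esub> b) \<odot>\<^bsub>M\<^esub> x = a \<odot>\<^bsub>M\<^esub> x \<oplus>\<^bsub>M\<^esub> b \<odot>\<^bsub>M\<^esub> x"
    and smult_r_distr:
      "\<lbrakk>a \<in> carrier R; x \<in> carrier M; y \<in> carrier M\<rbrakk> \<Longrightarrow>
         a \<odot>\<^bsub>M\<^esub> (x \<oplus>\<^bsub>M\<^esub> y) = a \<odot>\<^bsub>M\<^esub> x \<oplus>\<^bsub>M\<^esub> a \<odot>\<^bsub>M\<^esub> y"
    and smult_assoc:
      "\<lbrakk>a \<in> carrier R; b \<in> carrier R; x \<in> carrier M\<rbrakk> \<Longrightarrow>
         (a \<otimes>\<^bsub>R\<^esub> b) \<odot>\<^bsub>M\<^esub> x = a \<odot>\<^bsub>M\<^esub> (b \<odot>\<^bsub>M\<^esub> x)"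
    and smult_one:
      "x \<in> carrier M \<Longrightarrow> \<one>\<^bsub>R\<^esub> \<odot>\<^bsub>M\<^esub> x = x"

definition assoc_algebra :: "('r::comm_ring_1, 'a) module \<Rightarrow> bool" where
  "assoc_algebra A \<longleftrightarrow> ring A \<and> left_module type_ring A \<and>
     (\<forall>r. \<forall>x\<in>carrier A. \<forall>y\<in>carrier A.
        (r \<odot>\<^bsub>A\<^esub> x) \<otimes>\<^bsub>A\<^esub> y = r \<odot>\<^bsub>A\<^esub> (x \<otimes>\<^bsub>A\<^esub> y) \<and>
        x \<otimes>\<^bsub>A\<^esub> (r \<odot>\<^bsub>A\<^esub> y) = r \<odot>\<^bsub>A\<^esub> (x \<otimes>\<^bsub>A\<^esub> y))"

definition restrict_scalars ::
  "('r::comm_ring_1, 'a) module \<Rightarrow> ('a, 'v) module \<Rightarrow> ('r, 'v) module" where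
  "restrict_scalars A V =
     \<lparr> carrier = carrier V, monoid.mult = monoid.mult V, one = one V,
       ring.zero = ring.zero V, add = add V,
       Module.module.smult = (\<lambda>r v. (r \<odot>\<^bsub>A\<^esub> \<one>\<^bsub>A\<^esub>) \<odot>\<^bsub>V\<^esub> v) \<rparr>"

text \<open>Homomorphisms are extensional functions, so that they are determined by their
  values on the carrier.\<close>

definition module_Hom ::
  "('a, 'r) ring_scheme \<Rightarrow> ('a, 'v) module \<Rightarrow> ('a, 'w) module \<Rightarrow> ('v \<Rightarrow> 'w) set" where
  "module_Hom R V W = {f \<in> carrier V \<rightarrow>\<^sub>E carrier W.
     (\<forall>x\<in>carrier V. \<forall>y\<in>carrier V. f (x \<oplus>\<^bsub>V\<^esub> y) = f x \<oplus>\<^bsub>W\<^esub> f y) \<and>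
     (\<forall>a\<in>carrier R. \<forall>x\<in>carrier V. f (a \<odot>\<^bsub>V\<^esub> x) = a \<odot>\<^bsub>W\<^esub> f x)}"

definition module_Iso ::
  "('a, 'r) ring_scheme \<Rightarrow> ('a, 'v) module \<Rightarrow> ('a, 'w) module \<Rightarrow> ('v \<Rightarrow> 'w) set" where
  "module_Iso R V W = {f \<in> module_Hom R V W. bij_betw f (carrier V) (carrier W)}"

definition simple_module :: "('a, 'r) ring_scheme \<Rightarrow> ('a, 'v) module \<Rightarrow> bool" where
  "simple_module R V \<longleftrightarrow> left_module R V \<and> carrier V \<noteq> {\<zero>\<^bsub>V\<^esub>} \<and>
     (\<forall>W. submodule W R V \<longrightarrow> W = {\<zero>\<^bsub>V\<^esub>} \<or> W = carrier V)"

text \<open>The module is the sum of its simple submodules.\<close>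

definition semisimple_module :: "('a, 'r) ring_scheme \<Rightarrow> ('a, 'v) module \<Rightarrow> bool" where
  "semisimple_module R V \<longleftrightarrow> left_module R V \<and>
     carrier V = generate (add_monoid V)
       (\<Union>{W. submodule W R V \<and> simple_module R (V\<lparr>carrier := W\<rparr>)})"

definition indecomposable_module :: "('a, 'r) ring_scheme \<Rightarrow> ('a, 'v) module \<Rightarrow> bool" where
  "indecomposable_module R V \<longleftrightarrow> left_module R V \<and> carrier V \<noteq> {\<zero>\<^bsub>V\<^esub>} \<and>
     (\<forall>W1 W2. submodule W1 R V \<and> submodule W2 R V \<and>
        W1 <+>\<^bsub>V\<^esub> W2 = carrier V \<and> W1 \<inter> W2 = {\<zero>\<^bsub>V\<^esub>} \<longrightarrow>
        W1 = {\<zero>\<^bsub>V\<^esub>} \<or> W2 = {\<zero>\<^bsub>V\<^esub>})"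

definition regular_module :: "('a, 'r) ring_scheme \<Rightarrow> ('a, 'a) module" where
  "regular_module R =
     \<lparr> carrier = carrier R, monoid.mult = monoid.mult R, one = one R,
       ring.zero = ring.zero R, add = add R, Module.module.smult = monoid.mult R \<rparr>"

text \<open>A simple module is isomorphic to a quotient of the regular module, so every isomorphism
  class of simple modules has a representative whose carrier is a set of elements of type
  \<open>'b\<close>.\<close>

definition split_semisimple :: "('k::comm_ring_1, 'b) module \<Rightarrow> bool" where
  "split_semisimple B \<longleftrightarrow> assoc_algebra B \<and> semisimple_module B (regular_module B) \<and>
     (\<forall>S :: ('b, 'b) module. simple_module B S \<longrightarrow>
        (\<forall>\<phi>\<in>module_Hom B S S. \<exists>c. \<forall>x\<in>carrier S. \<phi> x = (c \<odot>\<^bsub>B\<^esub> \<one>\<^bsub>B\<^esub>) \<odot>\<^bsub>S\<^esub> x))"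


section \<open>Bases, rank and trace\<close>

definition is_finite_basis :: "('r::comm_ring_1, 'v) module \<Rightarrow> 'v set \<Rightarrow> bool" where
  "is_finite_basis V E \<longleftrightarrow> finite E \<and> E \<subseteq> carrier V \<and>
     (\<forall>v\<in>carrier V. \<exists>!c. c \<in> extensional E \<and> v = finsum V (\<lambda>x. c x \<odot>\<^bsub>V\<^esub> x) E)"

definition free_finite_rank :: "('r::comm_ring_1, 'v) module \<Rightarrow> bool" where
  "free_finite_rank V \<longleftrightarrow> left_module type_ring V \<and> (\<exists>E. is_finite_basis V E)"

definition some_basis :: "('r::comm_ring_1, 'v) module \<Rightarrow> 'v set" where
  "some_basis V = (SOME E. is_finite_basis V E)"

definition module_rank :: "('r::comm_ring_1, 'v) module \<Rightarrow> nat" where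
  "module_rank V = card (some_basis V)"

definition coordinates :: "('r::comm_ring_1, 'v) module \<Rightarrow> 'v set \<Rightarrow> 'v \<Rightarrow> 'v \<Rightarrow> 'r" where
  "coordinates V E v = (THE c. c \<in> extensional E \<and> v = finsum V (\<lambda>x. c x \<odot>\<^bsub>V\<^esub> x) E)"

definition module_trace :: "('r::comm_ring_1, 'v) module \<Rightarrow> ('v \<Rightarrow> 'v) \<Rightarrow> 'r" where
  "module_trace V \<alpha> = (\<Sum>x\<in>some_basis V. coordinates V (some_basis V) (\<alpha> x) x)"


section \<open>Symmetric algebras\<close>

definition dual_module :: "('r::comm_ring_1, 'a) module \<Rightarrow> ('a \<Rightarrow> 'r) set" where
  "dual_module A = {f \<in> extensional (carrier A).
     (\<forall>x\<in>carrier A. \<forall>y\<in>carrier A. f (x \<oplus>\<^bsub>A\<^esub> y) = f x + f y) \<and>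
     (\<forall>r. \<forall>x\<in>carrier A. f (r \<odot>\<^bsub>A\<^esub> x) = r * f x)}"

text \<open>The bimodule structure on the dual is \<open>(a \<cdot> f \<cdot> b) z = f (b z a)\<close>.\<close>

definition dual_bimodule_iso :: "('r::comm_ring_1, 'a) module \<Rightarrow> ('a \<Rightarrow> 'a \<Rightarrow> 'r) \<Rightarrow> bool" where
  "dual_bimodule_iso A \<Phi> \<longleftrightarrow> bij_betw \<Phi> (carrier A) (dual_module A) \<and>
     (\<forall>x\<in>carrier A. \<forall>y\<in>carrier A. \<forall>z\<in>carrier A. \<Phi> (x \<oplus>\<^bsub>A\<^esub> y) z = \<Phi> x z + \<Phi> y z) \<and>
     (\<forall>a\<in>carrier A. \<forall>x\<in>carrier A. \<forall>b\<in>carrier A. \<forall>z\<in>carrier A.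
        \<Phi> (a \<otimes>\<^bsub>A\<^esub> x \<otimes>\<^bsub>A\<^esub> b) z = \<Phi> x (b \<otimes>\<^bsub>A\<^esub> z \<otimes>\<^bsub>A\<^esub> a))"

definition symmetric_algebra :: "('r::comm_ring_1, 'a) module \<Rightarrow> bool" where
  "symmetric_algebra A \<longleftrightarrow> assoc_algebra A \<and> free_finite_rank A \<and> (\<exists>\<Phi>. dual_bimodule_iso A \<Phi>)"

definition symmetrising_form :: "('r::comm_ring_1, 'a) module \<Rightarrow> ('a \<Rightarrow> 'r) \<Rightarrow> bool" where
  "symmetrising_form A s \<longleftrightarrow> (\<exists>\<Phi>. dual_bimodule_iso A \<Phi> \<and> s = \<Phi> \<one>\<^bsub>A\<^esub>)"

definition dual_basis_elt ::
  "('r::comm_ring_1, 'a) module \<Rightarrow> ('a \<Rightarrow> 'r) \<Rightarrow> 'a set \<Rightarrow> 'a \<Rightarrow> 'a" where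
  "dual_basis_elt A s E y =
     (THE z. z \<in> carrier A \<and> (\<forall>x\<in>E. s (x \<otimes>\<^bsub>A\<^esub> z) = (if x = y then 1 else 0)))"

definition rel_proj_elt :: "('r::comm_ring_1, 'a) module \<Rightarrow> ('a \<Rightarrow> 'r) \<Rightarrow> 'a" where
  "rel_proj_elt A s =
     (let E = some_basis A in finsum A (\<lambda>x. x \<otimes>\<^bsub>A\<^esub> dual_basis_elt A s E x) E)"

definition projective_scalar_property :: "('r::comm_ring_1, 'a) module \<Rightarrow> bool" where
  "projective_scalar_property A \<longleftrightarrow> symmetric_algebra A \<and>
     (\<exists>s r. symmetrising_form A s \<and> rel_proj_elt A s = r \<odot>\<^bsub>A\<^esub> \<one>\<^bsub>A\<^esub>)"


section \<open>Extension of scalars to the field of fractions\<close>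

text \<open>The tensor product of the field of fractions with a module \<open>M\<close> is the free abelian group
  on pairs \<open>(k, m)\<close>, modulo the subgroup generated by the bilinearity relations; its
  elements are cosets. Operations are defined on coset representatives; the unions below
  range over sets that coincide because the operations are well defined.\<close>

type_synonym ('o, 'm) tens = "(('o fract \<times> 'm) \<Rightarrow>\<^sub>0 int) set"

definition tensor_free :: "('o::idom, 'm) module \<Rightarrow> (('o fract \<times> 'm) \<Rightarrow>\<^sub>0 int) monoid" where
  "tensor_free M = free_Abelian_group (UNIV \<times> carrier M)"

definition tensor_relators :: "('o::idom, 'm) module \<Rightarrow> ('o, 'm) tens" where
  "tensor_relators M =
     {frag_of (k + l, m) - frag_of (k, m) - frag_of (l, m) | k l m. m \<in> carrier M} \<union>
     {frag_of (k, m \<oplus>\<^bsub>M\<^esub> n) - frag_of (k, m) - frag_of (k, n) | k m n.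
        m \<in> carrier M \<and> n \<in> carrier M} \<union>
     {frag_of (k * Fract r 1, m) - frag_of (k, r \<odot>\<^bsub>M\<^esub> m) | k r m. m \<in> carrier M}"

definition tensor_kernel :: "('o::idom, 'm) module \<Rightarrow> ('o, 'm) tens" where
  "tensor_kernel M = generate (tensor_free M) (tensor_relators M)"

definition tensor_coset :: "('o::idom, 'm) module \<Rightarrow> (('o fract \<times> 'm) \<Rightarrow>\<^sub>0 int) \<Rightarrow> ('o, 'm) tens" where
  "tensor_coset M f = tensor_kernel M #>\<^bsub>tensor_free M\<^esub> f"

definition tensor_group :: "('o::idom, 'm) module \<Rightarrow> ('o, 'm) tens monoid" where
  "tensor_group M = tensor_free M Mod tensor_kernel M"

definition tensor_scale :: "('o::idom, 'm) module \<Rightarrow> 'o fract \<Rightarrow> ('o, 'm) tens \<Rightarrow> ('o, 'm) tens" where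
  "tensor_scale M k S =
     (\<Union>f\<in>S. tensor_coset M (frag_extend (\<lambda>(l, m). frag_of (k * l, m)) f))"

text \<open>The biadditive extension of \<open>(k \<otimes> a, l \<otimes> m) \<mapsto> kl \<otimes> act a m\<close>.\<close>

definition tensor_act ::
  "('a \<Rightarrow> 'm \<Rightarrow> 'm) \<Rightarrow> ('o::idom, 'm) module \<Rightarrow> ('o, 'a) tens \<Rightarrow> ('o, 'm) tens \<Rightarrow> ('o, 'm) tens" where
  "tensor_act act M S T =
     (\<Union>f\<in>S. \<Union>g\<in>T. tensor_coset M
        (frag_extend (\<lambda>(k, a). frag_extend (\<lambda>(l, m). frag_of (k * l, act a m)) g) f))"

definition frac_algebra :: "('o::idom, 'a) module \<Rightarrow> ('o fract, ('o, 'a) tens) module" where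
  "frac_algebra A =
     \<lparr> carrier = carrier (tensor_group A),
       monoid.mult = tensor_act (monoid.mult A) A,
       one = tensor_coset A (frag_of (1, \<one>\<^bsub>A\<^esub>)),
       ring.zero = one (tensor_group A),
       add = monoid.mult (tensor_group A),
       Module.module.smult = tensor_scale A \<rparr>"

definition frac_module ::
  "('o::idom, 'a) module \<Rightarrow> ('a, 'v) module \<Rightarrow> (('o, 'a) tens, ('o, 'v) tens) module" where
  "frac_module A V = (let V0 = restrict_scalars A V in
     \<lparr> carrier = carrier (tensor_group V0),
       monoid.mult = undefined,
       one = undefined,
       ring.zero = one (tensor_group V0),
       add = monoid.mult (tensor_group V0),
       Module.module.smult = tensor_act (Module.module.smult V) V0 \<rparr>)"


section \<open>Lattices, Knoerr lattices and heights\<close>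

definition lattice_over :: "('o::idom, 'a) module \<Rightarrow> ('a, 'v) module \<Rightarrow> bool" where
  "lattice_over A V \<longleftrightarrow> left_module A V \<and> free_finite_rank (restrict_scalars A V)"

definition lattice_rank :: "('o::idom, 'a) module \<Rightarrow> ('a, 'v) module \<Rightarrow> nat" where
  "lattice_rank A V = module_rank (restrict_scalars A V)"

definition irreducible_lattice :: "('o::idom, 'a) module \<Rightarrow> ('a, 'v) module \<Rightarrow> bool" where
  "irreducible_lattice A V \<longleftrightarrow>
     lattice_over A V \<and> simple_module (frac_algebra A) (frac_module A V)"

definition knoerr_lattice :: "('o::idom, 'a) module \<Rightarrow> ('a, 'v) module \<Rightarrow> bool" where
  "knoerr_lattice A V \<longleftrightarrow> lattice_over A V \<and> indecomposable_module A V \<and>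
     (\<forall>\<alpha>\<in>module_Hom A V V.
        PIdl\<^bsub>type_ring\<^esub> (module_trace (restrict_scalars A V) \<alpha>)
          \<subseteq> PIdl\<^bsub>type_ring\<^esub> (of_nat (lattice_rank A V)) \<and>
        (PIdl\<^bsub>type_ring\<^esub> (module_trace (restrict_scalars A V) \<alpha>)
           = PIdl\<^bsub>type_ring\<^esub> (of_nat (lattice_rank A V))
         \<longleftrightarrow> \<alpha> \<in> module_Iso A V V))"

definition p_part :: "nat \<Rightarrow> nat \<Rightarrow> nat" where
  "p_part p r = p ^ multiplicity p r"

definition min_p_part :: "nat \<Rightarrow> ('o::idom, 'a) module \<Rightarrow> 'v itself \<Rightarrow> nat" where
  "min_p_part p A _ =
     Inf {p_part p (lattice_rank A V) | V :: ('a, 'v) module. irreducible_lattice A V}"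

text \<open>The exponent \<open>h\<close> with \<open>p_part p (rank V) = p ^ (m + h)\<close>, where
  \<open>p ^ m\<close> is the minimum above; it is an integer so that the subtraction is not truncated.\<close>

definition lattice_height :: "nat \<Rightarrow> ('o::idom, 'a) module \<Rightarrow> ('a, 'v) module \<Rightarrow> int" where
  "lattice_height p A V =
     int (multiplicity p (p_part p (lattice_rank A V)))
     - int (multiplicity p (min_p_part p A TYPE('v)))"


section \<open>Morita equivalences\<close>

text \<open>\<open>Mod(A)\<close> is the category of all \<open>A\<close>-modules whose carrier is a subset of a universe
  type \<open>'u\<close>, which should be large enough to contain a copy of \<open>A\<close> (and then, \<open>A\<close> being
  infinite, of every finitely generated module). A functor is an object map together with a map sending \<open>M\<close>, \<open>N\<close> and a morphism
  \<open>M \<rightarrow> N\<close> to a morphism between the images.\<close>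

definition linear_functor ::
  "('o::comm_ring_1, 'a) module \<Rightarrow> ('o, 'b) module \<Rightarrow>
   (('a, 'u) module \<Rightarrow> ('b, 'u) module) \<Rightarrow>
   (('a, 'u) module \<Rightarrow> ('a, 'u) module \<Rightarrow> ('u \<Rightarrow> 'u) \<Rightarrow> ('u \<Rightarrow> 'u)) \<Rightarrow> bool" where
  "linear_functor A B Fo Fm \<longleftrightarrow>
     (\<forall>M. left_module A M \<longrightarrow> left_module B (Fo M)) \<and>
     (\<forall>M N. left_module A M \<and> left_module A N \<longrightarrow>
        Fm M N ` module_Hom A M N \<subseteq> module_Hom B (Fo M) (Fo N)) \<and>
     (\<forall>M. left_module A M \<longrightarrow>
        Fm M M (\<lambda>x\<in>carrier M. x) = (\<lambda>y\<in>carrier (Fo M). y)) \<and>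
     (\<forall>L M N. left_module A L \<and> left_module A M \<and> left_module A N \<longrightarrow>
        (\<forall>f\<in>module_Hom A L M. \<forall>g\<in>module_Hom A M N.
           Fm L N (compose (carrier L) g f) =
             compose (carrier (Fo L)) (Fm M N g) (Fm L M f))) \<and>
     (\<forall>M N. left_module A M \<and> left_module A N \<longrightarrow>
        (\<forall>f\<in>module_Hom A M N. \<forall>g\<in>module_Hom A M N.
           Fm M N (\<lambda>x\<in>carrier M. f x \<oplus>\<^bsub>N\<^esub> g x) =
             (\<lambda>y\<in>carrier (Fo M). Fm M N f y \<oplus>\<^bsub>Fo N\<^esub> Fm M N g y)) \<and>
        (\<forall>r. \<forall>f\<in>module_Hom A M N.
           Fm M N (\<lambda>x\<in>carrier M. (r \<odot>\<^bsub>A\<^esub> \<one>\<^bsub>A\<^esub>) \<odot>\<^bsub>N\<^esub> f x) =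
             (\<lambda>y\<in>carrier (Fo M). (r \<odot>\<^bsub>B\<^esub> \<one>\<^bsub>B\<^esub>) \<odot>\<^bsub>Fo N\<^esub> Fm M N f y)))"

definition naturally_iso_to_identity ::
  "('a, 'r) ring_scheme \<Rightarrow>
   (('a, 'u) module \<Rightarrow> ('a, 'u) module) \<Rightarrow>
   (('a, 'u) module \<Rightarrow> ('a, 'u) module \<Rightarrow> ('u \<Rightarrow> 'u) \<Rightarrow> ('u \<Rightarrow> 'u)) \<Rightarrow> bool" where
  "naturally_iso_to_identity A Ho Hm \<longleftrightarrow> (\<exists>\<eta>.
     (\<forall>M. left_module A M \<longrightarrow> \<eta> M \<in> module_Iso A M (Ho M)) \<and>
     (\<forall>M N. left_module A M \<and> left_module A N \<longrightarrow>
        (\<forall>f\<in>module_Hom A M N.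
           compose (carrier M) (\<eta> N) f = compose (carrier M) (Hm M N f) (\<eta> M))))"

definition morita_equivalence ::
  "('o::comm_ring_1, 'a) module \<Rightarrow> ('o, 'b) module \<Rightarrow>
   (('a, 'u) module \<Rightarrow> ('b, 'u) module) \<Rightarrow>
   (('a, 'u) module \<Rightarrow> ('a, 'u) module \<Rightarrow> ('u \<Rightarrow> 'u) \<Rightarrow> ('u \<Rightarrow> 'u)) \<Rightarrow> bool" where
  "morita_equivalence A B Fo Fm \<longleftrightarrow> linear_functor A B Fo Fm \<and>
     (\<exists>Go Gm. linear_functor B A Go Gm \<and>
        naturally_iso_to_identity A (Go \<circ> Fo) (\<lambda>M N. Gm (Fo M) (Fo N) \<circ> Fm M N) \<and>
        naturally_iso_to_identity B (Fo \<circ> Go) (\<lambda>M N. Fm (Go M) (Go N) \<circ> Gm M N))"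

end

theory Submission
  imports Defs
begin

text \<open>
  Let \<open>F\<close> be the given equivalence from \<open>A\<close>-modules to \<open>A'\<close>-modules, let \<open>s\<close> be a symmetrising
  form of \<open>A\<close> whose relative projective element is \<open>\<lambda>\<close>, and let \<open>\<lambda>'\<close> be the corresponding scalar
  for \<open>A'\<close>. The theorem rests on one trace formula: there is a central unit \<open>u\<close> of \<open>A\<close> such that
    \<open>\<lambda> tr\<^bsub>F V\<^esub>(F \<alpha>) = \<lambda>' tr\<^bsub>V\<^esub>(\<alpha> u)\<close>
  for every \<open>A\<close>-lattice \<open>V\<close> and every endomorphism \<open>\<alpha>\<close> of \<open>V\<close> (\<open>central_unit_element\<close>).

  The formula is obtained in three steps.

  \<^item> Since an equivalence preserves generators, \<open>A'\<close> is a direct summand of a finite sum of copies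
    of the image \<open>F A\<close> of the regular module (\<open>generator\<close>). This makes \<open>F V\<close> a direct summand over
    the ground ring of a finite sum of copies of \<open>V\<close>, and it gives an element \<open>a\<close> of \<open>A\<close> with
    \<open>tr\<^bsub>F V\<^esub>(F \<alpha>) = tr\<^bsub>V\<^esub>(\<alpha> a)\<close> for all \<open>V\<close> and \<open>\<alpha>\<close> (\<open>trace_image\<close>).

  \<^item> The projective scalar property says that the regular character of \<open>A\<close> is \<open>\<lambda> s\<close>
    (\<open>trace_rmult\<close>), and that replacing \<open>a\<close> by the central element \<open>w = \<Sum> x a x\<^sup>v\<close>, summed over a
    basis of \<open>A\<close> with dual basis elements \<open>x\<^sup>v\<close>, multiplies each of these traces by \<open>\<lambda>\<close>
    (\<open>trace_average\<close>). Conversely \<open>F A\<close> is a direct summand of a finite sum of copies of \<open>A'\<close>, so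
    that the endomorphisms of \<open>F A\<close> have traces divisible by \<open>\<lambda>'\<close>. Taking \<open>V = A\<close> one finds that
    \<open>\<lambda>'\<close> divides \<open>s(w b)\<close> for all \<open>b\<close>, and therefore \<open>w = \<lambda>' u\<close> for some \<open>u\<close>, because \<open>s\<close> is
    a perfect pairing (\<open>central_element\<close>).

  \<^item> Applying the formula to \<open>F\<close> and to its inverse, and comparing traces on \<open>A\<close>, shows that \<open>u\<close>
    is invertible.

  Knoerr lattices. If \<open>V\<close> is a Knoerr lattice, then \<open>u\<close> acts on \<open>V\<close> as an automorphism, so
  \<open>tr\<^bsub>V\<^esub>(u)\<close> is a unit multiple of the rank of \<open>V\<close>; with \<open>\<alpha> = 1\<close> the formula says that
  \<open>\<lambda> rk(F V)\<close> and \<open>\<lambda>' rk(V)\<close> are associated (\<open>rank_image\<close>). Since \<open>F \<alpha>\<close> is an automorphism if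
  and only if \<open>\<alpha> u\<close> is one, the Knoerr condition passes from \<open>V\<close> to \<open>F V\<close> (\<open>knoerr_image\<close>).

  Heights. An automorphism of an irreducible lattice is multiplication by a unit of the ground ring,
  because the algebra splits over the field of fractions. Hence \<open>\<lambda> rk(F V)\<close> and \<open>\<lambda>' rk(V)\<close> are
  also associated for irreducible \<open>V\<close>, and \<open>F\<close> changes the exponents of \<open>p\<close> in the ranks of \<open>U\<close>
  and of all irreducible lattices by the same amount. It then changes the minimum over the
  irreducible lattices by this amount as well, and the difference is unaltered
  (\<open>height_image\<close>).

  The last argument presupposes that \<open>F\<close> permutes the irreducible lattices (\<open>irreducible_image\<close>),
  although irreducibility refers to the algebra over the field of fractions, where \<open>F\<close> is not
  defined. It is therefore expressed by the endomorphisms of the lattice: a nonzero lattice is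
  irreducible exactly when each of its nonzero endomorphisms divides a nonzero scalar
  (\<open>irreducible_lattice_endomorphism\<close>, \<open>irreducible_lattice_of_endomorphisms\<close>). For the converse
  half the projective scalar property enters a second time, through an averaged projection.
\<close>

section \<open>Linear maps\<close>

lemma type_ring_simps [simp]:
  "carrier (type_ring :: 'r::comm_ring_1 ring) = UNIV"
  "monoid.mult (type_ring :: 'r ring) = (*)"
  "one (type_ring :: 'r ring) = 1"
  "ring.zero (type_ring :: 'r ring) = 0"
  "add (type_ring :: 'r ring) = (+)"
  by (simp_all add: ring_of_type_algebra_def fun_eq_iff)

lemma left_moduleI:
  assumes "ring R" "abelian_group M"
    and "\<And>a x. \<lbrakk>a \<in> carrier R; x \<in> carrier M\<rbrakk> \<Longrightarrow> a \<odot>\<^bsub>M\<^esub> x \<in> carrier M"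
    and "\<And>a b x. \<lbrakk>a \<in> carrier R; b \<in> carrier R; x \<in> carrier M\<rbrakk> \<Longrightarrow>
         (a \<oplus>\<^bsub>R\<^esub> b) \<odot>\<^bsub>M\<^esub> x = a \<odot>\<^bsub>M\<^esub> x \<oplus>\<^bsub>M\<^esub> b \<odot>\<^bsub>M\<^esub> x"
    and "\<And>a x y. \<lbrakk>a \<in> carrier R; x \<in> carrier M; y \<in> carrier M\<rbrakk> \<Longrightarrow>
         a \<odot>\<^bsub>M\<^esub> (x \<oplus>\<^bsub>M\<^esub> y) = a \<odot>\<^bsub>M\<^esub> x \<oplus>\<^bsub>M\<^esub> a \<odot>\<^bsub>M\<^esub> y"
    and "\<And>a b x. \<lbrakk>a \<in> carrier R; b \<in> carrier R; x \<in> carrier M\<rbrakk> \<Longrightarrow>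
         (a \<otimes>\<^bsub>R\<^esub> b) \<odot>\<^bsub>M\<^esub> x = a \<odot>\<^bsub>M\<^esub> (b \<odot>\<^bsub>M\<^esub> x)"
    and "\<And>x. x \<in> carrier M \<Longrightarrow> \<one>\<^bsub>R\<^esub> \<odot>\<^bsub>M\<^esub> x = x"
  shows "left_module R M"
  using assms by (simp add: left_module_def left_module_axioms_def)

context left_module
begin

lemma smult_r_zero: "a \<in> carrier R \<Longrightarrow> a \<odot>\<^bsub>M\<^esub> \<zero>\<^bsub>M\<^esub> = \<zero>\<^bsub>M\<^esub>"
  by (metis M.add.l_cancel_one M.zero_closed smult_closed smult_r_distr M.add.l_one)

lemma smult_l_zero: "x \<in> carrier M \<Longrightarrow> \<zero>\<^bsub>R\<^esub> \<odot>\<^bsub>M\<^esub> x = \<zero>\<^bsub>M\<^esub>"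
  by (metis M.add.l_cancel_one R.zero_closed smult_closed smult_l_distr R.add.l_one)

lemma smult_r_minus:
  assumes "a \<in> carrier R" "x \<in> carrier M"
  shows "a \<odot>\<^bsub>M\<^esub> (\<ominus>\<^bsub>M\<^esub> x) = \<ominus>\<^bsub>M\<^esub> (a \<odot>\<^bsub>M\<^esub> x)"
proof -
  have "a \<odot>\<^bsub>M\<^esub> (\<ominus>\<^bsub>M\<^esub> x) \<oplus>\<^bsub>M\<^esub> a \<odot>\<^bsub>M\<^esub> x = \<zero>\<^bsub>M\<^esub>"
    using assms by (metis M.add.inv_closed M.l_neg smult_r_distr smult_r_zero)
  then show ?thesis
    using assms by (simp add: M.minus_equality smult_closed)
qed

lemma smult_l_minus:
  assumes "a \<in> carrier R" "x \<in> carrier M"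
  shows "(\<ominus>\<^bsub>R\<^esub> a) \<odot>\<^bsub>M\<^esub> x = \<ominus>\<^bsub>M\<^esub> (a \<odot>\<^bsub>M\<^esub> x)"
proof -
  have "(\<ominus>\<^bsub>R\<^esub> a) \<odot>\<^bsub>M\<^esub> x \<oplus>\<^bsub>M\<^esub> a \<odot>\<^bsub>M\<^esub> x = \<zero>\<^bsub>M\<^esub>"
    using assms by (metis R.add.inv_closed R.l_neg smult_l_distr smult_l_zero)
  then show ?thesis
    using assms by (simp add: M.minus_equality smult_closed)
qed

lemma smult_finsum:
  assumes "a \<in> carrier R" "\<And>i. i \<in> I \<Longrightarrow> h i \<in> carrier M"
  shows "a \<odot>\<^bsub>M\<^esub> finsum M h I = finsum M (\<lambda>i. a \<odot>\<^bsub>M\<^esub> h i) I"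
  using assms(2)
proof (induction I rule: infinite_finite_induct)
  case (insert i I)
  then show ?case
    using assms(1) by (simp add: smult_r_distr smult_closed Pi_def M.finsum_closed)
qed (auto simp: assms smult_r_zero)

end

text \<open>
  Unlike the elements of \<open>module_Hom\<close>, these maps may take any values outside the carrier, so that
  compositions and sums can be written as plain functions; \<open>module_Hom_iff\<close> links the two notions.
\<close>

definition module_map ::
  "('a, 'r) ring_scheme \<Rightarrow> ('a, 'v) module \<Rightarrow> ('a, 'w) module \<Rightarrow> ('v \<Rightarrow> 'w) \<Rightarrow> bool" where
  "module_map R V W f \<longleftrightarrow> (\<forall>x\<in>carrier V. f x \<in> carrier W) \<and>
     (\<forall>x\<in>carrier V. \<forall>y\<in>carrier V. f (x \<oplus>\<^bsub>V\<^esub> y) = f x \<oplus>\<^bsub>W\<^esub> f y) \<and>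
     (\<forall>a\<in>carrier R. \<forall>x\<in>carrier V. f (a \<odot>\<^bsub>V\<^esub> x) = a \<odot>\<^bsub>W\<^esub> f x)"

lemma module_Hom_iff:
  "f \<in> module_Hom R V W \<longleftrightarrow> f \<in> extensional (carrier V) \<and> module_map R V W f"
  unfolding module_Hom_def module_map_def by (auto simp: PiE_def)

lemma module_map_closed: "\<lbrakk>module_map R V W f; x \<in> carrier V\<rbrakk> \<Longrightarrow> f x \<in> carrier W"
  and module_map_add: "\<lbrakk>module_map R V W f; x \<in> carrier V; y \<in> carrier V\<rbrakk> \<Longrightarrow>
    f (x \<oplus>\<^bsub>V\<^esub> y) = f x \<oplus>\<^bsub>W\<^esub> f y"
  and module_map_smult: "\<lbrakk>module_map R V W f; a \<in> carrier R; x \<in> carrier V\<rbrakk> \<Longrightarrow>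
    f (a \<odot>\<^bsub>V\<^esub> x) = a \<odot>\<^bsub>W\<^esub> f x"
  by (simp_all add: module_map_def)

lemma module_map_cong:
  assumes "left_module R V" "\<And>x. x \<in> carrier V \<Longrightarrow> f x = g x"
  shows "module_map R V W f \<longleftrightarrow> module_map R V W g"
proof -
  interpret left_module R V by fact
  show ?thesis
    using assms(2) by (auto simp: module_map_def smult_closed)
qed

lemma module_map_restrict [simp]:
  assumes "left_module R V"
  shows "module_map R V W (restrict f (carrier V)) \<longleftrightarrow> module_map R V W f"
  by (rule module_map_cong[OF assms]) simp

lemma module_map_compose:
  "\<lbrakk>module_map R U V f; module_map R V W g\<rbrakk> \<Longrightarrow> module_map R U W (\<lambda>x. g (f x))"
  by (simp add: module_map_def)

lemma module_map_id: "module_map R V V (\<lambda>x. x)"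
  by (simp add: module_map_def)

lemma module_map_zero:
  assumes "left_module R V" "left_module R W" "module_map R V W f"
  shows "f \<zero>\<^bsub>V\<^esub> = \<zero>\<^bsub>W\<^esub>"
proof -
  interpret V: left_module R V by fact
  interpret W: left_module R W by fact
  show ?thesis
    using module_map_add[OF assms(3), of "\<zero>\<^bsub>V\<^esub>" "\<zero>\<^bsub>V\<^esub>"] module_map_closed[OF assms(3)]
    by (metis V.M.zero_closed V.M.l_zero W.M.add.l_cancel_one)
qed

lemma module_map_minus:
  assumes "left_module R V" "left_module R W" "module_map R V W f" "x \<in> carrier V"
  shows "f (\<ominus>\<^bsub>V\<^esub> x) = \<ominus>\<^bsub>W\<^esub> f x"
proof -
  interpret V: left_module R V by fact
  interpret W: left_module R W by fact
  show ?thesis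
    using module_map_add[OF assms(3), of "\<ominus>\<^bsub>V\<^esub> x" x] module_map_closed[OF assms(3)]
      module_map_zero[OF assms(1-3)] assms(4)
    by (metis V.M.a_inv_closed V.M.l_neg W.M.minus_equality)
qed

lemma module_map_finsum:
  assumes "left_module R V" "left_module R W" "module_map R V W f"
    "\<And>i. i \<in> I \<Longrightarrow> h i \<in> carrier V"
  shows "f (finsum V h I) = finsum W (\<lambda>i. f (h i)) I"
proof -
  interpret V: left_module R V by fact
  interpret W: left_module R W by fact
  show ?thesis
    using assms(4)
  proof (induction I rule: infinite_finite_induct)
    case (insert i I)
    then show ?case
      using module_map_add[OF assms(3)] module_map_closed[OF assms(3)]
      by (simp add: Pi_def V.M.finsum_closed)
  qed (auto simp: module_map_zero[OF assms(1-3)])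
qed

lemma module_map_add_maps:
  assumes "left_module R V" "left_module R W" "module_map R V W f" "module_map R V W g"
  shows "module_map R V W (\<lambda>x. f x \<oplus>\<^bsub>W\<^esub> g x)"
proof -
  interpret V: left_module R V by fact
  interpret W: left_module R W by fact
  show ?thesis
    using assms(3,4) unfolding module_map_def
    by (auto simp: W.smult_r_distr W.M.a_ac)
qed

lemma module_map_finsum_maps:
  assumes "left_module R V" "left_module R W" "\<And>i. i \<in> I \<Longrightarrow> module_map R V W (f i)"
  shows "module_map R V W (\<lambda>x. \<Oplus>\<^bsub>W\<^esub>i\<in>I. f i x)"
proof -
  interpret V: left_module R V by fact
  interpret W: left_module R W by fact
  have zero: "module_map R V W (\<lambda>x. \<zero>\<^bsub>W\<^esub>)"
    by (simp add: module_map_def W.smult_r_zero)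
  show ?thesis
    using assms(3)
  proof (induction I rule: infinite_finite_induct)
    case (insert i I)
    have "module_map R V W (\<lambda>x. f i x \<oplus>\<^bsub>W\<^esub> (\<Oplus>\<^bsub>W\<^esub>i\<in>I. f i x))"
      using insert by (intro module_map_add_maps[OF assms(1,2)]) auto
    moreover have "(\<Oplus>\<^bsub>W\<^esub>i\<in>insert i I. f i x) = f i x \<oplus>\<^bsub>W\<^esub> (\<Oplus>\<^bsub>W\<^esub>i\<in>I. f i x)" if "x \<in> carrier V" for x
      using insert that by (intro W.M.finsum_insert) (auto intro!: module_map_closed[of R V W])
    ultimately show ?case
      by (subst module_map_cong[OF assms(1)])
  qed (use zero in auto)
qed

lemma module_map_inverse:
  assumes "left_module R V" "module_map R V W f" "bij_betw f (carrier V) (carrier W)"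
  shows "module_map R W V (inv_into (carrier V) f)"
proof -
  interpret V: left_module R V by fact
  have inv: "inv_into (carrier V) f y \<in> carrier V" "f (inv_into (carrier V) f y) = y"
    if "y \<in> carrier W" for y
    using that assms(3) by (auto simp: bij_betw_def inv_into_into f_inv_into_f)
  have inj: "inv_into (carrier V) f (f x) = x" if "x \<in> carrier V" for x
    using that assms(3) by (auto simp: bij_betw_def)
  show ?thesis
    unfolding module_map_def
  proof (intro conjI ballI)
    fix x y assume xy: "x \<in> carrier W" "y \<in> carrier W"
    let ?x = "inv_into (carrier V) f x" and ?y = "inv_into (carrier V) f y"
    have "f (?x \<oplus>\<^bsub>V\<^esub> ?y) = x \<oplus>\<^bsub>W\<^esub> y"
      using inv xy by (simp add: module_map_add[OF assms(2)])
    then show "inv_into (carrier V) f (x \<oplus>\<^bsub>W\<^esub> y) = ?x \<oplus>\<^bsub>V\<^esub> ?y"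
      using inj[of "?x \<oplus>\<^bsub>V\<^esub> ?y"] inv xy by simp
  next
    fix a x assume ax: "a \<in> carrier R" "x \<in> carrier W"
    let ?x = "inv_into (carrier V) f x"
    have "f (a \<odot>\<^bsub>V\<^esub> ?x) = a \<odot>\<^bsub>W\<^esub> x"
      using inv ax by (simp add: module_map_smult[OF assms(2)])
    then show "inv_into (carrier V) f (a \<odot>\<^bsub>W\<^esub> x) = a \<odot>\<^bsub>V\<^esub> ?x"
      using inj[of "a \<odot>\<^bsub>V\<^esub> ?x"] inv ax by (simp add: V.smult_closed)
  qed (simp add: inv)
qed

lemma submoduleI:
  assumes "left_module R V" "N \<subseteq> carrier V" "\<zero>\<^bsub>V\<^esub> \<in> N"
    "\<And>x y. \<lbrakk>x \<in> N; y \<in> N\<rbrakk> \<Longrightarrow> x \<oplus>\<^bsub>V\<^esub> y \<in> N"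
    "\<And>a x. \<lbrakk>a \<in> carrier R; x \<in> N\<rbrakk> \<Longrightarrow> a \<odot>\<^bsub>V\<^esub> x \<in> N"
  shows "submodule N R V"
proof -
  interpret V: left_module R V by fact
  have "\<ominus>\<^bsub>V\<^esub> x \<in> N" if "x \<in> N" for x
    using assms(5)[of "\<ominus>\<^bsub>R\<^esub> \<one>\<^bsub>R\<^esub>" x] that assms(2) V.smult_l_minus[of "\<one>\<^bsub>R\<^esub>" x]
    by (auto simp: V.smult_one)
  then show ?thesis
    using assms unfolding submodule_def submodule_axioms_def subgroup_def
    by (auto simp: a_inv_def)
qed

lemma submoduleD:
  assumes "submodule N R V"
  shows "N \<subseteq> carrier V" "\<zero>\<^bsub>V\<^esub> \<in> N" "\<And>x y. \<lbrakk>x \<in> N; y \<in> N\<rbrakk> \<Longrightarrow> x \<oplus>\<^bsub>V\<^esub> y \<in> N"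
    "\<And>x. x \<in> N \<Longrightarrow> \<ominus>\<^bsub>V\<^esub> x \<in> N" "\<And>a x. \<lbrakk>a \<in> carrier R; x \<in> N\<rbrakk> \<Longrightarrow> a \<odot>\<^bsub>V\<^esub> x \<in> N"
  using assms unfolding submodule_def submodule_axioms_def subgroup_def
  by (auto simp: a_inv_def)

lemma left_module_submodule:
  assumes V: "left_module R V" and N: "submodule N R V"
  shows "left_module R (V\<lparr>carrier := N\<rparr>)"
proof -
  interpret V: left_module R V by fact
  note D = submoduleD[OF N]
  have c: "x \<in> carrier V" if "x \<in> N" for x using D that by auto
  have "abelian_group (V\<lparr>carrier := N\<rparr>)"
  proof (rule abelian_groupI)
    fix x assume "x \<in> carrier (V\<lparr>carrier := N\<rparr>)"
    then show "\<exists>y\<in>carrier (V\<lparr>carrier := N\<rparr>). y \<oplus>\<^bsub>V\<lparr>carrier := N\<rparr>\<^esub> x = \<zero>\<^bsub>V\<lparr>carrier := N\<rparr>\<^esub>"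
      using D(4) c V.M.l_neg by auto
  qed (use D c in \<open>auto simp: V.M.a_ac\<close>)
  then show ?thesis
    by (intro left_moduleI)
      (use D c in \<open>auto simp: V.R.ring_axioms V.smult_l_distr V.smult_r_distr V.smult_assoc V.smult_one\<close>)
qed

lemma submodule_kernel:
  assumes "left_module R V" "left_module R W" "module_map R V W f"
  shows "submodule {x \<in> carrier V. f x = \<zero>\<^bsub>W\<^esub>} R V"
proof -
  interpret V: left_module R V by fact
  interpret W: left_module R W by fact
  show ?thesis
    by (rule submoduleI)
      (auto simp: assms V.smult_closed W.smult_r_zero module_map_zero[OF assms] module_map_add[OF assms(3)]
        module_map_smult[OF assms(3)])
qed

lemma submodule_image:
  assumes "left_module R V" "left_module R W" "module_map R V W f" "submodule N R V"
  shows "submodule (f ` N) R W"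
proof (rule submoduleI)
  note D = submoduleD[OF assms(4)]
  show "f ` N \<subseteq> carrier W" using D assms(3) by (auto simp: module_map_def)
  show "\<zero>\<^bsub>W\<^esub> \<in> f ` N" using module_map_zero[OF assms(1-3)] D(2) by (metis imageI)
  show "x \<oplus>\<^bsub>W\<^esub> y \<in> f ` N" if "x \<in> f ` N" "y \<in> f ` N" for x y
    using that D(1,3) by (auto simp: subset_iff module_map_add[OF assms(3), symmetric])
  show "a \<odot>\<^bsub>W\<^esub> x \<in> f ` N" if "a \<in> carrier R" "x \<in> f ` N" for a x
    using that D(1,5) by (auto simp: subset_iff module_map_smult[OF assms(3), symmetric])
qed fact

section \<open>Free modules of finite rank\<close>

text \<open>
  Again without extensionality, so that coordinate functions and composites qualify as they stand.
\<close>

definition functional :: "('r::comm_ring_1, 'v) module \<Rightarrow> ('v \<Rightarrow> 'r) \<Rightarrow> bool" where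
  "functional V \<phi> \<longleftrightarrow>
     (\<forall>x\<in>carrier V. \<forall>y\<in>carrier V. \<phi> (x \<oplus>\<^bsub>V\<^esub> y) = \<phi> x + \<phi> y) \<and>
     (\<forall>r. \<forall>x\<in>carrier V. \<phi> (r \<odot>\<^bsub>V\<^esub> x) = r * \<phi> x)"

lemma dual_module_iff: "f \<in> dual_module A \<longleftrightarrow> f \<in> extensional (carrier A) \<and> functional A f"
  by (auto simp: dual_module_def functional_def)

lemma functional_add: "\<lbrakk>functional V \<phi>; x \<in> carrier V; y \<in> carrier V\<rbrakk> \<Longrightarrow> \<phi> (x \<oplus>\<^bsub>V\<^esub> y) = \<phi> x + \<phi> y"
  and functional_smult: "\<lbrakk>functional V \<phi>; x \<in> carrier V\<rbrakk> \<Longrightarrow> \<phi> (r \<odot>\<^bsub>V\<^esub> x) = r * \<phi> x"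
  by (simp_all add: functional_def)

lemma functional_zero:
  assumes "left_module type_ring V" "functional V \<phi>"
  shows "\<phi> \<zero>\<^bsub>V\<^esub> = 0"
proof -
  interpret V: left_module type_ring V by fact
  show ?thesis
    using functional_add[OF assms(2), of "\<zero>\<^bsub>V\<^esub>" "\<zero>\<^bsub>V\<^esub>"] by simp
qed

lemma functional_minus:
  assumes "left_module type_ring V" "functional V \<phi>" "x \<in> carrier V"
  shows "\<phi> (\<ominus>\<^bsub>V\<^esub> x) = - \<phi> x"
proof -
  interpret V: left_module type_ring V by fact
  have "\<phi> (\<ominus>\<^bsub>V\<^esub> x) + \<phi> x = 0"
    using functional_add[OF assms(2), of "\<ominus>\<^bsub>V\<^esub> x" x] assms functional_zero[OF assms(1,2)]
    by (simp add: V.M.l_neg)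
  then show ?thesis
    by (simp add: eq_neg_iff_add_eq_0)
qed

lemma functional_finsum:
  assumes "left_module type_ring V" "functional V \<phi>" "\<And>i. i \<in> I \<Longrightarrow> h i \<in> carrier V"
  shows "\<phi> (finsum V h I) = (\<Sum>i\<in>I. \<phi> (h i))"
proof -
  interpret V: left_module type_ring V by fact
  show ?thesis
    using assms(3)
    by (induction I rule: infinite_finite_induct)
      (auto simp: functional_zero[OF assms(1,2)] functional_add[OF assms(2)] V.M.finsum_closed Pi_def)
qed

lemma functional_finsum_smult:
  assumes "left_module type_ring V" "functional V \<phi>" "\<And>i. i \<in> I \<Longrightarrow> h i \<in> carrier V"
  shows "\<phi> (\<Oplus>\<^bsub>V\<^esub>i\<in>I. c i \<odot>\<^bsub>V\<^esub> h i) = (\<Sum>i\<in>I. c i * \<phi> (h i))"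
proof -
  interpret V: left_module type_ring V by fact
  have "\<phi> (\<Oplus>\<^bsub>V\<^esub>i\<in>I. c i \<odot>\<^bsub>V\<^esub> h i) = (\<Sum>i\<in>I. \<phi> (c i \<odot>\<^bsub>V\<^esub> h i))"
    by (rule functional_finsum) (use assms in \<open>auto simp: V.smult_closed\<close>)
  then show ?thesis
    using assms(3) by (simp add: functional_smult[OF assms(2)])
qed

lemma functional_compose:
  "\<lbrakk>module_map type_ring V W f; functional W \<phi>\<rbrakk> \<Longrightarrow> functional V (\<lambda>x. \<phi> (f x))"
  by (simp add: functional_def module_map_def)

lemma functional_submodule:
  "\<lbrakk>functional V \<phi>; N \<subseteq> carrier V\<rbrakk> \<Longrightarrow> functional (V\<lparr>carrier := N\<rparr>) \<phi>"
  by (auto simp: functional_def subset_iff)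

lemma submodule_functional_kernel:
  assumes "left_module type_ring V" "functional V \<phi>"
  shows "submodule {x \<in> carrier V. \<phi> x = 0} type_ring V"
proof -
  interpret V: left_module type_ring V by fact
  show ?thesis
    by (rule submoduleI)
      (auto simp: assms V.smult_closed functional_zero functional_add[OF assms(2)] functional_smult[OF assms(2)])
qed

lemma finsum_submodule:
  assumes "left_module R V" "submodule N R V" "\<And>i. i \<in> I \<Longrightarrow> h i \<in> N"
  shows "finsum (V\<lparr>carrier := N\<rparr>) h I = finsum V h I"
proof -
  have "module_map R (V\<lparr>carrier := N\<rparr>) V (\<lambda>x. x)"
    using submoduleD(1)[OF assms(2)] by (auto simp: module_map_def)
  then show ?thesis
    using module_map_finsum[OF left_module_submodule[OF assms(1,2)] assms(1), of "\<lambda>x. x" I h] assms(3)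
    by simp
qed

text \<open>
  Uniqueness of coordinates reduces to the zero vector by subtracting two expansions.
\<close>

lemma is_finite_basisI:
  assumes V: "left_module type_ring V" and E: "finite E" "E \<subseteq> carrier V"
    and span: "\<And>v. v \<in> carrier V \<Longrightarrow> \<exists>c. v = (\<Oplus>\<^bsub>V\<^esub>x\<in>E. c x \<odot>\<^bsub>V\<^esub> x)"
    and indep: "\<And>c x. \<lbrakk>(\<Oplus>\<^bsub>V\<^esub>x\<in>E. c x \<odot>\<^bsub>V\<^esub> x) = \<zero>\<^bsub>V\<^esub>; x \<in> E\<rbrakk> \<Longrightarrow> c x = 0"
  shows "is_finite_basis V E"
  unfolding is_finite_basis_def
proof (intro conjI ballI E)
  interpret V: left_module type_ring V by fact
  have c: "c x \<odot>\<^bsub>V\<^esub> x \<in> carrier V" if "x \<in> E" for c :: "_ \<Rightarrow> 'a" and x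
    using that E by (auto intro: V.smult_closed)
  fix v assume v: "v \<in> carrier V"
  then obtain c where cv: "v = (\<Oplus>\<^bsub>V\<^esub>x\<in>E. c x \<odot>\<^bsub>V\<^esub> x)"
    using span by blast
  have "v = (\<Oplus>\<^bsub>V\<^esub>x\<in>E. restrict c E x \<odot>\<^bsub>V\<^esub> x)"
    unfolding cv by (rule V.M.finsum_cong') (use c in auto)
  moreover have "e = e'" if "e \<in> extensional E" "e' \<in> extensional E"
    "v = (\<Oplus>\<^bsub>V\<^esub>x\<in>E. e x \<odot>\<^bsub>V\<^esub> x)" "v = (\<Oplus>\<^bsub>V\<^esub>x\<in>E. e' x \<odot>\<^bsub>V\<^esub> x)" for e e'
  proof (rule extensionalityI[OF that(1,2)])
    fix x assume x: "x \<in> E"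
    have "(\<Oplus>\<^bsub>V\<^esub>x\<in>E. (e x - e' x) \<odot>\<^bsub>V\<^esub> x) \<oplus>\<^bsub>V\<^esub> v = v"
    proof -
      have "(\<Oplus>\<^bsub>V\<^esub>x\<in>E. (e x - e' x) \<odot>\<^bsub>V\<^esub> x) \<oplus>\<^bsub>V\<^esub> (\<Oplus>\<^bsub>V\<^esub>x\<in>E. e' x \<odot>\<^bsub>V\<^esub> x) =
          (\<Oplus>\<^bsub>V\<^esub>x\<in>E. (e x - e' x) \<odot>\<^bsub>V\<^esub> x \<oplus>\<^bsub>V\<^esub> e' x \<odot>\<^bsub>V\<^esub> x)"
        using c by (intro V.M.finsum_addf[symmetric]) auto
      also have "\<dots> = (\<Oplus>\<^bsub>V\<^esub>x\<in>E. e x \<odot>\<^bsub>V\<^esub> x)"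
      proof (rule V.M.finsum_cong')
        fix x assume "x \<in> E"
        then show "(e x - e' x) \<odot>\<^bsub>V\<^esub> x \<oplus>\<^bsub>V\<^esub> e' x \<odot>\<^bsub>V\<^esub> x = e x \<odot>\<^bsub>V\<^esub> x"
          using V.smult_l_distr[of "e x - e' x" "e' x" x] E by auto
      qed (use c in auto)
      finally show ?thesis using that by simp
    qed
    then have "(\<Oplus>\<^bsub>V\<^esub>x\<in>E. (e x - e' x) \<odot>\<^bsub>V\<^esub> x) = \<zero>\<^bsub>V\<^esub>"
      using v c by (subst (asm) V.M.add.r_cancel_one) (auto intro!: V.M.finsum_closed)
    then show "e x = e' x"
      using indep[of "\<lambda>x. e x - e' x" x] x by simp
  qed
  ultimately show "\<exists>!c. c \<in> extensional E \<and> v = (\<Oplus>\<^bsub>V\<^esub>x\<in>E. c x \<odot>\<^bsub>V\<^esub> x)"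
    by (intro ex1I[of _ "restrict c E"]) auto
qed

lemma coordinates_sum:
  assumes "is_finite_basis V E" "v \<in> carrier V"
  shows "(\<Oplus>\<^bsub>V\<^esub>x\<in>E. coordinates V E v x \<odot>\<^bsub>V\<^esub> x) = v"
proof -
  have "\<exists>!c. c \<in> extensional E \<and> v = (\<Oplus>\<^bsub>V\<^esub>x\<in>E. c x \<odot>\<^bsub>V\<^esub> x)"
    using assms by (auto simp: is_finite_basis_def)
  from theI'[OF this] show ?thesis
    by (simp add: coordinates_def)
qed

lemma coordinates_unique:
  assumes "left_module type_ring V" "is_finite_basis V E" "x \<in> E"
    "v = (\<Oplus>\<^bsub>V\<^esub>x\<in>E. c x \<odot>\<^bsub>V\<^esub> x)"
  shows "coordinates V E v x = c x"
proof -
  interpret V: left_module type_ring V by fact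
  have E: "E \<subseteq> carrier V" using assms(2) by (simp add: is_finite_basis_def)
  then have c: "c x \<odot>\<^bsub>V\<^esub> x \<in> carrier V" if "x \<in> E" for x
    using that by (auto intro: V.smult_closed)
  have "v = (\<Oplus>\<^bsub>V\<^esub>x\<in>E. restrict c E x \<odot>\<^bsub>V\<^esub> x)"
    unfolding assms(4) by (rule V.M.finsum_cong') (use c in auto)
  moreover have "v \<in> carrier V"
    unfolding assms(4) using c by (intro V.M.finsum_closed) auto
  then have "\<exists>!c. c \<in> extensional E \<and> v = (\<Oplus>\<^bsub>V\<^esub>x\<in>E. c x \<odot>\<^bsub>V\<^esub> x)"
    using assms by (auto simp: is_finite_basis_def)
  ultimately have "coordinates V E v = restrict c E"
    unfolding coordinates_def by (intro the1_equality) auto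
  then show ?thesis using assms(3) by simp
qed

lemma functional_coordinates:
  assumes "left_module type_ring V" "is_finite_basis V E" "x \<in> E"
  shows "functional V (\<lambda>v. coordinates V E v x)"
proof -
  interpret V: left_module type_ring V by fact
  have E: "E \<subseteq> carrier V" using assms(2) by (simp add: is_finite_basis_def)
  then have c: "c x \<odot>\<^bsub>V\<^esub> x \<in> carrier V" if "x \<in> E" for x and c :: "_ \<Rightarrow> 'a"
    using that by (auto intro: V.smult_closed)
  let ?k = "coordinates V E"
  show ?thesis
    unfolding functional_def
  proof (intro conjI ballI allI)
    fix v w assume vw: "v \<in> carrier V" "w \<in> carrier V"
    have "(\<Oplus>\<^bsub>V\<^esub>x\<in>E. (?k v x + ?k w x) \<odot>\<^bsub>V\<^esub> x) =
        (\<Oplus>\<^bsub>V\<^esub>x\<in>E. ?k v x \<odot>\<^bsub>V\<^esub> x \<oplus>\<^bsub>V\<^esub> ?k w x \<odot>\<^bsub>V\<^esub> x)"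
    proof (rule V.M.finsum_cong')
      fix x assume "x \<in> E"
      then show "(?k v x + ?k w x) \<odot>\<^bsub>V\<^esub> x = ?k v x \<odot>\<^bsub>V\<^esub> x \<oplus>\<^bsub>V\<^esub> ?k w x \<odot>\<^bsub>V\<^esub> x"
        using V.smult_l_distr[of "?k v x" "?k w x" x] E by auto
    qed (use c in auto)
    also have "\<dots> = v \<oplus>\<^bsub>V\<^esub> w"
      using c vw by (subst V.M.finsum_addf) (auto simp: coordinates_sum[OF assms(2)])
    finally show "?k (v \<oplus>\<^bsub>V\<^esub> w) x = ?k v x + ?k w x"
      using coordinates_unique[OF assms, of "v \<oplus>\<^bsub>V\<^esub> w" "\<lambda>x. ?k v x + ?k w x"] by simp
  next
    fix r v assume v: "v \<in> carrier V"
    have "(\<Oplus>\<^bsub>V\<^esub>x\<in>E. (r * ?k v x) \<odot>\<^bsub>V\<^esub> x) = (\<Oplus>\<^bsub>V\<^esub>x\<in>E. r \<odot>\<^bsub>V\<^esub> (?k v x \<odot>\<^bsub>V\<^esub> x))"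
    proof (rule V.M.finsum_cong')
      fix x assume "x \<in> E"
      then show "(r * ?k v x) \<odot>\<^bsub>V\<^esub> x = r \<odot>\<^bsub>V\<^esub> (?k v x \<odot>\<^bsub>V\<^esub> x)"
        using V.smult_assoc[of r "?k v x" x] E by auto
    qed (use c V.smult_closed in auto)
    also have "\<dots> = r \<odot>\<^bsub>V\<^esub> v"
      using c v V.smult_finsum[of r E "\<lambda>x. ?k v x \<odot>\<^bsub>V\<^esub> x"] coordinates_sum[OF assms(2) v] by simp
    finally show "?k (r \<odot>\<^bsub>V\<^esub> v) x = r * ?k v x"
      using coordinates_unique[OF assms, of "r \<odot>\<^bsub>V\<^esub> v" "\<lambda>x. r * ?k v x"] by simp
  qed
qed

lemma coordinates_basis:
  assumes "left_module type_ring V" "is_finite_basis V E" "x \<in> E" "y \<in> E"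
  shows "coordinates V E y x = (if x = y then 1 else 0)"
proof -
  interpret V: left_module type_ring V by fact
  have E: "E \<subseteq> carrier V" "finite E" using assms(2) by (simp_all add: is_finite_basis_def)
  have y: "y \<in> carrier V" using assms(4) E by auto
  have "(\<Oplus>\<^bsub>V\<^esub>x\<in>E. (if x = y then 1 else 0) \<odot>\<^bsub>V\<^esub> x) = (\<Oplus>\<^bsub>V\<^esub>x\<in>E. if y = x then x else \<zero>\<^bsub>V\<^esub>)"
  proof (rule V.M.finsum_cong')
    fix x assume "x \<in> E"
    then show "(if x = y then 1 else 0) \<odot>\<^bsub>V\<^esub> x = (if y = x then x else \<zero>\<^bsub>V\<^esub>)"
      using E V.smult_one[of x] V.smult_l_zero[of x] by auto
  qed (use E in auto)
  also have "\<dots> = y"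
    using V.M.finsum_singleton[of y E "\<lambda>x. x"] assms(4) E by (auto simp: Pi_def)
  finally show ?thesis
    using coordinates_unique[OF assms(1-3), of y "\<lambda>x. if x = y then 1 else 0"] by simp
qed

lemma coordinates_eqI:
  assumes "is_finite_basis V E" "v \<in> carrier V" "w \<in> carrier V"
    "\<And>x. x \<in> E \<Longrightarrow> coordinates V E v x = coordinates V E w x" "left_module type_ring V"
  shows "v = w"
proof -
  interpret V: left_module type_ring V by fact
  have E: "E \<subseteq> carrier V" using assms(1) by (simp add: is_finite_basis_def)
  have "(\<Oplus>\<^bsub>V\<^esub>x\<in>E. coordinates V E v x \<odot>\<^bsub>V\<^esub> x) = (\<Oplus>\<^bsub>V\<^esub>x\<in>E. coordinates V E w x \<odot>\<^bsub>V\<^esub> x)"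
    using E by (intro V.M.finsum_cong') (auto simp: assms(4) intro!: V.smult_closed)
  then show ?thesis
    using coordinates_sum[OF assms(1)] assms(2,3) by simp
qed

lemma some_basis:
  "free_finite_rank V \<Longrightarrow> is_finite_basis V (some_basis V)"
  unfolding free_finite_rank_def some_basis_def by (metis someI_ex)

lemma free_finite_rank_left_module: "free_finite_rank V \<Longrightarrow> left_module type_ring V"
  by (simp add: free_finite_rank_def)

lemma free_torsion_free:
  fixes V :: "('o::idom, 'v) module"
  assumes "free_finite_rank V" "v \<in> carrier V" "r \<odot>\<^bsub>V\<^esub> v = \<zero>\<^bsub>V\<^esub>" "r \<noteq> 0"
  shows "v = \<zero>\<^bsub>V\<^esub>"
proof -
  note L = free_finite_rank_left_module[OF assms(1)] and E = some_basis[OF assms(1)]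
  interpret V: left_module type_ring V by fact
  show ?thesis
  proof (rule coordinates_eqI[OF E assms(2) _ _ L])
    fix x assume x: "x \<in> some_basis V"
    note F = functional_coordinates[OF L E x]
    have "r * coordinates V (some_basis V) v x = 0"
      using functional_smult[OF F assms(2), of r] functional_zero[OF L F] assms(3) by simp
    then show "coordinates V (some_basis V) v x = coordinates V (some_basis V) \<zero>\<^bsub>V\<^esub> x"
      using functional_zero[OF L F] assms(4) by simp
  qed simp
qed

lemma free_smult_cancel:
  fixes V :: "('o::idom, 'v) module"
  assumes "free_finite_rank V" "v \<in> carrier V" "w \<in> carrier V" "r \<odot>\<^bsub>V\<^esub> v = r \<odot>\<^bsub>V\<^esub> w" "r \<noteq> 0"
  shows "v = w"
proof -
  interpret V: left_module type_ring V using free_finite_rank_left_module[OF assms(1)] .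
  have "r \<odot>\<^bsub>V\<^esub> (v \<ominus>\<^bsub>V\<^esub> w) = \<zero>\<^bsub>V\<^esub>"
    using assms by (simp add: a_minus_def V.smult_r_distr V.smult_r_minus V.smult_closed V.M.r_neg)
  then have "v \<ominus>\<^bsub>V\<^esub> w = \<zero>\<^bsub>V\<^esub>"
    using free_torsion_free[OF assms(1)] assms by simp
  then have "\<ominus>\<^bsub>V\<^esub> (\<ominus>\<^bsub>V\<^esub> w) = v"
    using assms by (intro V.M.minus_equality) (auto simp: a_minus_def)
  then show ?thesis
    using assms by simp
qed

lemma principal_domain_ideal:
  fixes J :: "'o::idom set"
  assumes "principal_domain (type_ring :: 'o ring)" "0 \<in> J"
    "\<And>a b. \<lbrakk>a \<in> J; b \<in> J\<rbrakk> \<Longrightarrow> a + b \<in> J" "\<And>a x. a \<in> J \<Longrightarrow> x * a \<in> J"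
  obtains d where "d \<in> J" "\<And>a. a \<in> J \<Longrightarrow> d dvd a"
proof -
  interpret T: cring "type_ring :: 'o ring" by (rule cring_from_type_algebra)
  have "ideal J (type_ring :: 'o ring)"
  proof (rule idealI)
    show "subgroup J (add_monoid type_ring)"
    proof (rule T.add.subgroupI)
      fix a assume "a \<in> J"
      moreover have "\<ominus>\<^bsub>type_ring\<^esub> a = - 1 * a"
        by (rule T.minus_equality) auto
      ultimately show "\<ominus>\<^bsub>type_ring\<^esub> a \<in> J"
        using assms(4)[of a "- 1"] by simp
    qed (use assms in auto)
  qed (use assms(4) T.ring_axioms in \<open>auto simp: mult.commute\<close>)
  then obtain d where d: "J = PIdl\<^bsub>type_ring\<^esub> d"
    using assms(1) unfolding principal_domain_def principal_domain_axioms_def by blast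
  show ?thesis
    by (rule that[of d]) (use T.cgenideal_self[of d] in \<open>auto simp: d cgenideal_def\<close>)
qed

text \<open>
  This replaces the theorem that submodules of free modules over a principal ideal domain are free,
  in a form that needs no ambient free module. One functional is split off at a time: its image is an
  ideal, generated by its value at some \<open>w\<close>, and a basis of its kernel together with \<open>w\<close> is a
  basis, unless the functional vanishes.
\<close>

lemma free_of_jointly_injective_functionals:
  fixes V :: "('o::idom, 'v) module"
  assumes PID: "principal_domain (type_ring :: 'o ring)" and "finite I"
    "left_module type_ring V" "\<And>i. i \<in> I \<Longrightarrow> functional V (\<phi> i)"
    "\<And>v. \<lbrakk>v \<in> carrier V; \<And>i. i \<in> I \<Longrightarrow> \<phi> i v = 0\<rbrakk> \<Longrightarrow> v = \<zero>\<^bsub>V\<^esub>"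
  shows "free_finite_rank V"
  using assms(2-)
proof (induction I arbitrary: V rule: finite_induct)
  case (empty V)
  interpret V: left_module type_ring V by fact
  have "carrier V = {\<zero>\<^bsub>V\<^esub>}"
    using empty by auto
  then have "is_finite_basis V {}"
    using empty by (intro is_finite_basisI) auto
  then show ?case
    using empty by (auto simp: free_finite_rank_def)
next
  case (insert i I V)
  interpret V: left_module type_ring V by fact
  note F = insert.prems(2)[of i, simplified]
  define N where "N = {x \<in> carrier V. \<phi> i x = 0}"
  have N: "submodule N type_ring V"
    unfolding N_def by (rule submodule_functional_kernel) fact+
  note LN = left_module_submodule[OF insert.prems(1) N]
  have "free_finite_rank (V\<lparr>carrier := N\<rparr>)"
  proof (rule insert.IH[OF LN])
    show "functional (V\<lparr>carrier := N\<rparr>) (\<phi> j)" if "j \<in> I" for j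
      using insert.prems(2)[of j] that by (intro functional_submodule) (auto simp: N_def)
    show "v = \<zero>\<^bsub>V\<lparr>carrier := N\<rparr>\<^esub>" if "v \<in> carrier (V\<lparr>carrier := N\<rparr>)" "\<And>j. j \<in> I \<Longrightarrow> \<phi> j v = 0" for v
      using insert.prems(3)[of v] that by (auto simp: N_def)
  qed
  then obtain E where E: "is_finite_basis (V\<lparr>carrier := N\<rparr>) E"
    by (auto simp: free_finite_rank_def)
  then have E': "finite E" "E \<subseteq> N"
    by (auto simp: is_finite_basis_def)
  have EV: "E \<subseteq> carrier V" using E'(2) by (auto simp: N_def)
  have sumE: "(\<Oplus>\<^bsub>V\<lparr>carrier := N\<rparr>\<^esub>x\<in>E. c x \<odot>\<^bsub>V\<lparr>carrier := N\<rparr>\<^esub> x) = (\<Oplus>\<^bsub>V\<^esub>x\<in>E. c x \<odot>\<^bsub>V\<^esub> x)" for c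
    using finsum_submodule[OF insert.prems(1) N, of E "\<lambda>x. c x \<odot>\<^bsub>V\<^esub> x"] E'(2) submoduleD(5)[OF N]
    by auto
  obtain d where d: "d \<in> \<phi> i ` carrier V" "\<And>a. a \<in> \<phi> i ` carrier V \<Longrightarrow> d dvd a"
  proof (rule principal_domain_ideal[OF PID, of "\<phi> i ` carrier V"])
    show "0 \<in> \<phi> i ` carrier V"
      using functional_zero[OF insert.prems(1) F] V.M.zero_closed by (metis imageI)
    show "a + b \<in> \<phi> i ` carrier V" if "a \<in> \<phi> i ` carrier V" "b \<in> \<phi> i ` carrier V" for a b
      using that by (auto simp: functional_add[OF F, symmetric])
    show "x * a \<in> \<phi> i ` carrier V" if "a \<in> \<phi> i ` carrier V" for a x
      using that by (auto simp: functional_smult[OF F, symmetric] V.smult_closed)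
  qed blast
  then obtain w where w: "w \<in> carrier V" "\<phi> i w = d"
    by auto
  have dvd: "\<exists>c. \<phi> i v = c * d" if "v \<in> carrier V" for v
    using d(2)[of "\<phi> i v"] that by (auto simp: dvd_def mult.commute)
  show ?case
  proof (cases "d = 0")
    case True
    then have "N = carrier V"
      using dvd by (auto simp: N_def)
    then show ?thesis
      using \<open>free_finite_rank (V\<lparr>carrier := N\<rparr>)\<close> by simp
  next
    case False
    have wE: "w \<notin> E"
      using E'(2) w False by (auto simp: N_def)
    have cl: "c x \<odot>\<^bsub>V\<^esub> x \<in> carrier V" if "x \<in> insert w E" for c :: "'v \<Rightarrow> 'o" and x
      using that w EV by (auto intro!: V.smult_closed)
    have sum_insert: "(\<Oplus>\<^bsub>V\<^esub>x\<in>insert w E. c x \<odot>\<^bsub>V\<^esub> x) = c w \<odot>\<^bsub>V\<^esub> w \<oplus>\<^bsub>V\<^esub> (\<Oplus>\<^bsub>V\<^esub>x\<in>E. c x \<odot>\<^bsub>V\<^esub> x)" for c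
      using cl E' wE by (intro V.M.finsum_insert) auto
    have sumcl: "(\<Oplus>\<^bsub>V\<^esub>x\<in>E. c x \<odot>\<^bsub>V\<^esub> x) \<in> carrier V" for c :: "'v \<Rightarrow> 'o"
      using cl by (intro V.M.finsum_closed) auto
    have "is_finite_basis V (insert w E)"
    proof (rule is_finite_basisI)
      fix v assume v: "v \<in> carrier V"
      then obtain b where b: "\<phi> i v = b * d" using dvd by auto
      let ?n = "v \<oplus>\<^bsub>V\<^esub> \<ominus>\<^bsub>V\<^esub> (b \<odot>\<^bsub>V\<^esub> w)"
      have bw: "b \<odot>\<^bsub>V\<^esub> w \<in> carrier V" using w by (auto intro: V.smult_closed)
      have "?n \<in> N"
        using v w b bw by (simp add: N_def functional_add[OF F] functional_minus[OF insert.prems(1) F] functional_smult[OF F])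
      \<comment> \<open>The vector \<open>v - b w\<close> lies in the kernel of the functional and is expanded in the basis of the kernel.\<close>
      define c where "c = coordinates (V\<lparr>carrier := N\<rparr>) E ?n"
      have c: "?n = (\<Oplus>\<^bsub>V\<^esub>x\<in>E. c x \<odot>\<^bsub>V\<^esub> x)"
        using coordinates_sum[OF E, of ?n] \<open>?n \<in> N\<close> unfolding sumE c_def by simp
      have "v = b \<odot>\<^bsub>V\<^esub> w \<oplus>\<^bsub>V\<^esub> ?n"
        using v bw by (simp add: V.M.a_lcomm V.M.r_neg V.M.a_assoc)
      also have "?n = (\<Oplus>\<^bsub>V\<^esub>x\<in>E. (c(w := b)) x \<odot>\<^bsub>V\<^esub> x)"
        unfolding c using wE cl by (intro V.M.finsum_cong') (auto simp: fun_upd_def)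
      finally have "v = (\<Oplus>\<^bsub>V\<^esub>x\<in>insert w E. (c(w := b)) x \<odot>\<^bsub>V\<^esub> x)"
        unfolding sum_insert by simp
      then show "\<exists>c. v = (\<Oplus>\<^bsub>V\<^esub>x\<in>insert w E. c x \<odot>\<^bsub>V\<^esub> x)" by blast
    next
      fix c x assume c: "(\<Oplus>\<^bsub>V\<^esub>x\<in>insert w E. c x \<odot>\<^bsub>V\<^esub> x) = \<zero>\<^bsub>V\<^esub>" and x: "x \<in> insert w E"
      have "\<phi> i (\<Oplus>\<^bsub>V\<^esub>x\<in>insert w E. c x \<odot>\<^bsub>V\<^esub> x) = (\<Sum>x\<in>insert w E. c x * \<phi> i x)"
        using w EV by (intro functional_finsum_smult F insert.prems) auto
      also have "\<dots> = c w * d"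
        using wE E' w by (auto simp: N_def intro!: sum.neutral)
      finally have cw: "c w = 0"
        using c False functional_zero[OF insert.prems(1) F] by simp
      then have "c w \<odot>\<^bsub>V\<^esub> w = \<zero>\<^bsub>V\<^esub>"
        using V.smult_l_zero[of w] w by simp
      then have "(\<Oplus>\<^bsub>V\<^esub>x\<in>E. c x \<odot>\<^bsub>V\<^esub> x) = \<zero>\<^bsub>V\<^esub>"
        using c sumcl unfolding sum_insert by simp
      then have "coordinates (V\<lparr>carrier := N\<rparr>) E \<zero>\<^bsub>V\<^esub> x = c x" if "x \<in> E" for x
        using coordinates_unique[OF LN E that, of "\<zero>\<^bsub>V\<^esub>" c] unfolding sumE by simp
      then have "c x = 0" if "x \<in> E" for x
        using functional_zero[OF LN functional_coordinates[OF LN E that]] that by simp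
      with cw x show "c x = 0" by auto
    qed (use insert.prems E' w EV in auto)
    then show ?thesis
      using insert.prems by (auto simp: free_finite_rank_def)
  qed
qed

text \<open>
  Over the field of fractions, functionals that separate points span the dual space; clearing
  denominators gives the factor \<open>d\<close>. The induction is over the functionals, restricting to the kernel
  of one of them, so no basis is involved.
\<close>

lemma jointly_injective_functionals_span:
  fixes V :: "('o::idom, 'v) module"
  assumes "finite I" "left_module type_ring V" "\<And>i. i \<in> I \<Longrightarrow> functional V (\<phi> i)"
    "\<And>v. \<lbrakk>v \<in> carrier V; \<And>i. i \<in> I \<Longrightarrow> \<phi> i v = 0\<rbrakk> \<Longrightarrow> v = \<zero>\<^bsub>V\<^esub>"
    "functional V \<psi>"
  shows "\<exists>d c. d \<noteq> 0 \<and> (\<forall>v\<in>carrier V. d * \<psi> v = (\<Sum>i\<in>I. c i * \<phi> i v))"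
  using assms
proof (induction I arbitrary: V rule: finite_induct)
  case (empty V)
  then have "\<psi> v = 0" if "v \<in> carrier V" for v
    using that functional_zero[OF empty(1,4)] by auto
  then show ?case by (intro exI[of _ 1]) auto
next
  case (insert i I V)
  interpret V: left_module type_ring V by fact
  note F = insert.prems(2)[of i, simplified]
  define N where "N = {x \<in> carrier V. \<phi> i x = 0}"
  have N: "submodule N type_ring V"
    unfolding N_def by (rule submodule_functional_kernel) fact+
  note LN = left_module_submodule[OF insert.prems(1) N]
  have "\<exists>d c. d \<noteq> 0 \<and> (\<forall>v\<in>carrier (V\<lparr>carrier := N\<rparr>). d * \<psi> v = (\<Sum>j\<in>I. c j * \<phi> j v))"
  proof (rule insert.IH[OF LN])
    show "functional (V\<lparr>carrier := N\<rparr>) (\<phi> j)" if "j \<in> I" for j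
      using insert.prems(2)[of j] that by (intro functional_submodule) (auto simp: N_def)
    show "v = \<zero>\<^bsub>V\<lparr>carrier := N\<rparr>\<^esub>" if "v \<in> carrier (V\<lparr>carrier := N\<rparr>)" "\<And>j. j \<in> I \<Longrightarrow> \<phi> j v = 0" for v
      using insert.prems(3)[of v] that by (auto simp: N_def)
    show "functional (V\<lparr>carrier := N\<rparr>) \<psi>"
      using insert.prems(4) by (intro functional_submodule) (auto simp: N_def)
  qed
  then obtain d c where dc: "d \<noteq> 0" "\<And>v. v \<in> N \<Longrightarrow> d * \<psi> v = (\<Sum>j\<in>I. c j * \<phi> j v)"
    by auto
  show ?case
  proof (cases "\<forall>w\<in>carrier V. \<phi> i w = 0")
    case True
    then have "d * \<psi> v = (\<Sum>j\<in>insert i I. (c(i := 0)) j * \<phi> j v)" if "v \<in> carrier V" for v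
      using dc(2)[of v] that insert.hyps by (auto simp: N_def intro!: sum.cong)
    then show ?thesis using dc(1) by blast
  next
    case False
    then obtain w where w: "w \<in> carrier V" "\<phi> i w \<noteq> 0" by auto
    define t where "t = d * \<psi> w - (\<Sum>j\<in>I. c j * \<phi> j w)"
    have "(d * \<phi> i w) * \<psi> v = (\<Sum>j\<in>insert i I. ((\<lambda>j. \<phi> i w * c j)(i := t)) j * \<phi> j v)"
      if v: "v \<in> carrier V" for v
    proof -
      \<comment> \<open>A combination of \<open>v\<close> and \<open>w\<close> on which the functional \<open>\<phi> i\<close> vanishes.\<close>
      let ?n = "\<phi> i w \<odot>\<^bsub>V\<^esub> v \<oplus>\<^bsub>V\<^esub> \<ominus>\<^bsub>V\<^esub> (\<phi> i v \<odot>\<^bsub>V\<^esub> w)"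
      have cl: "\<phi> i w \<odot>\<^bsub>V\<^esub> v \<in> carrier V" "\<phi> i v \<odot>\<^bsub>V\<^esub> w \<in> carrier V"
        using v w by (auto intro: V.smult_closed)
      have n: "\<chi> ?n = \<phi> i w * \<chi> v - \<phi> i v * \<chi> w" if "functional V \<chi>" for \<chi>
        using v w cl that by (simp add: functional_add functional_smult functional_minus insert.prems(1))
      have "?n \<in> N"
        using n[OF F] cl by (simp add: N_def mult.commute)
      from dc(2)[OF this] have "d * (\<phi> i w * \<psi> v - \<phi> i v * \<psi> w) =
          (\<Sum>j\<in>I. c j * (\<phi> i w * \<phi> j v - \<phi> i v * \<phi> j w))"
        using n insert.prems by simp
      also have "\<dots> = (\<Sum>j\<in>I. \<phi> i w * c j * \<phi> j v) - \<phi> i v * (\<Sum>j\<in>I. c j * \<phi> j w)"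
        by (simp add: sum_subtractf sum_distrib_left algebra_simps)
      finally have "(d * \<phi> i w) * \<psi> v = t * \<phi> i v + (\<Sum>j\<in>I. \<phi> i w * c j * \<phi> j v)"
        by (simp add: t_def algebra_simps)
      also have "(\<Sum>j\<in>I. \<phi> i w * c j * \<phi> j v) = (\<Sum>j\<in>I. ((\<lambda>j. \<phi> i w * c j)(i := t)) j * \<phi> j v)"
        using insert.hyps by (intro sum.cong) auto
      finally show ?thesis
        using insert.hyps by simp
    qed
    moreover have "d * \<phi> i w \<noteq> 0" using dc w by simp
    ultimately show ?thesis by blast
  qed
qed

text \<open>
  A subspace over the field of fractions is a direct summand, so a projection onto it exists; this is
  its integral shadow, a projection multiplied by a common denominator \<open>d\<close>. The coordinate functions
  of \<open>N\<close> extend to all of \<open>V\<close> after multiplication by nonzero scalars, by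
  \<open>jointly_injective_functionals_span\<close> applied to the coordinates of \<open>V\<close>.
\<close>

lemma almost_retraction:
  fixes V :: "('o::idom, 'v) module"
  assumes V: "free_finite_rank V" and N: "submodule N type_ring V"
    and FN: "free_finite_rank (V\<lparr>carrier := N\<rparr>)"
  obtains d \<pi> where "d \<noteq> 0" "module_map type_ring V V \<pi>" "\<And>v. v \<in> carrier V \<Longrightarrow> \<pi> v \<in> N"
    "\<And>v. v \<in> N \<Longrightarrow> \<pi> v = d \<odot>\<^bsub>V\<^esub> v"
proof -
  note L = free_finite_rank_left_module[OF V] and E = some_basis[OF V]
  note LN = free_finite_rank_left_module[OF FN] and F = some_basis[OF FN]
  let ?N = "V\<lparr>carrier := N\<rparr>" let ?E = "some_basis V" let ?F = "some_basis ?N"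
  interpret V: left_module type_ring V by fact
  have NV: "N \<subseteq> carrier V" using submoduleD[OF N] by auto
  have fin: "finite ?E" "finite ?F" "?F \<subseteq> N" using E F by (auto simp: is_finite_basis_def)
  have "\<exists>d c. d \<noteq> 0 \<and> (\<forall>v\<in>carrier ?N. d * coordinates ?N ?F v f = (\<Sum>e\<in>?E. c e * coordinates V ?E v e))"
    if "f \<in> ?F" for f
  proof (rule jointly_injective_functionals_span[OF fin(1) LN])
    show "functional ?N (\<lambda>v. coordinates V ?E v e)" if "e \<in> ?E" for e
      by (intro functional_submodule functional_coordinates L E that NV)
    show "v = \<zero>\<^bsub>?N\<^esub>" if "v \<in> carrier ?N" "\<And>e. e \<in> ?E \<Longrightarrow> coordinates V ?E v e = 0" for v
      using coordinates_eqI[OF E _ _ _ L, of v "\<zero>\<^bsub>V\<^esub>"] that NV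
        functional_zero[OF L functional_coordinates[OF L E]] by auto
    show "functional ?N (\<lambda>v. coordinates ?N ?F v f)"
      by (intro functional_coordinates LN F that)
  qed
  then have "\<forall>f\<in>?F. \<exists>dc. fst dc \<noteq> 0 \<and>
      (\<forall>v\<in>N. fst dc * coordinates ?N ?F v f = (\<Sum>e\<in>?E. snd dc e * coordinates V ?E v e))"
    by simp
  from bchoice[OF this] obtain dc where dc': "\<forall>f\<in>?F. fst (dc f) \<noteq> 0 \<and>
      (\<forall>v\<in>N. fst (dc f) * coordinates ?N ?F v f = (\<Sum>e\<in>?E. snd (dc f) e * coordinates V ?E v e))" ..
  define d c where "d f = fst (dc f)" and "c f = snd (dc f)" for f
  have dc: "d f \<noteq> 0" "\<And>v. v \<in> N \<Longrightarrow>
      d f * coordinates ?N ?F v f = (\<Sum>e\<in>?E. c f e * coordinates V ?E v e)" if "f \<in> ?F" for f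
    using dc' that by (auto simp: d_def c_def)
  \<comment> \<open>A common denominator for the extended coordinate functions.\<close>
  define D where "D = prod d ?F"
  have "D \<noteq> 0" unfolding D_def using dc fin by simp
  have "\<exists>k. D = k * d f" if "f \<in> ?F" for f
    using dvd_prodI[OF fin(2) that, of d] by (auto simp: D_def dvd_def mult.commute)
  then obtain k where k: "\<And>f. f \<in> ?F \<Longrightarrow> D = k f * d f" by metis
  define \<psi> where "\<psi> f v = (\<Sum>e\<in>?E. (k f * c f e) * coordinates V ?E v e)" for f v
  define \<pi> where "\<pi> v = (\<Oplus>\<^bsub>V\<^esub>f\<in>?F. \<psi> f v \<odot>\<^bsub>V\<^esub> f)" for v
  have psi: "functional V (\<psi> f)" for f
    unfolding \<psi>_def functional_def
    using functional_add[OF functional_coordinates[OF L E]] functional_smult[OF functional_coordinates[OF L E]]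
    by (auto simp: algebra_simps sum.distrib sum_distrib_left)
  have fV: "f \<in> carrier V" if "f \<in> ?F" for f using that fin NV by auto
  have "module_map type_ring V V \<pi>"
    unfolding \<pi>_def
  proof (rule module_map_finsum_maps[OF L L])
    fix f assume "f \<in> ?F"
    then show "module_map type_ring V V (\<lambda>v. \<psi> f v \<odot>\<^bsub>V\<^esub> f)"
      using fV V.smult_l_distr[of _ _ f] V.smult_assoc[of _ _ f]
      by (auto simp: module_map_def V.smult_closed functional_add[OF psi] functional_smult[OF psi])
  qed
  moreover have "\<pi> v \<in> N" for v
  proof -
    interpret N: left_module type_ring ?N by fact
    have "(\<Oplus>\<^bsub>?N\<^esub>f\<in>?F. \<psi> f v \<odot>\<^bsub>?N\<^esub> f) \<in> carrier ?N"
      using fin N.smult_closed by (intro N.M.finsum_closed) auto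
    moreover have "\<psi> f v \<odot>\<^bsub>V\<^esub> f \<in> N" if "f \<in> ?F" for f
      using submoduleD(5)[OF N] fin that by auto
    ultimately show ?thesis
      using finsum_submodule[OF L N, of ?F "\<lambda>f. \<psi> f v \<odot>\<^bsub>V\<^esub> f"] by (simp add: \<pi>_def)
  qed
  moreover have "\<pi> v = D \<odot>\<^bsub>V\<^esub> v" if v: "v \<in> N" for v
  proof -
    have "\<psi> f v = D * coordinates ?N ?F v f" if "f \<in> ?F" for f
      using dc(2)[OF that v] k[OF that] by (simp add: \<psi>_def sum_distrib_left mult.assoc)
    then have "\<pi> v = (\<Oplus>\<^bsub>V\<^esub>f\<in>?F. D \<odot>\<^bsub>V\<^esub> (coordinates ?N ?F v f \<odot>\<^bsub>V\<^esub> f))"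
      unfolding \<pi>_def using fV V.smult_assoc[of D] by (intro V.M.finsum_cong') (auto simp: V.smult_closed)
    also have "\<dots> = D \<odot>\<^bsub>V\<^esub> (\<Oplus>\<^bsub>V\<^esub>f\<in>?F. coordinates ?N ?F v f \<odot>\<^bsub>V\<^esub> f)"
      using fV by (intro V.smult_finsum[symmetric]) (auto intro!: V.smult_closed)
    also have "(\<Oplus>\<^bsub>V\<^esub>f\<in>?F. coordinates ?N ?F v f \<odot>\<^bsub>V\<^esub> f) = v"
    proof -
      have "coordinates ?N ?F v f \<odot>\<^bsub>V\<^esub> f \<in> N" if "f \<in> ?F" for f
        using submoduleD(5)[OF N] fin that by auto
      then show ?thesis
        using finsum_submodule[OF L N, of ?F "\<lambda>f. coordinates ?N ?F v f \<odot>\<^bsub>V\<^esub> f"]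
          coordinates_sum[OF F, of v] v by simp
    qed
    finally show ?thesis .
  qed
  ultimately show ?thesis
    using that \<open>D \<noteq> 0\<close> by blast
qed

section \<open>The trace\<close>

lemma module_trace_cong:
  assumes "free_finite_rank V" "\<And>x. x \<in> carrier V \<Longrightarrow> \<alpha> x = \<beta> x"
  shows "module_trace V \<alpha> = module_trace V \<beta>"
  unfolding module_trace_def
  using some_basis[OF assms(1)] assms(2) by (intro sum.cong) (auto simp: is_finite_basis_def subset_iff)

lemma module_trace_id:
  assumes "free_finite_rank V"
  shows "module_trace V (\<lambda>x. x) = of_nat (module_rank V)"
proof -
  note L = free_finite_rank_left_module[OF assms] and E = some_basis[OF assms]
  have "module_trace V (\<lambda>x. x) = (\<Sum>x\<in>some_basis V. 1)"
    unfolding module_trace_def by (intro sum.cong) (auto simp: coordinates_basis[OF L E])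
  then show ?thesis by (simp add: module_rank_def)
qed

lemma module_trace_smult:
  assumes "free_finite_rank V" "\<And>x. x \<in> carrier V \<Longrightarrow> \<alpha> x \<in> carrier V"
  shows "module_trace V (\<lambda>x. r \<odot>\<^bsub>V\<^esub> \<alpha> x) = r * module_trace V \<alpha>"
proof -
  note L = free_finite_rank_left_module[OF assms(1)] and E = some_basis[OF assms(1)]
  have "some_basis V \<subseteq> carrier V" using E by (simp add: is_finite_basis_def)
  then show ?thesis
    unfolding module_trace_def sum_distrib_left
    using assms(2) by (intro sum.cong) (auto simp: functional_smult[OF functional_coordinates[OF L E]])
qed

lemma module_trace_finsum:
  assumes "free_finite_rank V" "\<And>i x. \<lbrakk>i \<in> I; x \<in> carrier V\<rbrakk> \<Longrightarrow> \<gamma> i x \<in> carrier V"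
  shows "module_trace V (\<lambda>x. \<Oplus>\<^bsub>V\<^esub>i\<in>I. \<gamma> i x) = (\<Sum>i\<in>I. module_trace V (\<gamma> i))"
proof -
  note L = free_finite_rank_left_module[OF assms(1)] and E = some_basis[OF assms(1)]
  have E': "some_basis V \<subseteq> carrier V" using E by (simp add: is_finite_basis_def)
  have "module_trace V (\<lambda>x. \<Oplus>\<^bsub>V\<^esub>i\<in>I. \<gamma> i x) =
      (\<Sum>x\<in>some_basis V. \<Sum>i\<in>I. coordinates V (some_basis V) (\<gamma> i x) x)"
    unfolding module_trace_def
  proof (rule sum.cong)
    fix x assume x: "x \<in> some_basis V"
    then show "coordinates V (some_basis V) (\<Oplus>\<^bsub>V\<^esub>i\<in>I. \<gamma> i x) x =
        (\<Sum>i\<in>I. coordinates V (some_basis V) (\<gamma> i x) x)"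
      using functional_finsum[OF L functional_coordinates[OF L E x], of I "\<lambda>i. \<gamma> i x"] assms(2) E' by auto
  qed simp
  then show ?thesis
    unfolding module_trace_def by (simp add: sum.swap[of _ I])
qed

lemma functional_via_coordinates:
  assumes "left_module type_ring M" "left_module type_ring N" "is_finite_basis M B" "B \<subseteq> carrier M"
    "x \<in> carrier M" "functional N \<phi>" "module_map type_ring M N h"
  shows "\<phi> (h x) = (\<Sum>b\<in>B. coordinates M B x b * \<phi> (h b))"
proof -
  have "functional M (\<lambda>x. \<phi> (h x))" by (rule functional_compose) fact+
  from functional_finsum_smult[OF assms(1) this, of B "\<lambda>x. x" "coordinates M B x"] show ?thesis
    using coordinates_sum[OF assms(3,5)] assms(4) by auto
qed

text \<open>
  Both sides are the double sum of products of matrix entries of \<open>f\<close> and \<open>g\<close>. All comparisons of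
  traces below, including independence of the basis, come from this symmetry.
\<close>

lemma module_trace_commute:
  assumes V: "free_finite_rank V" and W: "free_finite_rank W"
    and f: "module_map type_ring V W f" and g: "module_map type_ring W V g"
  shows "module_trace V (\<lambda>x. g (f x)) = module_trace W (\<lambda>y. f (g y))"
proof -
  note LV = free_finite_rank_left_module[OF V] and E = some_basis[OF V]
  note LW = free_finite_rank_left_module[OF W] and D = some_basis[OF W]
  let ?E = "some_basis V" let ?D = "some_basis W"
  let ?c = "coordinates V ?E" let ?d = "coordinates W ?D"
  interpret V: left_module type_ring V by (rule LV)
  interpret W: left_module type_ring W by (rule LW)
  have EV: "?E \<subseteq> carrier V" and DW: "?D \<subseteq> carrier W"
    using E D by (simp_all add: is_finite_basis_def)
  note 1 = functional_via_coordinates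
  have "module_trace V (\<lambda>x. g (f x)) = (\<Sum>e\<in>?E. \<Sum>b\<in>?D. ?d (f e) b * ?c (g b) e)"
    unfolding module_trace_def using EV module_map_closed[OF f] functional_coordinates[OF LV E]
    by (intro sum.cong 1[OF LW LV D DW _ _ g]) auto
  also have "\<dots> = (\<Sum>b\<in>?D. \<Sum>e\<in>?E. ?c (g b) e * ?d (f e) b)"
    by (subst sum.swap) (simp add: mult.commute)
  also have "\<dots> = module_trace W (\<lambda>y. f (g y))"
    unfolding module_trace_def using DW module_map_closed[OF g] functional_coordinates[OF LW D]
    by (intro sum.cong 1[OF LV LW E EV _ _ f, symmetric]) auto
  finally show ?thesis .
qed

lemma module_trace_conjugate:
  assumes V: "free_finite_rank V" and W: "free_finite_rank W"
    and f: "module_map type_ring V W f" and g: "module_map type_ring W V g"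
    and gf: "\<And>x. x \<in> carrier V \<Longrightarrow> g (f x) = x"
    and \<beta>: "module_map type_ring V V \<beta>" and \<alpha>: "\<And>y. y \<in> carrier W \<Longrightarrow> \<alpha> y = f (\<beta> (g y))"
  shows "module_trace W \<alpha> = module_trace V \<beta>"
proof -
  have "module_trace W \<alpha> = module_trace W (\<lambda>y. f (\<beta> (g y)))"
    by (rule module_trace_cong[OF W]) (rule \<alpha>)
  also have "\<dots> = module_trace V (\<lambda>x. \<beta> (g (f x)))"
    using module_trace_commute[OF V W f module_map_compose[OF g \<beta>]] by simp
  also have "\<dots> = module_trace V \<beta>"
    by (rule module_trace_cong[OF V]) (simp add: gf)
  finally show ?thesis .
qed

text \<open>
  For \<open>W\<close> presented as a direct summand of a sum of copies of \<open>V\<close>, expand \<open>\<beta>\<close> through the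
  presentation and move each \<open>g i\<close> to the front by \<open>module_trace_commute\<close>.
\<close>

lemma module_trace_factor:
  assumes V: "free_finite_rank V" and W: "free_finite_rank W"
    and f: "\<And>i. i \<in> I \<Longrightarrow> module_map type_ring V W (f i)"
    and g: "\<And>i. i \<in> I \<Longrightarrow> module_map type_ring W V (g i)"
    and id: "\<And>w. w \<in> carrier W \<Longrightarrow> (\<Oplus>\<^bsub>W\<^esub>i\<in>I. f i (g i w)) = w"
    and \<beta>: "module_map type_ring W W \<beta>"
  shows "module_trace W \<beta> = (\<Sum>i\<in>I. module_trace V (\<lambda>x. g i (\<beta> (f i x))))"
proof -
  note LV = free_finite_rank_left_module[OF V] note LW = free_finite_rank_left_module[OF W]
  interpret W: left_module type_ring W by (rule LW)
  have "module_trace W \<beta> = module_trace W (\<lambda>w. \<Oplus>\<^bsub>W\<^esub>i\<in>I. \<beta> (f i (g i w)))"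
  proof (rule module_trace_cong[OF W])
    fix w assume w: "w \<in> carrier W"
    have "\<beta> (\<Oplus>\<^bsub>W\<^esub>i\<in>I. f i (g i w)) = (\<Oplus>\<^bsub>W\<^esub>i\<in>I. \<beta> (f i (g i w)))"
      using w f g by (intro module_map_finsum[OF LW LW \<beta>]) (auto simp: module_map_def)
    then show "\<beta> w = (\<Oplus>\<^bsub>W\<^esub>i\<in>I. \<beta> (f i (g i w)))"
      using id[OF w] by simp
  qed
  also have "\<dots> = (\<Sum>i\<in>I. module_trace W (\<lambda>w. \<beta> (f i (g i w))))"
    using f g \<beta> by (intro module_trace_finsum[OF W]) (auto simp: module_map_def)
  also have "\<dots> = (\<Sum>i\<in>I. module_trace V (\<lambda>x. g i (\<beta> (f i x))))"
  proof (rule sum.cong)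
    fix i assume i: "i \<in> I"
    show "module_trace W (\<lambda>w. \<beta> (f i (g i w))) = module_trace V (\<lambda>x. g i (\<beta> (f i x)))"
      using module_trace_commute[OF W V g[OF i] module_map_compose[OF f[OF i] \<beta>]] .
  qed simp
  finally show ?thesis .
qed

text \<open>
  The coordinates of all the components \<open>g i w\<close> separate the points of \<open>W\<close>.
\<close>

lemma free_of_factor:
  fixes V :: "('o::idom, 'v) module" and W :: "('o, 'w) module" and f :: "'i \<Rightarrow> 'v \<Rightarrow> 'w"
  assumes PID: "principal_domain (type_ring :: 'o ring)" and I: "finite I"
    and V: "free_finite_rank V" and LW: "left_module type_ring W"
    and f: "\<And>i. i \<in> I \<Longrightarrow> module_map type_ring V W (f i)"
    and g: "\<And>i. i \<in> I \<Longrightarrow> module_map type_ring W V (g i)"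
    and id: "\<And>w. w \<in> carrier W \<Longrightarrow> (\<Oplus>\<^bsub>W\<^esub>i\<in>I. f i (g i w)) = w"
  shows "free_finite_rank W"
proof -
  note LV = free_finite_rank_left_module[OF V] and E = some_basis[OF V]
  interpret V: left_module type_ring V by (rule LV)
  interpret W: left_module type_ring W by (rule LW)
  let ?E = "some_basis V"
  have fin: "finite (I \<times> ?E)" using I E by (simp add: is_finite_basis_def)
  show ?thesis
  proof (rule free_of_jointly_injective_functionals[OF PID fin LW])
    show "functional W (case_prod (\<lambda>i e w. coordinates V ?E (g i w) e) ie)" if "ie \<in> I \<times> ?E" for ie
      using that functional_compose[OF g functional_coordinates[OF LV E]] by auto
    fix w assume w: "w \<in> carrier W"
      and 0: "\<And>ie. ie \<in> I \<times> ?E \<Longrightarrow> (case_prod (\<lambda>i e w. coordinates V ?E (g i w) e) ie) w = 0"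
    have "g i w = \<zero>\<^bsub>V\<^esub>" if i: "i \<in> I" for i
    proof (rule coordinates_eqI[OF E _ _ _ LV])
      fix e assume "e \<in> ?E"
      then show "coordinates V ?E (g i w) e = coordinates V ?E \<zero>\<^bsub>V\<^esub> e"
        using 0[of "(i, e)"] i functional_zero[OF LV functional_coordinates[OF LV E]] by auto
    qed (use module_map_closed[OF g[OF i]] w in auto)
    then have "(\<Oplus>\<^bsub>W\<^esub>i\<in>I. f i (g i w)) = (\<Oplus>\<^bsub>W\<^esub>i\<in>I. \<zero>\<^bsub>W\<^esub>)"
      using module_map_zero[OF LV LW f] by (intro W.M.finsum_cong') auto
    then show "w = \<zero>\<^bsub>W\<^esub>" using id[OF w] by simp
  qed
qed

section \<open>Modules over an algebra\<close>

lemma assoc_algebraD: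
  assumes "assoc_algebra A"
  shows "ring A" "left_module type_ring A"
    "\<And>r x y. \<lbrakk>x \<in> carrier A; y \<in> carrier A\<rbrakk> \<Longrightarrow> (r \<odot>\<^bsub>A\<^esub> x) \<otimes>\<^bsub>A\<^esub> y = r \<odot>\<^bsub>A\<^esub> (x \<otimes>\<^bsub>A\<^esub> y)"
    "\<And>r x y. \<lbrakk>x \<in> carrier A; y \<in> carrier A\<rbrakk> \<Longrightarrow> x \<otimes>\<^bsub>A\<^esub> (r \<odot>\<^bsub>A\<^esub> y) = r \<odot>\<^bsub>A\<^esub> (x \<otimes>\<^bsub>A\<^esub> y)"
  using assms by (auto simp: assoc_algebra_def)

lemma restrict_scalars_simps [simp]:
  "carrier (restrict_scalars A V) = carrier V"
  "add (restrict_scalars A V) = add V"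
  "ring.zero (restrict_scalars A V) = ring.zero V"
  "Module.module.smult (restrict_scalars A V) r v = (r \<odot>\<^bsub>A\<^esub> \<one>\<^bsub>A\<^esub>) \<odot>\<^bsub>V\<^esub> v"
  by (simp_all add: restrict_scalars_def)

lemma finsum_restrict_scalars [simp]: "finsum (restrict_scalars A V) = finsum V"
  by (simp add: fun_eq_iff finsum_def finprod_def restrict_scalars_def)

lemma abelian_group_restrict_scalars: "abelian_group V \<Longrightarrow> abelian_group (restrict_scalars A V)"
proof (rule abelian_groupI)
  assume "abelian_group V"
  then interpret V: abelian_group V .
  show "\<exists>y\<in>carrier (restrict_scalars A V). y \<oplus>\<^bsub>restrict_scalars A V\<^esub> x = \<zero>\<^bsub>restrict_scalars A V\<^esub>"
    if "x \<in> carrier (restrict_scalars A V)" for x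
    using V.l_neg[of x] that by auto
  show "x \<oplus>\<^bsub>restrict_scalars A V\<^esub> y \<oplus>\<^bsub>restrict_scalars A V\<^esub> z =
      x \<oplus>\<^bsub>restrict_scalars A V\<^esub> (y \<oplus>\<^bsub>restrict_scalars A V\<^esub> z)"
    if "x \<in> carrier (restrict_scalars A V)" "y \<in> carrier (restrict_scalars A V)"
      "z \<in> carrier (restrict_scalars A V)" for x y z
    using that by (simp add: V.a_assoc)
  show "x \<oplus>\<^bsub>restrict_scalars A V\<^esub> y = y \<oplus>\<^bsub>restrict_scalars A V\<^esub> x"
    if "x \<in> carrier (restrict_scalars A V)" "y \<in> carrier (restrict_scalars A V)" for x y
    using that by (simp add: V.a_comm)
  show "x \<oplus>\<^bsub>restrict_scalars A V\<^esub> y \<in> carrier (restrict_scalars A V)"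
    if "x \<in> carrier (restrict_scalars A V)" "y \<in> carrier (restrict_scalars A V)" for x y
    using that by simp
  show "\<zero>\<^bsub>restrict_scalars A V\<^esub> \<in> carrier (restrict_scalars A V)" by simp
  show "\<zero>\<^bsub>restrict_scalars A V\<^esub> \<oplus>\<^bsub>restrict_scalars A V\<^esub> x = x"
    if "x \<in> carrier (restrict_scalars A V)" for x
    using that by simp
qed

locale assoc_alg =
  fixes A :: "('r::comm_ring_1, 'a) module" (structure)
  assumes assoc_algebra: "assoc_algebra A"
begin

sublocale ring A by (rule assoc_algebraD(1)[OF assoc_algebra])
sublocale S: left_module type_ring A by (rule assoc_algebraD(2)[OF assoc_algebra])

lemmas smult_mult = assoc_algebraD(3)[OF assoc_algebra]
lemmas mult_smult = assoc_algebraD(4)[OF assoc_algebra]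

lemma smult_cl [simp]: "x \<in> carrier A \<Longrightarrow> r \<odot> x \<in> carrier A"
  by (rule S.smult_closed) simp_all

lemma unit_mult: "x \<in> carrier A \<Longrightarrow> (r \<odot> \<one>) \<otimes> x = r \<odot> x"
  by (simp add: smult_mult)

lemma mult_unit: "x \<in> carrier A \<Longrightarrow> x \<otimes> (r \<odot> \<one>) = r \<odot> x"
  by (simp add: mult_smult)

lemma left_module_restrict_scalars:
  assumes "left_module A V"
  shows "left_module type_ring (restrict_scalars A V)"
proof -
  interpret V: left_module A V by fact
  show ?thesis
  proof (rule left_moduleI)
    show "ring (type_ring :: 'r ring)" by (rule ring_from_type_algebra)
    show "abelian_group (restrict_scalars A V)"
      by (rule abelian_group_restrict_scalars) (rule V.M.abelian_group_axioms)
    fix a b :: 'r and x assume "x \<in> carrier (restrict_scalars A V)"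
    then have x: "x \<in> carrier V" by simp
    show "a \<odot>\<^bsub>restrict_scalars A V\<^esub> x \<in> carrier (restrict_scalars A V)"
      using x by (simp add: V.smult_closed)
    show "(a \<oplus>\<^bsub>type_ring\<^esub> b) \<odot>\<^bsub>restrict_scalars A V\<^esub> x =
        a \<odot>\<^bsub>restrict_scalars A V\<^esub> x \<oplus>\<^bsub>restrict_scalars A V\<^esub> b \<odot>\<^bsub>restrict_scalars A V\<^esub> x"
      using x S.smult_l_distr[of a b \<one>] by (simp add: V.smult_l_distr)
    show "(a \<otimes>\<^bsub>type_ring\<^esub> b) \<odot>\<^bsub>restrict_scalars A V\<^esub> x =
        a \<odot>\<^bsub>restrict_scalars A V\<^esub> (b \<odot>\<^bsub>restrict_scalars A V\<^esub> x)"
      using x S.smult_assoc[of a b \<one>] V.smult_assoc[of "a \<odot> \<one>" "b \<odot> \<one>" x]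
      by (simp add: smult_mult)
  next
    fix x assume "x \<in> carrier (restrict_scalars A V)"
    then show "\<one>\<^bsub>type_ring\<^esub> \<odot>\<^bsub>restrict_scalars A V\<^esub> x = x"
      using S.smult_one[of \<one>] by (simp add: V.smult_one)
  qed (simp add: V.smult_r_distr)
qed

lemma module_map_restrict_scalars:
  "module_map A V W f \<Longrightarrow> module_map type_ring (restrict_scalars A V) (restrict_scalars A W) f"
  by (simp add: module_map_def)

lemma central_unit: "a \<in> carrier A \<Longrightarrow> a \<otimes> (r \<odot> \<one>) = (r \<odot> \<one>) \<otimes> a"
  by (simp add: unit_mult mult_unit)

lemma module_map_action:
  assumes "left_module A V" "a \<in> carrier A"
  shows "module_map type_ring (restrict_scalars A V) (restrict_scalars A V) (\<lambda>v. a \<odot>\<^bsub>V\<^esub> v)"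
proof -
  interpret V: left_module A V by fact
  show ?thesis
    using assms(2) central_unit[OF assms(2)]
    by (auto simp: module_map_def V.smult_closed V.smult_r_distr V.smult_assoc[symmetric])
qed

lemma module_map_orbit:
  assumes "left_module A V" "v \<in> carrier V"
  shows "module_map type_ring A (restrict_scalars A V) (\<lambda>a. a \<odot>\<^bsub>V\<^esub> v)"
proof -
  interpret V: left_module A V by fact
  show ?thesis
    using assms(2) by (auto simp: module_map_def V.smult_closed V.smult_l_distr V.smult_assoc[symmetric] unit_mult)
qed

lemma module_map_central:
  assumes "left_module A V" "u \<in> carrier A" "\<And>a. a \<in> carrier A \<Longrightarrow> u \<otimes>\<^bsub>A\<^esub> a = a \<otimes>\<^bsub>A\<^esub> u"
  shows "module_map A V V (\<lambda>v. u \<odot>\<^bsub>V\<^esub> v)"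
proof -
  interpret V: left_module A V by (rule assms(1))
  show ?thesis
    unfolding module_map_def
  proof (intro conjI ballI)
    fix a x assume ax: "a \<in> carrier A" "x \<in> carrier V"
    have "u \<odot>\<^bsub>V\<^esub> (a \<odot>\<^bsub>V\<^esub> x) = (u \<otimes>\<^bsub>A\<^esub> a) \<odot>\<^bsub>V\<^esub> x"
      using V.smult_assoc[OF assms(2) ax] by simp
    also have "\<dots> = a \<odot>\<^bsub>V\<^esub> (u \<odot>\<^bsub>V\<^esub> x)"
      unfolding assms(3)[OF ax(1)] by (rule V.smult_assoc[OF ax(1) assms(2) ax(2)])
    finally show "u \<odot>\<^bsub>V\<^esub> (a \<odot>\<^bsub>V\<^esub> x) = a \<odot>\<^bsub>V\<^esub> (u \<odot>\<^bsub>V\<^esub> x)" .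
  qed (simp_all add: assms(2) V.smult_closed V.smult_r_distr)
qed

lemma left_module_regular: "left_module A (regular_module A)"
proof (rule left_moduleI)
  show "abelian_group (regular_module A)"
  proof (rule abelian_groupI)
    show "\<exists>y\<in>carrier (regular_module A). y \<oplus>\<^bsub>regular_module A\<^esub> x = \<zero>\<^bsub>regular_module A\<^esub>"
      if "x \<in> carrier (regular_module A)" for x
      using l_neg[of x] that by (auto simp: regular_module_def)
  qed (auto simp: regular_module_def a_ac)
qed (auto simp: regular_module_def ring_axioms l_distr r_distr m_assoc)

lemma action_finsum:
  assumes "left_module A V" "v \<in> carrier V" "\<And>i. i \<in> I \<Longrightarrow> h i \<in> carrier A"
  shows "finsum A h I \<odot>\<^bsub>V\<^esub> v = (\<Oplus>\<^bsub>V\<^esub>i\<in>I. h i \<odot>\<^bsub>V\<^esub> v)"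
  using module_map_finsum[OF S.left_module_axioms left_module_restrict_scalars[OF assms(1)]
      module_map_orbit[OF assms(1,2)], of I h] assms(3) by simp

end

lemma (in abelian_group) finsum_swap:
  assumes "\<And>i j. \<lbrakk>i \<in> I; j \<in> J\<rbrakk> \<Longrightarrow> h i j \<in> carrier G" "finite I" "finite J"
  shows "(\<Oplus>i\<in>I. \<Oplus>j\<in>J. h i j) = (\<Oplus>j\<in>J. \<Oplus>i\<in>I. h i j)"
  using assms(2,1)
proof (induction I rule: finite_induct)
  case (insert i I)
  have "(\<Oplus>j\<in>J. \<Oplus>i\<in>insert i I. h i j) = (\<Oplus>j\<in>J. h i j \<oplus> (\<Oplus>i\<in>I. h i j))"
    using insert by (intro finsum_cong') (auto intro!: finsum_insert finsum_closed)
  also have "\<dots> = (\<Oplus>j\<in>J. h i j) \<oplus> (\<Oplus>j\<in>J. \<Oplus>i\<in>I. h i j)"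
    using insert by (intro finsum_addf) (auto intro!: finsum_closed)
  also have "\<dots> = (\<Oplus>i\<in>insert i I. \<Oplus>j\<in>J. h i j)"
    using insert by (subst finsum_insert) (auto intro!: finsum_closed)
  finally show ?case by simp
qed (use assms in simp)

text \<open>
  The module structure on the image of \<open>V\<close> under an injection \<open>f\<close> into another type. The ring
  fields that a module record carries are left undefined.
\<close>

definition transport_module :: "('v \<Rightarrow> 'w) \<Rightarrow> ('a, 'v) module \<Rightarrow> ('a, 'w) module" where
  "transport_module f V = (let g = inv_into (carrier V) f in
     \<lparr> carrier = f ` carrier V, monoid.mult = undefined, one = undefined, ring.zero = f \<zero>\<^bsub>V\<^esub>,
       add = (\<lambda>x y. f (g x \<oplus>\<^bsub>V\<^esub> g y)), Module.module.smult = (\<lambda>a x. f (a \<odot>\<^bsub>V\<^esub> g x)) \<rparr>)"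

lemma transport_module:
  assumes V: "left_module R V" and f: "inj_on f (carrier V)"
  shows "left_module R (transport_module f V)" "module_map R V (transport_module f V) f"
    "bij_betw f (carrier V) (carrier (transport_module f V))"
proof -
  interpret V: left_module R V by fact
  let ?g = "inv_into (carrier V) f" let ?T = "transport_module f V"
  have g [simp]: "?g (f x) = x" if "x \<in> carrier V" for x using f that by simp
  have T: "carrier ?T = f ` carrier V" "\<zero>\<^bsub>?T\<^esub> = f \<zero>\<^bsub>V\<^esub>"
    "\<And>x y. \<lbrakk>x \<in> carrier V; y \<in> carrier V\<rbrakk> \<Longrightarrow> f x \<oplus>\<^bsub>?T\<^esub> f y = f (x \<oplus>\<^bsub>V\<^esub> y)"
    "\<And>a x. x \<in> carrier V \<Longrightarrow> a \<odot>\<^bsub>?T\<^esub> f x = f (a \<odot>\<^bsub>V\<^esub> x)"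
    by (simp_all add: transport_module_def Let_def)
  have "abelian_group ?T"
  proof (rule abelian_groupI)
    fix x assume "x \<in> carrier ?T"
    then obtain v where "x = f v" "v \<in> carrier V" by (auto simp: T)
    then show "\<exists>y\<in>carrier ?T. y \<oplus>\<^bsub>?T\<^esub> x = \<zero>\<^bsub>?T\<^esub>"
      by (intro bexI[of _ "f (\<ominus>\<^bsub>V\<^esub> v)"]) (auto simp: T V.M.l_neg)
  qed (auto simp: T V.M.a_ac)
  then show "left_module R ?T"
    by (intro left_moduleI)
      (auto simp: T V.R.ring_axioms V.smult_l_distr V.smult_r_distr V.smult_assoc V.smult_one V.smult_closed)
  show "module_map R V ?T f"
    by (simp add: module_map_def T)
  show "bij_betw f (carrier V) (carrier ?T)"
    using f by (simp add: bij_betw_def T)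
qed

lemma lattice_overD:
  assumes "lattice_over A V"
  shows "left_module A V" "free_finite_rank (restrict_scalars A V)"
  using assms by (auto simp: lattice_over_def)

section \<open>Symmetric algebras\<close>

locale symm_alg = assoc_alg A for A :: "('r::idom, 'a) module" (structure) +
  fixes \<Phi> :: "'a \<Rightarrow> 'a \<Rightarrow> 'r"
  assumes free: "free_finite_rank A" and Phi: "dual_bimodule_iso A \<Phi>"
begin

definition s :: "'a \<Rightarrow> 'r" where "s = \<Phi> \<one>"

abbreviation E :: "'a set" where "E \<equiv> some_basis A"

definition dual :: "'a \<Rightarrow> 'a" where "dual = dual_basis_elt A s E"

lemma basis: "is_finite_basis A E"
  by (rule some_basis[OF free])

lemma basis_finite [simp]: "finite E" and basis_subset: "E \<subseteq> carrier A"
  using basis by (simp_all add: is_finite_basis_def)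

lemma basis_in [simp]: "x \<in> E \<Longrightarrow> x \<in> carrier A"
  using basis_subset by auto

lemma Phi_dual: "x \<in> carrier A \<Longrightarrow> \<Phi> x \<in> dual_module A"
  using Phi by (auto simp: dual_bimodule_iso_def bij_betw_def)

lemma Phi_bimodule: "\<lbrakk>a \<in> carrier A; x \<in> carrier A; b \<in> carrier A; z \<in> carrier A\<rbrakk> \<Longrightarrow>
    \<Phi> (a \<otimes> x \<otimes> b) z = \<Phi> x (b \<otimes> z \<otimes> a)"
  using Phi by (auto simp: dual_bimodule_iso_def)

lemma Phi_eq: "\<lbrakk>x \<in> carrier A; z \<in> carrier A\<rbrakk> \<Longrightarrow> \<Phi> x z = s (x \<otimes> z)"
  using Phi_bimodule[of \<one> \<one> x z] by (simp add: s_def)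

lemma s_commute: "\<lbrakk>x \<in> carrier A; z \<in> carrier A\<rbrakk> \<Longrightarrow> s (x \<otimes> z) = s (z \<otimes> x)"
  using Phi_bimodule[of x \<one> \<one> z] Phi_eq[of x z] by (simp add: s_def)

lemma s_functional: "functional A s"
  using Phi_dual[of \<one>] by (simp add: s_def dual_module_iff)

lemma module_map_lmult: "a \<in> carrier A \<Longrightarrow> module_map type_ring A A (\<lambda>x. a \<otimes> x)"
  by (simp add: module_map_def r_distr mult_smult)

lemma module_map_rmult: "a \<in> carrier A \<Longrightarrow> module_map type_ring A A (\<lambda>x. x \<otimes> a)"
  by (simp add: module_map_def l_distr smult_mult)

lemma s_lmult: "a \<in> carrier A \<Longrightarrow> functional A (\<lambda>x. s (a \<otimes> x))"
  by (rule functional_compose[OF module_map_lmult s_functional])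

lemma s_rmult: "a \<in> carrier A \<Longrightarrow> functional A (\<lambda>x. s (x \<otimes> a))"
  by (rule functional_compose[OF module_map_rmult s_functional])

lemma form_nondegenerate:
  assumes "x \<in> carrier A" "y \<in> carrier A" "\<And>z. z \<in> carrier A \<Longrightarrow> s (x \<otimes> z) = s (y \<otimes> z)"
  shows "x = y"
proof -
  have "\<Phi> x = \<Phi> y"
    using Phi_dual[OF assms(1)] Phi_dual[OF assms(2)] assms
    by (intro extensionalityI[of _ "carrier A"]) (auto simp: dual_module_iff Phi_eq)
  then show ?thesis
    using Phi assms by (auto simp: dual_bimodule_iso_def bij_betw_def inj_on_def)
qed

lemma form_represents:
  assumes "functional A \<phi>"
  obtains u where "u \<in> carrier A" "\<And>z. z \<in> carrier A \<Longrightarrow> \<phi> z = s (u \<otimes> z)"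
proof -
  have "restrict \<phi> (carrier A) \<in> dual_module A"
    using assms by (auto simp: dual_module_iff functional_def)
  then obtain u where u: "u \<in> carrier A" "\<Phi> u = restrict \<phi> (carrier A)"
    using Phi unfolding dual_bimodule_iso_def bij_betw_def by (metis imageE)
  show ?thesis
    by (rule that[OF u(1)]) (use u Phi_eq in \<open>metis restrict_apply'\<close>)
qed

lemma form_nondegenerate_basis:
  assumes "x \<in> carrier A" "y \<in> carrier A" "\<And>e. e \<in> E \<Longrightarrow> s (e \<otimes> x) = s (e \<otimes> y)"
  shows "x = y"
proof (rule form_nondegenerate[OF assms(1,2)])
  fix z assume z: "z \<in> carrier A"
  have "s (z \<otimes> w) = (\<Sum>e\<in>E. coordinates A E z e * s (e \<otimes> w))" if "w \<in> carrier A" for w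
    using functional_finsum_smult[OF S.left_module_axioms s_rmult[OF that], of E "\<lambda>x. x" "coordinates A E z"]
      coordinates_sum[OF basis z] by simp
  then have "s (z \<otimes> x) = s (z \<otimes> y)" using assms by simp
  then show "s (x \<otimes> z) = s (y \<otimes> z)" using assms z by (simp add: s_commute)
qed

lemma dual:
  assumes y: "y \<in> E"
  shows "dual y \<in> carrier A" "\<And>x. x \<in> E \<Longrightarrow> s (x \<otimes> dual y) = (if x = y then 1 else 0)"
proof -
  obtain u where u: "u \<in> carrier A" "\<And>z. z \<in> carrier A \<Longrightarrow> coordinates A E z y = s (u \<otimes> z)"
    using form_represents[OF functional_coordinates[OF S.left_module_axioms basis y]] by metis
  let ?P = "\<lambda>z. z \<in> carrier A \<and> (\<forall>x\<in>E. s (x \<otimes> z) = (if x = y then 1 else 0))"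
  have "?P u"
    using u coordinates_basis[OF S.left_module_axioms basis y] s_commute by auto
  moreover have "w = u" if "?P w" for w
    using that \<open>?P u\<close> by (intro form_nondegenerate_basis) auto
  ultimately have "?P (dual y)"
    unfolding dual_def dual_basis_elt_def by (rule theI)
  then show "dual y \<in> carrier A" "\<And>x. x \<in> E \<Longrightarrow> s (x \<otimes> dual y) = (if x = y then 1 else 0)" by auto
qed

lemmas dual_in [simp] = dual(1)

text \<open>
  The dual basis reads off coordinates, so that the trace of an operator on \<open>A\<close> can be written in
  terms of the form.
\<close>

lemma coordinates_eq:
  assumes a: "a \<in> carrier A" and y: "y \<in> E"
  shows "coordinates A E a y = s (a \<otimes> dual y)"
proof -
  have "s (a \<otimes> dual y) = (\<Sum>e\<in>E. coordinates A E a e * s (e \<otimes> dual y))"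
    using functional_finsum_smult[OF S.left_module_axioms s_rmult[OF dual(1)[OF y]], of E "\<lambda>x. x" "coordinates A E a"]
      coordinates_sum[OF basis a] by simp
  also have "\<dots> = (\<Sum>e\<in>E. if e = y then coordinates A E a e else 0)"
    using dual(2)[OF y] by (intro sum.cong) auto
  finally show ?thesis using y by simp
qed

lemma expand:
  assumes a: "a \<in> carrier A"
  shows "(\<Oplus>x\<in>E. s (a \<otimes> dual x) \<odot> x) = a"
proof -
  have "(\<Oplus>x\<in>E. s (a \<otimes> dual x) \<odot> x) = (\<Oplus>x\<in>E. coordinates A E a x \<odot> x)"
    using a by (intro finsum_cong') (auto simp: coordinates_eq)
  then show ?thesis using coordinates_sum[OF basis a] by simp
qed

lemma expand_dual:
  assumes a: "a \<in> carrier A"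
  shows "(\<Oplus>x\<in>E. s (a \<otimes> x) \<odot> dual x) = a"
proof (rule form_nondegenerate_basis)
  show "(\<Oplus>x\<in>E. s (a \<otimes> x) \<odot> dual x) \<in> carrier A"
    by (rule finsum_closed) auto
  fix e assume e: "e \<in> E"
  have "s (e \<otimes> (\<Oplus>x\<in>E. s (a \<otimes> x) \<odot> dual x)) = (\<Sum>x\<in>E. s (a \<otimes> x) * s (e \<otimes> dual x))"
    by (rule functional_finsum_smult[OF S.left_module_axioms s_lmult]) (use e in auto)
  also have "\<dots> = (\<Sum>x\<in>E. if x = e then s (a \<otimes> x) else 0)"
    using dual(2) e by (intro sum.cong) auto
  also have "\<dots> = s (e \<otimes> a)"
    using e a s_commute by simp
  finally show "s (e \<otimes> (\<Oplus>x\<in>E. s (a \<otimes> x) \<odot> dual x)) = s (e \<otimes> a)" .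
qed fact

text \<open>
  Averaging over a pair of dual bases, the analogue of summing the conjugates of a linear map over a
  finite group.
\<close>

definition casimir :: "('a, 'v) module \<Rightarrow> ('a, 'w) module \<Rightarrow> ('v \<Rightarrow> 'w) \<Rightarrow> 'v \<Rightarrow> 'w" where
  "casimir V W \<pi> v = (\<Oplus>\<^bsub>W\<^esub>x\<in>E. x \<odot>\<^bsub>W\<^esub> \<pi> (dual x \<odot>\<^bsub>V\<^esub> v))"

text \<open>
  The Casimir tensor \<open>\<Sum> x \<otimes> x\<^sup>v\<close> is invariant, that is, \<open>\<Sum> a x \<otimes> x\<^sup>v = \<Sum> x \<otimes> x\<^sup>v a\<close>:
  expanding \<open>a x\<close> in the basis and \<open>x\<^sup>v a\<close> in the dual basis, both sides become the double sum with
  the coefficients \<open>s (a x y\<^sup>v)\<close>, by symmetry of the form.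
\<close>

lemma casimir_module_map:
  assumes V: "left_module A V" and W: "left_module A W"
    and \<pi>: "module_map type_ring (restrict_scalars A V) (restrict_scalars A W) \<pi>"
  shows "module_map A V W (casimir V W \<pi>)"
proof -
  interpret V: left_module A V by fact
  interpret W: left_module A W by fact
  note RV = left_module_restrict_scalars[OF V] and RW = left_module_restrict_scalars[OF W]
  interpret RW: left_module type_ring "restrict_scalars A W" by fact
  have pc: "\<pi> v \<in> carrier W" if "v \<in> carrier V" for v
    using module_map_closed[OF \<pi>] that by simp
  have "module_map type_ring (restrict_scalars A V) (restrict_scalars A W)
      (\<lambda>v. \<Oplus>\<^bsub>restrict_scalars A W\<^esub>x\<in>E. x \<odot>\<^bsub>W\<^esub> \<pi> (dual x \<odot>\<^bsub>V\<^esub> v))"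
  proof (rule module_map_finsum_maps[OF RV RW])
    fix x assume "x \<in> E"
    then show "module_map type_ring (restrict_scalars A V) (restrict_scalars A W)
        (\<lambda>v. x \<odot>\<^bsub>W\<^esub> \<pi> (dual x \<odot>\<^bsub>V\<^esub> v))"
      by (intro module_map_compose[OF _ module_map_action[OF W]]
            module_map_compose[OF module_map_action[OF V] \<pi>]) auto
  qed
  then have add: "module_map type_ring (restrict_scalars A V) (restrict_scalars A W) (casimir V W \<pi>)"
    by (simp add: casimir_def[abs_def])
  have "casimir V W \<pi> (a \<odot>\<^bsub>V\<^esub> v) = a \<odot>\<^bsub>W\<^esub> casimir V W \<pi> v"
    if a: "a \<in> carrier A" and v: "v \<in> carrier V" for a v
  proof -
    \<comment> \<open>The common double sum, where \<open>y\<close> sits on the left and the dual of \<open>x\<close> acts on the argument.\<close>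
    define t where "t x y = ((s (a \<otimes> x \<otimes> dual y)) \<odot> \<one>) \<odot>\<^bsub>W\<^esub> (y \<odot>\<^bsub>W\<^esub> \<pi> (dual x \<odot>\<^bsub>V\<^esub> v))" for x y
    have tc: "t x y \<in> carrier W" if "x \<in> E" "y \<in> E" for x y
      using that v by (simp add: t_def W.smult_closed V.smult_closed pc)
    have 1: "a \<odot>\<^bsub>W\<^esub> (x \<odot>\<^bsub>W\<^esub> \<pi> (dual x \<odot>\<^bsub>V\<^esub> v)) = (\<Oplus>\<^bsub>W\<^esub>y\<in>E. t x y)" if x: "x \<in> E" for x
    proof -
      let ?w = "\<pi> (dual x \<odot>\<^bsub>V\<^esub> v)"
      have w: "?w \<in> carrier W" using x v by (simp add: V.smult_closed pc)
      have "a \<odot>\<^bsub>W\<^esub> (x \<odot>\<^bsub>W\<^esub> ?w) = (\<Oplus>y\<in>E. s (a \<otimes> x \<otimes> dual y) \<odot> y) \<odot>\<^bsub>W\<^esub> ?w"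
        using x a w expand[of "a \<otimes> x"] by (simp add: W.smult_assoc)
      also have "\<dots> = (\<Oplus>\<^bsub>W\<^esub>y\<in>E. (s (a \<otimes> x \<otimes> dual y) \<odot> y) \<odot>\<^bsub>W\<^esub> ?w)"
        by (rule action_finsum[OF W w]) simp
      also have "\<dots> = (\<Oplus>\<^bsub>W\<^esub>y\<in>E. t x y)"
        using w by (intro W.M.finsum_cong')
          (auto simp: t_def W.smult_assoc[symmetric] unit_mult W.smult_closed)
      finally show ?thesis .
    qed
    have 2: "y \<odot>\<^bsub>W\<^esub> \<pi> (dual y \<odot>\<^bsub>V\<^esub> (a \<odot>\<^bsub>V\<^esub> v)) = (\<Oplus>\<^bsub>W\<^esub>x\<in>E. t x y)" if y: "y \<in> E" for y
    proof -
      have "dual y \<odot>\<^bsub>V\<^esub> (a \<odot>\<^bsub>V\<^esub> v) = (\<Oplus>x\<in>E. s (dual y \<otimes> a \<otimes> x) \<odot> dual x) \<odot>\<^bsub>V\<^esub> v"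
        using y a v expand_dual[of "dual y \<otimes> a"] by (simp add: V.smult_assoc)
      also have "\<dots> = (\<Oplus>\<^bsub>V\<^esub>x\<in>E. (s (dual y \<otimes> a \<otimes> x) \<odot> dual x) \<odot>\<^bsub>V\<^esub> v)"
        by (rule action_finsum[OF V v]) simp
      finally have "\<pi> (dual y \<odot>\<^bsub>V\<^esub> (a \<odot>\<^bsub>V\<^esub> v)) =
          \<pi> (\<Oplus>\<^bsub>restrict_scalars A V\<^esub>x\<in>E. (s (dual y \<otimes> a \<otimes> x) \<odot> dual x) \<odot>\<^bsub>V\<^esub> v)" by simp
      also have "\<dots> = (\<Oplus>\<^bsub>restrict_scalars A W\<^esub>x\<in>E. \<pi> ((s (dual y \<otimes> a \<otimes> x) \<odot> dual x) \<odot>\<^bsub>V\<^esub> v))"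
        using v by (intro module_map_finsum[OF RV RW \<pi>]) (auto simp: V.smult_closed)
      finally have "y \<odot>\<^bsub>W\<^esub> \<pi> (dual y \<odot>\<^bsub>V\<^esub> (a \<odot>\<^bsub>V\<^esub> v)) =
          y \<odot>\<^bsub>W\<^esub> (\<Oplus>\<^bsub>W\<^esub>x\<in>E. \<pi> ((s (dual y \<otimes> a \<otimes> x) \<odot> dual x) \<odot>\<^bsub>V\<^esub> v))" by simp
      also have "\<dots> = (\<Oplus>\<^bsub>W\<^esub>x\<in>E. y \<odot>\<^bsub>W\<^esub> \<pi> ((s (dual y \<otimes> a \<otimes> x) \<odot> dual x) \<odot>\<^bsub>V\<^esub> v))"
        using y v by (intro W.smult_finsum) (auto simp: pc V.smult_closed)
      also have "\<dots> = (\<Oplus>\<^bsub>W\<^esub>x\<in>E. t x y)"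
      proof (rule W.M.finsum_cong')
        fix x assume x: "x \<in> E"
        have "s (dual y \<otimes> a \<otimes> x) = s (a \<otimes> x \<otimes> dual y)"
          using s_commute[of "dual y" "a \<otimes> x"] x y a by (simp add: m_assoc)
        moreover have "\<pi> ((r \<odot> dual x) \<odot>\<^bsub>V\<^esub> v) = (r \<odot> \<one>) \<odot>\<^bsub>W\<^esub> \<pi> (dual x \<odot>\<^bsub>V\<^esub> v)" for r
          using module_map_smult[OF \<pi>, of r "dual x \<odot>\<^bsub>V\<^esub> v"] x v
          by (simp add: V.smult_closed V.smult_assoc[symmetric] unit_mult)
        ultimately show "y \<odot>\<^bsub>W\<^esub> \<pi> ((s (dual y \<otimes> a \<otimes> x) \<odot> dual x) \<odot>\<^bsub>V\<^esub> v) = t x y"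
          using x y v pc central_unit[of y]
          by (simp add: t_def W.smult_assoc[symmetric] V.smult_closed)
      qed (use tc y in auto)
      finally show ?thesis .
    qed
    have "casimir V W \<pi> (a \<odot>\<^bsub>V\<^esub> v) = (\<Oplus>\<^bsub>W\<^esub>y\<in>E. \<Oplus>\<^bsub>W\<^esub>x\<in>E. t x y)"
      unfolding casimir_def using tc by (intro W.M.finsum_cong') (auto simp: 2 intro!: W.M.finsum_closed)
    also have "\<dots> = (\<Oplus>\<^bsub>W\<^esub>x\<in>E. \<Oplus>\<^bsub>W\<^esub>y\<in>E. t x y)"
      using tc by (intro W.M.finsum_swap) auto
    also have "\<dots> = (\<Oplus>\<^bsub>W\<^esub>x\<in>E. a \<odot>\<^bsub>W\<^esub> (x \<odot>\<^bsub>W\<^esub> \<pi> (dual x \<odot>\<^bsub>V\<^esub> v)))"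
      using a v by (intro W.M.finsum_cong') (auto simp: 1[symmetric] intro!: W.smult_closed pc V.smult_closed)
    also have "\<dots> = a \<odot>\<^bsub>W\<^esub> casimir V W \<pi> v"
      unfolding casimir_def using a v
      by (intro W.smult_finsum[symmetric]) (auto intro!: W.smult_closed pc V.smult_closed)
    finally show ?thesis .
  qed
  then show ?thesis
    using add by (simp add: module_map_def)
qed

definition proj_elt :: 'a where "proj_elt = rel_proj_elt A s"

lemma proj_elt_eq: "proj_elt = (\<Oplus>x\<in>E. x \<otimes> dual x)"
  by (simp add: proj_elt_def rel_proj_elt_def Let_def dual_def)

text \<open>
  The Casimir tensor is symmetric because the form is: expanding a dual basis element in the basis,
  both sums become \<open>\<Sum> s (x\<^sup>v y\<^sup>v) y x\<close>.
\<close>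

lemma proj_elt_eq': "proj_elt = (\<Oplus>x\<in>E. dual x \<otimes> x)"
proof -
  define t where "t x y = s (dual x \<otimes> dual y) \<odot> (y \<otimes> x)" for x y
  have tc: "t x y \<in> carrier A" if "x \<in> E" "y \<in> E" for x y
    using that by (simp add: t_def)
  have 1: "dual x \<otimes> x = (\<Oplus>y\<in>E. t x y)" if x: "x \<in> E" for x
  proof -
    have "(\<Oplus>y\<in>E. s (dual x \<otimes> dual y) \<odot> y) \<otimes> x = (\<Oplus>y\<in>E. (s (dual x \<otimes> dual y) \<odot> y) \<otimes> x)"
      using x by (intro finsum_ldistr) auto
    also have "\<dots> = (\<Oplus>y\<in>E. t x y)"
      using x by (intro finsum_cong') (auto simp: t_def smult_mult)
    finally show ?thesis using expand[of "dual x"] x by simp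
  qed
  have 2: "y \<otimes> dual y = (\<Oplus>x\<in>E. t x y)" if y: "y \<in> E" for y
  proof -
    have "y \<otimes> (\<Oplus>x\<in>E. s (dual y \<otimes> dual x) \<odot> x) = (\<Oplus>x\<in>E. y \<otimes> (s (dual y \<otimes> dual x) \<odot> x))"
      using y by (intro finsum_rdistr) auto
    also have "\<dots> = (\<Oplus>x\<in>E. t x y)"
      using y by (intro finsum_cong') (auto simp: t_def mult_smult s_commute)
    finally show ?thesis using expand[of "dual y"] y by simp
  qed
  have "(\<Oplus>x\<in>E. dual x \<otimes> x) = (\<Oplus>x\<in>E. \<Oplus>y\<in>E. t x y)"
    using tc by (intro finsum_cong') (auto simp: 1 intro!: finsum_closed)
  also have "\<dots> = (\<Oplus>y\<in>E. \<Oplus>x\<in>E. t x y)"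
    using tc by (intro finsum_swap) auto
  also have "\<dots> = proj_elt"
    unfolding proj_elt_eq using tc by (intro finsum_cong') (auto simp: 2)
  finally show ?thesis by simp
qed

end

locale psp_alg = symm_alg A \<Phi> for A :: "('r::idom, 'a) module" (structure) and \<Phi> +
  fixes lam :: 'r
  assumes proj_scalar: "proj_elt = lam \<odot> \<one>"
begin

text \<open>
  The regular character evaluated at \<open>a\<close> is \<open>s (a z)\<close>, where \<open>z\<close> is the relative projective
  element; this is where it matters that \<open>z\<close> is a scalar.
\<close>

lemma trace_rmult:
  assumes a: "a \<in> carrier A"
  shows "module_trace A (\<lambda>x. x \<otimes> a) = lam * s a"
proof -
  have "module_trace A (\<lambda>x. x \<otimes> a) = (\<Sum>x\<in>E. s (a \<otimes> (dual x \<otimes> x)))"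
    unfolding module_trace_def
  proof (rule sum.cong)
    fix x assume x: "x \<in> E"
    have "coordinates A E (x \<otimes> a) x = s (x \<otimes> (a \<otimes> dual x))"
      using a x by (simp add: coordinates_eq m_assoc)
    also have "\<dots> = s (a \<otimes> dual x \<otimes> x)"
      using a x by (intro s_commute) auto
    finally show "coordinates A E (x \<otimes> a) x = s (a \<otimes> (dual x \<otimes> x))"
      using a x by (simp add: m_assoc)
  qed simp
  also have "\<dots> = s (a \<otimes> proj_elt)"
    unfolding proj_elt_eq'
    by (rule functional_finsum[OF S.left_module_axioms s_lmult[OF a], symmetric]) auto
  also have "\<dots> = lam * s a"
    using a by (simp add: proj_scalar mult_unit functional_smult[OF s_functional])
  finally show ?thesis .
qed

definition average :: "'a \<Rightarrow> 'a" where
  "average b = (\<Oplus>x\<in>E. x \<otimes> b \<otimes> dual x)"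

lemma average_in [simp]: "b \<in> carrier A \<Longrightarrow> average b \<in> carrier A"
  unfolding average_def by (rule finsum_closed) auto

text \<open>
  The average is the value at \<open>1\<close> of the homomorphism \<open>casimir\<close> of left multiplication by \<open>b\<close>,
  and this homomorphism is right multiplication as well as left multiplication by its value at \<open>1\<close>.
\<close>

lemma average_central:
  assumes b: "b \<in> carrier A" and a: "a \<in> carrier A"
  shows "a \<otimes> average b = average b \<otimes> a"
proof -
  let ?R = "regular_module A"
  have eq: "casimir ?R ?R (\<lambda>x. b \<otimes> x) v = average b \<otimes> v" if v: "v \<in> carrier A" for v
  proof -
    have fs: "finsum ?R = finsum A"
      by (simp add: fun_eq_iff finsum_def finprod_def regular_module_def)
    have "casimir ?R ?R (\<lambda>x. b \<otimes> x) v = (\<Oplus>x\<in>E. x \<otimes> (b \<otimes> (dual x \<otimes> v)))"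
      unfolding casimir_def fs by (simp add: regular_module_def)
    also have "\<dots> = (\<Oplus>x\<in>E. (x \<otimes> b \<otimes> dual x) \<otimes> v)"
      using b v by (intro finsum_cong') (auto simp: m_assoc)
    also have "\<dots> = average b \<otimes> v"
      unfolding average_def using b v by (intro finsum_ldistr[symmetric]) auto
    finally show ?thesis .
  qed
  have "module_map type_ring (restrict_scalars A ?R) (restrict_scalars A ?R) (\<lambda>x. b \<otimes> x)"
    using module_map_action[OF left_module_regular b] by (simp add: regular_module_def)
  from casimir_module_map[OF left_module_regular left_module_regular this]
  have "casimir ?R ?R (\<lambda>x. b \<otimes> x) (a \<odot>\<^bsub>?R\<^esub> \<one>) = a \<odot>\<^bsub>?R\<^esub> casimir ?R ?R (\<lambda>x. b \<otimes> x) \<one>"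
    by (rule module_map_smult) (use a in \<open>simp_all add: regular_module_def\<close>)
  moreover have "x \<odot>\<^bsub>?R\<^esub> y = x \<otimes> y" for x y
    by (simp add: regular_module_def)
  ultimately have "casimir ?R ?R (\<lambda>x. b \<otimes> x) (a \<otimes> \<one>) = a \<otimes> casimir ?R ?R (\<lambda>x. b \<otimes> x) \<one>"
    by simp
  then show ?thesis
    using eq a b by simp
qed

text \<open>
  Under the trace, the factor \<open>x\<close> on the left of \<open>x b x\<^sup>v\<close> can be moved to the right end, since
  \<open>\<alpha>\<close> commutes with it; there the factors combine to \<open>b\<close> times the relative projective element.
\<close>

lemma trace_average:
  assumes V: "lattice_over A V" and \<alpha>: "module_map A V V \<alpha>" and b: "b \<in> carrier A"
  shows "lam * module_trace (restrict_scalars A V) (\<lambda>v. \<alpha> (b \<odot>\<^bsub>V\<^esub> v)) =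
    module_trace (restrict_scalars A V) (\<lambda>v. \<alpha> (average b \<odot>\<^bsub>V\<^esub> v))"
proof -
  let ?R = "restrict_scalars A V"
  note L = lattice_overD(1)[OF V] and F = lattice_overD(2)[OF V]
  note RL = left_module_restrict_scalars[OF L]
  interpret V: left_module A V by (rule L)
  note R\<alpha> = module_map_restrict_scalars[OF \<alpha>] and act = module_map_action[OF L]
  have ac: "\<alpha> v \<in> carrier V" if "v \<in> carrier V" for v using module_map_closed[OF \<alpha>] that .
  have "module_trace ?R (\<lambda>v. \<alpha> (average b \<odot>\<^bsub>V\<^esub> v)) =
      module_trace ?R (\<lambda>v. \<Oplus>\<^bsub>?R\<^esub>x\<in>E. x \<odot>\<^bsub>V\<^esub> \<alpha> (b \<odot>\<^bsub>V\<^esub> (dual x \<odot>\<^bsub>V\<^esub> v)))"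
  proof (rule module_trace_cong[OF F])
    fix v assume "v \<in> carrier ?R" then have v: "v \<in> carrier V" by simp
    have "average b \<odot>\<^bsub>V\<^esub> v = (\<Oplus>\<^bsub>V\<^esub>x\<in>E. (x \<otimes> b \<otimes> dual x) \<odot>\<^bsub>V\<^esub> v)"
      unfolding average_def using b by (intro action_finsum[OF L v]) auto
    then have "\<alpha> (average b \<odot>\<^bsub>V\<^esub> v) = (\<Oplus>\<^bsub>V\<^esub>x\<in>E. \<alpha> ((x \<otimes> b \<otimes> dual x) \<odot>\<^bsub>V\<^esub> v))"
      using module_map_finsum[OF L L \<alpha>, of E "\<lambda>x. (x \<otimes> b \<otimes> dual x) \<odot>\<^bsub>V\<^esub> v"] b v
      by (simp add: V.smult_closed)
    also have "\<dots> = (\<Oplus>\<^bsub>V\<^esub>x\<in>E. x \<odot>\<^bsub>V\<^esub> \<alpha> (b \<odot>\<^bsub>V\<^esub> (dual x \<odot>\<^bsub>V\<^esub> v)))"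
      using b v by (intro V.M.finsum_cong')
        (auto simp: module_map_smult[OF \<alpha>, symmetric] V.smult_assoc[symmetric] V.smult_closed ac m_assoc)
    finally show "\<alpha> (average b \<odot>\<^bsub>V\<^esub> v) = (\<Oplus>\<^bsub>?R\<^esub>x\<in>E. x \<odot>\<^bsub>V\<^esub> \<alpha> (b \<odot>\<^bsub>V\<^esub> (dual x \<odot>\<^bsub>V\<^esub> v)))" by simp
  qed
  also have "\<dots> = (\<Sum>x\<in>E. module_trace ?R (\<lambda>v. x \<odot>\<^bsub>V\<^esub> \<alpha> (b \<odot>\<^bsub>V\<^esub> (dual x \<odot>\<^bsub>V\<^esub> v))))"
    using b by (intro module_trace_finsum[OF F]) (auto simp: V.smult_closed ac)
  also have "\<dots> = (\<Sum>x\<in>E. module_trace ?R (\<lambda>v. \<alpha> (b \<odot>\<^bsub>V\<^esub> (dual x \<odot>\<^bsub>V\<^esub> (x \<odot>\<^bsub>V\<^esub> v)))))"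
    using b by (intro sum.cong refl module_trace_commute[OF F F] act
        module_map_compose[OF _ R\<alpha>] module_map_compose[OF act act]) auto
  also have "\<dots> = module_trace ?R (\<lambda>v. \<Oplus>\<^bsub>?R\<^esub>x\<in>E. \<alpha> (b \<odot>\<^bsub>V\<^esub> (dual x \<odot>\<^bsub>V\<^esub> (x \<odot>\<^bsub>V\<^esub> v))))"
    using b by (intro module_trace_finsum[OF F, symmetric]) (auto simp: V.smult_closed ac)
  also have "\<dots> = module_trace ?R (\<lambda>v. lam \<odot>\<^bsub>?R\<^esub> \<alpha> (b \<odot>\<^bsub>V\<^esub> v))"
  proof (rule module_trace_cong[OF F])
    fix v assume "v \<in> carrier ?R" then have v: "v \<in> carrier V" by simp
    have "(\<Oplus>\<^bsub>V\<^esub>x\<in>E. \<alpha> (b \<odot>\<^bsub>V\<^esub> (dual x \<odot>\<^bsub>V\<^esub> (x \<odot>\<^bsub>V\<^esub> v)))) = (\<Oplus>\<^bsub>V\<^esub>x\<in>E. \<alpha> (b \<odot>\<^bsub>V\<^esub> ((dual x \<otimes> x) \<odot>\<^bsub>V\<^esub> v)))"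
      using b v by (intro V.M.finsum_cong') (auto simp: V.smult_assoc V.smult_closed ac)
    also have "\<dots> = \<alpha> (\<Oplus>\<^bsub>V\<^esub>x\<in>E. b \<odot>\<^bsub>V\<^esub> ((dual x \<otimes> x) \<odot>\<^bsub>V\<^esub> v))"
      using b v by (intro module_map_finsum[OF L L \<alpha>, symmetric]) (auto simp: V.smult_closed)
    also have "(\<Oplus>\<^bsub>V\<^esub>x\<in>E. b \<odot>\<^bsub>V\<^esub> ((dual x \<otimes> x) \<odot>\<^bsub>V\<^esub> v)) = b \<odot>\<^bsub>V\<^esub> (\<Oplus>\<^bsub>V\<^esub>x\<in>E. (dual x \<otimes> x) \<odot>\<^bsub>V\<^esub> v)"
      using b v by (intro V.smult_finsum[symmetric]) (auto simp: V.smult_closed)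
    also have "(\<Oplus>\<^bsub>V\<^esub>x\<in>E. (dual x \<otimes> x) \<odot>\<^bsub>V\<^esub> v) = proj_elt \<odot>\<^bsub>V\<^esub> v"
      unfolding proj_elt_eq' by (rule action_finsum[OF L v, symmetric]) auto
    finally show "(\<Oplus>\<^bsub>?R\<^esub>x\<in>E. \<alpha> (b \<odot>\<^bsub>V\<^esub> (dual x \<odot>\<^bsub>V\<^esub> (x \<odot>\<^bsub>V\<^esub> v)))) = lam \<odot>\<^bsub>?R\<^esub> \<alpha> (b \<odot>\<^bsub>V\<^esub> v)"
      using b v central_unit[OF b]
      by (simp add: proj_scalar module_map_smult[OF \<alpha>, symmetric] V.smult_closed V.smult_assoc[symmetric])
  qed
  also have "\<dots> = lam * module_trace ?R (\<lambda>v. \<alpha> (b \<odot>\<^bsub>V\<^esub> v))"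
    using b by (intro module_trace_smult[OF F]) (simp add: V.smult_closed ac)
  finally show ?thesis by simp
qed

end

section \<open>Equivalences of module categories\<close>

text \<open>
  The module \<open>P\<close> is a copy of the regular module whose carrier lies in the type \<open>'u\<close>, on which the
  functors are defined; \<open>e\<close> plays the role of the identity of \<open>A\<close>.
\<close>

locale free_on = assoc_alg A for A :: "('r::comm_ring_1, 'a) module" +
  fixes P :: "('a, 'u) module" and e :: 'u
  assumes P_module: "left_module A P" and e_in: "e \<in> carrier P"
    and orbit_bij: "bij_betw (\<lambda>a. a \<odot>\<^bsub>P\<^esub> e) (carrier A) (carrier P)"
begin

sublocale P: left_module A P by (rule P_module)

lemma generated:
  assumes "x \<in> carrier P" obtains a where "a \<in> carrier A" "x = a \<odot>\<^bsub>P\<^esub> e"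
  using assms orbit_bij unfolding bij_betw_def by (metis imageE)

text \<open>
  The homomorphism \<open>a e \<mapsto> a v\<close>: as \<open>P\<close> is free on \<open>e\<close>, homomorphisms out of \<open>P\<close> correspond to
  elements.
\<close>

definition extend :: "('a, 'v) module \<Rightarrow> 'v \<Rightarrow> 'u \<Rightarrow> 'v" where
  "extend V v x = inv_into (carrier A) (\<lambda>a. a \<odot>\<^bsub>P\<^esub> e) x \<odot>\<^bsub>V\<^esub> v"

lemma extend_orbit [simp]: "a \<in> carrier A \<Longrightarrow> extend V v (a \<odot>\<^bsub>P\<^esub> e) = a \<odot>\<^bsub>V\<^esub> v"
  unfolding extend_def using orbit_bij by (subst inv_into_f_f) (auto simp: bij_betw_def)

lemma extend_e: "\<lbrakk>left_module A V; v \<in> carrier V\<rbrakk> \<Longrightarrow> extend V v e = v"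
  using extend_orbit[of "\<one>\<^bsub>A\<^esub>" V v] P.smult_one[OF e_in] by (simp add: left_module.smult_one)

lemma extend_module_map:
  assumes "left_module A V" "v \<in> carrier V"
  shows "module_map A P V (extend V v)"
proof -
  interpret V: left_module A V by fact
  show ?thesis
    unfolding module_map_def
  proof (intro conjI ballI)
    fix x assume "x \<in> carrier P"
    then show "extend V v x \<in> carrier V"
      by (elim generated) (simp add: V.smult_closed assms)
    fix y assume "y \<in> carrier P"
    then obtain b where b: "b \<in> carrier A" "y = b \<odot>\<^bsub>P\<^esub> e" by (elim generated)
    obtain a where a: "a \<in> carrier A" "x = a \<odot>\<^bsub>P\<^esub> e"
      using \<open>x \<in> carrier P\<close> by (elim generated)
    show "extend V v (x \<oplus>\<^bsub>P\<^esub> y) = extend V v x \<oplus>\<^bsub>V\<^esub> extend V v y"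
      using extend_orbit[of "a \<oplus>\<^bsub>A\<^esub> b" V v] a b e_in assms by (simp add: P.smult_l_distr V.smult_l_distr)
  next
    fix c x assume c: "c \<in> carrier A" and "x \<in> carrier P"
    then obtain a where a: "a \<in> carrier A" "x = a \<odot>\<^bsub>P\<^esub> e" by (elim generated)
    show "extend V v (c \<odot>\<^bsub>P\<^esub> x) = c \<odot>\<^bsub>V\<^esub> extend V v x"
      using extend_orbit[of "c \<otimes>\<^bsub>A\<^esub> a" V v] a c e_in assms by (simp add: P.smult_assoc V.smult_assoc)
  qed
qed

lemma maps_eqI:
  assumes "module_map A P V f" "module_map A P V g" "f e = g e" "x \<in> carrier P"
  shows "f x = g x"
  using assms(4) by (elim generated) (simp add: assms module_map_smult[OF assms(1)]
      module_map_smult[OF assms(2)] e_in)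

lemma extend_unique:
  assumes "left_module A V" "module_map A P V f" "x \<in> carrier P"
  shows "extend V (f e) x = f x"
  by (rule maps_eqI[OF extend_module_map[OF assms(1)] assms(2) _ assms(3)])
    (use assms(1) module_map_closed[OF assms(2) e_in] in \<open>simp_all add: extend_e\<close>)

end

lemma free_on_exists:
  assumes "assoc_algebra A" "carrier A \<lesssim> (UNIV :: 'u set)"
  obtains P :: "('a, 'u) module" and e where "free_on A P e"
proof -
  interpret A: assoc_alg A by (rule assoc_alg.intro[OF assms(1)])
  obtain j :: "'a \<Rightarrow> 'u" where j: "inj_on j (carrier A)"
    using assms(2) by (auto simp: lepoll_def)
  have R: "carrier (regular_module A) = carrier A" "\<And>a x. a \<odot>\<^bsub>regular_module A\<^esub> x = a \<otimes>\<^bsub>A\<^esub> x"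
    by (simp_all add: regular_module_def)
  let ?P = "transport_module j (regular_module A)"
  have j': "inj_on j (carrier (regular_module A))" using j by (simp add: R)
  have T: "left_module A ?P" "module_map A (regular_module A) ?P j" "bij_betw j (carrier A) (carrier ?P)"
    using transport_module[OF A.left_module_regular j'] by (simp_all add: R)
  have eq: "a \<odot>\<^bsub>?P\<^esub> j \<one>\<^bsub>A\<^esub> = j a" if "a \<in> carrier A" for a
    using module_map_smult[OF T(2), of a "\<one>\<^bsub>A\<^esub>"] that by (simp add: R)
  have "free_on A ?P (j \<one>\<^bsub>A\<^esub>)"
  proof (intro free_on.intro free_on_axioms.intro A.assoc_alg_axioms T)
    show "j \<one>\<^bsub>A\<^esub> \<in> carrier ?P" using T(3) by (auto simp: bij_betw_def)
    show "bij_betw (\<lambda>a. a \<odot>\<^bsub>?P\<^esub> j \<one>\<^bsub>A\<^esub>) (carrier A) (carrier ?P)"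
      using T(3) bij_betw_cong[of "carrier A" "\<lambda>a. a \<odot>\<^bsub>?P\<^esub> j \<one>\<^bsub>A\<^esub>" j] eq by auto
  qed
  then show ?thesis by (rule that)
qed

text \<open>
  A functor is specified on extensional functions only; restricting the argument first makes it
  applicable to every \<open>module_map\<close>.
\<close>

definition on_map ::
  "(('a, 'u) module \<Rightarrow> ('a, 'u) module \<Rightarrow> ('u \<Rightarrow> 'u) \<Rightarrow> ('u \<Rightarrow> 'u)) \<Rightarrow>
   ('a, 'u) module \<Rightarrow> ('a, 'u) module \<Rightarrow> ('u \<Rightarrow> 'u) \<Rightarrow> ('u \<Rightarrow> 'u)" where
  "on_map Fm M N f = Fm M N (restrict f (carrier M))"

lemma restrict_in_module_Hom: "left_module R V \<Longrightarrow> module_map R V W f \<Longrightarrow> restrict f (carrier V) \<in> module_Hom R V W"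
  by (simp add: module_Hom_iff)

locale lin_functor =
  fixes A :: "('o::comm_ring_1, 'a) module" and B :: "('o, 'b) module"
    and Fo :: "('a, 'u) module \<Rightarrow> ('b, 'u) module"
    and Fm :: "('a, 'u) module \<Rightarrow> ('a, 'u) module \<Rightarrow> ('u \<Rightarrow> 'u) \<Rightarrow> ('u \<Rightarrow> 'u)"
  assumes is_functor: "linear_functor A B Fo Fm"
begin

abbreviation Fmap where "Fmap \<equiv> on_map Fm"

lemma ob: "left_module A M \<Longrightarrow> left_module B (Fo M)"
  using is_functor by (simp add: linear_functor_def)

lemma map:
  assumes "left_module A M" "left_module A N" "module_map A M N f"
  shows "module_map B (Fo M) (Fo N) (Fmap M N f)"
proof -
  have "Fm M N ` module_Hom A M N \<subseteq> module_Hom B (Fo M) (Fo N)"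
    using is_functor assms(1,2) by (simp add: linear_functor_def)
  then have "Fmap M N f \<in> module_Hom B (Fo M) (Fo N)"
    using restrict_in_module_Hom[OF assms(1,3)] by (auto simp: on_map_def)
  then show ?thesis by (simp add: module_Hom_iff)
qed

lemma map_extensional:
  assumes "left_module A M" "left_module A N" "module_map A M N f"
  shows "restrict (Fmap M N f) (carrier (Fo M)) = Fmap M N f"
proof -
  have "Fm M N ` module_Hom A M N \<subseteq> module_Hom B (Fo M) (Fo N)"
    using is_functor assms(1,2) by (simp add: linear_functor_def)
  then have "Fmap M N f \<in> module_Hom B (Fo M) (Fo N)"
    using restrict_in_module_Hom[OF assms(1,3)] by (auto simp: on_map_def)
  then show ?thesis by (simp add: module_Hom_iff extensional_restrict)
qed

lemma map_cong: "(\<And>x. x \<in> carrier M \<Longrightarrow> f x = g x) \<Longrightarrow> Fmap M N f = Fmap M N g"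
  unfolding on_map_def by (metis restrict_ext)

lemma map_id:
  assumes "left_module A M" "y \<in> carrier (Fo M)"
  shows "Fmap M M (\<lambda>x. x) y = y"
  using is_functor assms by (auto simp: linear_functor_def on_map_def)

lemma map_compose:
  assumes "left_module A L" "left_module A M" "left_module A N"
    "module_map A L M f" "module_map A M N g" "y \<in> carrier (Fo L)"
  shows "Fmap L N (\<lambda>x. g (f x)) y = Fmap M N g (Fmap L M f y)"
proof -
  have "Fm L N (compose (carrier L) (restrict g (carrier M)) (restrict f (carrier L))) =
      compose (carrier (Fo L)) (Fm M N (restrict g (carrier M))) (Fm L M (restrict f (carrier L)))"
    using is_functor restrict_in_module_Hom[OF assms(1,4)] restrict_in_module_Hom[OF assms(2,5)] assms(1-3)
    unfolding linear_functor_def by blast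
  moreover have "compose (carrier L) (restrict g (carrier M)) (restrict f (carrier L)) =
      restrict (\<lambda>x. g (f x)) (carrier L)"
    using module_map_closed[OF assms(4)] by (auto simp: compose_def fun_eq_iff)
  ultimately show ?thesis
    using assms(6) by (simp add: on_map_def compose_def)
qed

lemma map_add:
  assumes "left_module A M" "left_module A N" "module_map A M N f" "module_map A M N g" "y \<in> carrier (Fo M)"
  shows "Fmap M N (\<lambda>x. f x \<oplus>\<^bsub>N\<^esub> g x) y = Fmap M N f y \<oplus>\<^bsub>Fo N\<^esub> Fmap M N g y"
proof -
  have "Fm M N (\<lambda>x\<in>carrier M. restrict f (carrier M) x \<oplus>\<^bsub>N\<^esub> restrict g (carrier M) x) =
       (\<lambda>y\<in>carrier (Fo M). Fm M N (restrict f (carrier M)) y \<oplus>\<^bsub>Fo N\<^esub> Fm M N (restrict g (carrier M)) y)"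
    using is_functor restrict_in_module_Hom[OF assms(1,3)] restrict_in_module_Hom[OF assms(1,4)] assms(1,2)
    unfolding linear_functor_def by blast
  moreover have "(\<lambda>x\<in>carrier M. restrict f (carrier M) x \<oplus>\<^bsub>N\<^esub> restrict g (carrier M) x) =
     (\<lambda>x\<in>carrier M. f x \<oplus>\<^bsub>N\<^esub> g x)" by auto
  ultimately show ?thesis
    using assms(5) by (simp add: on_map_def)
qed

lemma map_smult:
  assumes "left_module A M" "left_module A N" "module_map A M N f" "y \<in> carrier (Fo M)"
  shows "Fmap M N (\<lambda>x. (r \<odot>\<^bsub>A\<^esub> \<one>\<^bsub>A\<^esub>) \<odot>\<^bsub>N\<^esub> f x) y = (r \<odot>\<^bsub>B\<^esub> \<one>\<^bsub>B\<^esub>) \<odot>\<^bsub>Fo N\<^esub> Fmap M N f y"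
proof -
  have "Fm M N (\<lambda>x\<in>carrier M. (r \<odot>\<^bsub>A\<^esub> \<one>\<^bsub>A\<^esub>) \<odot>\<^bsub>N\<^esub> restrict f (carrier M) x) =
       (\<lambda>y\<in>carrier (Fo M). (r \<odot>\<^bsub>B\<^esub> \<one>\<^bsub>B\<^esub>) \<odot>\<^bsub>Fo N\<^esub> Fm M N (restrict f (carrier M)) y)"
    using is_functor restrict_in_module_Hom[OF assms(1,3)] assms(1,2)
    unfolding linear_functor_def by blast
  moreover have "(\<lambda>x\<in>carrier M. (r \<odot>\<^bsub>A\<^esub> \<one>\<^bsub>A\<^esub>) \<odot>\<^bsub>N\<^esub> restrict f (carrier M) x) =
     (\<lambda>x\<in>carrier M. (r \<odot>\<^bsub>A\<^esub> \<one>\<^bsub>A\<^esub>) \<odot>\<^bsub>N\<^esub> f x)" by auto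
  ultimately show ?thesis
    using assms(4) by (simp add: on_map_def)
qed

lemma map_zero:
  assumes "left_module A M" "left_module A N" "y \<in> carrier (Fo M)"
  shows "Fmap M N (\<lambda>x. \<zero>\<^bsub>N\<^esub>) y = \<zero>\<^bsub>Fo N\<^esub>"
proof -
  interpret N: left_module A N by fact
  interpret FN: left_module B "Fo N" using ob assms by simp
  have z: "module_map A M N (\<lambda>x. \<zero>\<^bsub>N\<^esub>)" by (simp add: module_map_def N.smult_r_zero)
  have c: "Fmap M N (\<lambda>x. \<zero>\<^bsub>N\<^esub>) y \<in> carrier (Fo N)"
    using map[OF assms(1,2) z] assms(3) by (simp add: module_map_def)
  have "Fmap M N (\<lambda>x. \<zero>\<^bsub>N\<^esub>) y = Fmap M N (\<lambda>x. \<zero>\<^bsub>N\<^esub>) y \<oplus>\<^bsub>Fo N\<^esub> Fmap M N (\<lambda>x. \<zero>\<^bsub>N\<^esub>) y"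
    using map_add[OF assms(1,2) z z assms(3)] by simp
  then show ?thesis
    using c by (metis FN.M.add.l_cancel_one)
qed

lemma map_finsum:
  assumes "left_module A M" "left_module A N" "\<And>i. i \<in> I \<Longrightarrow> module_map A M N (f i)" "y \<in> carrier (Fo M)"
  shows "Fmap M N (\<lambda>x. \<Oplus>\<^bsub>N\<^esub>i\<in>I. f i x) y = (\<Oplus>\<^bsub>Fo N\<^esub>i\<in>I. Fmap M N (f i) y)"
proof -
  interpret N: left_module A N by fact
  interpret FN: left_module B "Fo N" using ob assms by simp
  show ?thesis
    using assms(3)
  proof (induction I rule: infinite_finite_induct)
    case (insert i I)
    have c: "f j x \<in> carrier N" if "j \<in> insert i I" "x \<in> carrier M" for j x
      using module_map_closed[OF insert.prems[OF that(1)] that(2)] .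
    have "Fmap M N (\<lambda>x. \<Oplus>\<^bsub>N\<^esub>i\<in>insert i I. f i x) y = Fmap M N (\<lambda>x. f i x \<oplus>\<^bsub>N\<^esub> (\<Oplus>\<^bsub>N\<^esub>i\<in>I. f i x)) y"
      using insert.hyps c by (intro fun_cong[OF map_cong] N.M.finsum_insert) auto
    also have "\<dots> = Fmap M N (f i) y \<oplus>\<^bsub>Fo N\<^esub> Fmap M N (\<lambda>x. \<Oplus>\<^bsub>N\<^esub>i\<in>I. f i x) y"
      using insert assms by (intro map_add module_map_finsum_maps) auto
    also have "\<dots> = (\<Oplus>\<^bsub>Fo N\<^esub>i\<in>insert i I. Fmap M N (f i) y)"
      using insert module_map_closed[OF map[OF assms(1,2)] assms(4)]
      by (subst FN.M.finsum_insert) auto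
    finally show ?case .
  qed (use map_zero assms in auto)
qed

end

locale equivalence =
  A: assoc_alg A + B: assoc_alg B + F: lin_functor A B Fo Fm + G: lin_functor B A Go Gm
  for A :: "('o::comm_ring_1, 'a) module" and B :: "('o, 'b) module"
    and Fo :: "('a, 'u) module \<Rightarrow> ('b, 'u) module"
    and Fm :: "('a, 'u) module \<Rightarrow> ('a, 'u) module \<Rightarrow> ('u \<Rightarrow> 'u) \<Rightarrow> ('u \<Rightarrow> 'u)"
    and Go :: "('b, 'u) module \<Rightarrow> ('a, 'u) module"
    and Gm :: "('b, 'u) module \<Rightarrow> ('b, 'u) module \<Rightarrow> ('u \<Rightarrow> 'u) \<Rightarrow> ('u \<Rightarrow> 'u)" +
  assumes unit: "naturally_iso_to_identity A (Go \<circ> Fo) (\<lambda>M N. Gm (Fo M) (Fo N) \<circ> Fm M N)"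
    and counit: "naturally_iso_to_identity B (Fo \<circ> Go) (\<lambda>M N. Fm (Go M) (Go N) \<circ> Gm M N)"
begin

lemma swap: "equivalence B A Go Gm Fo Fm"
  by (intro equivalence.intro equivalence_axioms.intro A.assoc_alg_axioms B.assoc_alg_axioms
      F.lin_functor_axioms G.lin_functor_axioms unit counit)

definition eta where "eta = (SOME \<eta>.
     (\<forall>M. left_module A M \<longrightarrow> \<eta> M \<in> module_Iso A M ((Go \<circ> Fo) M)) \<and>
     (\<forall>M N. left_module A M \<and> left_module A N \<longrightarrow>
        (\<forall>f\<in>module_Hom A M N.
           compose (carrier M) (\<eta> N) f = compose (carrier M) ((Gm (Fo M) (Fo N) \<circ> Fm M N) f) (\<eta> M))))"

lemma eta_prop: "(\<forall>M. left_module A M \<longrightarrow> eta M \<in> module_Iso A M ((Go \<circ> Fo) M)) \<and>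
     (\<forall>M N. left_module A M \<and> left_module A N \<longrightarrow>
        (\<forall>f\<in>module_Hom A M N.
           compose (carrier M) (eta N) f = compose (carrier M) ((Gm (Fo M) (Fo N) \<circ> Fm M N) f) (eta M)))"
  unfolding eta_def by (rule someI_ex[OF unit[unfolded naturally_iso_to_identity_def]])

lemma eta_map: "left_module A M \<Longrightarrow> module_map A M (Go (Fo M)) (eta M)"
  and eta_bij: "left_module A M \<Longrightarrow> bij_betw (eta M) (carrier M) (carrier (Go (Fo M)))"
  using eta_prop by (auto simp: module_Iso_def module_Hom_iff)

lemma eta_natural:
  assumes "left_module A M" "left_module A N" "module_map A M N f" "x \<in> carrier M"
  shows "eta N (f x) = G.Fmap (Fo M) (Fo N) (F.Fmap M N f) (eta M x)"
proof -
  have "compose (carrier M) (eta N) (restrict f (carrier M)) =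
      compose (carrier M) (Gm (Fo M) (Fo N) (Fm M N (restrict f (carrier M)))) (eta M)"
    using eta_prop restrict_in_module_Hom[OF assms(1,3)] assms(1,2) by auto
  then have "compose (carrier M) (eta N) (restrict f (carrier M)) x =
      compose (carrier M) (Gm (Fo M) (Fo N) (Fm M N (restrict f (carrier M)))) (eta M) x" by simp
  then show ?thesis
    using assms(4) F.map_extensional[OF assms(1-3)] unfolding on_map_def[of Gm]
    by (simp add: compose_def) (simp add: on_map_def)
qed

lemma faithful:
  assumes "left_module A M" "left_module A N" "module_map A M N f" "module_map A M N g"
    "\<And>y. y \<in> carrier (Fo M) \<Longrightarrow> F.Fmap M N f y = F.Fmap M N g y" "x \<in> carrier M"
  shows "f x = g x"
proof -
  have "G.Fmap (Fo M) (Fo N) (F.Fmap M N f) = G.Fmap (Fo M) (Fo N) (F.Fmap M N g)"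
    using assms(5) by (rule G.map_cong)
  then have "eta N (f x) = eta N (g x)"
    using eta_natural[OF assms(1,2,3,6)] eta_natural[OF assms(1,2,4,6)] by simp
  then show ?thesis
    using eta_bij[OF assms(2)] module_map_closed[OF assms(3,6)] module_map_closed[OF assms(4,6)]
    by (auto simp: bij_betw_def inj_on_def)
qed

text \<open>
  The preimage of \<open>h\<close> is \<open>G h\<close> transported along the unit \<open>eta\<close>. Applying \<open>F\<close> to it gives \<open>h\<close>
  because \<open>G\<close> is faithful and sends both maps to the same map.
\<close>

lemma full:
  assumes M: "left_module A M" and N: "left_module A N" and h: "module_map B (Fo M) (Fo N) h"
  obtains f where "module_map A M N f" "\<And>y. y \<in> carrier (Fo M) \<Longrightarrow> F.Fmap M N f y = h y"
proof -
  interpret S: equivalence B A Go Gm Fo Fm by (rule swap)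
  let ?i = "inv_into (carrier N) (eta N)"
  define f where "f x = ?i (G.Fmap (Fo M) (Fo N) h (eta M x))" for x
  note FM = F.ob[OF M] and FN = F.ob[OF N]
  have f: "module_map A M N f"
    unfolding f_def
    by (rule module_map_compose[OF module_map_compose[OF eta_map[OF M] G.map[OF FM FN h]]
          module_map_inverse[OF N eta_map[OF N] eta_bij[OF N]]])
  have "F.Fmap M N f y = h y" if y: "y \<in> carrier (Fo M)" for y
  proof (rule S.faithful[OF FM FN F.map[OF M N f] h _ y])
    fix z assume z: "z \<in> carrier (Go (Fo M))"
    then obtain x where x: "x \<in> carrier M" "z = eta M x"
      using eta_bij[OF M] by (auto simp: bij_betw_def)
    have "G.Fmap (Fo M) (Fo N) h (eta M x) \<in> carrier (Go (Fo N))"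
      using module_map_closed[OF G.map[OF FM FN h]] z x by simp
    then have "eta N (f x) = G.Fmap (Fo M) (Fo N) h z"
      unfolding f_def x(2) using eta_bij[OF N] by (auto simp: bij_betw_def f_inv_into_f)
    then show "G.Fmap (Fo M) (Fo N) (F.Fmap M N f) z = G.Fmap (Fo M) (Fo N) h z"
      using eta_natural[OF M N f x(1)] x(2) by simp
  qed
  then show ?thesis using that f by blast
qed

end

text \<open>
  The trace of \<open>Q\<close> in \<open>M\<close> in the sense of module theory: the submodule generated by the images of all
  homomorphisms from \<open>Q\<close> to \<open>M\<close>.
\<close>

inductive_set trace_submodule :: "('b, 'r) ring_scheme \<Rightarrow> ('b, 'u) module \<Rightarrow> ('b, 'u) module \<Rightarrow> 'u set"
  for B Q M where
  zero: "\<zero>\<^bsub>M\<^esub> \<in> trace_submodule B Q M"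
| add: "\<lbrakk>module_map B Q M f; q \<in> carrier Q; y \<in> trace_submodule B Q M\<rbrakk> \<Longrightarrow>
    f q \<oplus>\<^bsub>M\<^esub> y \<in> trace_submodule B Q M"

lemma trace_submodule_subset:
  assumes "left_module B M" "y \<in> trace_submodule B Q M"
  shows "y \<in> carrier M"
proof -
  interpret M: left_module B M by fact
  show ?thesis
    using assms(2) by induction (auto simp: module_map_closed)
qed

lemma submodule_trace_submodule:
  assumes Q: "left_module B Q" and M: "left_module B M"
  shows "submodule (trace_submodule B Q M) B M"
proof (rule submoduleI[OF M])
  interpret M: left_module B M by fact
  interpret Q: left_module B Q by fact
  note sub = trace_submodule_subset[OF M]
  show "trace_submodule B Q M \<subseteq> carrier M" using sub by auto
  show "\<zero>\<^bsub>M\<^esub> \<in> trace_submodule B Q M" by (rule trace_submodule.zero)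
  show "x \<oplus>\<^bsub>M\<^esub> y \<in> trace_submodule B Q M" if "x \<in> trace_submodule B Q M" "y \<in> trace_submodule B Q M" for x y
    using that(1)
  proof induction
    case zero
    then show ?case using that(2) sub by simp
  next
    case (add f q z)
    have "f q \<oplus>\<^bsub>M\<^esub> (z \<oplus>\<^bsub>M\<^esub> y) \<in> trace_submodule B Q M"
      by (rule trace_submodule.add[OF add(1,2,4)])
    then show ?case using add that(2) sub module_map_closed[OF add(1,2)] by (simp add: M.M.a_assoc)
  qed
  show "b \<odot>\<^bsub>M\<^esub> x \<in> trace_submodule B Q M" if b: "b \<in> carrier B" and "x \<in> trace_submodule B Q M" for b x
    using that(2)
  proof induction
    case zero
    then show ?case using b by (simp add: M.smult_r_zero trace_submodule.zero)
  next
    case (add f q z)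
    have c: "b \<odot>\<^bsub>Q\<^esub> q \<in> carrier Q" using add b by (simp add: Q.smult_closed)
    have "b \<odot>\<^bsub>M\<^esub> z \<in> trace_submodule B Q M" by fact
    then have "f (b \<odot>\<^bsub>Q\<^esub> q) \<oplus>\<^bsub>M\<^esub> (b \<odot>\<^bsub>M\<^esub> z) \<in> trace_submodule B Q M"
      by (rule trace_submodule.add[OF add(1) c])
    then show ?case
      using add b sub module_map_closed[OF add(1,2)] module_map_smult[OF add(1) b add(2)]
      by (simp add: M.smult_r_distr)
  qed
qed

lemma trace_submodule_sum:
  assumes M: "left_module B M" and "y \<in> trace_submodule B Q M"
  shows "\<exists>(n::nat) f q. (\<forall>i<n. module_map B Q M (f i) \<and> q i \<in> carrier Q) \<and> y = (\<Oplus>\<^bsub>M\<^esub>i\<in>{..<n}. f i (q i))"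
  using assms(2)
proof induction
  interpret M: left_module B M by fact
  case zero
  show ?case by (intro exI[of _ 0]) simp
next
  interpret M: left_module B M by fact
  case (add f0 q0 y)
  then obtain n :: nat and f q where IH: "\<And>i. i < n \<Longrightarrow> module_map B Q M (f i) \<and> q i \<in> carrier Q"
    "y = (\<Oplus>\<^bsub>M\<^esub>i\<in>{..<n}. f i (q i))" by auto
  define f' where "f' = f(n := f0)"
  define q' where "q' = q(n := q0)"
  have m: "module_map B Q M (f' i) \<and> q' i \<in> carrier Q" if "i < Suc n" for i
    using that IH add by (auto simp: f'_def q'_def less_Suc_eq)
  have c: "f' i (q' i) \<in> carrier M" if "i < Suc n" for i
    using module_map_closed[OF conjunct1[OF m[OF that]] conjunct2[OF m[OF that]]] .
  have "(\<Oplus>\<^bsub>M\<^esub>i\<in>{..<Suc n}. f' i (q' i)) = f' n (q' n) \<oplus>\<^bsub>M\<^esub> (\<Oplus>\<^bsub>M\<^esub>i\<in>{..<n}. f' i (q' i))"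
    unfolding lessThan_Suc using c by (intro M.M.finsum_insert) auto
  also have "(\<Oplus>\<^bsub>M\<^esub>i\<in>{..<n}. f' i (q' i)) = y"
    unfolding IH(2)
  proof (rule M.M.finsum_cong')
    show "(\<lambda>i. f i (q i)) \<in> {..<n} \<rightarrow> carrier M"
      using module_map_closed[OF conjunct1[OF IH(1)] conjunct2[OF IH(1)]] by auto
  qed (auto simp: f'_def q'_def)
  finally have "f0 q0 \<oplus>\<^bsub>M\<^esub> y = (\<Oplus>\<^bsub>M\<^esub>i\<in>{..<Suc n}. f' i (q' i))"
    by (simp add: f'_def q'_def)
  then show ?case using m by blast
qed

locale equivalence_free = equivalence A B Fo Fm Go Gm + PA: free_on A P e + PB: free_on B P' e'
  for A :: "('o::comm_ring_1, 'a) module" and B :: "('o, 'b) module"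
    and Fo :: "('a, 'u) module \<Rightarrow> ('b, 'u) module"
    and Fm :: "('a, 'u) module \<Rightarrow> ('a, 'u) module \<Rightarrow> ('u \<Rightarrow> 'u) \<Rightarrow> ('u \<Rightarrow> 'u)"
    and Go :: "('b, 'u) module \<Rightarrow> ('a, 'u) module"
    and Gm :: "('b, 'u) module \<Rightarrow> ('b, 'u) module \<Rightarrow> ('u \<Rightarrow> 'u) \<Rightarrow> ('u \<Rightarrow> 'u)"
    and P :: "('a, 'u) module" and e :: 'u and P' :: "('b, 'u) module" and e' :: 'u
begin

lemma swap_free: "equivalence_free B A Go Gm Fo Fm P' e' P e"
  by (intro equivalence_free.intro swap PA.free_on_axioms PB.free_on_axioms)

text \<open>
  The adjunction at work: homomorphisms from \<open>F P\<close> to \<open>N\<close> correspond to homomorphisms from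
  \<open>P\<close> to \<open>G N\<close>, and these correspond to elements of \<open>G N\<close>.
\<close>

lemma image_map_exists:
  assumes N: "left_module B N" and y: "y \<in> carrier (Go N)"
  obtains f where "module_map B (Fo P) N f" "G.Fmap (Fo P) N f (eta P e) = y"
proof -
  interpret S: equivalence B A Go Gm Fo Fm by (rule swap)
  note GN = G.ob[OF N] and P = PA.P_module
  let ?h = "\<lambda>z. PA.extend (Go N) y (inv_into (carrier P) (eta P) z)"
  have h: "module_map A (Go (Fo P)) (Go N) ?h"
    by (rule module_map_compose[OF module_map_inverse[OF P eta_map[OF P] eta_bij[OF P]]
          PA.extend_module_map[OF GN y]])
  obtain f where f: "module_map B (Fo P) N f" "\<And>z. z \<in> carrier (Go (Fo P)) \<Longrightarrow> G.Fmap (Fo P) N f z = ?h z"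
    using S.full[OF F.ob[OF P] N h] by blast
  have "eta P e \<in> carrier (Go (Fo P))" "inv_into (carrier P) (eta P) (eta P e) = e"
    using eta_bij[OF P] PA.e_in by (auto simp: bij_betw_def)
  then have "G.Fmap (Fo P) N f (eta P e) = y"
    using f(2) PA.extend_e[OF GN y] by simp
  then show ?thesis using that f(1) by blast
qed

lemma image_map_unique:
  assumes N: "left_module B N" and f: "module_map B (Fo P) N f" and g: "module_map B (Fo P) N g"
    and eq: "G.Fmap (Fo P) N f (eta P e) = G.Fmap (Fo P) N g (eta P e)" and q: "q \<in> carrier (Fo P)"
  shows "f q = g q"
proof -
  interpret S: equivalence B A Go Gm Fo Fm by (rule swap)
  note P = PA.P_module note FP = F.ob[OF P]
  show ?thesis
  proof (rule S.faithful[OF FP N f g _ q])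
    fix z assume "z \<in> carrier (Go (Fo P))"
    then obtain x where x: "x \<in> carrier P" "z = eta P x"
      using eta_bij[OF P] by (auto simp: bij_betw_def)
    show "G.Fmap (Fo P) N f z = G.Fmap (Fo P) N g z"
      unfolding x(2)
      by (rule PA.maps_eqI[OF module_map_compose[OF eta_map[OF P] G.map[OF FP N f]]
            module_map_compose[OF eta_map[OF P] G.map[OF FP N g]] eq x(1)])
  qed
qed

text \<open>
  The module \<open>F P\<close> is a generator, as \<open>P\<close> is one. The inclusion of the trace \<open>M\<close> of \<open>F P\<close>
  in \<open>P'\<close> induces a bijection on homomorphisms from \<open>F P\<close>, hence a bijection
  from \<open>G M\<close> onto \<open>G P'\<close>. So this inclusion is an isomorphism, \<open>e'\<close> lies in \<open>M\<close>, and
  expressing \<open>e'\<close> as a sum of values \<open>f i (q i)\<close> splits \<open>P'\<close> off a sum of copies of \<open>F P\<close>.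
\<close>

lemma generator:
  obtains n :: nat and f g where "\<And>i. i < n \<Longrightarrow> module_map B (Fo P) P' (f i)"
    "\<And>i. i < n \<Longrightarrow> module_map B P' (Fo P) (g i)"
    "\<And>y. y \<in> carrier P' \<Longrightarrow> (\<Oplus>\<^bsub>P'\<^esub>i\<in>{..<n}. f i (g i y)) = y"
proof -
  interpret S: equivalence B A Go Gm Fo Fm by (rule swap)
  note P = PA.P_module and P' = PB.P_module
  define Q where "Q = Fo P"
  have Q: "left_module B Q" unfolding Q_def by (rule F.ob[OF P])
  define T where "T = trace_submodule B Q P'"
  have T: "submodule T B P'" unfolding T_def by (rule submodule_trace_submodule[OF Q P'])
  define M where "M = P'\<lparr>carrier := T\<rparr>"
  have M: "left_module B M" unfolding M_def by (rule left_module_submodule[OF P' T])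
  have \<iota>: "module_map B M P' (\<lambda>x. x)"
    using submoduleD(1)[OF T] by (auto simp: M_def module_map_def)
  have into: "module_map B Q M f" if f: "module_map B Q P' f" for f
  proof -
    have "f q \<in> T" if "q \<in> carrier Q" for q
      using trace_submodule.add[OF f that trace_submodule.zero] PB.P.M.r_zero[OF module_map_closed[OF f that]]
      by (simp add: T_def)
    then show ?thesis using f by (simp add: M_def module_map_def)
  qed
  let ?i = "G.Fmap M P' (\<lambda>x. x)"
  have comp: "G.Fmap Q P' f z = ?i (G.Fmap Q M f z)" if "module_map B Q M f" "z \<in> carrier (Go Q)" for f z
    using G.map_compose[OF Q M P' that(1) \<iota> that(2)] by simp
  have ee: "eta P e \<in> carrier (Go Q)"
    using module_map_closed[OF eta_map[OF P] PA.e_in] by (simp add: Q_def)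
  have "bij_betw ?i (carrier (Go M)) (carrier (Go P'))"
    unfolding bij_betw_def
  proof (intro conjI inj_onI equalityI subsetI)
    fix x y assume xy: "x \<in> carrier (Go M)" "y \<in> carrier (Go M)" "?i x = ?i y"
    obtain f where f: "module_map B Q M f" "G.Fmap Q M f (eta P e) = x"
      using image_map_exists[OF M xy(1)] by (auto simp: Q_def)
    obtain g where g: "module_map B Q M g" "G.Fmap Q M g (eta P e) = y"
      using image_map_exists[OF M xy(2)] by (auto simp: Q_def)
    have "f q = g q" if "q \<in> carrier Q" for q
    proof (rule image_map_unique[OF P', of f g q, folded Q_def])
      show "module_map B Q P' f" "module_map B Q P' g"
        using module_map_compose[OF f(1) \<iota>] module_map_compose[OF g(1) \<iota>] by auto
      show "G.Fmap Q P' f (eta P e) = G.Fmap Q P' g (eta P e)"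
        using comp[OF f(1) ee] comp[OF g(1) ee] f g xy(3) by simp
    qed fact
    then have "G.Fmap Q M f = G.Fmap Q M g" by (rule G.map_cong)
    then show "x = y" using f g by simp
  next
    fix y assume "y \<in> ?i ` carrier (Go M)"
    then show "y \<in> carrier (Go P')" using module_map_closed[OF G.map[OF M P' \<iota>]] by auto
  next
    fix y assume "y \<in> carrier (Go P')"
    then obtain f where f: "module_map B Q P' f" "G.Fmap Q P' f (eta P e) = y"
      using image_map_exists[OF P'] by (auto simp: Q_def)
    have "y = ?i (G.Fmap Q M f (eta P e))" using comp[OF into[OF f(1)] ee] f by simp
    then show "y \<in> ?i ` carrier (Go M)"
      using module_map_closed[OF G.map[OF Q M into[OF f(1)]] ee] by blast
  qed
  then have h: "module_map A (Go P') (Go M) (inv_into (carrier (Go M)) ?i)"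
    and h': "\<And>y. y \<in> carrier (Go P') \<Longrightarrow> ?i (inv_into (carrier (Go M)) ?i y) = y"
    using module_map_inverse[OF G.ob[OF M] G.map[OF M P' \<iota>]] by (auto simp: bij_betw_def f_inv_into_f)
  \<comment> \<open>The inverse of the bijection on \<open>G P\'\<close> is the image of a map \<open>\<kappa>\<close> from \<open>P\'\<close> to \<open>M\<close>, whose composite with the inclusion is the identity.\<close>
  obtain \<kappa> where \<kappa>: "module_map B P' M \<kappa>"
    "\<And>y. y \<in> carrier (Go P') \<Longrightarrow> G.Fmap P' M \<kappa> y = inv_into (carrier (Go M)) ?i y"
    using S.full[OF P' M h] by blast
  have "\<kappa> e' = e'"
  proof (rule S.faithful[OF P' P' _ _ _ PB.e_in])
    show "module_map B P' P' \<kappa>" using module_map_compose[OF \<kappa>(1) \<iota>] by simp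
    show "module_map B P' P' (\<lambda>x. x)" by (rule module_map_id)
    show "G.Fmap P' P' \<kappa> y = G.Fmap P' P' (\<lambda>x. x) y" if "y \<in> carrier (Go P')" for y
      using G.map_compose[OF P' M P' \<kappa>(1) \<iota> that] \<kappa>(2)[OF that] h'[OF that] G.map_id[OF P' that] by simp
  qed
  then have "e' \<in> T"
    using module_map_closed[OF \<kappa>(1) PB.e_in] by (simp add: M_def)
  then obtain n :: nat and f q where fq: "\<And>i. i < n \<Longrightarrow> module_map B Q P' (f i)" "\<And>i. i < n \<Longrightarrow> q i \<in> carrier Q"
    "e' = (\<Oplus>\<^bsub>P'\<^esub>i\<in>{..<n}. f i (q i))"
    using trace_submodule_sum[OF P'] unfolding T_def by blast
  define g where "g i = PB.extend Q (q i)" for i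
  have g: "module_map B P' Q (g i)" if "i < n" for i
    unfolding g_def by (rule PB.extend_module_map[OF Q fq(2)[OF that]])
  have "(\<Oplus>\<^bsub>P'\<^esub>i\<in>{..<n}. f i (g i y)) = y" if y: "y \<in> carrier P'" for y
  proof (rule PB.maps_eqI[OF _ _ _ y])
    show "module_map B P' P' (\<lambda>y. \<Oplus>\<^bsub>P'\<^esub>i\<in>{..<n}. f i (g i y))"
      by (rule module_map_finsum_maps[OF P' P']) (use module_map_compose[OF g fq(1)] in simp)
    show "module_map B P' P' (\<lambda>x. x)" by (rule module_map_id)
    have "f i (q i) \<in> carrier P'" if "i < n" for i
      using module_map_closed[OF fq(1)[OF that] fq(2)[OF that]] .
    then have "(\<Oplus>\<^bsub>P'\<^esub>i\<in>{..<n}. f i (g i e')) = (\<Oplus>\<^bsub>P'\<^esub>i\<in>{..<n}. f i (q i))"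
      using PB.extend_e[OF Q fq(2)] by (intro PB.P.M.finsum_cong') (auto simp: g_def)
    then show "(\<Oplus>\<^bsub>P'\<^esub>i\<in>{..<n}. f i (g i e')) = e'" using fq(3) by simp
  qed
  then show ?thesis using that fq(1) g unfolding Q_def by blast
qed

end

section \<open>Comparing traces\<close>

context psp_alg
begin

text \<open>
  The trace of the identity of \<open>A\<close> is the rank of \<open>A\<close> on the one hand and \<open>\<lambda> s(1)\<close> on the
  other.
\<close>

lemma lam_nonzero:
  assumes char0: "\<And>n::nat. of_nat n = (0::'r) \<Longrightarrow> n = 0" and "carrier A \<noteq> {\<zero>}"
  shows "lam \<noteq> 0"
proof
  assume "lam = 0"
  then have "module_trace A (\<lambda>x. x) = 0"
    using trace_rmult[of \<one>] module_trace_cong[OF free, of "\<lambda>x. x \<otimes> \<one>" "\<lambda>x. x"] by simp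
  then have "module_rank A = 0"
    using module_trace_id[OF free] char0 by metis
  then have "E = {}"
    by (simp add: module_rank_def)
  then have "x = \<zero>" if "x \<in> carrier A" for x
    using expand[OF that] by simp
  then show False using assms(2) by auto
qed

end

locale free_psp = psp_alg A \<Phi> lam + free_on A P e
  for A :: "('o::idom, 'a) module" (structure) and \<Phi> and lam and P :: "('a, 'u) module" and e +
  assumes PID: "principal_domain (type_ring :: 'o ring)"
begin

lemma lattice_generator: "lattice_over A P"
proof -
  note L = left_module_restrict_scalars[OF P_module]
  let ?g = "inv_into (carrier A) (\<lambda>a. a \<odot>\<^bsub>P\<^esub> e)"
  note f = module_map_orbit[OF P_module e_in]
  note g = module_map_inverse[OF S.left_module_axioms f]
  have "free_finite_rank (restrict_scalars A P)"
  proof (rule free_of_factor[OF PID _ free L f, of "{()}"])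
    show "module_map type_ring (restrict_scalars A P) A ?g" if "i \<in> {()}" for i :: unit
      by (rule g) (use orbit_bij in simp)
    show "(\<Oplus>\<^bsub>restrict_scalars A P\<^esub>i\<in>{()}. ?g w \<odot>\<^bsub>P\<^esub> e) = w" if "w \<in> carrier (restrict_scalars A P)" for w
    proof -
      have "?g w \<odot>\<^bsub>P\<^esub> e = w"
        using that orbit_bij f_inv_into_f[of w "\<lambda>a. a \<odot>\<^bsub>P\<^esub> e" "carrier A"] by (simp add: bij_betw_def)
      then show ?thesis using that by simp
    qed
  qed simp
  then show ?thesis using P_module by (simp add: lattice_over_def)
qed

text \<open>
  Under the identification of \<open>A\<close> with \<open>P\<close>, the endomorphism \<open>\<gamma>\<close> is right multiplication by
  \<open>d\<close>, so this is \<open>trace_rmult\<close>.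
\<close>

lemma trace_generator:
  assumes \<gamma>: "module_map A P P \<gamma>" and d: "d \<in> carrier A" "\<gamma> e = d \<odot>\<^bsub>P\<^esub> e"
  shows "module_trace (restrict_scalars A P) \<gamma> = lam * s d"
proof -
  let ?g = "inv_into (carrier A) (\<lambda>a. a \<odot>\<^bsub>P\<^esub> e)"
  note f = module_map_orbit[OF P_module e_in]
  have "bij_betw (\<lambda>a. a \<odot>\<^bsub>P\<^esub> e) (carrier A) (carrier (restrict_scalars A P))"
    using orbit_bij by simp
  note g = module_map_inverse[OF S.left_module_axioms f this]
  have gf: "?g (x \<odot>\<^bsub>P\<^esub> e) = x" if "x \<in> carrier A" for x
    using that orbit_bij by (intro inv_into_f_f) (auto simp: bij_betw_def)
  have "module_trace (restrict_scalars A P) \<gamma> = module_trace A (\<lambda>x. x \<otimes> d)"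
  proof (rule module_trace_conjugate[OF free lattice_overD(2)[OF lattice_generator] f g gf module_map_rmult[OF d(1)]])
    fix y assume "y \<in> carrier (restrict_scalars A P)"
    then obtain b where b: "b \<in> carrier A" "y = b \<odot>\<^bsub>P\<^esub> e" using generated[of y] by auto
    show "\<gamma> y = (?g y \<otimes> d) \<odot>\<^bsub>P\<^esub> e"
      using b d e_in by (simp add: gf module_map_smult[OF \<gamma>] P.smult_assoc)
  qed
  then show ?thesis using trace_rmult[OF d(1)] by simp
qed

end

text \<open>
  The situation of the theorem, symmetric in the two algebras: every statement about \<open>F\<close> yields the
  corresponding statement about the inverse \<open>G\<close> through \<open>swap_psp\<close>.
\<close>

locale equivalence_psp = equivalence_free A B Fo Fm Go Gm P e P' e' +
  SA: free_psp A \<Phi> lam P e + SB: free_psp B \<Phi>' lam' P' e'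
  for A :: "('o::idom, 'a) module" and B :: "('o, 'b) module"
    and Fo :: "('a, 'u) module \<Rightarrow> ('b, 'u) module"
    and Fm :: "('a, 'u) module \<Rightarrow> ('a, 'u) module \<Rightarrow> ('u \<Rightarrow> 'u) \<Rightarrow> ('u \<Rightarrow> 'u)"
    and Go :: "('b, 'u) module \<Rightarrow> ('a, 'u) module"
    and Gm :: "('b, 'u) module \<Rightarrow> ('b, 'u) module \<Rightarrow> ('u \<Rightarrow> 'u) \<Rightarrow> ('u \<Rightarrow> 'u)"
    and P :: "('a, 'u) module" and e :: 'u and P' :: "('b, 'u) module" and e' :: 'u
    and \<Phi> lam \<Phi>' lam' +
  assumes lam_nz: "lam \<noteq> 0" and lam'_nz: "lam' \<noteq> 0"
begin

lemma swap_psp: "equivalence_psp B A Go Gm Fo Fm P' e' P e \<Phi>' lam' \<Phi> lam"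
  by (intro equivalence_psp.intro swap_free SA.free_psp_axioms SB.free_psp_axioms
      equivalence_psp_axioms.intro lam_nz lam'_nz)

text \<open>
  Homomorphisms from \<open>F P\<close> to \<open>F V\<close> are the maps \<open>F (a e \<mapsto> a v)\<close> with \<open>v\<close> in \<open>V\<close>, and homomorphisms from
  \<open>P'\<close> to \<open>F V\<close> are elements of \<open>F V\<close>. Composing with \<open>g i\<close> and \<open>f i\<close> from the lemma
  \<open>generator\<close> therefore gives linear maps \<open>\<xi> i\<close> from \<open>V\<close> to \<open>F V\<close> and \<open>Y i\<close> back, natural in \<open>V\<close>, with
  \<open>\<Sum> \<xi> i (Y i w) = w\<close>. The composite \<open>Y i \<circ> \<xi> i\<close> comes from the endomorphism \<open>g i \<circ> f i\<close> of \<open>F P\<close>, which is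
  the image of right multiplication by some \<open>a i\<close>, and hence is the action of \<open>a i\<close>. The trace of \<open>F \<alpha>\<close> is then
  the sum of the traces of \<open>\<alpha> (a i)\<close>, and \<open>a\<close> is the sum of the \<open>a i\<close>.
\<close>

lemma trace_image:
  obtains a where "a \<in> carrier A"
    "\<And>V. lattice_over A V \<Longrightarrow> lattice_over B (Fo V)"
    "\<And>V \<alpha>. \<lbrakk>lattice_over A V; module_map A V V \<alpha>\<rbrakk> \<Longrightarrow>
       module_trace (restrict_scalars B (Fo V)) (F.Fmap V V \<alpha>) =
       module_trace (restrict_scalars A V) (\<lambda>v. \<alpha> (a \<odot>\<^bsub>V\<^esub> v))"
proof -
  note P = PA.P_module and P' = PB.P_module
  define Q where "Q = Fo P"
  have Q: "left_module B Q" unfolding Q_def by (rule F.ob[OF P])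
  obtain n :: nat and f g where f: "\<And>i. i < n \<Longrightarrow> module_map B Q P' (f i)"
    and g: "\<And>i. i < n \<Longrightarrow> module_map B P' Q (g i)"
    and fg: "\<And>y. y \<in> carrier P' \<Longrightarrow> (\<Oplus>\<^bsub>P'\<^esub>i\<in>{..<n}. f i (g i y)) = y"
    by (rule generator[folded Q_def]) (rule that)
  have "\<exists>c. i < n \<longrightarrow> module_map A P P c \<and> (\<forall>y\<in>carrier Q. F.Fmap P P c y = g i (f i y))" for i
  proof (cases "i < n")
    case True
    obtain c where "module_map A P P c" "\<And>y. y \<in> carrier (Fo P) \<Longrightarrow> F.Fmap P P c y = g i (f i y)"
      by (rule full[OF P P module_map_compose[OF f[OF True] g[OF True], unfolded Q_def]]) (rule that)
    then show ?thesis by (intro exI[of _ c]) (simp add: Q_def)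
  qed simp
  from choice[OF allI[OF this]] obtain c where c':
    "\<forall>i. i < n \<longrightarrow> module_map A P P (c i) \<and> (\<forall>y\<in>carrier Q. F.Fmap P P (c i) y = g i (f i y))" ..
  then have c: "\<And>i. i < n \<Longrightarrow> module_map A P P (c i)"
    "\<And>i y. \<lbrakk>i < n; y \<in> carrier Q\<rbrakk> \<Longrightarrow> F.Fmap P P (c i) y = g i (f i y)"
    by auto
  have "\<exists>a. a \<in> carrier A \<and> c i e = a \<odot>\<^bsub>P\<^esub> e" if "i < n" for i
    by (rule PA.generated[OF module_map_closed[OF c(1)[OF that] PA.e_in]]) (intro exI conjI)
  then obtain a where a: "\<And>i. i < n \<Longrightarrow> a i \<in> carrier A" "\<And>i. i < n \<Longrightarrow> c i e = a i \<odot>\<^bsub>P\<^esub> e"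
    by metis
  define b where "b = (\<Oplus>\<^bsub>A\<^esub>i\<in>{..<n}. a i)"
  have b: "b \<in> carrier A" unfolding b_def using a(1) by (intro A.finsum_closed) auto
  have main: "lattice_over B (Fo V) \<and> (\<forall>\<alpha>. module_map A V V \<alpha> \<longrightarrow>
       module_trace (restrict_scalars B (Fo V)) (F.Fmap V V \<alpha>) =
       module_trace (restrict_scalars A V) (\<lambda>v. \<alpha> (b \<odot>\<^bsub>V\<^esub> v)))" if latV: "lattice_over A V" for V
  proof -
    note V = lattice_overD(1)[OF latV] and frV = lattice_overD(2)[OF latV]
    define W where "W = Fo V"
    have W: "left_module B W" unfolding W_def by (rule F.ob[OF V])
    interpret V: left_module A V by (rule V)
    interpret W: left_module B W by (rule W)
    \<comment> \<open>The homomorphism from \<open>F P\<close> to \<open>F V\<close> that corresponds to the element \<open>v\<close>.\<close>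
    define ev where "ev v = F.Fmap P V (PA.extend V v)" for v
    have ev_map: "module_map B Q W (ev v)" if "v \<in> carrier V" for v
      unfolding ev_def Q_def W_def by (rule F.map[OF P V PA.extend_module_map[OF V that]])
    have ev_closed: "ev v y \<in> carrier W" if "v \<in> carrier V" "y \<in> carrier Q" for v y
      using module_map_closed[OF ev_map[OF that(1)] that(2)] .
    have ev_add: "ev (v \<oplus>\<^bsub>V\<^esub> v') y = ev v y \<oplus>\<^bsub>W\<^esub> ev v' y"
      if "v \<in> carrier V" "v' \<in> carrier V" "y \<in> carrier Q" for v v' y
    proof -
      have "PA.extend V (v \<oplus>\<^bsub>V\<^esub> v') x = PA.extend V v x \<oplus>\<^bsub>V\<^esub> PA.extend V v' x" if "x \<in> carrier P" for x
        using that \<open>v \<in> carrier V\<close> \<open>v' \<in> carrier V\<close> by (elim PA.generated) (simp add: V.smult_r_distr)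
      then have "ev (v \<oplus>\<^bsub>V\<^esub> v') = F.Fmap P V (\<lambda>x. PA.extend V v x \<oplus>\<^bsub>V\<^esub> PA.extend V v' x)"
        unfolding ev_def by (rule F.map_cong)
      then show ?thesis
        using F.map_add[OF P V PA.extend_module_map[OF V that(1)] PA.extend_module_map[OF V that(2)]] that(3)
        by (simp add: ev_def W_def Q_def)
    qed
    have ev_smult: "ev ((r \<odot>\<^bsub>A\<^esub> \<one>\<^bsub>A\<^esub>) \<odot>\<^bsub>V\<^esub> v) y = (r \<odot>\<^bsub>B\<^esub> \<one>\<^bsub>B\<^esub>) \<odot>\<^bsub>W\<^esub> ev v y"
      if "v \<in> carrier V" "y \<in> carrier Q" for v y r
    proof -
      have "PA.extend V ((r \<odot>\<^bsub>A\<^esub> \<one>\<^bsub>A\<^esub>) \<odot>\<^bsub>V\<^esub> v) x = (r \<odot>\<^bsub>A\<^esub> \<one>\<^bsub>A\<^esub>) \<odot>\<^bsub>V\<^esub> PA.extend V v x" if "x \<in> carrier P" for x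
        using that \<open>v \<in> carrier V\<close>
        by (elim PA.generated) (simp add: V.smult_assoc[symmetric] A.central_unit)
      then have "ev ((r \<odot>\<^bsub>A\<^esub> \<one>\<^bsub>A\<^esub>) \<odot>\<^bsub>V\<^esub> v) = F.Fmap P V (\<lambda>x. (r \<odot>\<^bsub>A\<^esub> \<one>\<^bsub>A\<^esub>) \<odot>\<^bsub>V\<^esub> PA.extend V v x)"
        unfolding ev_def by (rule F.map_cong)
      then show ?thesis
        using F.map_smult[OF P V PA.extend_module_map[OF V that(1)]] that(2)
        by (simp add: ev_def W_def Q_def)
    qed
    have ev_inj: "v = v'" if "v \<in> carrier V" "v' \<in> carrier V" "\<And>y. y \<in> carrier Q \<Longrightarrow> ev v y = ev v' y" for v v'
    proof -
      have "PA.extend V v e = PA.extend V v' e"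
        using that(3) unfolding ev_def Q_def
        by (intro faithful[OF P V PA.extend_module_map[OF V that(1)] PA.extend_module_map[OF V that(2)] _ PA.e_in])
      then show ?thesis using that by (simp add: PA.extend_e[OF V])
    qed
    have ev_surj: "\<exists>v\<in>carrier V. \<forall>y\<in>carrier Q. ev v y = h y" if h: "module_map B Q W h" for h
    proof -
      obtain k where k: "module_map A P V k" "\<And>y. y \<in> carrier Q \<Longrightarrow> F.Fmap P V k y = h y"
        by (rule full[OF P V h[unfolded Q_def W_def], folded Q_def]) (rule that)
      have "ev (k e) = F.Fmap P V k"
        unfolding ev_def by (rule F.map_cong) (rule PA.extend_unique[OF V k(1)])
      then show ?thesis
        using k(2) module_map_closed[OF k(1) PA.e_in] by (intro bexI[of _ "k e"]) auto
    qed
    have ev_nat: "ev (\<alpha> v) y = F.Fmap V V \<alpha> (ev v y)"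
      if \<alpha>: "module_map A V V \<alpha>" and v: "v \<in> carrier V" and y: "y \<in> carrier Q" for \<alpha> v y
    proof -
      have "PA.extend V (\<alpha> v) x = \<alpha> (PA.extend V v x)" if "x \<in> carrier P" for x
        using PA.extend_unique[OF V module_map_compose[OF PA.extend_module_map[OF V v] \<alpha>] that]
        by (simp add: PA.extend_e[OF V v])
      then have "ev (\<alpha> v) = F.Fmap P V (\<lambda>x. \<alpha> (PA.extend V v x))"
        unfolding ev_def by (rule F.map_cong)
      then show ?thesis
        using F.map_compose[OF P V V PA.extend_module_map[OF V v] \<alpha>] y by (simp add: ev_def Q_def)
    qed
    \<comment> \<open>The value \<open>\<xi> i v\<close> describes the homomorphism \<open>ev v \<circ> g i\<close> on \<open>P\'\<close>, and \<open>Y i w\<close> describes the homomorphism \<open>(b e\' \<mapsto> b w) \<circ> f i\<close> on \<open>F P\<close>.\<close>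
    define \<xi> where "\<xi> i v = ev v (g i e')" for i v
    define Y where "Y i w = (SOME v. v \<in> carrier V \<and> (\<forall>y\<in>carrier Q. ev v y = PB.extend W w (f i y)))" for i w
    have Y: "Y i w \<in> carrier V" "\<And>y. y \<in> carrier Q \<Longrightarrow> ev (Y i w) y = PB.extend W w (f i y)"
      if "i < n" "w \<in> carrier W" for i w
    proof -
      have "\<exists>v. v \<in> carrier V \<and> (\<forall>y\<in>carrier Q. ev v y = PB.extend W w (f i y))"
        using ev_surj[OF module_map_compose[OF f[OF that(1)] PB.extend_module_map[OF W that(2)]]]
        unfolding Bex_def .
      from someI_ex[OF this] have *: "Y i w \<in> carrier V \<and> (\<forall>y\<in>carrier Q. ev (Y i w) y = PB.extend W w (f i y))"
        unfolding Y_def .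
      then show "Y i w \<in> carrier V" by (rule conjunct1)
      show "ev (Y i w) y = PB.extend W w (f i y)" if "y \<in> carrier Q" for y
        using conjunct2[OF *] that by (rule bspec)
    qed
    have Y_eqI: "Y i w = v" if "i < n" "w \<in> carrier W" "v \<in> carrier V"
      "\<And>y. y \<in> carrier Q \<Longrightarrow> ev v y = PB.extend W w (f i y)" for i w v
    proof (rule ev_inj[OF Y(1)[OF that(1,2)] that(3)])
      show "ev (Y i w) y = ev v y" if "y \<in> carrier Q" for y
        by (simp only: Y(2)[OF \<open>i < n\<close> \<open>w \<in> carrier W\<close> that] \<open>\<And>y. y \<in> carrier Q \<Longrightarrow> ev v y = PB.extend W w (f i y)\<close>[OF that])
    qed
    have ge: "g i e' \<in> carrier Q" if "i < n" for i
      using module_map_closed[OF g[OF that] PB.e_in] .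
    have fc: "f i y \<in> carrier P'" if "i < n" "y \<in> carrier Q" for i y
      using module_map_closed[OF f[OF that(1)] that(2)] .
    have Xc: "\<xi> i v \<in> carrier W" if "i < n" "v \<in> carrier V" for i v
      unfolding \<xi>_def by (rule ev_closed[OF that(2) ge[OF that(1)]])
    let ?RV = "restrict_scalars A V" and ?RW = "restrict_scalars B W"
    have Xm: "module_map type_ring ?RV ?RW (\<xi> i)" if "i < n" for i
      using ge[OF that] Xc[OF that] unfolding module_map_def by (auto simp: \<xi>_def ev_add ev_smult)
    have Ym: "module_map type_ring ?RW ?RV (Y i)" if i: "i < n" for i
      unfolding module_map_def
    proof (intro conjI ballI)
      fix w w' assume "w \<in> carrier ?RW" "w' \<in> carrier ?RW"
      then have w: "w \<in> carrier W" "w' \<in> carrier W" by auto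
      have "PB.extend W (w \<oplus>\<^bsub>W\<^esub> w') x = PB.extend W w x \<oplus>\<^bsub>W\<^esub> PB.extend W w' x" if "x \<in> carrier P'" for x
        using that w by (elim PB.generated) (simp add: W.smult_r_distr)
      then have "Y i (w \<oplus>\<^bsub>W\<^esub> w') = Y i w \<oplus>\<^bsub>V\<^esub> Y i w'"
        using w Y[OF i] fc[OF i] by (intro Y_eqI[OF i]) (auto simp: ev_add)
      then show "Y i (w \<oplus>\<^bsub>?RW\<^esub> w') = Y i w \<oplus>\<^bsub>?RV\<^esub> Y i w'" by simp
    next
      fix r w assume "w \<in> carrier ?RW"
      then have w: "w \<in> carrier W" by simp
      have "PB.extend W ((r \<odot>\<^bsub>B\<^esub> \<one>\<^bsub>B\<^esub>) \<odot>\<^bsub>W\<^esub> w) x = (r \<odot>\<^bsub>B\<^esub> \<one>\<^bsub>B\<^esub>) \<odot>\<^bsub>W\<^esub> PB.extend W w x" if "x \<in> carrier P'" for x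
        using that w by (elim PB.generated) (simp add: W.smult_assoc[symmetric] B.central_unit)
      then have "Y i ((r \<odot>\<^bsub>B\<^esub> \<one>\<^bsub>B\<^esub>) \<odot>\<^bsub>W\<^esub> w) = (r \<odot>\<^bsub>A\<^esub> \<one>\<^bsub>A\<^esub>) \<odot>\<^bsub>V\<^esub> Y i w"
        using w Y[OF i] fc[OF i] by (intro Y_eqI[OF i]) (auto simp: ev_smult V.smult_closed W.smult_closed)
      then show "Y i (r \<odot>\<^bsub>?RW\<^esub> w) = r \<odot>\<^bsub>?RV\<^esub> Y i w" by simp
    qed (use Y[OF i] in auto)
    have XY: "(\<Oplus>\<^bsub>?RW\<^esub>i\<in>{..<n}. \<xi> i (Y i w)) = w" if "w \<in> carrier ?RW" for w
    proof -
      have w: "w \<in> carrier W" using that by simp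
      note ext = PB.extend_module_map[OF W w]
      have "(\<Oplus>\<^bsub>W\<^esub>i\<in>{..<n}. \<xi> i (Y i w)) = (\<Oplus>\<^bsub>W\<^esub>i\<in>{..<n}. PB.extend W w (f i (g i e')))"
        using Y(2)[OF _ w ge] fc[OF _ ge]
        by (intro W.M.finsum_cong') (auto simp: \<xi>_def module_map_closed[OF ext])
      also have "\<dots> = PB.extend W w (\<Oplus>\<^bsub>P'\<^esub>i\<in>{..<n}. f i (g i e'))"
        using fc[OF _ ge] by (intro module_map_finsum[OF P' W ext, symmetric]) auto
      also have "\<dots> = w"
        using fg[OF PB.e_in] PB.extend_e[OF W w] by simp
      finally show ?thesis by simp
    qed
    have YX: "Y i (\<xi> i v) = a i \<odot>\<^bsub>V\<^esub> v" if i: "i < n" and v: "v \<in> carrier V" for i v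
    proof (rule Y_eqI[OF i Xc[OF i v]])
      show "a i \<odot>\<^bsub>V\<^esub> v \<in> carrier V" using a(1)[OF i] v by (rule V.smult_closed)
      fix y assume y: "y \<in> carrier Q"
      have "PB.extend W (\<xi> i v) z = ev v (g i z)" if "z \<in> carrier P'" for z
        using PB.extend_unique[OF W module_map_compose[OF g[OF i] ev_map[OF v]] that] by (simp add: \<xi>_def)
      then have "PB.extend W (\<xi> i v) (f i y) = ev v (F.Fmap P P (c i) y)"
        using fc[OF i y] c(2)[OF i y] by simp
      also have "\<dots> = F.Fmap P V (\<lambda>x. PA.extend V v (c i x)) y"
        using F.map_compose[OF P P V c(1)[OF i] PA.extend_module_map[OF V v]] y by (simp add: ev_def Q_def)
      also have "F.Fmap P V (\<lambda>x. PA.extend V v (c i x)) = ev (a i \<odot>\<^bsub>V\<^esub> v)"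
        unfolding ev_def
      proof (rule F.map_cong)
        fix x assume x: "x \<in> carrier P"
        show "PA.extend V v (c i x) = PA.extend V (a i \<odot>\<^bsub>V\<^esub> v) x"
          using PA.extend_unique[OF V module_map_compose[OF c(1)[OF i] PA.extend_module_map[OF V v]] x]
          by (simp add: a[OF i])
      qed
      finally show "ev (a i \<odot>\<^bsub>V\<^esub> v) y = PB.extend W (\<xi> i v) (f i y)" ..
    qed
    have YF: "Y i (F.Fmap V V \<alpha> w) = \<alpha> (Y i w)"
      if i: "i < n" and \<alpha>: "module_map A V V \<alpha>" and w: "w \<in> carrier W" for i \<alpha> w
    proof (rule Y_eqI[OF i])
      have F\<alpha>: "module_map B W W (F.Fmap V V \<alpha>)" unfolding W_def by (rule F.map[OF V V \<alpha>])
      show "F.Fmap V V \<alpha> w \<in> carrier W" by (rule module_map_closed[OF F\<alpha> w])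
      show "\<alpha> (Y i w) \<in> carrier V" by (rule module_map_closed[OF \<alpha> Y(1)[OF i w]])
      fix y assume y: "y \<in> carrier Q"
      have "PB.extend W (F.Fmap V V \<alpha> w) (f i y) = F.Fmap V V \<alpha> (PB.extend W w (f i y))"
        using PB.extend_unique[OF W module_map_compose[OF PB.extend_module_map[OF W w] F\<alpha>] fc[OF i y]]
        by (simp add: PB.extend_e[OF W w])
      then show "ev (\<alpha> (Y i w)) y = PB.extend W (F.Fmap V V \<alpha> w) (f i y)"
        using ev_nat[OF \<alpha> Y(1)[OF i w] y] Y(2)[OF i w y] by simp
    qed
    note RW = B.left_module_restrict_scalars[OF W]
    have frW: "free_finite_rank ?RW"
    proof (rule free_of_factor[where V = ?RV and f = \<xi> and g = Y and I = "{..<n}"])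
      show "(\<Oplus>\<^bsub>?RW\<^esub>i\<in>{..<n}. \<xi> i (Y i w)) = w" if "w \<in> carrier ?RW" for w
        by (rule XY[OF that])
    qed (use SA.PID frV RW Xm Ym in auto)
    moreover have "module_trace ?RW (F.Fmap V V \<alpha>) = module_trace ?RV (\<lambda>v. \<alpha> (b \<odot>\<^bsub>V\<^esub> v))"
      if \<alpha>: "module_map A V V \<alpha>" for \<alpha>
    proof -
      have F\<alpha>: "module_map B W W (F.Fmap V V \<alpha>)" unfolding W_def by (rule F.map[OF V V \<alpha>])
      have ac: "\<alpha> v \<in> carrier V" if "v \<in> carrier V" for v by (rule module_map_closed[OF \<alpha> that])
      have "module_trace ?RW (F.Fmap V V \<alpha>) =
          (\<Sum>i\<in>{..<n}. module_trace ?RV (\<lambda>v. Y i (F.Fmap V V \<alpha> (\<xi> i v))))"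
      proof (rule module_trace_factor[where V = ?RV and f = \<xi> and g = Y and I = "{..<n}"])
        show "(\<Oplus>\<^bsub>?RW\<^esub>i\<in>{..<n}. \<xi> i (Y i w)) = w" if "w \<in> carrier ?RW" for w
          by (rule XY[OF that])
      qed (use frV frW B.module_map_restrict_scalars[OF F\<alpha>] Xm Ym in auto)
      also have "\<dots> = (\<Sum>i\<in>{..<n}. module_trace ?RV (\<lambda>v. \<alpha> (a i \<odot>\<^bsub>V\<^esub> v)))"
        by (intro sum.cong refl module_trace_cong[OF frV]) (simp add: YF[OF _ \<alpha> Xc] YX)
      also have "\<dots> = module_trace ?RV (\<lambda>v. \<Oplus>\<^bsub>?RV\<^esub>i\<in>{..<n}. \<alpha> (a i \<odot>\<^bsub>V\<^esub> v))"
        using a(1) by (intro module_trace_finsum[OF frV, symmetric]) (auto intro!: ac V.smult_closed)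
      also have "\<dots> = module_trace ?RV (\<lambda>v. \<alpha> (b \<odot>\<^bsub>V\<^esub> v))"
      proof (rule module_trace_cong[OF frV])
        fix v assume "v \<in> carrier ?RV" then have v: "v \<in> carrier V" by simp
        have "b \<odot>\<^bsub>V\<^esub> v = (\<Oplus>\<^bsub>V\<^esub>i\<in>{..<n}. a i \<odot>\<^bsub>V\<^esub> v)"
          unfolding b_def using a(1) by (intro A.action_finsum[OF V v]) auto
        then show "(\<Oplus>\<^bsub>?RV\<^esub>i\<in>{..<n}. \<alpha> (a i \<odot>\<^bsub>V\<^esub> v)) = \<alpha> (b \<odot>\<^bsub>V\<^esub> v)"
          using module_map_finsum[OF V V \<alpha>, of "{..<n}" "\<lambda>i. a i \<odot>\<^bsub>V\<^esub> v"] a(1) v by (simp add: V.smult_closed)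
      qed
      finally show ?thesis .
    qed
    ultimately show ?thesis
      using W unfolding W_def lattice_over_def by blast
  qed
  show ?thesis using that b main by blast
qed

lemma lattice_image: "lattice_over A V \<Longrightarrow> lattice_over B (Fo V)"
  using trace_image by metis

text \<open>
  By the lemma \<open>generator\<close> for the inverse functor, \<open>F P\<close> is a direct summand of a finite sum of copies
  of \<open>P'\<close>, and the endomorphisms of \<open>P'\<close> have traces divisible by \<open>lam'\<close> by
  \<open>trace_generator\<close>.
\<close>

lemma trace_image_generator:
  assumes \<beta>: "module_map B (Fo P) (Fo P) \<beta>"
  shows "\<exists>t. module_trace (restrict_scalars B (Fo P)) \<beta> = lam' * t"
proof -
  interpret S: equivalence_psp B A Go Gm Fo Fm P' e' P e \<Phi>' lam' \<Phi> lam by (rule swap_psp)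
  note P = PA.P_module and P' = PB.P_module
  note Q = F.ob[OF P] and GP' = G.ob[OF P']
  obtain n :: nat and f g where f: "\<And>i. i < n \<Longrightarrow> module_map A (Go P') P (f i)"
    and g: "\<And>i. i < n \<Longrightarrow> module_map A P (Go P') (g i)"
    and fg: "\<And>y. y \<in> carrier P \<Longrightarrow> (\<Oplus>\<^bsub>P\<^esub>i\<in>{..<n}. f i (g i y)) = y"
    by (rule S.generator) (rule that)
  \<comment> \<open>Apply \<open>F\<close> to the splitting of \<open>P\<close> and replace \<open>F (G P\')\<close> by \<open>P\'\<close>.\<close>
  let ?i = "inv_into (carrier P') (S.eta P')"
  define f' where "f' i y = F.Fmap (Go P') P (f i) (S.eta P' y)" for i y
  define g' where "g' i y = ?i (F.Fmap P (Go P') (g i) y)" for i y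
  have f': "module_map B P' (Fo P) (f' i)" if "i < n" for i
    unfolding f'_def by (rule module_map_compose[OF S.eta_map[OF P'] F.map[OF GP' P f[OF that]]])
  have g': "module_map B (Fo P) P' (g' i)" if "i < n" for i
    unfolding g'_def
    by (rule module_map_compose[OF F.map[OF P GP' g[OF that]] module_map_inverse[OF P' S.eta_map[OF P'] S.eta_bij[OF P']]])
  interpret Q: left_module B "Fo P" by (rule Q)
  have fg': "(\<Oplus>\<^bsub>Fo P\<^esub>i\<in>{..<n}. f' i (g' i q)) = q" if q: "q \<in> carrier (Fo P)" for q
  proof -
    have eq: "f' i (g' i q) = F.Fmap P P (\<lambda>x. f i (g i x)) q" if "i < n" for i
    proof -
      have "F.Fmap P (Go P') (g i) q \<in> carrier (Fo (Go P'))"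
        by (rule module_map_closed[OF F.map[OF P GP' g[OF that]] q])
      then have "S.eta P' (g' i q) = F.Fmap P (Go P') (g i) q"
        unfolding g'_def using S.eta_bij[OF P'] by (auto simp: bij_betw_def f_inv_into_f)
      then show ?thesis
        unfolding f'_def using F.map_compose[OF P GP' P g[OF that] f[OF that] q] by simp
    qed
    have fgm: "module_map A P P (\<lambda>x. f i (g i x))" if "i < n" for i
      by (rule module_map_compose[OF g[OF that] f[OF that]])
    have "(\<Oplus>\<^bsub>Fo P\<^esub>i\<in>{..<n}. f' i (g' i q)) = (\<Oplus>\<^bsub>Fo P\<^esub>i\<in>{..<n}. F.Fmap P P (\<lambda>x. f i (g i x)) q)"
      using module_map_closed[OF F.map[OF P P fgm] q] by (intro Q.M.finsum_cong') (auto simp: eq)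
    also have "\<dots> = F.Fmap P P (\<lambda>x. \<Oplus>\<^bsub>P\<^esub>i\<in>{..<n}. f i (g i x)) q"
      using fgm by (intro F.map_finsum[OF P P _ q, symmetric]) auto
    also have "F.Fmap P P (\<lambda>x. \<Oplus>\<^bsub>P\<^esub>i\<in>{..<n}. f i (g i x)) = F.Fmap P P (\<lambda>x. x)"
      by (rule F.map_cong) (rule fg)
    also have "\<dots> q = q" by (rule F.map_id[OF P q])
    finally show ?thesis .
  qed
  note frP' = lattice_overD(2)[OF SB.lattice_generator] and frQ = lattice_overD(2)[OF lattice_image[OF SA.lattice_generator]]
  have "module_trace (restrict_scalars B (Fo P)) \<beta> =
      (\<Sum>i\<in>{..<n}. module_trace (restrict_scalars B P') (\<lambda>x. g' i (\<beta> (f' i x))))"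
    by (rule module_trace_factor[OF frP' frQ])
      (use fg' \<beta> f' g' in \<open>auto intro!: B.module_map_restrict_scalars\<close>)
  moreover have "\<exists>t. module_trace (restrict_scalars B P') (\<lambda>x. g' i (\<beta> (f' i x))) = lam' * t" if i: "i \<in> {..<n}" for i
  proof -
    have \<gamma>: "module_map B P' P' (\<lambda>x. g' i (\<beta> (f' i x)))"
      using module_map_compose[OF module_map_compose[OF f' \<beta>] g'] i by simp
    obtain d where "d \<in> carrier B" "g' i (\<beta> (f' i e')) = d \<odot>\<^bsub>P'\<^esub> e'"
      by (rule PB.generated[OF module_map_closed[OF \<gamma> PB.e_in]]) (rule that)
    then show ?thesis
      using SB.trace_generator[OF \<gamma>] by blast
  qed
  then have "lam' dvd (\<Sum>i\<in>{..<n}. module_trace (restrict_scalars B P') (\<lambda>x. g' i (\<beta> (f' i x))))"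
    by (intro dvd_sum) (auto simp: dvd_def)
  ultimately show ?thesis
    by (simp add: dvd_def)
qed

text \<open>
  The average \<open>w\<close> of the element given by \<open>trace_image\<close> satisfies the formula with \<open>w\<close> in place of
  \<open>lam' u\<close>. Evaluating it on \<open>P\<close>, whose endomorphisms are right multiplications, gives
  \<open>lam s(w b) = lam tr(F \<alpha>)\<close>, and the trace on the right is divisible by \<open>lam'\<close>. Dividing the functional
  \<open>b \<mapsto> s (w b)\<close> by \<open>lam'\<close> and representing the quotient by an element yields \<open>u\<close>.
\<close>

lemma central_element:
  obtains u where "u \<in> carrier A" "\<And>a. a \<in> carrier A \<Longrightarrow> u \<otimes>\<^bsub>A\<^esub> a = a \<otimes>\<^bsub>A\<^esub> u"
    "\<And>V \<alpha>. \<lbrakk>lattice_over A V; module_map A V V \<alpha>\<rbrakk> \<Longrightarrow>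
       lam * module_trace (restrict_scalars B (Fo V)) (F.Fmap V V \<alpha>) =
       lam' * module_trace (restrict_scalars A V) (\<lambda>v. \<alpha> (u \<odot>\<^bsub>V\<^esub> v))"
proof -
  note P = PA.P_module
  obtain a where a: "a \<in> carrier A" and tr: "\<And>V \<alpha>. \<lbrakk>lattice_over A V; module_map A V V \<alpha>\<rbrakk> \<Longrightarrow>
       module_trace (restrict_scalars B (Fo V)) (F.Fmap V V \<alpha>) =
       module_trace (restrict_scalars A V) (\<lambda>v. \<alpha> (a \<odot>\<^bsub>V\<^esub> v))"
    by (rule trace_image) (rule that)
  define w where "w = SA.average a"
  have w: "w \<in> carrier A" and wc: "\<And>b. b \<in> carrier A \<Longrightarrow> b \<otimes>\<^bsub>A\<^esub> w = w \<otimes>\<^bsub>A\<^esub> b"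
    using a SA.average_central by (auto simp: w_def)
  have "\<exists>t. SA.s (w \<otimes>\<^bsub>A\<^esub> b) = lam' * t" if b: "b \<in> carrier A" for b
  proof -
    have be: "b \<odot>\<^bsub>P\<^esub> e \<in> carrier P" using b PA.e_in by (rule PA.P.smult_closed)
    let ?\<alpha> = "PA.extend P (b \<odot>\<^bsub>P\<^esub> e)"
    note \<alpha> = PA.extend_module_map[OF P be]
    have "module_map A P P (\<lambda>v. w \<odot>\<^bsub>P\<^esub> v)"
      using w wc by (auto simp: module_map_def PA.P.smult_closed PA.P.smult_r_distr PA.P.smult_assoc[symmetric])
    then have m: "module_map A P P (\<lambda>v. ?\<alpha> (w \<odot>\<^bsub>P\<^esub> v))" by (rule module_map_compose[OF _ \<alpha>])
    have "lam * module_trace (restrict_scalars A P) (\<lambda>v. ?\<alpha> (a \<odot>\<^bsub>P\<^esub> v)) =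
        module_trace (restrict_scalars A P) (\<lambda>v. ?\<alpha> (w \<odot>\<^bsub>P\<^esub> v))"
      unfolding w_def by (rule SA.trace_average[OF SA.lattice_generator \<alpha> a])
    also have "\<dots> = lam * SA.s (w \<otimes>\<^bsub>A\<^esub> b)"
      by (rule SA.trace_generator[OF m]) (use w b PA.e_in in \<open>simp_all add: PA.P.smult_assoc\<close>)
    finally have "SA.s (w \<otimes>\<^bsub>A\<^esub> b) = module_trace (restrict_scalars A P) (\<lambda>v. ?\<alpha> (a \<odot>\<^bsub>P\<^esub> v))"
      using lam_nz by simp
    then show ?thesis
      using tr[OF SA.lattice_generator \<alpha>] trace_image_generator[OF F.map[OF P P \<alpha>]] by simp
  qed
  then obtain \<phi> where \<phi>: "\<And>b. b \<in> carrier A \<Longrightarrow> SA.s (w \<otimes>\<^bsub>A\<^esub> b) = lam' * \<phi> b" by metis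
  have "functional A \<phi>"
    unfolding functional_def
  proof (intro conjI ballI allI)
    fix x y assume "x \<in> carrier A" "y \<in> carrier A"
    then have "lam' * \<phi> (x \<oplus>\<^bsub>A\<^esub> y) = lam' * (\<phi> x + \<phi> y)"
      using functional_add[OF SA.s_lmult[OF w], of x y] by (simp add: \<phi> distrib_left)
    then show "\<phi> (x \<oplus>\<^bsub>A\<^esub> y) = \<phi> x + \<phi> y" using lam'_nz by simp
  next
    fix r x assume "x \<in> carrier A"
    then have "lam' * \<phi> (r \<odot>\<^bsub>A\<^esub> x) = lam' * (r * \<phi> x)"
      using functional_smult[OF SA.s_lmult[OF w], of x r] by (simp add: \<phi> mult.left_commute)
    then show "\<phi> (r \<odot>\<^bsub>A\<^esub> x) = r * \<phi> x" using lam'_nz by simp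
  qed
  then obtain u where u: "u \<in> carrier A" "\<And>z. z \<in> carrier A \<Longrightarrow> \<phi> z = SA.s (u \<otimes>\<^bsub>A\<^esub> z)"
    using SA.form_represents by metis
  have wu: "w = lam' \<odot>\<^bsub>A\<^esub> u"
  proof (rule SA.form_nondegenerate[OF w])
    show "lam' \<odot>\<^bsub>A\<^esub> u \<in> carrier A" using u by simp
    fix z assume z: "z \<in> carrier A"
    show "SA.s (w \<otimes>\<^bsub>A\<^esub> z) = SA.s ((lam' \<odot>\<^bsub>A\<^esub> u) \<otimes>\<^bsub>A\<^esub> z)"
      using u z by (simp add: \<phi> A.smult_mult functional_smult[OF SA.s_functional])
  qed
  have uc: "u \<otimes>\<^bsub>A\<^esub> b = b \<otimes>\<^bsub>A\<^esub> u" if b: "b \<in> carrier A" for b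
  proof (rule free_smult_cancel[OF SA.free _ _ _ lam'_nz])
    show "lam' \<odot>\<^bsub>A\<^esub> (u \<otimes>\<^bsub>A\<^esub> b) = lam' \<odot>\<^bsub>A\<^esub> (b \<otimes>\<^bsub>A\<^esub> u)"
      using wc[OF b] u b unfolding wu by (simp add: A.smult_mult A.mult_smult)
  qed (use u b in auto)
  show ?thesis
  proof (rule that[OF u(1) uc])
    fix V :: "('a, 'u) module" and \<alpha> assume V: "lattice_over A V" and \<alpha>: "module_map A V V \<alpha>"
    interpret V: left_module A V by (rule lattice_overD(1)[OF V])
    note fr = lattice_overD(2)[OF V]
    have "lam * module_trace (restrict_scalars B (Fo V)) (F.Fmap V V \<alpha>) =
        module_trace (restrict_scalars A V) (\<lambda>v. \<alpha> (w \<odot>\<^bsub>V\<^esub> v))"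
      using tr[OF V \<alpha>] SA.trace_average[OF V \<alpha> a] by (simp add: w_def)
    also have "\<dots> = module_trace (restrict_scalars A V) (\<lambda>v. lam' \<odot>\<^bsub>restrict_scalars A V\<^esub> \<alpha> (u \<odot>\<^bsub>V\<^esub> v))"
      using u by (intro module_trace_cong[OF fr])
        (simp add: wu module_map_smult[OF \<alpha>, symmetric] V.smult_closed V.smult_assoc[symmetric] A.unit_mult)
    also have "\<dots> = lam' * module_trace (restrict_scalars A V) (\<lambda>v. \<alpha> (u \<odot>\<^bsub>V\<^esub> v))"
      using u by (intro module_trace_smult[OF fr]) (auto intro!: module_map_closed[OF \<alpha>] V.smult_closed)
    finally show "lam * module_trace (restrict_scalars B (Fo V)) (F.Fmap V V \<alpha>) =
       lam' * module_trace (restrict_scalars A V) (\<lambda>v. \<alpha> (u \<odot>\<^bsub>V\<^esub> v))" .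
  qed
qed

end

context equivalence_psp
begin

text \<open>
  Let \<open>u'\<close> be the central element that belongs to the inverse functor. Its action on \<open>F P\<close> is \<open>F c\<close>
  for an endomorphism \<open>c\<close> of \<open>P\<close>, that is, for right multiplication by some \<open>v\<close>. Going to \<open>F P\<close>
  and back, the scalars \<open>lam\<close> and \<open>lam'\<close> cancel, and \<open>tr \<alpha> = tr (\<alpha> c u)\<close> for all endomorphisms \<open>\<alpha>\<close> of \<open>P\<close>.
  On \<open>P\<close> traces are values of the form, so nondegeneracy gives \<open>u v = 1\<close>.
\<close>

lemma central_unit_element:
  obtains u v where "u \<in> carrier A" "v \<in> carrier A" "u \<otimes>\<^bsub>A\<^esub> v = \<one>\<^bsub>A\<^esub>" "v \<otimes>\<^bsub>A\<^esub> u = \<one>\<^bsub>A\<^esub>"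
    "\<And>a. a \<in> carrier A \<Longrightarrow> u \<otimes>\<^bsub>A\<^esub> a = a \<otimes>\<^bsub>A\<^esub> u"
    "\<And>V \<alpha>. \<lbrakk>lattice_over A V; module_map A V V \<alpha>\<rbrakk> \<Longrightarrow>
       lam * module_trace (restrict_scalars B (Fo V)) (F.Fmap V V \<alpha>) =
       lam' * module_trace (restrict_scalars A V) (\<lambda>v. \<alpha> (u \<odot>\<^bsub>V\<^esub> v))"
proof -
  interpret S: equivalence_psp B A Go Gm Fo Fm P' e' P e \<Phi>' lam' \<Phi> lam by (rule swap_psp)
  note P = PA.P_module note Q = F.ob[OF P]
  note latP = SA.lattice_generator note latQ = lattice_image[OF latP]
  note latGQ = S.lattice_image[OF latQ]
  interpret Q: left_module B "Fo P" by (rule Q)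
  obtain u where u: "u \<in> carrier A" "\<And>a. a \<in> carrier A \<Longrightarrow> u \<otimes>\<^bsub>A\<^esub> a = a \<otimes>\<^bsub>A\<^esub> u"
    and tr: "\<And>V \<alpha>. \<lbrakk>lattice_over A V; module_map A V V \<alpha>\<rbrakk> \<Longrightarrow>
       lam * module_trace (restrict_scalars B (Fo V)) (F.Fmap V V \<alpha>) =
       lam' * module_trace (restrict_scalars A V) (\<lambda>v. \<alpha> (u \<odot>\<^bsub>V\<^esub> v))"
    by (rule central_element) (rule that)
  obtain u' where u': "u' \<in> carrier B" "\<And>a. a \<in> carrier B \<Longrightarrow> u' \<otimes>\<^bsub>B\<^esub> a = a \<otimes>\<^bsub>B\<^esub> u'"
    and tr': "\<And>V \<alpha>. \<lbrakk>lattice_over B V; module_map B V V \<alpha>\<rbrakk> \<Longrightarrow>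
       lam' * module_trace (restrict_scalars A (Go V)) (G.Fmap V V \<alpha>) =
       lam * module_trace (restrict_scalars B V) (\<lambda>v. \<alpha> (u' \<odot>\<^bsub>V\<^esub> v))"
    by (rule S.central_element) (rule that)
  have u'_map: "module_map B (Fo P) (Fo P) (\<lambda>q. u' \<odot>\<^bsub>Fo P\<^esub> q)"
    by (rule B.module_map_central[OF Q u'(1)]) (rule u'(2))
  obtain c where c: "module_map A P P c" "\<And>q. q \<in> carrier (Fo P) \<Longrightarrow> F.Fmap P P c q = u' \<odot>\<^bsub>Fo P\<^esub> q"
    by (rule full[OF P P u'_map]) (rule that)
  obtain v where v: "v \<in> carrier A" "c e = v \<odot>\<^bsub>P\<^esub> e"
    by (rule PA.generated[OF module_map_closed[OF c(1) PA.e_in]]) (rule that)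
  have key: "module_trace (restrict_scalars A P) \<alpha> = module_trace (restrict_scalars A P) (\<lambda>x. \<alpha> (c (u \<odot>\<^bsub>P\<^esub> x)))"
    if \<alpha>: "module_map A P P \<alpha>" for \<alpha>
  proof -
    let ?GF = "G.Fmap (Fo P) (Fo P) (F.Fmap P P \<alpha>)"
    let ?i = "inv_into (carrier P) (eta P)"
    note F\<alpha> = F.map[OF P P \<alpha>]
    have "module_trace (restrict_scalars A (Go (Fo P))) ?GF = module_trace (restrict_scalars A P) \<alpha>"
    proof (rule module_trace_conjugate[where f = "eta P" and g = ?i])
      show "free_finite_rank (restrict_scalars A P)" "free_finite_rank (restrict_scalars A (Go (Fo P)))"
        using lattice_overD(2)[OF latP] lattice_overD(2)[OF latGQ] by auto
      show "module_map type_ring (restrict_scalars A P) (restrict_scalars A (Go (Fo P))) (eta P)"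
        "module_map type_ring (restrict_scalars A P) (restrict_scalars A P) \<alpha>"
        by (intro A.module_map_restrict_scalars eta_map P \<alpha>)+
      show "module_map type_ring (restrict_scalars A (Go (Fo P))) (restrict_scalars A P) ?i"
        by (intro A.module_map_restrict_scalars module_map_inverse eta_map eta_bij P)
      show "?i (eta P x) = x" if "x \<in> carrier (restrict_scalars A P)" for x
        using eta_bij[OF P] that by (auto simp: bij_betw_def)
      fix y assume "y \<in> carrier (restrict_scalars A (Go (Fo P)))"
      then obtain x where x: "x \<in> carrier P" "y = eta P x"
        using eta_bij[OF P] by (auto simp: bij_betw_def)
      then have "?i y = x" using eta_bij[OF P] by (auto simp: bij_betw_def)
      then show "?GF y = eta P (\<alpha> (?i y))"
        using eta_natural[OF P P \<alpha> x(1)] x by simp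
    qed
    then have "lam' * module_trace (restrict_scalars A P) \<alpha> =
        lam * module_trace (restrict_scalars B (Fo P)) (\<lambda>q. F.Fmap P P \<alpha> (u' \<odot>\<^bsub>Fo P\<^esub> q))"
      using tr'[OF latQ F\<alpha>] by simp
    also have "module_trace (restrict_scalars B (Fo P)) (\<lambda>q. F.Fmap P P \<alpha> (u' \<odot>\<^bsub>Fo P\<^esub> q)) =
        module_trace (restrict_scalars B (Fo P)) (F.Fmap P P (\<lambda>x. \<alpha> (c x)))"
      by (rule module_trace_cong[OF lattice_overD(2)[OF latQ]])
        (simp add: F.map_compose[OF P P P c(1) \<alpha>] c(2))
    also have "lam * \<dots> = lam' * module_trace (restrict_scalars A P) (\<lambda>x. \<alpha> (c (u \<odot>\<^bsub>P\<^esub> x)))"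
      by (rule tr[OF latP module_map_compose[OF c(1) \<alpha>]])
    finally show ?thesis using lam'_nz by simp
  qed
  have "u \<otimes>\<^bsub>A\<^esub> v = \<one>\<^bsub>A\<^esub>"
  proof (rule SA.form_nondegenerate)
    fix b assume b: "b \<in> carrier A"
    have be: "b \<odot>\<^bsub>P\<^esub> e \<in> carrier P" using b PA.e_in by (rule PA.P.smult_closed)
    let ?\<alpha> = "PA.extend P (b \<odot>\<^bsub>P\<^esub> e)"
    note \<alpha> = PA.extend_module_map[OF P be]
    have "module_trace (restrict_scalars A P) ?\<alpha> = lam * SA.s b"
      by (rule SA.trace_generator[OF \<alpha> b]) (rule PA.extend_e[OF P be])
    moreover have "module_trace (restrict_scalars A P) (\<lambda>x. ?\<alpha> (c (u \<odot>\<^bsub>P\<^esub> x))) = lam * SA.s (u \<otimes>\<^bsub>A\<^esub> v \<otimes>\<^bsub>A\<^esub> b)"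
    proof (rule SA.trace_generator)
      show "module_map A P P (\<lambda>x. ?\<alpha> (c (u \<odot>\<^bsub>P\<^esub> x)))"
        by (rule module_map_compose[OF module_map_compose[OF A.module_map_central[OF P u] c(1)] \<alpha>])
      have "c (u \<odot>\<^bsub>P\<^esub> e) = (u \<otimes>\<^bsub>A\<^esub> v) \<odot>\<^bsub>P\<^esub> e"
        using u(1) v PA.e_in by (simp add: module_map_smult[OF c(1)] PA.P.smult_assoc)
      then have "?\<alpha> (c (u \<odot>\<^bsub>P\<^esub> e)) = (u \<otimes>\<^bsub>A\<^esub> v) \<odot>\<^bsub>P\<^esub> (b \<odot>\<^bsub>P\<^esub> e)"
        using u(1) v(1) by simp
      then show "?\<alpha> (c (u \<odot>\<^bsub>P\<^esub> e)) = (u \<otimes>\<^bsub>A\<^esub> v \<otimes>\<^bsub>A\<^esub> b) \<odot>\<^bsub>P\<^esub> e"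
        using u(1) v(1) b PA.e_in by (simp add: PA.P.smult_assoc)
    qed (use u v b in auto)
    ultimately have "SA.s b = SA.s (u \<otimes>\<^bsub>A\<^esub> v \<otimes>\<^bsub>A\<^esub> b)"
      using key[OF \<alpha>] lam_nz by simp
    then show "SA.s (u \<otimes>\<^bsub>A\<^esub> v \<otimes>\<^bsub>A\<^esub> b) = SA.s (\<one>\<^bsub>A\<^esub> \<otimes>\<^bsub>A\<^esub> b)" using b by simp
  qed (use u v in auto)
  then show ?thesis
    using u(2)[OF v(1)] by (intro that[OF u(1) v(1) _ _ u(2) tr]) simp_all
qed

end

section \<open>Extension of scalars to the field of fractions\<close>

locale tensor =
  fixes M :: "('o::idom, 'm) module"
  assumes M_module: "left_module type_ring M"
begin

sublocale M: left_module type_ring M by (rule M_module)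

text \<open>
  Equality of the elements of the tensor product that two formal sums represent.
\<close>

definition eqv :: "('o fract \<times> 'm \<Rightarrow>\<^sub>0 int) \<Rightarrow> ('o fract \<times> 'm \<Rightarrow>\<^sub>0 int) \<Rightarrow> bool" where
  "eqv f g \<longleftrightarrow> f - g \<in> tensor_kernel M"

lemma relator_cases [consumes 1, case_names scalar vector move]:
  assumes "r \<in> tensor_relators M"
  obtains a b x where "x \<in> carrier M" "r = frag_of (a + b, x) - frag_of (a, x) - frag_of (b, x)"
  | a x y where "x \<in> carrier M" "y \<in> carrier M" "r = frag_of (a, x \<oplus>\<^bsub>M\<^esub> y) - frag_of (a, x) - frag_of (a, y)"
  | a s x where "x \<in> carrier M" "r = frag_of (a * Fract s 1, x) - frag_of (a, s \<odot>\<^bsub>M\<^esub> x)"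
  using assms unfolding tensor_relators_def by blast

lemma relators_keys: "f \<in> tensor_relators M \<Longrightarrow> Poly_Mapping.keys f \<subseteq> UNIV \<times> carrier M"
  unfolding tensor_relators_def
  by (auto dest!: subsetD[OF keys_diff] simp: M.smult_closed)

lemma kernel_subgroup: "subgroup (tensor_kernel M) (tensor_free M)"
  unfolding tensor_kernel_def tensor_free_def
  by (rule group.generate_is_subgroup) (auto dest: relators_keys)

lemma kernel_keys: "f \<in> tensor_kernel M \<Longrightarrow> Poly_Mapping.keys f \<subseteq> UNIV \<times> carrier M"
  using subsetD[OF subgroup.subset[OF kernel_subgroup], of f] by (simp add: tensor_free_def)

lemma kernel_zero: "0 \<in> tensor_kernel M"
  using subgroup.one_closed[OF kernel_subgroup] by (simp add: tensor_free_def)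

lemma kernel_add: "\<lbrakk>f \<in> tensor_kernel M; g \<in> tensor_kernel M\<rbrakk> \<Longrightarrow> f + g \<in> tensor_kernel M"
  using subgroup.m_closed[OF kernel_subgroup] by (simp add: tensor_free_def)

lemma kernel_minus: "f \<in> tensor_kernel M \<Longrightarrow> - f \<in> tensor_kernel M"
  using subgroup.m_inv_closed[OF kernel_subgroup, of f] kernel_keys[of f] by (simp add: tensor_free_def)

lemma kernel_diff: "\<lbrakk>f \<in> tensor_kernel M; g \<in> tensor_kernel M\<rbrakk> \<Longrightarrow> f - g \<in> tensor_kernel M"
  using kernel_add[OF _ kernel_minus, of f g] by simp

lemma kernel_relator: "f \<in> tensor_relators M \<Longrightarrow> f \<in> tensor_kernel M"
  unfolding tensor_kernel_def by (rule generate.incl)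

lemma kernel_induct [consumes 1, case_names zero relator add minus]:
  assumes "f \<in> tensor_kernel M" "Q 0" "\<And>r. r \<in> tensor_relators M \<Longrightarrow> Q r"
    "\<And>f g. \<lbrakk>Q f; Q g\<rbrakk> \<Longrightarrow> Q (f + g)" "\<And>f. Q f \<Longrightarrow> Q (- f)"
  shows "Q f"
  using assms(1) unfolding tensor_kernel_def
proof induction
  case (inv h)
  then show ?case using assms(3,5) relators_keys[of h] by (simp add: tensor_free_def)
qed (use assms in \<open>auto simp: tensor_free_def\<close>)

lemma coset_def: "tensor_coset M f = {n + f | n. n \<in> tensor_kernel M}"
  by (auto simp: tensor_coset_def r_coset_def tensor_free_def)

lemma coset_eq_iff: "tensor_coset M f = tensor_coset M g \<longleftrightarrow> eqv f g"
proof
  assume "tensor_coset M f = tensor_coset M g"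
  then have "0 + f \<in> tensor_coset M g" using kernel_zero unfolding coset_def by blast
  then show "eqv f g" unfolding coset_def eqv_def by auto
next
  have *: "tensor_coset M f \<subseteq> tensor_coset M g" if "eqv f g" for f g
  proof
    fix x assume "x \<in> tensor_coset M f"
    then obtain n where n: "n \<in> tensor_kernel M" "x = n + f" unfolding coset_def by auto
    then have "x = (n + (f - g)) + g" by simp
    then show "x \<in> tensor_coset M g"
      using kernel_add[OF n(1) that[unfolded eqv_def]] unfolding coset_def by blast
  qed
  assume f: "eqv f g"
  then have "eqv g f" unfolding eqv_def using kernel_minus[of "f - g"] by simp
  with f show "tensor_coset M f = tensor_coset M g" using * by auto
qed

lemma coset_member: "f' \<in> tensor_coset M f \<longleftrightarrow> eqv f' f"
  unfolding coset_def eqv_def by (auto intro: exI[of _ "f' - f"])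

lemma eqv_refl: "eqv f f"
  by (simp add: eqv_def kernel_zero)

lemma eqv_sym: "eqv f g \<Longrightarrow> eqv g f"
  and eqv_trans: "\<lbrakk>eqv f g; eqv g h\<rbrakk> \<Longrightarrow> eqv f h"
  by (simp_all flip: coset_eq_iff)

lemma eqv_diff:
  assumes "eqv f f'" "eqv g g'" shows "eqv (f - g) (f' - g')"
proof -
  have "(f - g) - (f' - g') = (f - f') - (g - g')" by simp
  then show ?thesis using kernel_diff assms unfolding eqv_def by metis
qed

lemma eqv_add:
  assumes "eqv f f'" "eqv g g'" shows "eqv (f + g) (f' + g')"
proof -
  have "(f + g) - (f' + g') = (f - f') + (g - g')" by simp
  then show ?thesis using kernel_add assms unfolding eqv_def by metis
qed

lemma eqv_add_scalar: "m \<in> carrier M \<Longrightarrow> eqv (frag_of (k + l, m)) (frag_of (k, m) + frag_of (l, m))"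
  unfolding eqv_def diff_diff_add[symmetric]
  by (rule kernel_relator) (auto simp: tensor_relators_def)

lemma eqv_add_vector: "\<lbrakk>m \<in> carrier M; n \<in> carrier M\<rbrakk> \<Longrightarrow>
    eqv (frag_of (k, m \<oplus>\<^bsub>M\<^esub> n)) (frag_of (k, m) + frag_of (k, n))"
  unfolding eqv_def diff_diff_add[symmetric]
  by (rule kernel_relator) (unfold tensor_relators_def, blast)

lemma eqv_move: "m \<in> carrier M \<Longrightarrow> eqv (frag_of (k * Fract r 1, m)) (frag_of (k, r \<odot>\<^bsub>M\<^esub> m))"
  unfolding eqv_def by (rule kernel_relator) (unfold tensor_relators_def, blast)

lemma eqv_zero: "eqv (frag_of (k, \<zero>\<^bsub>M\<^esub>)) 0"
proof -
  have "eqv (frag_of (k, \<zero>\<^bsub>M\<^esub>)) (frag_of (k, \<zero>\<^bsub>M\<^esub>) + frag_of (k, \<zero>\<^bsub>M\<^esub>))"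
    using eqv_add_vector[of "\<zero>\<^bsub>M\<^esub>" "\<zero>\<^bsub>M\<^esub>" k] by simp
  then show ?thesis
    unfolding eqv_def using kernel_minus by force
qed

lemma eqv_minus_vector:
  assumes "m \<in> carrier M" "n \<in> carrier M"
  shows "eqv (frag_of (k, m \<ominus>\<^bsub>M\<^esub> n)) (frag_of (k, m) - frag_of (k, n))"
proof -
  have "m = (m \<ominus>\<^bsub>M\<^esub> n) \<oplus>\<^bsub>M\<^esub> n"
    using assms by (simp add: a_minus_def M.M.a_assoc M.M.l_neg)
  then have "eqv (frag_of (k, m)) (frag_of (k, m \<ominus>\<^bsub>M\<^esub> n) + frag_of (k, n))"
    using eqv_add_vector[of "m \<ominus>\<^bsub>M\<^esub> n" n k] assms by simp
  then have "eqv (frag_of (k, m) - frag_of (k, n)) (frag_of (k, m \<ominus>\<^bsub>M\<^esub> n) + frag_of (k, n) - frag_of (k, n))"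
    by (rule eqv_diff[OF _ eqv_refl])
  then show ?thesis by (simp add: eqv_sym)
qed

lemma Fract_expand: "d \<noteq> 0 \<Longrightarrow> d' \<noteq> 0 \<Longrightarrow> Fract 1 d = Fract 1 (d * d') * Fract (d' :: 'o) 1"
  by (simp add: eq_fract)

lemma eqv_expand:
  assumes "m \<in> carrier M" "d \<noteq> 0" "d' \<noteq> 0"
  shows "eqv (frag_of (Fract 1 d, m)) (frag_of (Fract 1 (d * d'), d' \<odot>\<^bsub>M\<^esub> m))"
  unfolding Fract_expand[OF assms(2,3)] by (rule eqv_move[OF assms(1)])

text \<open>
  Any element of the tensor product can be brought over a common denominator.
\<close>

lemma eqv_fraction:
  assumes "Poly_Mapping.keys f \<subseteq> UNIV \<times> carrier M"
  shows "\<exists>d m. d \<noteq> 0 \<and> m \<in> carrier M \<and> eqv f (frag_of (Fract 1 d, m))"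
  using assms
proof (induction f rule: frag_induction)
  case zero
  show ?case using eqv_sym[OF eqv_zero] by (intro exI[of _ 1] exI[of _ "\<zero>\<^bsub>M\<^esub>"]) auto
next
  case (diff x y)
  then obtain d m d' m' where *: "d \<noteq> 0" "m \<in> carrier M" "eqv x (frag_of (Fract 1 d, m))"
    "d' \<noteq> 0" "m' \<in> carrier M" "eqv y (frag_of (Fract 1 d', m'))" by blast
  have cl: "d' \<odot>\<^bsub>M\<^esub> m \<in> carrier M" "d \<odot>\<^bsub>M\<^esub> m' \<in> carrier M" using * by (auto intro: M.smult_closed)
  have "eqv x (frag_of (Fract 1 (d * d'), d' \<odot>\<^bsub>M\<^esub> m))"
    using eqv_trans[OF *(3) eqv_expand] * by auto
  moreover have "eqv y (frag_of (Fract 1 (d * d'), d \<odot>\<^bsub>M\<^esub> m'))"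
    using eqv_trans[OF *(6) eqv_expand[of m' d' d]] * by (auto simp: mult.commute)
  ultimately have "eqv (x - y) (frag_of (Fract 1 (d * d'), d' \<odot>\<^bsub>M\<^esub> m \<ominus>\<^bsub>M\<^esub> d \<odot>\<^bsub>M\<^esub> m'))"
    by (intro eqv_trans[OF eqv_diff eqv_sym[OF eqv_minus_vector[OF cl]]])
  then show ?case using * cl by (intro exI[of _ "d * d'"] exI[of _ "d' \<odot>\<^bsub>M\<^esub> m \<ominus>\<^bsub>M\<^esub> d \<odot>\<^bsub>M\<^esub> m'"]) auto
next
  case (one x)
  then obtain k m where x: "x = (k, m)" "m \<in> carrier M" by auto
  obtain a b where k: "k = Fract a b" "b \<noteq> 0" by (cases k) auto
  have "eqv (frag_of x) (frag_of (Fract 1 b, a \<odot>\<^bsub>M\<^esub> m))"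
    using eqv_move[OF x(2), of "Fract 1 b" a] by (simp add: x(1) k(1))
  then show ?case using k x M.smult_closed[of a m] by auto
qed

definition pure :: "'o fract \<Rightarrow> 'm \<Rightarrow> ('o, 'm) tens" where
  "pure k m = tensor_coset M (frag_of (k, m))"

lemma tensor_comm_group: "comm_group (tensor_group M)"
  unfolding tensor_group_def
  by (rule comm_group.abelian_FactGroup) (use kernel_subgroup in \<open>auto simp: tensor_free_def abelian_free_Abelian_group\<close>)

lemma carrier_tensor_group: "carrier (tensor_group M) = tensor_coset M ` {f. Poly_Mapping.keys f \<subseteq> UNIV \<times> carrier M}"
  unfolding tensor_group_def carrier_FactGroup tensor_coset_def
  by (auto simp: tensor_free_def)

lemma pure_closed: "m \<in> carrier M \<Longrightarrow> pure k m \<in> carrier (tensor_group M)"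
  by (auto simp: carrier_tensor_group pure_def)

lemma pure_cases:
  assumes "x \<in> carrier (tensor_group M)"
  obtains d m where "d \<noteq> 0" "m \<in> carrier M" "x = pure (Fract 1 d) m"
proof -
  obtain f where f: "x = tensor_coset M f" "Poly_Mapping.keys f \<subseteq> UNIV \<times> carrier M"
    using assms unfolding carrier_tensor_group by auto
  obtain d m where "d \<noteq> 0" "m \<in> carrier M" "eqv f (frag_of (Fract 1 d, m))"
    using eqv_fraction[OF f(2)] by blast
  then show ?thesis using that f(1) by (simp add: pure_def coset_eq_iff)
qed

lemma pure_expand: "\<lbrakk>m \<in> carrier M; d \<noteq> 0; d' \<noteq> 0\<rbrakk> \<Longrightarrow> pure (Fract 1 d) m = pure (Fract 1 (d * d')) (d' \<odot>\<^bsub>M\<^esub> m)"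
  unfolding pure_def coset_eq_iff by (rule eqv_expand)

lemma pure_cases2:
  assumes "x \<in> carrier (tensor_group M)" "y \<in> carrier (tensor_group M)"
  obtains d m n where "d \<noteq> 0" "m \<in> carrier M" "n \<in> carrier M" "x = pure (Fract 1 d) m" "y = pure (Fract 1 d) n"
proof -
  obtain d m where x: "d \<noteq> 0" "m \<in> carrier M" "x = pure (Fract 1 d) m" using pure_cases[OF assms(1)] .
  obtain d' n where y: "d' \<noteq> 0" "n \<in> carrier M" "y = pure (Fract 1 d') n" using pure_cases[OF assms(2)] .
  show ?thesis
  proof (rule that)
    show "d * d' \<noteq> 0" using x y by simp
    show "d' \<odot>\<^bsub>M\<^esub> m \<in> carrier M" "d \<odot>\<^bsub>M\<^esub> n \<in> carrier M" using x y by (auto intro: M.smult_closed)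
    show "x = pure (Fract 1 (d * d')) (d' \<odot>\<^bsub>M\<^esub> m)" using x y pure_expand[of m d d'] by simp
    show "y = pure (Fract 1 (d * d')) (d \<odot>\<^bsub>M\<^esub> n)" using x y pure_expand[of n d' d] by (simp add: mult.commute)
  qed
qed

lemma coset_add: "tensor_coset M f \<otimes>\<^bsub>tensor_group M\<^esub> tensor_coset M g = tensor_coset M (f + g)"
proof -
  have "\<exists>h\<in>tensor_coset M f. \<exists>k\<in>tensor_coset M g. x = h + k" if "eqv x (f + g)" for x
  proof (intro bexI)
    show "x = (x - g) + g" by simp
    show "x - g \<in> tensor_coset M f"
      using that by (simp add: coset_member eqv_def diff_diff_add add.commute)
  qed (simp add: coset_member eqv_refl)
  then show ?thesis
    unfolding tensor_group_def mult_FactGroup set_mult_def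
    by (auto simp: coset_member tensor_free_def eqv_add)
qed

lemma pure_add_vector: "\<lbrakk>m \<in> carrier M; n \<in> carrier M\<rbrakk> \<Longrightarrow>
    pure k (m \<oplus>\<^bsub>M\<^esub> n) = pure k m \<otimes>\<^bsub>tensor_group M\<^esub> pure k n"
  unfolding pure_def coset_add coset_eq_iff by (rule eqv_add_vector)

lemma pure_zero: "pure k \<zero>\<^bsub>M\<^esub> = \<one>\<^bsub>tensor_group M\<^esub>"
proof -
  have "\<one>\<^bsub>tensor_group M\<^esub> = tensor_coset M 0"
    by (auto simp: tensor_group_def coset_def)
  then show ?thesis
    unfolding pure_def by (simp add: coset_eq_iff eqv_zero)
qed

text \<open>
  Well-definedness of a map on the tensor product has to be verified on the generating relations only.
\<close>

lemma frag_extend_kernel: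
  assumes "f \<in> tensor_kernel M" "\<And>r. r \<in> tensor_relators M \<Longrightarrow> frag_extend b r \<in> tensor_kernel M'"
    "left_module type_ring M'"
  shows "frag_extend b f \<in> tensor_kernel M'"
proof -
  interpret M': tensor M' by (rule tensor.intro[OF assms(3)])
  show ?thesis
    using assms(1)
    by (induction rule: kernel_induct)
      (auto simp: assms(2) frag_extend_add frag_extend_minus M'.kernel_zero M'.kernel_add M'.kernel_minus)
qed

text \<open>
  A functional on \<open>M\<close> extends to the tensor product with values in the field of fractions. The
  extension exists on formal sums by the universal property of the free abelian group, and it vanishes
  on the relations.
\<close>

lemma pure_eq_functional:
  assumes "functional M \<phi>" "pure k m = pure l n" "m \<in> carrier M" "n \<in> carrier M"
  shows "k * Fract (\<phi> m) 1 = l * Fract (\<phi> n) 1"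
proof -
  let ?G = "\<lparr>carrier = UNIV :: 'o fract set, monoid.mult = (+), one = 0\<rparr>"
  interpret G: comm_group ?G
  proof (rule comm_groupI)
    show "\<exists>y\<in>carrier ?G. y \<otimes>\<^bsub>?G\<^esub> x = \<one>\<^bsub>?G\<^esub>" for x
      by (auto intro: exI[of _ "- x"])
  qed (auto simp: algebra_simps)
  let ?S = "UNIV \<times> carrier M"
  obtain h where h: "h \<in> hom (free_Abelian_group ?S) ?G"
    "\<And>x. x \<in> ?S \<Longrightarrow> h (frag_of x) = (case x of (k, m) \<Rightarrow> k * Fract (\<phi> m) 1)"
    using G.free_Abelian_group_universal[of "\<lambda>(k, m). k * Fract (\<phi> m) 1" ?S] by auto
  have plus: "h (f + g) = h f + h g" if "Poly_Mapping.keys f \<subseteq> ?S" "Poly_Mapping.keys g \<subseteq> ?S" for f g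
    using h(1) that by (auto simp: hom_def)
  have sub: "h (f - g) = h f - h g" if "Poly_Mapping.keys f \<subseteq> ?S" "Poly_Mapping.keys g \<subseteq> ?S" for f g
    using plus[of "f - g" g] that keys_diff[of f g] by (simp add: le_sup_iff subset_trans[OF keys_diff])
  have kd: "Poly_Mapping.keys (f - g) \<subseteq> ?S" if "Poly_Mapping.keys f \<subseteq> ?S" "Poly_Mapping.keys g \<subseteq> ?S" for f g
    using that keys_diff[of f g] by blast
  have kp: "Poly_Mapping.keys (f + g) \<subseteq> ?S" if "Poly_Mapping.keys f \<subseteq> ?S" "Poly_Mapping.keys g \<subseteq> ?S" for f g
    using that keys_add[of f g] by blast
  have rel: "h r = 0" if "r \<in> tensor_relators M" for r
  proof -
    note F = functional_add[OF assms(1)] functional_smult[OF assms(1)]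
    have Fr: "Fract (x + y) 1 = Fract x 1 + Fract (y :: 'o) 1" for x y by simp
    from that show ?thesis
    proof (cases rule: relator_cases)
      case (scalar c b x)
      have "h r = h (frag_of (c + b, x)) - h (frag_of (c, x)) - h (frag_of (b, x))"
        using scalar(1) by (simp add: scalar(2) sub plus kd kp)
      then show ?thesis using scalar(1) by (simp add: h(2) distrib_right)
    next
      case (vector c x y)
      have "h r = h (frag_of (c, x \<oplus>\<^bsub>M\<^esub> y)) - h (frag_of (c, x)) - h (frag_of (c, y))"
        using vector(1,2) by (simp add: vector(3) sub plus kd kp)
      then show ?thesis using vector(1,2) by (simp add: h(2) F Fr distrib_left del: add_fract)
    next
      case (move c s x)
      then show ?thesis by (simp add: h(2) F sub M.smult_closed mult.assoc)
    qed
  qed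
  have h0: "h 0 = 0"
    using hom_one[OF h(1) group_free_Abelian_group G.is_group] by simp
  have "Poly_Mapping.keys f \<subseteq> ?S \<and> h f = 0" if "f \<in> tensor_kernel M" for f
    using that
  proof (induction rule: kernel_induct)
    case zero
    then show ?case using h0 by simp
  next
    case (relator r)
    then show ?case using rel relators_keys by auto
  next
    case (add f g)
    then show ?case using plus[of f g] keys_add[of f g] by auto
  next
    case (minus f)
    then show ?case using sub[of 0 f] h0 by auto
  qed
  then have "h (frag_of (k, m) - frag_of (l, n)) = 0"
    using assms(2) unfolding pure_def coset_eq_iff eqv_def by blast
  then show ?thesis using assms by (simp add: sub h(2))
qed

text \<open>
  For a free module the coordinate functions separate the elements of the tensor product, so
  \<open>M\<close> embeds into it.
\<close>

lemma pure_eq_free: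
  assumes M: "free_finite_rank M" and "m \<in> carrier M" "n \<in> carrier M"
    and eq: "pure (Fract a b) m = pure (Fract c d) n" and "b \<noteq> 0" "d \<noteq> 0"
  shows "(a * d) \<odot>\<^bsub>M\<^esub> m = (c * b) \<odot>\<^bsub>M\<^esub> n"
proof (rule coordinates_eqI[OF some_basis[OF M] _ _ _ M_module])
  fix x assume x: "x \<in> some_basis M"
  note F = functional_coordinates[OF M_module some_basis[OF M] x]
  have "Fract (a * coordinates M (some_basis M) m x) b = Fract (c * coordinates M (some_basis M) n x) d"
    using pure_eq_functional[OF F eq assms(2,3)] by simp
  then show "coordinates M (some_basis M) ((a * d) \<odot>\<^bsub>M\<^esub> m) x = coordinates M (some_basis M) ((c * b) \<odot>\<^bsub>M\<^esub> n) x"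
    using assms by (simp add: functional_smult[OF F] eq_fract algebra_simps)
qed (use assms in \<open>auto intro: M.smult_closed\<close>)

text \<open>
  The union over representatives that defines the operation is the union of a single coset.
\<close>

lemma scale_pure:
  assumes m: "m \<in> carrier M"
  shows "tensor_scale M k (pure l m) = pure (k * l) m"
proof -
  let ?h = "frag_extend (\<lambda>(l, m). frag_of (k * l, m))"
  have ker: "?h f \<in> tensor_kernel M" if "f \<in> tensor_kernel M" for f
  proof (rule frag_extend_kernel[OF that _ M_module])
    fix r assume "r \<in> tensor_relators M"
    then show "?h r \<in> tensor_kernel M"
    proof (cases rule: relator_cases)
      case (scalar c b x)
      then show ?thesis using eqv_add_scalar[OF scalar(1), of "k * c" "k * b"]
        by (simp add: frag_extend_diff frag_extend_add eqv_def distrib_left diff_diff_add)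
    next
      case (vector c x y)
      then show ?thesis using eqv_add_vector[OF vector(1,2), of "k * c"]
        by (simp add: frag_extend_diff frag_extend_add eqv_def diff_diff_add)
    next
      case (move c s x)
      then show ?thesis using eqv_move[OF move(1), of "k * c"]
        by (simp add: frag_extend_diff frag_extend_add eqv_def mult.assoc)
    qed
  qed
  have "tensor_coset M (?h f) = pure (k * l) m" if "f \<in> pure l m" for f
  proof -
    have "f - frag_of (l, m) \<in> tensor_kernel M" using that by (simp add: pure_def coset_member eqv_def)
    then have "?h (f - frag_of (l, m)) \<in> tensor_kernel M" by (rule ker)
    then show ?thesis unfolding pure_def coset_eq_iff eqv_def by (simp add: frag_extend_diff)
  qed
  moreover have "frag_of (l, m) \<in> pure l m" by (simp add: pure_def coset_member eqv_refl)
  ultimately show ?thesis unfolding tensor_scale_def by blast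
qed

lemma abelian_group_tensor:
  assumes "carrier T = carrier (tensor_group M)" "ring.zero T = one (tensor_group M)"
    "add T = monoid.mult (tensor_group M)"
  shows "abelian_group T"
proof -
  interpret G: comm_group "tensor_group M" by (rule tensor_comm_group)
  show ?thesis
  proof (rule abelian_groupI)
    show "\<exists>y\<in>carrier T. y \<oplus>\<^bsub>T\<^esub> x = \<zero>\<^bsub>T\<^esub>" if "x \<in> carrier T" for x
      using that G.l_inv[of x] by (auto simp: assms intro!: bexI[of _ "inv\<^bsub>tensor_group M\<^esub> x"])
  qed (auto simp: assms G.m_ac)
qed

end

text \<open>
  Covers both the multiplication of an algebra and its action on a module.
\<close>

locale tensor_bilinear = A: tensor A + M: tensor M
  for A :: "('o::idom, 'a) module" and M :: "('o, 'm) module" +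
  fixes act :: "'a \<Rightarrow> 'm \<Rightarrow> 'm"
  assumes act_closed: "\<lbrakk>a \<in> carrier A; m \<in> carrier M\<rbrakk> \<Longrightarrow> act a m \<in> carrier M"
    and act_add_left: "\<lbrakk>a \<in> carrier A; b \<in> carrier A; m \<in> carrier M\<rbrakk> \<Longrightarrow>
      act (a \<oplus>\<^bsub>A\<^esub> b) m = act a m \<oplus>\<^bsub>M\<^esub> act b m"
    and act_add_right: "\<lbrakk>a \<in> carrier A; m \<in> carrier M; n \<in> carrier M\<rbrakk> \<Longrightarrow>
      act a (m \<oplus>\<^bsub>M\<^esub> n) = act a m \<oplus>\<^bsub>M\<^esub> act a n"
    and act_smult_left: "\<lbrakk>a \<in> carrier A; m \<in> carrier M\<rbrakk> \<Longrightarrow> act (r \<odot>\<^bsub>A\<^esub> a) m = r \<odot>\<^bsub>M\<^esub> act a m"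
    and act_smult_right: "\<lbrakk>a \<in> carrier A; m \<in> carrier M\<rbrakk> \<Longrightarrow> act a (r \<odot>\<^bsub>M\<^esub> m) = r \<odot>\<^bsub>M\<^esub> act a m"
begin

lemma inner_kernel:
  assumes a: "a \<in> carrier A" and f: "f \<in> tensor_kernel M"
  shows "frag_extend (\<lambda>(l, m). frag_of (k * l, act a m)) f \<in> tensor_kernel M"
proof (rule M.frag_extend_kernel[OF f _ M.M_module])
  fix r assume "r \<in> tensor_relators M"
  then show "frag_extend (\<lambda>(l, m). frag_of (k * l, act a m)) r \<in> tensor_kernel M"
  proof (cases rule: M.relator_cases)
    case (scalar c b x)
    then show ?thesis using M.eqv_add_scalar[OF act_closed[OF a scalar(1)], of "k * c" "k * b"]
      by (simp add: frag_extend_diff frag_extend_add M.eqv_def distrib_left diff_diff_add)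
  next
    case (vector c x y)
    then show ?thesis using M.eqv_add_vector[OF act_closed[OF a vector(1)] act_closed[OF a vector(2)], of "k * c"]
      by (simp add: frag_extend_diff frag_extend_add M.eqv_def diff_diff_add act_add_right[OF a])
  next
    case (move c s x)
    then show ?thesis using M.eqv_move[OF act_closed[OF a move(1)], of "k * c"]
      by (simp add: frag_extend_diff frag_extend_add M.eqv_def mult.assoc act_smult_right[OF a])
  qed
qed

lemma outer_kernel:
  assumes f: "f \<in> tensor_kernel A" and g: "Poly_Mapping.keys g \<subseteq> UNIV \<times> carrier M"
  shows "frag_extend (\<lambda>(k, a). frag_extend (\<lambda>(l, m). frag_of (k * l, act a m)) g) f \<in> tensor_kernel M"
proof (rule A.frag_extend_kernel[OF f _ M.M_module])
  let ?I = "\<lambda>k a. frag_extend (\<lambda>(l, m). frag_of (k * l, act a m))"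
  have ind: "D g \<in> tensor_kernel M"
    if "\<And>x y. D (x - y) = D x - D y" "D 0 = 0" "\<And>l m. m \<in> carrier M \<Longrightarrow> D (frag_of (l, m)) \<in> tensor_kernel M"
    for D :: "_ \<Rightarrow> ('o fract \<times> 'm \<Rightarrow>\<^sub>0 int)"
    using g by (induction g rule: frag_induction) (auto simp: that M.kernel_zero M.kernel_diff)
  fix r assume "r \<in> tensor_relators A"
  then show "frag_extend (\<lambda>(k, a). ?I k a g) r \<in> tensor_kernel M"
  proof (cases rule: A.relator_cases)
    case (scalar c b x)
    have "?I (c + b) x g - ?I c x g - ?I b x g \<in> tensor_kernel M"
    proof (rule ind)
      fix l m assume "m \<in> carrier M"
      then show "?I (c + b) x (frag_of (l, m)) - ?I c x (frag_of (l, m)) - ?I b x (frag_of (l, m)) \<in> tensor_kernel M"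
        using M.eqv_add_scalar[OF act_closed[OF scalar(1)], of m "c * l" "b * l"]
        by (simp add: M.eqv_def distrib_right diff_diff_add)
    qed (auto simp: frag_extend_diff)
    then show ?thesis using scalar by (simp add: frag_extend_diff)
  next
    case (vector c x y)
    have "?I c (x \<oplus>\<^bsub>A\<^esub> y) g - ?I c x g - ?I c y g \<in> tensor_kernel M"
    proof (rule ind)
      fix l m assume "m \<in> carrier M"
      then show "?I c (x \<oplus>\<^bsub>A\<^esub> y) (frag_of (l, m)) - ?I c x (frag_of (l, m)) - ?I c y (frag_of (l, m)) \<in> tensor_kernel M"
        using M.eqv_add_vector[OF act_closed[OF vector(1)] act_closed[OF vector(2)], of m m "c * l"] vector
        by (simp add: M.eqv_def diff_diff_add act_add_left)
    qed (auto simp: frag_extend_diff)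
    then show ?thesis using vector by (simp add: frag_extend_diff)
  next
    case (move c s x)
    have "?I (c * Fract s 1) x g - ?I c (s \<odot>\<^bsub>A\<^esub> x) g \<in> tensor_kernel M"
    proof (rule ind)
      fix l m assume "m \<in> carrier M"
      then show "?I (c * Fract s 1) x (frag_of (l, m)) - ?I c (s \<odot>\<^bsub>A\<^esub> x) (frag_of (l, m)) \<in> tensor_kernel M"
        using M.eqv_move[OF act_closed[OF move(1)], of m "c * l" s] move
        by (simp add: M.eqv_def act_smult_left ac_simps)
    qed (auto simp: frag_extend_diff)
    then show ?thesis using move by (simp add: frag_extend_diff)
  qed
qed

text \<open>
  Independence of the representatives is shown for one argument at a time: if \<open>f\<close> is changed by a
  relation while \<open>g\<close> is kept, and then \<open>g\<close> while \<open>f\<close> is a single generator.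
\<close>

lemma act_pure:
  assumes a: "a \<in> carrier A" and m: "m \<in> carrier M"
  shows "tensor_act act M (A.pure k a) (M.pure l m) = M.pure (k * l) (act a m)"
proof -
  let ?I = "\<lambda>k a. frag_extend (\<lambda>(l, m). frag_of (k * l, act a m))"
  let ?B = "\<lambda>f g. frag_extend (\<lambda>(k, a). ?I k a g) f"
  have "tensor_coset M (?B f g) = M.pure (k * l) (act a m)" if f: "f \<in> A.pure k a" and g: "g \<in> M.pure l m" for f g
  proof -
    have f': "f - frag_of (k, a) \<in> tensor_kernel A" using f by (simp add: A.pure_def A.coset_member A.eqv_def)
    have g': "g - frag_of (l, m) \<in> tensor_kernel M" using g by (simp add: M.pure_def M.coset_member M.eqv_def)
    have "Poly_Mapping.keys ((g - frag_of (l, m)) + frag_of (l, m)) \<subseteq> UNIV \<times> carrier M"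
      using M.kernel_keys[OF g'] m by (intro subset_trans[OF keys_add]) auto
    then have gk: "Poly_Mapping.keys g \<subseteq> UNIV \<times> carrier M" by simp
    have "?B (f - frag_of (k, a)) g + ?I k a (g - frag_of (l, m)) \<in> tensor_kernel M"
      by (intro M.kernel_add outer_kernel[OF f' gk] inner_kernel[OF a g'])
    then show ?thesis
      unfolding M.pure_def M.coset_eq_iff M.eqv_def by (simp add: frag_extend_diff)
  qed
  moreover have "frag_of (k, a) \<in> A.pure k a" "frag_of (l, m) \<in> M.pure l m"
    by (simp_all add: A.pure_def A.coset_member A.eqv_refl M.pure_def M.coset_member M.eqv_refl)
  ultimately show ?thesis unfolding tensor_act_def by blast
qed

lemma act_tensor_closed:
  assumes "x \<in> carrier (tensor_group A)" "y \<in> carrier (tensor_group M)"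
  shows "tensor_act act M x y \<in> carrier (tensor_group M)"
  using assms by (elim A.pure_cases M.pure_cases) (auto simp: act_pure act_closed intro!: M.pure_closed)

lemma act_tensor_add_right:
  assumes "x \<in> carrier (tensor_group A)" "y \<in> carrier (tensor_group M)" "z \<in> carrier (tensor_group M)"
  shows "tensor_act act M x (y \<otimes>\<^bsub>tensor_group M\<^esub> z) =
    tensor_act act M x y \<otimes>\<^bsub>tensor_group M\<^esub> tensor_act act M x z"
proof -
  obtain c a where x: "a \<in> carrier A" "x = A.pure (Fract 1 c) a" using A.pure_cases[OF assms(1)] .
  obtain d m n where yz: "m \<in> carrier M" "n \<in> carrier M" "y = M.pure (Fract 1 d) m" "z = M.pure (Fract 1 d) n"
    using M.pure_cases2[OF assms(2,3)] .
  show ?thesis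
    using x yz by (simp add: M.pure_add_vector[symmetric] act_pure act_add_right act_closed)
qed

lemma act_tensor_add_left:
  assumes "x \<in> carrier (tensor_group A)" "y \<in> carrier (tensor_group A)" "z \<in> carrier (tensor_group M)"
  shows "tensor_act act M (x \<otimes>\<^bsub>tensor_group A\<^esub> y) z =
    tensor_act act M x z \<otimes>\<^bsub>tensor_group M\<^esub> tensor_act act M y z"
proof -
  obtain c a b where xy: "a \<in> carrier A" "b \<in> carrier A" "x = A.pure (Fract 1 c) a" "y = A.pure (Fract 1 c) b"
    using A.pure_cases2[OF assms(1,2)] .
  obtain d m where z: "m \<in> carrier M" "z = M.pure (Fract 1 d) m" using M.pure_cases[OF assms(3)] .
  show ?thesis
    using xy z by (simp add: A.pure_add_vector[symmetric] M.pure_add_vector[symmetric] act_pure act_add_left act_closed)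
qed

end

lemma frac_algebra_simps:
  "carrier (frac_algebra A) = carrier (tensor_group A)"
  "monoid.mult (frac_algebra A) = tensor_act (monoid.mult A) A"
  "one (frac_algebra A) = tensor_coset A (frag_of (1, \<one>\<^bsub>A\<^esub>))"
  "ring.zero (frac_algebra A) = one (tensor_group A)"
  "add (frac_algebra A) = monoid.mult (tensor_group A)"
  "Module.module.smult (frac_algebra A) = tensor_scale A"
  by (simp_all add: frac_algebra_def)

lemma frac_module_simps:
  "carrier (frac_module A V) = carrier (tensor_group (restrict_scalars A V))"
  "ring.zero (frac_module A V) = one (tensor_group (restrict_scalars A V))"
  "add (frac_module A V) = monoid.mult (tensor_group (restrict_scalars A V))"
  "Module.module.smult (frac_module A V) = tensor_act (Module.module.smult V) (restrict_scalars A V)"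
  by (simp_all add: frac_module_def Let_def)

lemma fract_one: "(1 :: 'o::idom fract) = Fract 1 1"
  by (simp add: One_fract_def)

locale frac_alg = assoc_alg A for A :: "('o::idom, 'a) module" (structure)
begin

sublocale T: tensor A
  by (rule tensor.intro) (rule S.left_module_axioms)

sublocale TB: tensor_bilinear A A "(\<otimes>)"
  by unfold_locales (auto simp: l_distr r_distr smult_mult mult_smult)

lemma one_frac_algebra: "\<one>\<^bsub>frac_algebra A\<^esub> = T.pure 1 \<one>"
  by (simp add: frac_algebra_simps T.pure_def)

lemma ring_frac_algebra: "ring (frac_algebra A)"
proof (rule ringI)
  show "abelian_group (frac_algebra A)"
    by (rule T.abelian_group_tensor) (simp_all add: frac_algebra_simps)
  show "monoid (frac_algebra A)"
  proof (rule monoidI)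
    fix x y z assume "x \<in> carrier (frac_algebra A)" "y \<in> carrier (frac_algebra A)" "z \<in> carrier (frac_algebra A)"
    then obtain c a d b e f where "a \<in> carrier A" "x = T.pure (Fract 1 c) a" "b \<in> carrier A" "y = T.pure (Fract 1 d) b"
      "f \<in> carrier A" "z = T.pure (Fract 1 e) f"
      unfolding frac_algebra_simps by (elim T.pure_cases) blast
    then show "x \<otimes>\<^bsub>frac_algebra A\<^esub> y \<otimes>\<^bsub>frac_algebra A\<^esub> z = x \<otimes>\<^bsub>frac_algebra A\<^esub> (y \<otimes>\<^bsub>frac_algebra A\<^esub> z)"
      by (simp add: frac_algebra_simps TB.act_pure m_assoc mult.assoc)
  next
    fix x assume "x \<in> carrier (frac_algebra A)"
    then obtain c a where "a \<in> carrier A" "x = T.pure (Fract 1 c) a"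
      unfolding frac_algebra_simps by (elim T.pure_cases) blast
    then show "\<one>\<^bsub>frac_algebra A\<^esub> \<otimes>\<^bsub>frac_algebra A\<^esub> x = x" "x \<otimes>\<^bsub>frac_algebra A\<^esub> \<one>\<^bsub>frac_algebra A\<^esub> = x"
      unfolding one_frac_algebra by (simp_all add: frac_algebra_simps TB.act_pure)
  next
    show "\<one>\<^bsub>frac_algebra A\<^esub> \<in> carrier (frac_algebra A)"
      unfolding one_frac_algebra frac_algebra_simps(1) by (rule T.pure_closed) simp
  qed (simp add: frac_algebra_simps TB.act_tensor_closed)
qed (auto simp: frac_algebra_simps TB.act_tensor_add_left TB.act_tensor_add_right)

lemma tensor_bilinear_module:
  assumes "left_module A V"
  shows "tensor_bilinear A (restrict_scalars A V) (Module.module.smult V)"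
proof -
  interpret V: left_module A V by (rule assms)
  interpret TV: tensor "restrict_scalars A V"
    by (rule tensor.intro) (rule left_module_restrict_scalars[OF assms])
  show ?thesis
    by unfold_locales
      (auto simp: V.smult_closed V.smult_l_distr V.smult_r_distr V.smult_assoc[symmetric] unit_mult mult_unit)
qed

lemma left_module_frac:
  assumes V: "left_module A V"
  shows "left_module (frac_algebra A) (frac_module A V)"
proof -
  interpret V: left_module A V by (rule V)
  interpret TV: tensor_bilinear A "restrict_scalars A V" "Module.module.smult V"
    by (rule tensor_bilinear_module[OF V])
  show ?thesis
  proof (rule left_moduleI[OF ring_frac_algebra])
    show "abelian_group (frac_module A V)"
      by (rule TV.M.abelian_group_tensor) (simp_all add: frac_module_simps)
    fix a b x assume "a \<in> carrier (frac_algebra A)" "b \<in> carrier (frac_algebra A)" "x \<in> carrier (frac_module A V)"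
    then obtain c a' d b' e v where "a' \<in> carrier A" "a = T.pure (Fract 1 c) a'" "b' \<in> carrier A" "b = T.pure (Fract 1 d) b'"
      "v \<in> carrier V" "x = TV.M.pure (Fract 1 e) v"
      unfolding frac_algebra_simps frac_module_simps by (elim T.pure_cases TV.M.pure_cases) auto
    then show "(a \<otimes>\<^bsub>frac_algebra A\<^esub> b) \<odot>\<^bsub>frac_module A V\<^esub> x = a \<odot>\<^bsub>frac_module A V\<^esub> (b \<odot>\<^bsub>frac_module A V\<^esub> x)"
      by (simp add: frac_algebra_simps frac_module_simps TB.act_pure TV.act_pure V.smult_assoc V.smult_closed mult.assoc)
  next
    fix x assume "x \<in> carrier (frac_module A V)"
    then obtain c v where "v \<in> carrier V" "x = TV.M.pure (Fract 1 c) v"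
      unfolding frac_module_simps by (elim TV.M.pure_cases) auto
    then show "\<one>\<^bsub>frac_algebra A\<^esub> \<odot>\<^bsub>frac_module A V\<^esub> x = x"
      unfolding one_frac_algebra by (simp add: frac_module_simps TV.act_pure V.smult_one)
  qed (auto simp: frac_algebra_simps frac_module_simps TV.act_tensor_add_left TV.act_tensor_add_right TV.act_tensor_closed)
qed

end

section \<open>Irreducible lattices\<close>

lemma simple_moduleI_iso:
  assumes V: "simple_module R V" and W: "left_module R W" and f: "module_map R V W f"
    and bij: "bij_betw f (carrier V) (carrier W)"
  shows "simple_module R W"
proof -
  have LV: "left_module R V" and nz: "carrier V \<noteq> {\<zero>\<^bsub>V\<^esub>}"
    and sub: "\<And>N. submodule N R V \<Longrightarrow> N = {\<zero>\<^bsub>V\<^esub>} \<or> N = carrier V"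
    using V by (auto simp: simple_module_def)
  interpret V: left_module R V by (rule LV)
  note g = module_map_inverse[OF LV f bij]
  let ?g = "inv_into (carrier V) f"
  have fg: "f (?g y) = y" if "y \<in> carrier W" for y
    using bij that by (auto simp: bij_betw_def f_inv_into_f)
  have gf: "?g (f x) = x" if "x \<in> carrier V" for x
    using bij that by (auto simp: bij_betw_def)
  show ?thesis
    unfolding simple_module_def
  proof (intro conjI W allI impI)
    show "carrier W \<noteq> {\<zero>\<^bsub>W\<^esub>}"
    proof
      assume W0: "carrier W = {\<zero>\<^bsub>W\<^esub>}"
      have "x = \<zero>\<^bsub>V\<^esub>" if "x \<in> carrier V" for x
        using gf[OF that] gf[OF V.M.zero_closed] module_map_closed[OF f that]
          module_map_closed[OF f V.M.zero_closed] W0 by auto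
      then show False using nz by auto
    qed
    fix N assume N: "submodule N R W"
    note NW = submoduleD(1)[OF N]
    have eq: "N = f ` ?g ` N" using NW fg by (force simp: image_image)
    from sub[OF submodule_image[OF W LV g N]] show "N = {\<zero>\<^bsub>W\<^esub>} \<or> N = carrier W"
    proof
      assume "?g ` N = {\<zero>\<^bsub>V\<^esub>}"
      then show ?thesis using eq module_map_zero[OF LV W f] by auto
    next
      assume "?g ` N = carrier V"
      then show ?thesis using eq bij by (auto simp: bij_betw_def)
    qed
  qed
qed

lemma simple_module_cyclic:
  assumes V: "simple_module R V" and x: "x \<in> carrier V" "x \<noteq> \<zero>\<^bsub>V\<^esub>"
  shows "(\<lambda>a. a \<odot>\<^bsub>V\<^esub> x) ` carrier R = carrier V"
proof -
  have LV: "left_module R V" and sub: "\<And>N. submodule N R V \<Longrightarrow> N = {\<zero>\<^bsub>V\<^esub>} \<or> N = carrier V"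
    using V by (auto simp: simple_module_def)
  interpret V: left_module R V by (rule LV)
  have "submodule ((\<lambda>a. a \<odot>\<^bsub>V\<^esub> x) ` carrier R) R V"
  proof (rule submoduleI[OF LV])
    show "\<zero>\<^bsub>V\<^esub> \<in> (\<lambda>a. a \<odot>\<^bsub>V\<^esub> x) ` carrier R"
      using V.smult_l_zero[OF x(1)] V.R.zero_closed by (metis imageI)
  qed (use x(1) in \<open>auto simp: V.smult_closed V.smult_l_distr[symmetric] V.smult_assoc[symmetric]\<close>)
  moreover have "x \<in> (\<lambda>a. a \<odot>\<^bsub>V\<^esub> x) ` carrier R"
    using V.smult_one[OF x(1)] V.R.one_closed by (metis imageI)
  ultimately show ?thesis using sub x(2) by blast
qed

text \<open>
  The definition of splitting speaks of simple modules whose elements have the type of the algebra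
  elements. A simple module is cyclic, so choosing for each of its elements a preimage in the algebra
  transports it to that type.
\<close>

lemma split_semisimple_scalar:
  fixes V :: "('b, 'v) module" and B :: "('k::comm_ring_1, 'b) module"
  assumes B: "split_semisimple B" and V: "simple_module B V" and \<alpha>: "module_map B V V \<alpha>"
  shows "\<exists>c. \<forall>x\<in>carrier V. \<alpha> x = (c \<odot>\<^bsub>B\<^esub> \<one>\<^bsub>B\<^esub>) \<odot>\<^bsub>V\<^esub> x"
proof -
  have LV: "left_module B V" using V by (simp add: simple_module_def)
  interpret V: left_module B V by (rule LV)
  obtain x0 where x0: "x0 \<in> carrier V" "x0 \<noteq> \<zero>\<^bsub>V\<^esub>"
    using V V.M.zero_closed unfolding simple_module_def by blast
  define \<sigma> where "\<sigma> = inv_into (carrier B) (\<lambda>b. b \<odot>\<^bsub>V\<^esub> x0)"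
  have inj: "inj_on \<sigma> (carrier V)"
    using inj_on_inv_into[of "carrier V" "\<lambda>b. b \<odot>\<^bsub>V\<^esub> x0" "carrier B"] simple_module_cyclic[OF V x0]
    by (simp add: \<sigma>_def)
  define S where "S = transport_module \<sigma> V"
  note S = transport_module[OF LV inj, folded S_def]
  have simple: "simple_module B S" by (rule simple_moduleI_iso[OF V S])
  note g = module_map_inverse[OF LV S(2,3)]
  let ?g = "inv_into (carrier V) \<sigma>"
  have "restrict (\<lambda>s. \<sigma> (\<alpha> (?g s))) (carrier S) \<in> module_Hom B S S"
    using module_map_compose[OF module_map_compose[OF g \<alpha>] S(2)] S(1) by (simp add: module_Hom_iff)
  moreover have "\<forall>\<phi>\<in>module_Hom B S S. \<exists>c. \<forall>x\<in>carrier S. \<phi> x = (c \<odot>\<^bsub>B\<^esub> \<one>\<^bsub>B\<^esub>) \<odot>\<^bsub>S\<^esub> x"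
    using B simple by (simp add: split_semisimple_def)
  ultimately have "\<exists>c. \<forall>x\<in>carrier S. restrict (\<lambda>s. \<sigma> (\<alpha> (?g s))) (carrier S) x = (c \<odot>\<^bsub>B\<^esub> \<one>\<^bsub>B\<^esub>) \<odot>\<^bsub>S\<^esub> x"
    by (rule bspec[rotated])
  then obtain c where "\<forall>x\<in>carrier S. restrict (\<lambda>s. \<sigma> (\<alpha> (?g s))) (carrier S) x = (c \<odot>\<^bsub>B\<^esub> \<one>\<^bsub>B\<^esub>) \<odot>\<^bsub>S\<^esub> x" ..
  then have c: "\<And>s. s \<in> carrier S \<Longrightarrow> \<sigma> (\<alpha> (?g s)) = (c \<odot>\<^bsub>B\<^esub> \<one>\<^bsub>B\<^esub>) \<odot>\<^bsub>S\<^esub> s"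
    by simp
  have c1: "c \<odot>\<^bsub>B\<^esub> \<one>\<^bsub>B\<^esub> \<in> carrier B"
  proof -
    interpret B: assoc_alg B by (rule assoc_alg.intro) (use B in \<open>simp add: split_semisimple_def\<close>)
    show ?thesis by simp
  qed
  have "\<alpha> x = (c \<odot>\<^bsub>B\<^esub> \<one>\<^bsub>B\<^esub>) \<odot>\<^bsub>V\<^esub> x" if x: "x \<in> carrier V" for x
  proof (rule inj_onD[OF inj])
    have "\<sigma> x \<in> carrier S" "?g (\<sigma> x) = x"
      using x inj module_map_closed[OF S(2) x] by auto
    then show "\<sigma> (\<alpha> x) = \<sigma> ((c \<odot>\<^bsub>B\<^esub> \<one>\<^bsub>B\<^esub>) \<odot>\<^bsub>V\<^esub> x)"
      using c[of "\<sigma> x"] module_map_smult[OF S(2) c1 x] by simp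
  qed (use x c1 module_map_closed[OF \<alpha> x] V.smult_closed in auto)
  then show ?thesis by blast
qed

lemma irreducible_lattice_nonzero:
  assumes V: "irreducible_lattice A V"
  shows "carrier V \<noteq> {\<zero>\<^bsub>V\<^esub>}"
proof
  assume V0: "carrier V = {\<zero>\<^bsub>V\<^esub>}"
  let ?R = "restrict_scalars A V"
  have "left_module type_ring ?R"
    using V by (simp add: irreducible_lattice_def lattice_over_def free_finite_rank_def)
  then interpret T: tensor ?R by (rule tensor.intro)
  have "x = \<one>\<^bsub>tensor_group ?R\<^esub>" if x: "x \<in> carrier (tensor_group ?R)" for x
  proof -
    obtain c m where "m \<in> carrier V" "x = T.pure (Fract 1 c) m"
      using x by (elim T.pure_cases) auto
    then show ?thesis using V0 T.pure_zero by simp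
  qed
  moreover have "\<one>\<^bsub>tensor_group ?R\<^esub> \<in> carrier (tensor_group ?R)"
    using T.pure_closed[of "\<zero>\<^bsub>V\<^esub>" 1] T.pure_zero[of 1] V0 by simp
  ultimately have "carrier (frac_module A V) = {\<zero>\<^bsub>frac_module A V\<^esub>}"
    unfolding frac_module_simps by blast
  then show False using V by (simp add: irreducible_lattice_def simple_module_def)
qed

context frac_alg
begin

lemma submodule_restrict_scalars:
  assumes "left_module A V" "submodule N A V"
  shows "submodule N type_ring (restrict_scalars A V)"
  by (rule submoduleI[OF left_module_restrict_scalars[OF assms(1)]]) (use submoduleD[OF assms(2)] in auto)

text \<open>
  Submodules of the extended module correspond to their intersections \<open>N\<close> with \<open>V\<close>, up to
  denominators. The criterion says that \<open>N\<close> contains a nonzero multiple of \<open>V\<close> unless it is zero, so that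
  dividing by this multiple one obtains everything.
\<close>

lemma irreducible_latticeI:
  assumes V: "lattice_over A V" and nz: "carrier V \<noteq> {\<zero>\<^bsub>V\<^esub>}"
    and crit: "\<And>N. \<lbrakk>submodule N A V; N \<noteq> {\<zero>\<^bsub>V\<^esub>}\<rbrakk> \<Longrightarrow>
      \<exists>d. d \<noteq> 0 \<and> (\<forall>v\<in>carrier V. (d \<odot> \<one>) \<odot>\<^bsub>V\<^esub> v \<in> N)"
  shows "irreducible_lattice A V"
proof -
  note LV = lattice_overD(1)[OF V] and fr = lattice_overD(2)[OF V]
  interpret V: left_module A V by (rule LV)
  interpret TV: tensor_bilinear A "restrict_scalars A V" "Module.module.smult V"
    by (rule tensor_bilinear_module[OF LV])
  let ?p = "TV.M.pure"
  let ?K = "frac_module A V"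
  note K = left_module_frac[OF LV]
  have Kz: "\<zero>\<^bsub>?K\<^esub> = ?p k \<zero>\<^bsub>V\<^esub>" for k
    using TV.M.pure_zero[of k] by (simp add: frac_module_simps)
  have Kc: "?p k v \<in> carrier ?K" if "v \<in> carrier V" for k v
    using TV.M.pure_closed[of v k] that by (simp add: frac_module_simps)
  have Kact: "T.pure k a \<odot>\<^bsub>?K\<^esub> ?p l v = ?p (k * l) (a \<odot>\<^bsub>V\<^esub> v)" if "a \<in> carrier A" "v \<in> carrier V" for k a l v
    using TV.act_pure[of a v k l] that by (simp add: frac_module_simps)
  have Bc: "T.pure k a \<in> carrier (frac_algebra A)" if "a \<in> carrier A" for k a
    using T.pure_closed[OF that, of k] by (simp add: frac_algebra_simps)
  have "simple_module (frac_algebra A) ?K"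
    unfolding simple_module_def
  proof (intro conjI K allI impI)
    obtain v where v: "v \<in> carrier V" "v \<noteq> \<zero>\<^bsub>V\<^esub>" using nz V.M.zero_closed by blast
    have "?p (Fract 1 1) v \<noteq> ?p (Fract 1 1) \<zero>\<^bsub>V\<^esub>"
      using TV.M.pure_eq_free[OF fr, of v "\<zero>\<^bsub>V\<^esub>" 1 1 1 1] v S.smult_one[of \<one>] by (auto simp: V.smult_one)
    then show "carrier ?K \<noteq> {\<zero>\<^bsub>?K\<^esub>}"
      using Kz[of "Fract 1 1"] Kc[OF v(1), of "Fract 1 1"] by auto
    fix W assume W: "submodule W (frac_algebra A) ?K"
    note WD = submoduleD[OF W]
    define N where "N = {v \<in> carrier V. ?p 1 v \<in> W}"
    have N: "submodule N A V"
    proof (rule submoduleI[OF LV])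
      show "\<zero>\<^bsub>V\<^esub> \<in> N" using WD(2) Kz[of 1] by (simp add: N_def)
      show "x \<oplus>\<^bsub>V\<^esub> y \<in> N" if "x \<in> N" "y \<in> N" for x y
        using that WD(3)[of "?p 1 x" "?p 1 y"] TV.M.pure_add_vector[of x y 1]
        by (simp add: N_def frac_module_simps)
      show "a \<odot>\<^bsub>V\<^esub> x \<in> N" if "a \<in> carrier A" "x \<in> N" for a x
        using that WD(5)[OF Bc[of a 1], of "?p 1 x"] Kact[of a x 1 1] by (simp add: N_def V.smult_closed)
    qed (auto simp: N_def)
    show "W = {\<zero>\<^bsub>?K\<^esub>} \<or> W = carrier ?K"
    proof (cases "N = {\<zero>\<^bsub>V\<^esub>}")
      case True
      have "x = \<zero>\<^bsub>?K\<^esub>" if x: "x \<in> W" for x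
      proof -
        have "x \<in> carrier (tensor_group (restrict_scalars A V))" using x WD(1) by (auto simp: frac_module_simps)
        then obtain d m where m: "d \<noteq> 0" "m \<in> carrier V" "x = ?p (Fract 1 d) m"
          by (elim TV.M.pure_cases) auto
        have "T.pure (Fract d 1) \<one> \<odot>\<^bsub>?K\<^esub> x \<in> W" using WD(5) Bc x by simp
        moreover have "T.pure (Fract d 1) \<one> \<odot>\<^bsub>?K\<^esub> x = ?p 1 m"
        proof -
          have "Fract d d = (1 :: 'o fract)" unfolding fract_one using m(1) by (simp add: eq_fract)
          then show ?thesis using m by (simp add: Kact V.smult_one)
        qed
        ultimately have "m \<in> N" using m by (simp add: N_def)
        then show ?thesis using True m Kz by simp
      qed
      then have "W = {\<zero>\<^bsub>?K\<^esub>}" using WD(2) by blast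
      then show ?thesis ..
    next
      case False
      then obtain d where d: "d \<noteq> 0" "\<And>v. v \<in> carrier V \<Longrightarrow> (d \<odot> \<one>) \<odot>\<^bsub>V\<^esub> v \<in> N"
        using crit[OF N] by blast
      have "x \<in> W" if x: "x \<in> carrier ?K" for x
      proof -
        obtain c m where m: "c \<noteq> 0" "m \<in> carrier V" "x = ?p (Fract 1 c) m"
          using x unfolding frac_module_simps by (elim TV.M.pure_cases) auto
        have "T.pure (Fract 1 (c * d)) \<one> \<odot>\<^bsub>?K\<^esub> ?p 1 ((d \<odot> \<one>) \<odot>\<^bsub>V\<^esub> m) \<in> W"
          using WD(5) Bc d(2)[OF m(2)] by (simp add: N_def)
        also have "T.pure (Fract 1 (c * d)) \<one> \<odot>\<^bsub>?K\<^esub> ?p 1 ((d \<odot> \<one>) \<odot>\<^bsub>V\<^esub> m) = x"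
          using m d TV.M.pure_expand[of m c d] by (simp add: Kact V.smult_one V.smult_closed)
        finally show ?thesis .
      qed
      then show ?thesis using WD(1) by auto
    qed
  qed
  then show ?thesis using V by (simp add: irreducible_lattice_def)
qed

text \<open>
  The fractions with numerator in \<open>N\<close> form a nonzero submodule, hence everything. So every element
  of \<open>V\<close> has a nonzero multiple in \<open>N\<close>, and the product of these multipliers over a basis works for all of \<open>V\<close>.
\<close>

lemma irreducible_lattice_submodule:
  assumes V: "irreducible_lattice A V" and N: "submodule N A V" "N \<noteq> {\<zero>\<^bsub>V\<^esub>}"
  shows "\<exists>d. d \<noteq> 0 \<and> (\<forall>v\<in>carrier V. (d \<odot> \<one>) \<odot>\<^bsub>V\<^esub> v \<in> N)"
proof -
  have lat: "lattice_over A V" and simple: "simple_module (frac_algebra A) (frac_module A V)"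
    using V by (auto simp: irreducible_lattice_def)
  note LV = lattice_overD(1)[OF lat] and fr = lattice_overD(2)[OF lat]
  note RV = left_module_restrict_scalars[OF LV]
  interpret V: left_module A V by (rule LV)
  interpret R: left_module type_ring "restrict_scalars A V" by (rule RV)
  interpret TV: tensor_bilinear A "restrict_scalars A V" "Module.module.smult V"
    by (rule tensor_bilinear_module[OF LV])
  let ?p = "TV.M.pure" let ?R = "restrict_scalars A V"
  let ?K = "frac_module A V"
  note ND = submoduleD[OF N(1)]
  have NV: "n \<in> carrier V" if "n \<in> N" for n using that ND(1) by auto
  have Nr: "r \<odot>\<^bsub>?R\<^esub> n \<in> N" if "n \<in> N" for r n using ND(5)[of "r \<odot> \<one>" n] that by simp
  \<comment> \<open>The fractions with numerator in \<open>N\<close>.\<close>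
  define W where "W = {x. \<exists>c n. c \<noteq> 0 \<and> n \<in> N \<and> x = ?p (Fract 1 c) n}"
  have WI: "?p (Fract 1 c) n \<in> W" if "c \<noteq> 0" "n \<in> N" for c n
    using that unfolding W_def by blast
  have WE: "\<exists>c n. c \<noteq> 0 \<and> n \<in> N \<and> x = ?p (Fract 1 c) n" if "x \<in> W" for x
    using that unfolding W_def by simp
  have "submodule W (frac_algebra A) ?K"
  proof (rule submoduleI[OF left_module_frac[OF LV]])
    show "W \<subseteq> carrier ?K" using NV TV.M.pure_closed by (auto simp: W_def frac_module_simps)
    have "?p (Fract 1 1) \<zero>\<^bsub>V\<^esub> \<in> W" by (rule WI) (use ND(2) in auto)
    then show "\<zero>\<^bsub>?K\<^esub> \<in> W" using TV.M.pure_zero[of "Fract 1 1"] by (simp add: frac_module_simps)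
    fix x y assume xy: "x \<in> W" "y \<in> W"
    obtain c n d m where *: "c \<noteq> 0" "n \<in> N" "x = ?p (Fract 1 c) n" "d \<noteq> 0" "m \<in> N" "y = ?p (Fract 1 d) m"
      using WE[OF xy(1)] WE[OF xy(2)] by (elim exE conjE) (rule that)
    have "x = ?p (Fract 1 (c * d)) (d \<odot>\<^bsub>?R\<^esub> n)" "y = ?p (Fract 1 (c * d)) (c \<odot>\<^bsub>?R\<^esub> m)"
      using TV.M.pure_expand[of n c d] TV.M.pure_expand[of m d c] * NV by (simp_all add: mult.commute)
    then have "x \<oplus>\<^bsub>?K\<^esub> y = ?p (Fract 1 (c * d)) (d \<odot>\<^bsub>?R\<^esub> n \<oplus>\<^bsub>V\<^esub> c \<odot>\<^bsub>?R\<^esub> m)"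
      using TV.M.pure_add_vector[of "d \<odot>\<^bsub>?R\<^esub> n" "c \<odot>\<^bsub>?R\<^esub> m"] NV[OF Nr] * by (simp add: frac_module_simps)
    moreover have "d \<odot>\<^bsub>?R\<^esub> n \<oplus>\<^bsub>V\<^esub> c \<odot>\<^bsub>?R\<^esub> m \<in> N" using ND(3) Nr * by blast
    moreover have "c * d \<noteq> 0" using * by simp
    ultimately show "x \<oplus>\<^bsub>?K\<^esub> y \<in> W" using WI by simp
  next
    fix b x assume b: "b \<in> carrier (frac_algebra A)" and x: "x \<in> W"
    obtain c a where a: "c \<noteq> 0" "a \<in> carrier A" "b = T.pure (Fract 1 c) a"
      using b unfolding frac_algebra_simps by (elim T.pure_cases) auto
    obtain d m where m: "d \<noteq> 0" "m \<in> N" "x = ?p (Fract 1 d) m"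
      using WE[OF x] by (elim exE conjE) (rule that)
    have "b \<odot>\<^bsub>?K\<^esub> x = ?p (Fract 1 (c * d)) (a \<odot>\<^bsub>V\<^esub> m)"
      using a m NV by (simp add: frac_module_simps TV.act_pure)
    moreover have "a \<odot>\<^bsub>V\<^esub> m \<in> N" using ND(5) a m by blast
    moreover have "c * d \<noteq> 0" using a m by simp
    ultimately show "b \<odot>\<^bsub>?K\<^esub> x \<in> W" using WI by simp
  qed
  moreover have "W \<noteq> {\<zero>\<^bsub>?K\<^esub>}"
  proof
    assume W0: "W = {\<zero>\<^bsub>?K\<^esub>}"
    obtain n where n: "n \<in> N" "n \<noteq> \<zero>\<^bsub>V\<^esub>" using N(2) ND(2) by blast
    have "?p (Fract 1 1) n \<in> W" by (rule WI) (use n in auto)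
    then have "?p (Fract 1 1) n = ?p (Fract 1 1) \<zero>\<^bsub>V\<^esub>"
      using W0 TV.M.pure_zero[of "Fract 1 1"] by (simp add: frac_module_simps)
    then show False
      using TV.M.pure_eq_free[OF fr, of n "\<zero>\<^bsub>V\<^esub>" 1 1 1 1] n NV S.smult_one[of \<one>] by (auto simp: V.smult_one)
  qed
  ultimately have W: "W = carrier ?K" using simple unfolding simple_module_def by blast
  have "\<exists>c. c \<noteq> 0 \<and> c \<odot>\<^bsub>?R\<^esub> v \<in> N" if v: "v \<in> carrier V" for v
  proof -
    have "?p (Fract 1 1) v \<in> W" unfolding W using TV.M.pure_closed v by (simp add: frac_module_simps)
    from WE[OF this] obtain c n where *: "c \<noteq> 0" "n \<in> N" "?p (Fract 1 1) v = ?p (Fract 1 c) n"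
      by (elim exE conjE) (rule that)
    have "c \<odot>\<^bsub>?R\<^esub> v = n"
      using TV.M.pure_eq_free[OF fr _ _ *(3)] v NV[OF *(2)] *(1) S.smult_one[of \<one>] by (simp add: V.smult_one)
    then show ?thesis using * by blast
  qed
  then have "\<forall>v. \<exists>c. v \<in> carrier V \<longrightarrow> c \<noteq> 0 \<and> c \<odot>\<^bsub>?R\<^esub> v \<in> N" by blast
  from choice[OF this] obtain c where c: "\<And>v. v \<in> carrier V \<Longrightarrow> c v \<noteq> 0" "\<And>v. v \<in> carrier V \<Longrightarrow> c v \<odot>\<^bsub>?R\<^esub> v \<in> N"
    by blast
  let ?E = "some_basis ?R"
  have E: "finite ?E" "\<And>e. e \<in> ?E \<Longrightarrow> e \<in> carrier V"
    using some_basis[OF fr] by (auto simp: is_finite_basis_def)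
  define d where "d = prod c ?E"
  have dE: "d \<odot>\<^bsub>?R\<^esub> e \<in> N" if e: "e \<in> ?E" for e
  proof -
    have "d = prod c (?E - {e}) * c e" unfolding d_def using E(1) e by (subst prod.remove[OF _ e]) (auto simp: mult.commute)
    then have "d \<odot>\<^bsub>?R\<^esub> e = prod c (?E - {e}) \<odot>\<^bsub>?R\<^esub> (c e \<odot>\<^bsub>?R\<^esub> e)"
      using R.smult_assoc[of "prod c (?E - {e})" "c e" e] E(2)[OF e] by simp
    then show ?thesis using Nr[OF c(2)[OF E(2)[OF e]]] by simp
  qed
  have "d \<odot>\<^bsub>?R\<^esub> v \<in> N" if v: "v \<in> carrier V" for v
  proof -
    let ?k = "coordinates ?R ?E v"
    note subR = submodule_restrict_scalars[OF LV N(1)]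
    interpret RN: left_module type_ring "?R\<lparr>carrier := N\<rparr>" by (rule left_module_submodule[OF RV subR])
    have kN: "?k e \<odot>\<^bsub>?R\<^esub> (d \<odot>\<^bsub>?R\<^esub> e) \<in> N" if "e \<in> ?E" for e by (rule Nr[OF dE[OF that]])
    have "d \<odot>\<^bsub>?R\<^esub> v = d \<odot>\<^bsub>?R\<^esub> (\<Oplus>\<^bsub>?R\<^esub>e\<in>?E. ?k e \<odot>\<^bsub>?R\<^esub> e)"
      using coordinates_sum[OF some_basis[OF fr], of v] v by simp
    also have "\<dots> = (\<Oplus>\<^bsub>?R\<^esub>e\<in>?E. d \<odot>\<^bsub>?R\<^esub> (?k e \<odot>\<^bsub>?R\<^esub> e))"
      using E by (intro R.smult_finsum) (auto simp: V.smult_closed)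
    also have "\<dots> = (\<Oplus>\<^bsub>?R\<^esub>e\<in>?E. ?k e \<odot>\<^bsub>?R\<^esub> (d \<odot>\<^bsub>?R\<^esub> e))"
    proof (rule R.M.finsum_cong')
      fix e assume e: "e \<in> ?E"
      show "d \<odot>\<^bsub>?R\<^esub> (?k e \<odot>\<^bsub>?R\<^esub> e) = ?k e \<odot>\<^bsub>?R\<^esub> (d \<odot>\<^bsub>?R\<^esub> e)"
        using R.smult_assoc[of d "?k e" e] R.smult_assoc[of "?k e" d e] E(2)[OF e] by (simp add: mult.commute)
    qed (use kN NV in auto)
    also have "\<dots> = (\<Oplus>\<^bsub>?R\<lparr>carrier := N\<rparr>\<^esub>e\<in>?E. ?k e \<odot>\<^bsub>?R\<^esub> (d \<odot>\<^bsub>?R\<^esub> e))"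
      by (rule finsum_submodule[OF RV subR kN, symmetric])
    also have "\<dots> \<in> carrier (?R\<lparr>carrier := N\<rparr>)"
      using kN by (intro RN.M.finsum_closed) auto
    finally show ?thesis by simp
  qed
  moreover have "d \<noteq> 0" unfolding d_def using c E by simp
  ultimately show ?thesis by auto
qed

text \<open>
  Schur's lemma without denominators: a nonzero endomorphism is injective, its image contains \<open>d V\<close> for
  some \<open>d\<close>, and \<open>\<gamma>\<close> is the inverse of \<open>\<alpha>\<close> multiplied by \<open>d\<close>.
\<close>

lemma irreducible_lattice_endomorphism:
  assumes V: "irreducible_lattice A V" and \<alpha>: "module_map A V V \<alpha>" and nz: "\<exists>v\<in>carrier V. \<alpha> v \<noteq> \<zero>\<^bsub>V\<^esub>"
  shows "\<exists>\<gamma> d. module_map A V V \<gamma> \<and> d \<noteq> 0 \<and> (\<forall>v\<in>carrier V. \<alpha> (\<gamma> v) = (d \<odot> \<one>) \<odot>\<^bsub>V\<^esub> v)"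
proof -
  have lat: "lattice_over A V" using V by (auto simp: irreducible_lattice_def)
  note LV = lattice_overD(1)[OF lat] and fr = lattice_overD(2)[OF lat]
  interpret V: left_module A V by (rule LV)
  note \<alpha>c = module_map_closed[OF \<alpha>]
  have cV: "submodule (carrier V) A V"
    by (rule submoduleI[OF LV]) (auto simp: V.smult_closed)
  have "\<alpha> ` carrier V \<noteq> {\<zero>\<^bsub>V\<^esub>}" using nz by auto
  then obtain d where d: "d \<noteq> 0" "\<And>v. v \<in> carrier V \<Longrightarrow> (d \<odot> \<one>) \<odot>\<^bsub>V\<^esub> v \<in> \<alpha> ` carrier V"
    using irreducible_lattice_submodule[OF V submodule_image[OF LV LV \<alpha> cV]] by blast
  let ?ker = "{v \<in> carrier V. \<alpha> v = \<zero>\<^bsub>V\<^esub>}"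
  have ker: "?ker = {\<zero>\<^bsub>V\<^esub>}"
  proof (rule ccontr)
    assume "?ker \<noteq> {\<zero>\<^bsub>V\<^esub>}"
    then obtain c where c: "c \<noteq> 0" "\<And>v. v \<in> carrier V \<Longrightarrow> (c \<odot> \<one>) \<odot>\<^bsub>V\<^esub> v \<in> ?ker"
      using irreducible_lattice_submodule[OF V submodule_kernel[OF LV LV \<alpha>]] by blast
    have "\<alpha> v = \<zero>\<^bsub>V\<^esub>" if "v \<in> carrier V" for v
      using free_torsion_free[OF fr, of "\<alpha> v" c] c(2)[OF that] c(1) that
      by (simp add: \<alpha>c module_map_smult[OF \<alpha>])
    then show False using nz by blast
  qed
  have inj: "inj_on \<alpha> (carrier V)"
  proof (rule inj_onI)
    fix x y assume xy: "x \<in> carrier V" "y \<in> carrier V" "\<alpha> x = \<alpha> y"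
    then have "\<alpha> (x \<oplus>\<^bsub>V\<^esub> \<ominus>\<^bsub>V\<^esub> y) = \<zero>\<^bsub>V\<^esub>"
      by (simp add: module_map_add[OF \<alpha>] module_map_minus[OF LV LV \<alpha>] \<alpha>c V.M.r_neg)
    then have "x \<oplus>\<^bsub>V\<^esub> \<ominus>\<^bsub>V\<^esub> y = \<zero>\<^bsub>V\<^esub>" using ker xy by auto
    then have "\<ominus>\<^bsub>V\<^esub> (\<ominus>\<^bsub>V\<^esub> y) = x" using xy by (intro V.M.minus_equality) auto
    then show "x = y" using xy by simp
  qed
  let ?I = "V\<lparr>carrier := \<alpha> ` carrier V\<rparr>"
  have \<alpha>I: "module_map A V ?I \<alpha>" using \<alpha> by (auto simp: module_map_def)
  have bij: "bij_betw \<alpha> (carrier V) (carrier ?I)" using inj by (simp add: bij_betw_def)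
  have "module_map A V ?I (\<lambda>v. (d \<odot> \<one>) \<odot>\<^bsub>V\<^esub> v)"
  proof -
    have "module_map A V V (\<lambda>v. (d \<odot> \<one>) \<odot>\<^bsub>V\<^esub> v)"
      by (rule module_map_central[OF LV]) (simp_all add: central_unit)
    then show ?thesis using d(2) by (simp add: module_map_def)
  qed
  from module_map_compose[OF this module_map_inverse[OF LV \<alpha>I bij]]
  have "module_map A V V (\<lambda>v. inv_into (carrier V) \<alpha> ((d \<odot> \<one>) \<odot>\<^bsub>V\<^esub> v))" .
  moreover have "\<alpha> (inv_into (carrier V) \<alpha> ((d \<odot> \<one>) \<odot>\<^bsub>V\<^esub> v)) = (d \<odot> \<one>) \<odot>\<^bsub>V\<^esub> v" if "v \<in> carrier V" for v
    using d(2)[OF that] by (rule f_inv_into_f)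
  ultimately show ?thesis using d(1) by blast
qed

text \<open>
  The extension of \<open>\<alpha>\<close> to the field of fractions is multiplication by a fraction \<open>a / b\<close>. This
  fraction lies in the ground ring, as can be seen on one coordinate of the image of a basis element.
\<close>

lemma irreducible_lattice_scalar:
  assumes B: "split_semisimple (frac_algebra A)" and V: "irreducible_lattice A V"
    and \<alpha>: "module_map A V V \<alpha>"
  shows "\<exists>r. \<forall>v\<in>carrier V. \<alpha> v = (r \<odot> \<one>) \<odot>\<^bsub>V\<^esub> v"
proof -
  have lat: "lattice_over A V" and simple: "simple_module (frac_algebra A) (frac_module A V)"
    using V by (auto simp: irreducible_lattice_def)
  note LV = lattice_overD(1)[OF lat] and fr = lattice_overD(2)[OF lat]
  note RV = left_module_restrict_scalars[OF LV]
  interpret V: left_module A V by (rule LV)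
  interpret TV: tensor_bilinear A "restrict_scalars A V" "Module.module.smult V"
    by (rule tensor_bilinear_module[OF LV])
  let ?p = "TV.M.pure" let ?R = "restrict_scalars A V"
  let ?K = "frac_module A V"
  note \<alpha>c = module_map_closed[OF \<alpha>]
  note nz = irreducible_lattice_nonzero[OF V]
  \<comment> \<open>The map \<open>m / d \<mapsto> \<alpha> m / d\<close> on the extended module.\<close>
  define K\<alpha> where "K\<alpha> y = (SOME z. \<exists>d m. d \<noteq> 0 \<and> m \<in> carrier V \<and> y = ?p (Fract 1 d) m \<and> z = ?p (Fract 1 d) (\<alpha> m))" for y
  have K\<alpha>: "K\<alpha> (?p (Fract 1 d) m) = ?p (Fract 1 d) (\<alpha> m)" if d: "d \<noteq> 0" and m: "m \<in> carrier V" for d m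
  proof -
    have "\<exists>d' m'. d' \<noteq> 0 \<and> m' \<in> carrier V \<and> ?p (Fract 1 d) m = ?p (Fract 1 d') m' \<and>
        K\<alpha> (?p (Fract 1 d) m) = ?p (Fract 1 d') (\<alpha> m')"
      unfolding K\<alpha>_def by (rule someI_ex) (use d m in blast)
    then obtain d' m' where m': "d' \<noteq> 0" "m' \<in> carrier V" "?p (Fract 1 d) m = ?p (Fract 1 d') m'"
      "K\<alpha> (?p (Fract 1 d) m) = ?p (Fract 1 d') (\<alpha> m')" by blast
    have "d' \<odot>\<^bsub>?R\<^esub> m = d \<odot>\<^bsub>?R\<^esub> m'"
      using TV.M.pure_eq_free[OF fr _ _ m'(3)] d m m' by simp
    then have "\<alpha> (d' \<odot>\<^bsub>?R\<^esub> m) = \<alpha> (d \<odot>\<^bsub>?R\<^esub> m')" by simp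
    then have "d' \<odot>\<^bsub>?R\<^esub> \<alpha> m = d \<odot>\<^bsub>?R\<^esub> \<alpha> m'"
      using m m' by (simp add: module_map_smult[OF \<alpha>])
    then show ?thesis
      using TV.M.pure_expand[of "\<alpha> m" d d'] TV.M.pure_expand[of "\<alpha> m'" d' d] m' d m
      by (simp add: \<alpha>c mult.commute)
  qed
  have "module_map (frac_algebra A) ?K ?K K\<alpha>"
    unfolding module_map_def frac_module_simps
  proof (intro conjI ballI)
    fix x y assume x: "x \<in> carrier (tensor_group ?R)"
    then obtain d m where m: "d \<noteq> 0" "m \<in> carrier V" "x = ?p (Fract 1 d) m"
      by (elim TV.M.pure_cases) auto
    show "K\<alpha> x \<in> carrier (tensor_group ?R)"
      using m by (simp add: K\<alpha> \<alpha>c TV.M.pure_closed)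
    assume y: "y \<in> carrier (tensor_group ?R)"
    obtain d m n where mn: "d \<noteq> 0" "m \<in> carrier V" "n \<in> carrier V" "x = ?p (Fract 1 d) m" "y = ?p (Fract 1 d) n"
      using TV.M.pure_cases2[OF x y] by auto
    have "x \<otimes>\<^bsub>tensor_group ?R\<^esub> y = ?p (Fract 1 d) (m \<oplus>\<^bsub>V\<^esub> n)"
      using TV.M.pure_add_vector[of m n "Fract 1 d"] mn by simp
    moreover have "K\<alpha> x \<otimes>\<^bsub>tensor_group ?R\<^esub> K\<alpha> y = ?p (Fract 1 d) (\<alpha> m \<oplus>\<^bsub>V\<^esub> \<alpha> n)"
      using TV.M.pure_add_vector[of "\<alpha> m" "\<alpha> n" "Fract 1 d"] mn by (simp add: K\<alpha> \<alpha>c)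
    ultimately show "K\<alpha> (x \<otimes>\<^bsub>tensor_group ?R\<^esub> y) = K\<alpha> x \<otimes>\<^bsub>tensor_group ?R\<^esub> K\<alpha> y"
      using mn by (simp add: K\<alpha> module_map_add[OF \<alpha>])
  next
    fix b x assume b: "b \<in> carrier (frac_algebra A)" and x: "x \<in> carrier (tensor_group ?R)"
    obtain c a where a: "c \<noteq> 0" "a \<in> carrier A" "b = T.pure (Fract 1 c) a"
      using b unfolding frac_algebra_simps by (elim T.pure_cases) auto
    obtain d m where m: "d \<noteq> 0" "m \<in> carrier V" "x = ?p (Fract 1 d) m"
      using x by (elim TV.M.pure_cases) auto
    show "K\<alpha> (tensor_act (Module.module.smult V) ?R b x) = tensor_act (Module.module.smult V) ?R b (K\<alpha> x)"
      using a m by (simp add: TV.act_pure K\<alpha> \<alpha>c V.smult_closed module_map_smult[OF \<alpha>])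
  qed
  from split_semisimple_scalar[OF B simple this] obtain c where
    c: "\<And>x. x \<in> carrier ?K \<Longrightarrow> K\<alpha> x = (c \<odot>\<^bsub>frac_algebra A\<^esub> \<one>\<^bsub>frac_algebra A\<^esub>) \<odot>\<^bsub>?K\<^esub> x" by blast
  obtain a b where ab: "c = Fract a b" "b \<noteq> 0" by (cases c) auto
  have c1: "c \<odot>\<^bsub>frac_algebra A\<^esub> \<one>\<^bsub>frac_algebra A\<^esub> = T.pure c \<one>"
    unfolding one_frac_algebra by (simp add: frac_algebra_simps T.scale_pure)
  have bv: "b \<odot>\<^bsub>?R\<^esub> \<alpha> v = a \<odot>\<^bsub>?R\<^esub> v" if v: "v \<in> carrier V" for v
  proof -
    have "?p (Fract 1 1) v \<in> carrier ?K" using v TV.M.pure_closed[of v] by (simp add: frac_module_simps)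
    from c[OF this] have "?p (Fract 1 1) (\<alpha> v) = ?p (Fract a b) v"
      using v unfolding c1 by (simp add: K\<alpha> frac_module_simps TV.act_pure V.smult_one ab)
    then show ?thesis
      using TV.M.pure_eq_free[OF fr, of "\<alpha> v" v 1 1 a b] v ab by (simp add: \<alpha>c)
  qed
  have "some_basis ?R \<noteq> {}"
  proof
    assume E: "some_basis ?R = {}"
    then have "v = \<zero>\<^bsub>V\<^esub>" if "v \<in> carrier V" for v
      using coordinates_sum[OF some_basis[OF fr], of v] that by simp
    then show False using nz by auto
  qed
  then obtain e where e: "e \<in> some_basis ?R" by auto
  then have eV: "e \<in> carrier V" using some_basis[OF fr] by (auto simp: is_finite_basis_def)
  note \<kappa> = functional_coordinates[OF RV some_basis[OF fr] e]
  define r where "r = coordinates ?R (some_basis ?R) (\<alpha> e) e"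
  have "b * r = a"
    using functional_smult[OF \<kappa>, of "\<alpha> e" b] functional_smult[OF \<kappa>, of e a] bv[OF eV] eV
      coordinates_basis[OF RV some_basis[OF fr] e e] by (simp add: r_def \<alpha>c)
  have "\<alpha> v = r \<odot>\<^bsub>?R\<^esub> v" if v: "v \<in> carrier V" for v
  proof (rule free_smult_cancel[OF fr _ _ _ ab(2)])
    show "b \<odot>\<^bsub>?R\<^esub> \<alpha> v = b \<odot>\<^bsub>?R\<^esub> (r \<odot>\<^bsub>?R\<^esub> v)"
      using bv[OF v] left_module.smult_assoc[OF RV, of b r v] v \<open>b * r = a\<close> by simp
  qed (use v \<alpha>c V.smult_closed in auto)
  then show ?thesis by auto
qed

end

lemma restrict_scalars_submodule:
  "restrict_scalars A (V\<lparr>carrier := N\<rparr>) = (restrict_scalars A V)\<lparr>carrier := N\<rparr>"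
  by (simp add: restrict_scalars_def)

lemma coordinates_jointly_injective:
  assumes "free_finite_rank V" "v \<in> carrier V" "\<And>e. e \<in> some_basis V \<Longrightarrow> coordinates V (some_basis V) v e = 0"
  shows "v = \<zero>\<^bsub>V\<^esub>"
proof -
  note L = free_finite_rank_left_module[OF assms(1)] and E = some_basis[OF assms(1)]
  interpret V: left_module type_ring V by (rule L)
  show ?thesis
    by (rule coordinates_eqI[OF E assms(2) _ _ L])
      (use assms(3) functional_zero[OF L functional_coordinates[OF L E]] in auto)
qed

lemma free_submodule:
  fixes V :: "('o::idom, 'v) module"
  assumes PID: "principal_domain (type_ring :: 'o ring)" and V: "free_finite_rank V" and N: "submodule N type_ring V"
  shows "free_finite_rank (V\<lparr>carrier := N\<rparr>)"
proof (rule free_of_jointly_injective_functionals[OF PID])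
  note L = free_finite_rank_left_module[OF V] and E = some_basis[OF V]
  show "finite (some_basis V)" using E by (simp add: is_finite_basis_def)
  show "left_module type_ring (V\<lparr>carrier := N\<rparr>)" by (rule left_module_submodule[OF L N])
  show "functional (V\<lparr>carrier := N\<rparr>) (\<lambda>v. coordinates V (some_basis V) v e)" if "e \<in> some_basis V" for e
    by (rule functional_submodule[OF functional_coordinates[OF L E that] submoduleD(1)[OF N]])
  show "v = \<zero>\<^bsub>V\<lparr>carrier := N\<rparr>\<^esub>" if "v \<in> carrier (V\<lparr>carrier := N\<rparr>)"
    "\<And>e. e \<in> some_basis V \<Longrightarrow> coordinates V (some_basis V) v e = 0" for v
    using coordinates_jointly_injective[OF V, of v] submoduleD(1)[OF N] that by auto
qed

context frac_alg
begin

lemma lattice_submodule: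
  assumes PID: "principal_domain (type_ring :: 'o ring)" and V: "lattice_over A V" and N: "submodule N A V"
  shows "lattice_over A (V\<lparr>carrier := N\<rparr>)"
  using left_module_submodule[OF lattice_overD(1)[OF V] N]
    free_submodule[OF PID lattice_overD(2)[OF V] submodule_restrict_scalars[OF lattice_overD(1)[OF V] N]]
  by (simp add: lattice_over_def restrict_scalars_submodule)

text \<open>
  A nonzero submodule \<open>N\<close> of minimal rank is irreducible. The rank is measured by the number of
  functionals required to separate the points of \<open>N\<close>. If \<open>N'\<close> is a nonzero submodule of such an \<open>N\<close>, then a
  functional on \<open>N\<close> that vanishes on \<open>N'\<close> must vanish, since otherwise one of the separating
  functionals could be omitted on \<open>N'\<close>. Applied to the coordinates of \<open>\<pi> v - d v\<close>, where \<open>\<pi>\<close> is an almost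
  retraction onto \<open>N'\<close>, this gives \<open>d v = \<pi> v \<in> N'\<close> for all \<open>v\<close>.
\<close>

lemma irreducible_sublattice:
  assumes PID: "principal_domain (type_ring :: 'o ring)" and U: "lattice_over A U" and nz: "carrier U \<noteq> {\<zero>\<^bsub>U\<^esub>}"
  shows "\<exists>N. irreducible_lattice A (U\<lparr>carrier := N\<rparr>)"
proof -
  note LU = lattice_overD(1)[OF U] and fr = lattice_overD(2)[OF U]
  let ?R = "restrict_scalars A U"
  note RU = left_module_restrict_scalars[OF LU]
  interpret U: left_module A U by (rule LU)
  \<comment> \<open>The functionals \<open>\<phi> i\<close> separate the points of \<open>N\<close>.\<close>
  define sep where "sep N I \<phi> \<longleftrightarrow> finite I \<and> (\<forall>i\<in>I. functional (?R\<lparr>carrier := N\<rparr>) (\<phi> i)) \<and>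
      (\<forall>v\<in>N. (\<forall>i\<in>I. \<phi> i v = 0) \<longrightarrow> v = \<zero>\<^bsub>U\<^esub>)" for N and I :: "'b set" and \<phi> :: "'b \<Rightarrow> 'b \<Rightarrow> 'o"
  define Q where "Q n \<longleftrightarrow> (\<exists>N I \<phi>. submodule N A U \<and> N \<noteq> {\<zero>\<^bsub>U\<^esub>} \<and> sep N I \<phi> \<and> card I = n)" for n
  have "submodule (carrier U) A U"
    by (rule submoduleI[OF LU]) (auto simp: U.smult_closed)
  moreover have "sep (carrier U) (some_basis ?R) (\<lambda>e v. coordinates ?R (some_basis ?R) v e)"
  proof -
    have eq: "?R\<lparr>carrier := carrier U\<rparr> = ?R" by (simp add: restrict_scalars_def)
    show ?thesis
      unfolding sep_def eq
    proof (intro conjI ballI impI)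
      show "finite (some_basis ?R)" using some_basis[OF fr] by (simp add: is_finite_basis_def)
      show "functional ?R (\<lambda>v. coordinates ?R (some_basis ?R) v e)" if "e \<in> some_basis ?R" for e
        by (rule functional_coordinates[OF RU some_basis[OF fr] that])
      show "v = \<zero>\<^bsub>U\<^esub>" if "v \<in> carrier U" "\<forall>e\<in>some_basis ?R. coordinates ?R (some_basis ?R) v e = 0" for v
        using coordinates_jointly_injective[OF fr, of v] that by simp
    qed
  qed
  ultimately have "Q (card (some_basis ?R))" unfolding Q_def using nz by blast
  then obtain n where n: "Q n" "\<And>m. m < n \<Longrightarrow> \<not> Q m"
    using exists_least_iff[of Q] by blast
  then obtain N I \<phi> where N: "submodule N A U" "N \<noteq> {\<zero>\<^bsub>U\<^esub>}" and sep: "sep N I \<phi>" and cI: "card I = n"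
    unfolding Q_def by blast
  let ?N = "U\<lparr>carrier := N\<rparr>" let ?RN = "?R\<lparr>carrier := N\<rparr>"
  note NU = submoduleD(1)[OF N(1)]
  note latN = lattice_submodule[OF PID U N(1)]
  note LN = left_module_submodule[OF LU N(1)]
  note frN = lattice_overD(2)[OF latN, unfolded restrict_scalars_submodule]
  note LRN = free_finite_rank_left_module[OF frN]
  have sepD: "finite I" "\<And>i. i \<in> I \<Longrightarrow> functional ?RN (\<phi> i)"
    "\<And>v. \<lbrakk>v \<in> carrier ?RN; \<And>i. i \<in> I \<Longrightarrow> \<phi> i v = 0\<rbrakk> \<Longrightarrow> v = \<zero>\<^bsub>?RN\<^esub>"
    using sep unfolding sep_def by auto
  have "irreducible_lattice A ?N"
  proof (rule irreducible_latticeI[OF latN])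
    show "carrier ?N \<noteq> {\<zero>\<^bsub>?N\<^esub>}" using N(2) by simp
    fix N' assume N': "submodule N' A ?N" "N' \<noteq> {\<zero>\<^bsub>?N\<^esub>}"
    note N'N = submoduleD(1)[OF N'(1)]
    have subU: "submodule N' A U"
      by (rule submoduleI[OF LU]) (use submoduleD[OF N'(1)] NU in auto)
    have vanish: "\<psi> v = 0" if \<psi>: "functional ?RN \<psi>" and 0: "\<And>v. v \<in> N' \<Longrightarrow> \<psi> v = 0" and v: "v \<in> N" for \<psi> v
    proof -
      have "\<exists>d c. d \<noteq> 0 \<and> (\<forall>v\<in>carrier ?RN. d * \<psi> v = (\<Sum>i\<in>I. c i * \<phi> i v))"
      proof (rule jointly_injective_functionals_span[OF sepD(1) LRN _ _ \<psi>])
        show "functional ?RN (\<phi> i)" if "i \<in> I" for i by (rule sepD(2)[OF that])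
        show "v = \<zero>\<^bsub>?RN\<^esub>" if "v \<in> carrier ?RN" "\<And>i. i \<in> I \<Longrightarrow> \<phi> i v = 0" for v
          by (rule sepD(3)[OF that])
      qed
      then obtain d c where "d \<noteq> 0 \<and> (\<forall>v\<in>carrier ?RN. d * \<psi> v = (\<Sum>i\<in>I. c i * \<phi> i v))"
        by (elim exE) (rule that)
      then have dc: "d \<noteq> 0" "\<And>v. v \<in> N \<Longrightarrow> d * \<psi> v = (\<Sum>i\<in>I. c i * \<phi> i v)"
        by auto
      have "c j = 0" if j: "j \<in> I" for j
      proof (rule ccontr)
        assume cj: "c j \<noteq> 0"
        have "sep N' (I - {j}) \<phi>"
          unfolding sep_def
        proof (intro conjI ballI impI)
          fix i assume "i \<in> I - {j}"
          then show "functional (?R\<lparr>carrier := N'\<rparr>) (\<phi> i)"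
            using functional_submodule[OF sepD(2), of i N'] N'N by simp
        next
          fix x assume x: "x \<in> N'" and x0: "\<forall>i\<in>I - {j}. \<phi> i x = 0"
          have xN: "x \<in> N" using x N'N by auto
          have "(\<Sum>i\<in>I. c i * \<phi> i x) = c j * \<phi> j x"
            using x0 j sepD(1) by (subst sum.remove[OF _ j]) auto
          then have "\<phi> j x = 0" using dc(2)[OF xN] 0[OF x] cj by simp
          then show "x = \<zero>\<^bsub>U\<^esub>" using sepD(3)[of x] x0 xN by auto
        qed (use sepD(1) in simp)
        then have "Q (card (I - {j}))" unfolding Q_def using subU N'(2) by auto
        moreover have "card (I - {j}) < n" using cI j sepD(1) by (metis card_Diff1_less)
        ultimately show False using n(2) by blast
      qed
      then show ?thesis using dc v by simp
    qed
    have subR: "submodule N' type_ring ?RN"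
      using submodule_restrict_scalars[OF LN N'(1)] by (simp add: restrict_scalars_submodule)
    obtain d \<pi> where d: "d \<noteq> 0" and \<pi>: "module_map type_ring ?RN ?RN \<pi>" "\<And>v. v \<in> carrier ?RN \<Longrightarrow> \<pi> v \<in> N'"
      "\<And>v. v \<in> N' \<Longrightarrow> \<pi> v = d \<odot>\<^bsub>?RN\<^esub> v"
      by (rule almost_retraction[OF frN subR free_submodule[OF PID frN subR]]) (rule that)
    interpret RN: left_module type_ring ?RN by (rule LRN)
    have "d \<odot>\<^bsub>?RN\<^esub> v \<in> N'" if v: "v \<in> carrier ?RN" for v
    proof -
      have "\<pi> v = d \<odot>\<^bsub>?RN\<^esub> v"
      proof (rule coordinates_eqI[OF some_basis[OF frN] module_map_closed[OF \<pi>(1) v] _ _ LRN])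
        show "d \<odot>\<^bsub>?RN\<^esub> v \<in> carrier ?RN" by (rule RN.smult_closed) (use v in simp_all)
        fix e assume e: "e \<in> some_basis ?RN"
        note \<kappa> = functional_coordinates[OF LRN some_basis[OF frN] e]
        let ?k = "\<lambda>v. coordinates ?RN (some_basis ?RN) v e"
        have "functional ?RN (\<lambda>v. ?k (\<pi> v) - d * ?k v)"
          using functional_compose[OF \<pi>(1) \<kappa>] \<kappa> unfolding functional_def by (auto simp: algebra_simps)
        then have "?k (\<pi> v) - d * ?k v = 0"
        proof (rule vanish)
          fix x assume x: "x \<in> N'"
          then have "?k (\<pi> x) = d * ?k x"
            using \<pi>(3)[OF x] functional_smult[OF \<kappa>, of x d] N'N by auto
          then show "?k (\<pi> x) - d * ?k x = 0" by simp
        qed (use v in simp)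
        then show "?k (\<pi> v) = ?k (d \<odot>\<^bsub>?RN\<^esub> v)" using functional_smult[OF \<kappa> v, of d] by simp
      qed
      then show ?thesis using \<pi>(2)[OF v] by simp
    qed
    then show "\<exists>d. d \<noteq> 0 \<and> (\<forall>v\<in>carrier ?N. (d \<odot> \<one>) \<odot>\<^bsub>?N\<^esub> v \<in> N')"
      using d by auto
  qed
  then show ?thesis by blast
qed

end

sublocale psp_alg \<subseteq> FA: frac_alg A
  by unfold_locales

context psp_alg
begin

text \<open>
  Averaging a linear almost retraction onto a submodule \<open>N\<close> yields a homomorphism with image
  in \<open>N\<close>, which on \<open>N\<close> is multiplication by \<open>d\<close> times the relative projective element, that is, by the
  nonzero scalar \<open>d lam\<close>. As the averaged map divides a nonzero scalar, \<open>N\<close> contains a nonzero multiple of \<open>V\<close>.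
\<close>

lemma irreducible_lattice_of_endomorphisms:
  assumes PID: "principal_domain (type_ring :: 'r ring)" and lam: "lam \<noteq> 0"
    and V: "lattice_over A V" and nz: "carrier V \<noteq> {\<zero>\<^bsub>V\<^esub>}"
    and endo: "\<And>\<alpha>. \<lbrakk>module_map A V V \<alpha>; \<exists>v\<in>carrier V. \<alpha> v \<noteq> \<zero>\<^bsub>V\<^esub>\<rbrakk> \<Longrightarrow>
      \<exists>\<gamma> d. module_map A V V \<gamma> \<and> d \<noteq> 0 \<and> (\<forall>v\<in>carrier V. \<alpha> (\<gamma> v) = (d \<odot> \<one>) \<odot>\<^bsub>V\<^esub> v)"
  shows "irreducible_lattice A V"
proof (rule FA.irreducible_latticeI[OF V nz])
  note LV = lattice_overD(1)[OF V] and fr = lattice_overD(2)[OF V]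
  let ?R = "restrict_scalars A V"
  interpret V: left_module A V by (rule LV)
  fix N assume N: "submodule N A V" "N \<noteq> {\<zero>\<^bsub>V\<^esub>}"
  note ND = submoduleD[OF N(1)]
  note subR = FA.submodule_restrict_scalars[OF LV N(1)]
  obtain d \<pi> where d: "d \<noteq> 0" and \<pi>: "module_map type_ring ?R ?R \<pi>" "\<And>v. v \<in> carrier ?R \<Longrightarrow> \<pi> v \<in> N"
    "\<And>v. v \<in> N \<Longrightarrow> \<pi> v = d \<odot>\<^bsub>?R\<^esub> v"
    by (rule almost_retraction[OF fr subR free_submodule[OF PID fr subR]]) (rule that)
  have image: "casimir V V \<pi> v \<in> N" if v: "v \<in> carrier V" for v
  proof -
    interpret LN: left_module A "V\<lparr>carrier := N\<rparr>" by (rule left_module_submodule[OF LV N(1)])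
    have xN: "x \<odot>\<^bsub>V\<^esub> \<pi> (dual x \<odot>\<^bsub>V\<^esub> v) \<in> N" if "x \<in> E" for x
      using ND(5)[OF basis_in[OF that] \<pi>(2)] v that by (simp add: V.smult_closed)
    have "(\<Oplus>\<^bsub>V\<lparr>carrier := N\<rparr>\<^esub>x\<in>E. x \<odot>\<^bsub>V\<^esub> \<pi> (dual x \<odot>\<^bsub>V\<^esub> v)) \<in> carrier (V\<lparr>carrier := N\<rparr>)"
      using xN by (intro LN.M.finsum_closed) auto
    then show ?thesis
      unfolding casimir_def using finsum_submodule[OF LV N(1) xN, of E] by simp
  qed
  have on_N: "casimir V V \<pi> v = ((d * lam) \<odot> \<one>) \<odot>\<^bsub>V\<^esub> v" if v: "v \<in> N" for v
  proof -
    have vV: "v \<in> carrier V" using v ND(1) by auto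
    have "casimir V V \<pi> v = (\<Oplus>\<^bsub>V\<^esub>x\<in>E. (d \<odot> \<one>) \<odot>\<^bsub>V\<^esub> ((x \<otimes> dual x) \<odot>\<^bsub>V\<^esub> v))"
      unfolding casimir_def
    proof (rule V.M.finsum_cong')
      fix x assume x: "x \<in> E"
      have "\<pi> (dual x \<odot>\<^bsub>V\<^esub> v) = (d \<odot> \<one>) \<odot>\<^bsub>V\<^esub> (dual x \<odot>\<^bsub>V\<^esub> v)"
        using \<pi>(3)[OF ND(5)[OF dual_in[OF x] v]] by simp
      then show "x \<odot>\<^bsub>V\<^esub> \<pi> (dual x \<odot>\<^bsub>V\<^esub> v) = (d \<odot> \<one>) \<odot>\<^bsub>V\<^esub> ((x \<otimes> dual x) \<odot>\<^bsub>V\<^esub> v)"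
        using x vV by (simp add: V.smult_assoc[symmetric] V.smult_closed unit_mult mult_smult)
    qed (use vV in \<open>auto simp: V.smult_closed\<close>)
    also have "\<dots> = (d \<odot> \<one>) \<odot>\<^bsub>V\<^esub> (\<Oplus>\<^bsub>V\<^esub>x\<in>E. (x \<otimes> dual x) \<odot>\<^bsub>V\<^esub> v)"
      using vV by (intro V.smult_finsum[symmetric]) (auto simp: V.smult_closed)
    also have "(\<Oplus>\<^bsub>V\<^esub>x\<in>E. (x \<otimes> dual x) \<odot>\<^bsub>V\<^esub> v) = proj_elt \<odot>\<^bsub>V\<^esub> v"
      unfolding proj_elt_eq using vV by (intro action_finsum[OF LV, symmetric]) auto
    also have "(d \<odot> \<one>) \<odot>\<^bsub>V\<^esub> (proj_elt \<odot>\<^bsub>V\<^esub> v) = ((d * lam) \<odot> \<one>) \<odot>\<^bsub>V\<^esub> v"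
      using vV S.smult_assoc[of d lam \<one>] by (simp add: proj_scalar V.smult_assoc[symmetric] unit_mult)
    finally show ?thesis .
  qed
  obtain n where n: "n \<in> N" "n \<noteq> \<zero>\<^bsub>V\<^esub>" using N(2) ND(2) by blast
  have nV: "n \<in> carrier V" using n ND(1) by auto
  have "casimir V V \<pi> n \<noteq> \<zero>\<^bsub>V\<^esub>"
    using free_torsion_free[OF fr, of n "d * lam"] n nV d lam by (auto simp: on_N)
  then obtain \<gamma> d' where \<gamma>: "module_map A V V \<gamma>" "d' \<noteq> 0"
    "\<And>v. v \<in> carrier V \<Longrightarrow> casimir V V \<pi> (\<gamma> v) = (d' \<odot> \<one>) \<odot>\<^bsub>V\<^esub> v"
    using endo[OF casimir_module_map[OF LV LV \<pi>(1)]] nV by blast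
  then have "(d' \<odot> \<one>) \<odot>\<^bsub>V\<^esub> v \<in> N" if "v \<in> carrier V" for v
    using image[OF module_map_closed[OF \<gamma>(1) that]] that by simp
  then show "\<exists>d. d \<noteq> 0 \<and> (\<forall>v\<in>carrier V. (d \<odot> \<one>) \<odot>\<^bsub>V\<^esub> v \<in> N)"
    using \<gamma>(2) by blast
qed

end

section \<open>Indecomposable modules\<close>

text \<open>
  Indecomposability in terms of endomorphisms, which an equivalence preserves: a decomposition
  defines the projection onto its first summand.
\<close>

lemma indecomposable_moduleI:
  assumes V: "left_module R V" and nz: "carrier V \<noteq> {\<zero>\<^bsub>V\<^esub>}"
    and idem: "\<And>\<epsilon>. \<lbrakk>module_map R V V \<epsilon>; \<And>x. x \<in> carrier V \<Longrightarrow> \<epsilon> (\<epsilon> x) = \<epsilon> x\<rbrakk> \<Longrightarrow>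
      (\<forall>x\<in>carrier V. \<epsilon> x = \<zero>\<^bsub>V\<^esub>) \<or> (\<forall>x\<in>carrier V. \<epsilon> x = x)"
  shows "indecomposable_module R V"
  unfolding indecomposable_module_def
proof (intro conjI V nz allI impI)
  interpret V: left_module R V by (rule V)
  fix W1 W2
  assume W: "submodule W1 R V \<and> submodule W2 R V \<and> W1 <+>\<^bsub>V\<^esub> W2 = carrier V \<and> W1 \<inter> W2 = {\<zero>\<^bsub>V\<^esub>}"
  then have W1: "submodule W1 R V" and W2: "submodule W2 R V" by auto
  note D1 = submoduleD[OF W1] and D2 = submoduleD[OF W2]
  have c1: "w \<in> carrier V" if "w \<in> W1" for w using D1(1) that by auto
  have c2: "w \<in> carrier V" if "w \<in> W2" for w using D2(1) that by auto
  have dec: "\<exists>a. a \<in> W1 \<and> (\<exists>b\<in>W2. x = a \<oplus>\<^bsub>V\<^esub> b)" if "x \<in> carrier V" for x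
  proof -
    have "x \<in> W1 <+>\<^bsub>V\<^esub> W2" using W that by simp
    then show ?thesis by (auto simp: set_add_def set_mult_def)
  qed
  have uniq: "a = a'" if "a \<in> W1" "b \<in> W2" "a' \<in> W1" "b' \<in> W2" "a \<oplus>\<^bsub>V\<^esub> b = a' \<oplus>\<^bsub>V\<^esub> b'" for a b a' b'
  proof -
    note c = c1[OF that(1)] c2[OF that(2)] c1[OF that(3)] c2[OF that(4)]
    have "a \<oplus>\<^bsub>V\<^esub> \<ominus>\<^bsub>V\<^esub> a' = (a \<oplus>\<^bsub>V\<^esub> b) \<oplus>\<^bsub>V\<^esub> (\<ominus>\<^bsub>V\<^esub> b \<oplus>\<^bsub>V\<^esub> \<ominus>\<^bsub>V\<^esub> a')"
      using c by (simp add: V.M.a_assoc V.M.r_neg2)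
    also have "\<dots> = (b' \<oplus>\<^bsub>V\<^esub> a') \<oplus>\<^bsub>V\<^esub> (\<ominus>\<^bsub>V\<^esub> a' \<oplus>\<^bsub>V\<^esub> \<ominus>\<^bsub>V\<^esub> b)"
      unfolding that(5) using c V.M.a_comm[of a' b'] V.M.a_comm[of "\<ominus>\<^bsub>V\<^esub> b" "\<ominus>\<^bsub>V\<^esub> a'"] by simp
    also have "\<dots> = b' \<oplus>\<^bsub>V\<^esub> \<ominus>\<^bsub>V\<^esub> b"
      using c by (simp add: V.M.a_assoc V.M.r_neg2)
    finally have eq: "a \<oplus>\<^bsub>V\<^esub> \<ominus>\<^bsub>V\<^esub> a' = b' \<oplus>\<^bsub>V\<^esub> \<ominus>\<^bsub>V\<^esub> b" .
    have "a \<oplus>\<^bsub>V\<^esub> \<ominus>\<^bsub>V\<^esub> a' \<in> W1" using that D1(3,4) by simp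
    moreover have "b' \<oplus>\<^bsub>V\<^esub> \<ominus>\<^bsub>V\<^esub> b \<in> W2" using that D2(3,4) by simp
    ultimately have "a \<oplus>\<^bsub>V\<^esub> \<ominus>\<^bsub>V\<^esub> a' = \<zero>\<^bsub>V\<^esub>" using eq W by auto
    then have "\<ominus>\<^bsub>V\<^esub> (\<ominus>\<^bsub>V\<^esub> a') = a" using that c1 by (intro V.M.minus_equality) auto
    then show ?thesis using that c1 by simp
  qed
  \<comment> \<open>The projection onto \<open>W1\<close> along \<open>W2\<close>.\<close>
  define \<epsilon> where "\<epsilon> x = (SOME a. a \<in> W1 \<and> (\<exists>b\<in>W2. x = a \<oplus>\<^bsub>V\<^esub> b))" for x
  have \<epsilon>: "\<epsilon> x \<in> W1 \<and> (\<exists>b\<in>W2. x = \<epsilon> x \<oplus>\<^bsub>V\<^esub> b)" if "x \<in> carrier V" for x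
    unfolding \<epsilon>_def by (rule someI_ex[OF dec[OF that]])
  have \<epsilon>_eq: "\<epsilon> (a \<oplus>\<^bsub>V\<^esub> b) = a" if ab: "a \<in> W1" "b \<in> W2" for a b
  proof -
    have "a \<oplus>\<^bsub>V\<^esub> b \<in> carrier V" using ab c1 c2 by simp
    from \<epsilon>[OF this] obtain b' where "\<epsilon> (a \<oplus>\<^bsub>V\<^esub> b) \<in> W1" "b' \<in> W2" "a \<oplus>\<^bsub>V\<^esub> b = \<epsilon> (a \<oplus>\<^bsub>V\<^esub> b) \<oplus>\<^bsub>V\<^esub> b'"
      by auto
    then show ?thesis using uniq ab by metis
  qed
  have \<epsilon>1: "\<epsilon> a = a" if "a \<in> W1" for a
    using \<epsilon>_eq[OF that D2(2)] c1[OF that] by simp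
  have \<epsilon>2: "\<epsilon> b = \<zero>\<^bsub>V\<^esub>" if "b \<in> W2" for b
    using \<epsilon>_eq[OF D1(2) that] c2[OF that] by simp
  have "module_map R V V \<epsilon>"
    unfolding module_map_def
  proof (intro conjI ballI)
    fix x assume x: "x \<in> carrier V"
    then show "\<epsilon> x \<in> carrier V" using \<epsilon> c1 by blast
    obtain b where b: "\<epsilon> x \<in> W1" "b \<in> W2" "x = \<epsilon> x \<oplus>\<^bsub>V\<^esub> b" using \<epsilon>[OF x] by auto
    fix y assume y: "y \<in> carrier V"
    obtain b' where b': "\<epsilon> y \<in> W1" "b' \<in> W2" "y = \<epsilon> y \<oplus>\<^bsub>V\<^esub> b'" using \<epsilon>[OF y] by auto
    have "x \<oplus>\<^bsub>V\<^esub> y = (\<epsilon> x \<oplus>\<^bsub>V\<^esub> b) \<oplus>\<^bsub>V\<^esub> (\<epsilon> y \<oplus>\<^bsub>V\<^esub> b')" using b(3) b'(3) by simp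
    also have "\<dots> = (\<epsilon> x \<oplus>\<^bsub>V\<^esub> \<epsilon> y) \<oplus>\<^bsub>V\<^esub> (b \<oplus>\<^bsub>V\<^esub> b')"
      using c1[OF b(1)] c2[OF b(2)] c1[OF b'(1)] c2[OF b'(2)] by (simp add: V.M.a_ac)
    finally show "\<epsilon> (x \<oplus>\<^bsub>V\<^esub> y) = \<epsilon> x \<oplus>\<^bsub>V\<^esub> \<epsilon> y"
      using \<epsilon>_eq D1(3)[OF b(1) b'(1)] D2(3)[OF b(2) b'(2)] by simp
  next
    fix a x assume a: "a \<in> carrier R" and x: "x \<in> carrier V"
    obtain b where b: "\<epsilon> x \<in> W1" "b \<in> W2" "x = \<epsilon> x \<oplus>\<^bsub>V\<^esub> b" using \<epsilon>[OF x] by auto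
    have "a \<odot>\<^bsub>V\<^esub> x = a \<odot>\<^bsub>V\<^esub> (\<epsilon> x \<oplus>\<^bsub>V\<^esub> b)" using b(3) by simp
    also have "\<dots> = a \<odot>\<^bsub>V\<^esub> \<epsilon> x \<oplus>\<^bsub>V\<^esub> a \<odot>\<^bsub>V\<^esub> b"
      by (rule V.smult_r_distr[OF a c1[OF b(1)] c2[OF b(2)]])
    finally show "\<epsilon> (a \<odot>\<^bsub>V\<^esub> x) = a \<odot>\<^bsub>V\<^esub> \<epsilon> x"
      using \<epsilon>_eq D1(5)[OF a b(1)] D2(5)[OF a b(2)] by simp
  qed
  moreover have "\<epsilon> (\<epsilon> x) = \<epsilon> x" if "x \<in> carrier V" for x
    using \<epsilon>1 \<epsilon>[OF that] by blast
  ultimately have "(\<forall>x\<in>carrier V. \<epsilon> x = \<zero>\<^bsub>V\<^esub>) \<or> (\<forall>x\<in>carrier V. \<epsilon> x = x)" by (rule idem)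
  then show "W1 = {\<zero>\<^bsub>V\<^esub>} \<or> W2 = {\<zero>\<^bsub>V\<^esub>}"
  proof
    assume "\<forall>x\<in>carrier V. \<epsilon> x = \<zero>\<^bsub>V\<^esub>"
    then have "w = \<zero>\<^bsub>V\<^esub>" if "w \<in> W1" for w using \<epsilon>1[OF that] c1[OF that] by simp
    then show ?thesis using D1(2) by blast
  next
    assume "\<forall>x\<in>carrier V. \<epsilon> x = x"
    then have "w = \<zero>\<^bsub>V\<^esub>" if "w \<in> W2" for w using \<epsilon>2[OF that] c2[OF that] by simp
    then show ?thesis using D2(2) by blast
  qed
qed

lemma indecomposable_module_idempotent:
  assumes V: "indecomposable_module R V" and \<epsilon>: "module_map R V V \<epsilon>"
    and idem: "\<And>x. x \<in> carrier V \<Longrightarrow> \<epsilon> (\<epsilon> x) = \<epsilon> x"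
  shows "(\<forall>x\<in>carrier V. \<epsilon> x = \<zero>\<^bsub>V\<^esub>) \<or> (\<forall>x\<in>carrier V. \<epsilon> x = x)"
proof -
  have L: "left_module R V" using V by (simp add: indecomposable_module_def)
  interpret V: left_module R V by (rule L)
  note c = module_map_closed[OF \<epsilon>]
  let ?W1 = "\<epsilon> ` carrier V" and ?W2 = "{x \<in> carrier V. \<epsilon> x = \<zero>\<^bsub>V\<^esub>}"
  have cV: "submodule (carrier V) R V" by (rule submoduleI[OF L]) (auto simp: V.smult_closed)
  have "submodule ?W1 R V" by (rule submodule_image[OF L L \<epsilon> cV])
  moreover have "submodule ?W2 R V" by (rule submodule_kernel[OF L L \<epsilon>])
  moreover have diff: "x \<oplus>\<^bsub>V\<^esub> \<ominus>\<^bsub>V\<^esub> \<epsilon> x \<in> ?W2" if "x \<in> carrier V" for x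
    using that idem[OF that] by (simp add: c module_map_add[OF \<epsilon>] module_map_minus[OF L L \<epsilon>] V.M.r_neg)
  have sum: "x = \<epsilon> x \<oplus>\<^bsub>V\<^esub> (x \<oplus>\<^bsub>V\<^esub> \<ominus>\<^bsub>V\<^esub> \<epsilon> x)" if "x \<in> carrier V" for x
    using that c[OF that] by (simp add: V.M.a_lcomm V.M.r_neg)
  have "?W1 <+>\<^bsub>V\<^esub> ?W2 = carrier V"
  proof
    show "?W1 <+>\<^bsub>V\<^esub> ?W2 \<subseteq> carrier V" by (auto simp: set_add_def set_mult_def c)
    show "carrier V \<subseteq> ?W1 <+>\<^bsub>V\<^esub> ?W2"
    proof
      fix x assume x: "x \<in> carrier V"
      then have "\<epsilon> x \<in> ?W1" by simp
      then show "x \<in> ?W1 <+>\<^bsub>V\<^esub> ?W2"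
        using diff[OF x] sum[OF x] unfolding set_add_def set_mult_def by force
    qed
  qed
  moreover have "?W1 \<inter> ?W2 = {\<zero>\<^bsub>V\<^esub>}"
  proof
    show "?W1 \<inter> ?W2 \<subseteq> {\<zero>\<^bsub>V\<^esub>}" using idem by auto
    have "\<zero>\<^bsub>V\<^esub> \<in> ?W1" using module_map_zero[OF L L \<epsilon>] V.M.zero_closed by (metis imageI)
    then show "{\<zero>\<^bsub>V\<^esub>} \<subseteq> ?W1 \<inter> ?W2" using module_map_zero[OF L L \<epsilon>] by simp
  qed
  ultimately have "?W1 = {\<zero>\<^bsub>V\<^esub>} \<or> ?W2 = {\<zero>\<^bsub>V\<^esub>}"
    using V unfolding indecomposable_module_def by blast
  then show ?thesis
  proof
    assume "?W2 = {\<zero>\<^bsub>V\<^esub>}"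
    then have "x \<oplus>\<^bsub>V\<^esub> \<ominus>\<^bsub>V\<^esub> \<epsilon> x = \<zero>\<^bsub>V\<^esub>" if "x \<in> carrier V" for x using diff[OF that] by simp
    then have "\<epsilon> x = x" if "x \<in> carrier V" for x
      using sum[OF that] c[OF that] that by simp
    then show ?thesis by blast
  qed blast
qed

lemma indecomposable_module_iso:
  assumes V: "indecomposable_module R V" and W: "left_module R W" and f: "module_map R V W f"
    and bij: "bij_betw f (carrier V) (carrier W)"
  shows "indecomposable_module R W"
proof (rule indecomposable_moduleI[OF W])
  have L: "left_module R V" and nz: "carrier V \<noteq> {\<zero>\<^bsub>V\<^esub>}" using V by (simp_all add: indecomposable_module_def)
  interpret V: left_module R V by (rule L)
  let ?g = "inv_into (carrier V) f"
  note g = module_map_inverse[OF L f bij]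
  have fg: "f (?g y) = y" if "y \<in> carrier W" for y
    using bij that by (auto simp: bij_betw_def f_inv_into_f)
  have gf: "?g (f x) = x" if "x \<in> carrier V" for x
    using bij that by (auto simp: bij_betw_def)
  show "carrier W \<noteq> {\<zero>\<^bsub>W\<^esub>}"
  proof
    assume W0: "carrier W = {\<zero>\<^bsub>W\<^esub>}"
    have "x = \<zero>\<^bsub>V\<^esub>" if "x \<in> carrier V" for x
      using gf[OF that] gf[OF V.M.zero_closed] module_map_closed[OF f that]
        module_map_closed[OF f V.M.zero_closed] W0 by auto
    then show False using nz by auto
  qed
  fix \<epsilon> assume \<epsilon>: "module_map R W W \<epsilon>" and idem: "\<And>x. x \<in> carrier W \<Longrightarrow> \<epsilon> (\<epsilon> x) = \<epsilon> x"
  note c = module_map_closed[OF \<epsilon>] and fc = module_map_closed[OF f] and gc = module_map_closed[OF g]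
  have "(\<forall>x\<in>carrier V. ?g (\<epsilon> (f x)) = \<zero>\<^bsub>V\<^esub>) \<or> (\<forall>x\<in>carrier V. ?g (\<epsilon> (f x)) = x)"
    by (rule indecomposable_module_idempotent[OF V module_map_compose[OF module_map_compose[OF f \<epsilon>] g]])
      (simp add: fg c fc idem)
  then show "(\<forall>x\<in>carrier W. \<epsilon> x = \<zero>\<^bsub>W\<^esub>) \<or> (\<forall>x\<in>carrier W. \<epsilon> x = x)"
  proof
    assume 0: "\<forall>x\<in>carrier V. ?g (\<epsilon> (f x)) = \<zero>\<^bsub>V\<^esub>"
    have "\<epsilon> y = \<zero>\<^bsub>W\<^esub>" if "y \<in> carrier W" for y
      using 0[rule_format, OF gc[OF that]] fg[OF that] fg[OF c[OF that]] module_map_zero[OF L W f] by simp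
    then show ?thesis by blast
  next
    assume 1: "\<forall>x\<in>carrier V. ?g (\<epsilon> (f x)) = x"
    have "\<epsilon> y = y" if "y \<in> carrier W" for y
      using 1[rule_format, OF gc[OF that]] fg[OF that] fg[OF c[OF that]] by simp
    then show ?thesis by blast
  qed
qed

context equivalence
begin

lemma image_nonzero:
  assumes V: "left_module A V" and nz: "carrier V \<noteq> {\<zero>\<^bsub>V\<^esub>}"
  shows "carrier (Fo V) \<noteq> {\<zero>\<^bsub>Fo V\<^esub>}"
proof
  assume F0: "carrier (Fo V) = {\<zero>\<^bsub>Fo V\<^esub>}"
  interpret V: left_module A V by (rule V)
  have z: "module_map A V V (\<lambda>x. \<zero>\<^bsub>V\<^esub>)" by (simp add: module_map_def V.smult_r_zero)
  have "x = \<zero>\<^bsub>V\<^esub>" if "x \<in> carrier V" for x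
    by (rule faithful[OF V V module_map_id z _ that])
      (use F0 module_map_closed[OF F.map[OF V V module_map_id]] module_map_closed[OF F.map[OF V V z]] in auto)
  then show False using nz by auto
qed

lemma image_bij_iff:
  assumes V: "left_module A V" and \<alpha>: "module_map A V V \<alpha>"
  shows "bij_betw (F.Fmap V V \<alpha>) (carrier (Fo V)) (carrier (Fo V)) \<longleftrightarrow> bij_betw \<alpha> (carrier V) (carrier V)"
proof
  note FV = F.ob[OF V] and F\<alpha> = F.map[OF V V \<alpha>]
  assume bij: "bij_betw \<alpha> (carrier V) (carrier V)"
  let ?b = "inv_into (carrier V) \<alpha>"
  have b: "module_map A V V ?b" by (rule module_map_inverse[OF V \<alpha> bij])
  show "bij_betw (F.Fmap V V \<alpha>) (carrier (Fo V)) (carrier (Fo V))"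
  proof (rule bij_betw_byWitness[where f' = "F.Fmap V V ?b"])
    show "\<forall>y\<in>carrier (Fo V). F.Fmap V V ?b (F.Fmap V V \<alpha> y) = y"
    proof
      fix y assume y: "y \<in> carrier (Fo V)"
      have "F.Fmap V V (\<lambda>x. ?b (\<alpha> x)) = F.Fmap V V (\<lambda>x. x)"
        by (rule F.map_cong) (use bij in \<open>auto simp: bij_betw_def\<close>)
      then show "F.Fmap V V ?b (F.Fmap V V \<alpha> y) = y"
        using F.map_compose[OF V V V \<alpha> b y] F.map_id[OF V y] by simp
    qed
    show "\<forall>y\<in>carrier (Fo V). F.Fmap V V \<alpha> (F.Fmap V V ?b y) = y"
    proof
      fix y assume y: "y \<in> carrier (Fo V)"
      have "F.Fmap V V (\<lambda>x. \<alpha> (?b x)) = F.Fmap V V (\<lambda>x. x)"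
        by (rule F.map_cong) (use bij in \<open>auto simp: bij_betw_def f_inv_into_f\<close>)
      then show "F.Fmap V V \<alpha> (F.Fmap V V ?b y) = y"
        using F.map_compose[OF V V V b \<alpha> y] F.map_id[OF V y] by simp
    qed
  qed (use module_map_closed[OF F\<alpha>] module_map_closed[OF F.map[OF V V b]] in auto)
next
  note FV = F.ob[OF V] and F\<alpha> = F.map[OF V V \<alpha>]
  assume bij: "bij_betw (F.Fmap V V \<alpha>) (carrier (Fo V)) (carrier (Fo V))"
  let ?c = "inv_into (carrier (Fo V)) (F.Fmap V V \<alpha>)"
  obtain \<beta> where \<beta>: "module_map A V V \<beta>" "\<And>y. y \<in> carrier (Fo V) \<Longrightarrow> F.Fmap V V \<beta> y = ?c y"
    by (rule full[OF V V module_map_inverse[OF FV F\<alpha> bij]]) (rule that)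
  have "\<beta> (\<alpha> x) = x" if x: "x \<in> carrier V" for x
  proof (rule faithful[OF V V module_map_compose[OF \<alpha> \<beta>(1)] module_map_id _ x])
    fix y assume y: "y \<in> carrier (Fo V)"
    show "F.Fmap V V (\<lambda>x. \<beta> (\<alpha> x)) y = F.Fmap V V (\<lambda>x. x) y"
      using F.map_compose[OF V V V \<alpha> \<beta>(1) y] F.map_id[OF V y] \<beta>(2)[OF module_map_closed[OF F\<alpha> y]] bij y
      by (simp add: bij_betw_def)
  qed
  moreover have "\<alpha> (\<beta> x) = x" if x: "x \<in> carrier V" for x
  proof (rule faithful[OF V V module_map_compose[OF \<beta>(1) \<alpha>] module_map_id _ x])
    fix y assume y: "y \<in> carrier (Fo V)"
    show "F.Fmap V V (\<lambda>x. \<alpha> (\<beta> x)) y = F.Fmap V V (\<lambda>x. x) y"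
      using F.map_compose[OF V V V \<beta>(1) \<alpha> y] F.map_id[OF V y] \<beta>(2)[OF y] bij y
      by (simp add: bij_betw_def f_inv_into_f)
  qed
  ultimately show "bij_betw \<alpha> (carrier V) (carrier V)"
    by (intro bij_betw_byWitness[where f' = \<beta>])
      (use module_map_closed[OF \<alpha>] module_map_closed[OF \<beta>(1)] in auto)
qed

lemma indecomposable_image:
  assumes V: "indecomposable_module A V"
  shows "indecomposable_module B (Fo V)"
proof -
  have L: "left_module A V" and nz: "carrier V \<noteq> {\<zero>\<^bsub>V\<^esub>}" using V by (simp_all add: indecomposable_module_def)
  note FV = F.ob[OF L]
  show ?thesis
  proof (rule indecomposable_moduleI[OF FV image_nonzero[OF L nz]])
    fix \<epsilon>' assume \<epsilon>': "module_map B (Fo V) (Fo V) \<epsilon>'" and idem': "\<And>y. y \<in> carrier (Fo V) \<Longrightarrow> \<epsilon>' (\<epsilon>' y) = \<epsilon>' y"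
    obtain \<epsilon> where \<epsilon>: "module_map A V V \<epsilon>" "\<And>y. y \<in> carrier (Fo V) \<Longrightarrow> F.Fmap V V \<epsilon> y = \<epsilon>' y"
      by (rule full[OF L L \<epsilon>']) (rule that)
    have "\<epsilon> (\<epsilon> x) = \<epsilon> x" if x: "x \<in> carrier V" for x
    proof (rule faithful[OF L L module_map_compose[OF \<epsilon>(1) \<epsilon>(1)] \<epsilon>(1) _ x])
      fix y assume y: "y \<in> carrier (Fo V)"
      show "F.Fmap V V (\<lambda>x. \<epsilon> (\<epsilon> x)) y = F.Fmap V V \<epsilon> y"
        using F.map_compose[OF L L L \<epsilon>(1) \<epsilon>(1) y] \<epsilon>(2) y idem'[OF y] module_map_closed[OF \<epsilon>' y] by simp
    qed
    from indecomposable_module_idempotent[OF V \<epsilon>(1) this]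
    show "(\<forall>x\<in>carrier (Fo V). \<epsilon>' x = \<zero>\<^bsub>Fo V\<^esub>) \<or> (\<forall>x\<in>carrier (Fo V). \<epsilon>' x = x)"
    proof
      assume "\<forall>x\<in>carrier V. \<epsilon> x = \<zero>\<^bsub>V\<^esub>"
      then have "F.Fmap V V \<epsilon> = F.Fmap V V (\<lambda>x. \<zero>\<^bsub>V\<^esub>)" by (intro F.map_cong) auto
      then show ?thesis using \<epsilon>(2) F.map_zero[OF L L] by auto
    next
      assume "\<forall>x\<in>carrier V. \<epsilon> x = x"
      then have "F.Fmap V V \<epsilon> = F.Fmap V V (\<lambda>x. x)" by (intro F.map_cong) auto
      then show ?thesis using \<epsilon>(2) F.map_id[OF L] by auto
    qed
  qed
qed

end

section \<open>Knoerr lattices\<close>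

lemma type_ring_PIdl: "PIdl\<^bsub>(type_ring :: 'o::idom ring)\<^esub> a = {x. a dvd x}"
  by (auto simp: cgenideal_def dvd_def mult.commute)

lemma type_ring_PIdl_subset: "PIdl\<^bsub>(type_ring :: 'o::idom ring)\<^esub> a \<subseteq> PIdl\<^bsub>type_ring\<^esub> b \<longleftrightarrow> b dvd a"
  unfolding type_ring_PIdl
proof
  assume "{x. a dvd x} \<subseteq> {x. b dvd x}"
  moreover have "a \<in> {x. a dvd x}" by simp
  ultimately show "b dvd a" by blast
next
  assume "b dvd a"
  then show "{x. a dvd x} \<subseteq> {x. b dvd x}" using dvd_trans[of b a] by auto
qed

abbreviation lattice_trace :: "('o::idom, 'a) module \<Rightarrow> ('a, 'v) module \<Rightarrow> ('v \<Rightarrow> 'v) \<Rightarrow> 'o" where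
  "lattice_trace A V \<equiv> module_trace (restrict_scalars A V)"

lemma knoerr_lattice_iff:
  fixes A :: "('o::idom, 'a) module" and V :: "('a, 'v) module"
  shows "knoerr_lattice A V \<longleftrightarrow> lattice_over A V \<and> indecomposable_module A V \<and>
    (\<forall>\<alpha>. module_map A V V \<alpha> \<longrightarrow> of_nat (lattice_rank A V) dvd lattice_trace A V \<alpha> \<and>
      (lattice_trace A V \<alpha> dvd of_nat (lattice_rank A V) \<longleftrightarrow> bij_betw \<alpha> (carrier V) (carrier V)))"
proof (cases "lattice_over A V")
  case True
  let ?t = "lattice_trace A V" and ?r = "of_nat (lattice_rank A V) :: 'o"
  note L = lattice_overD(1)[OF True] and fr = lattice_overD(2)[OF True]
  have "(\<forall>\<alpha>\<in>module_Hom A V V. PIdl\<^bsub>type_ring\<^esub> (?t \<alpha>) \<subseteq> PIdl\<^bsub>type_ring\<^esub> ?r \<and>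
      (PIdl\<^bsub>type_ring\<^esub> (?t \<alpha>) = PIdl\<^bsub>type_ring\<^esub> ?r \<longleftrightarrow> \<alpha> \<in> module_Iso A V V)) \<longleftrightarrow>
    (\<forall>\<alpha>. module_map A V V \<alpha> \<longrightarrow> ?r dvd ?t \<alpha> \<and> (?t \<alpha> dvd ?r \<longleftrightarrow> bij_betw \<alpha> (carrier V) (carrier V)))"
    (is "?lhs \<longleftrightarrow> ?rhs")
  proof
    assume l: ?lhs
    show ?rhs
    proof (intro allI impI)
      fix \<alpha> assume \<alpha>: "module_map A V V \<alpha>"
      let ?a = "restrict \<alpha> (carrier V)"
      have a: "?a \<in> module_Hom A V V" using \<alpha> L by (simp add: module_Hom_iff)
      have t: "?t ?a = ?t \<alpha>" by (rule module_trace_cong[OF fr]) simp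
      have b: "bij_betw ?a (carrier V) (carrier V) \<longleftrightarrow> bij_betw \<alpha> (carrier V) (carrier V)"
        by (rule bij_betw_cong) simp
      show "?r dvd ?t \<alpha> \<and> (?t \<alpha> dvd ?r \<longleftrightarrow> bij_betw \<alpha> (carrier V) (carrier V))"
        using l[rule_format, OF a] a unfolding set_eq_subset type_ring_PIdl_subset t module_Iso_def by (auto simp: b)
    qed
  next
    assume r: ?rhs
    show ?lhs
    proof
      fix \<alpha> assume \<alpha>: "\<alpha> \<in> module_Hom A V V"
      then show "PIdl\<^bsub>type_ring\<^esub> (?t \<alpha>) \<subseteq> PIdl\<^bsub>type_ring\<^esub> ?r \<and>
          (PIdl\<^bsub>type_ring\<^esub> (?t \<alpha>) = PIdl\<^bsub>type_ring\<^esub> ?r \<longleftrightarrow> \<alpha> \<in> module_Iso A V V)"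
        using r[rule_format, of \<alpha>] unfolding set_eq_subset type_ring_PIdl_subset module_Iso_def
        by (auto simp: module_Hom_iff)
    qed
  qed
  then show ?thesis by (simp add: knoerr_lattice_def)
qed (simp add: knoerr_lattice_def)

lemma lattice_trace_iso:
  assumes A: "assoc_algebra A" and V: "lattice_over A V" and W: "lattice_over A W"
    and f: "module_map A V W f" and bij: "bij_betw f (carrier V) (carrier W)"
    and \<beta>: "module_map A V V \<beta>"
    and \<alpha>: "\<And>y. y \<in> carrier W \<Longrightarrow> \<alpha> y = f (\<beta> (inv_into (carrier V) f y))"
  shows "lattice_trace A W \<alpha> = lattice_trace A V \<beta>"
proof -
  interpret A: assoc_alg A by (rule assoc_alg.intro[OF A])
  show ?thesis
  proof (rule module_trace_conjugate[OF lattice_overD(2)[OF V] lattice_overD(2)[OF W]])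
    show "module_map type_ring (restrict_scalars A V) (restrict_scalars A W) f"
      "module_map type_ring (restrict_scalars A V) (restrict_scalars A V) \<beta>"
      by (intro A.module_map_restrict_scalars f \<beta>)+
    show "module_map type_ring (restrict_scalars A W) (restrict_scalars A V) (inv_into (carrier V) f)"
      by (intro A.module_map_restrict_scalars module_map_inverse[OF lattice_overD(1)[OF V] f bij])
  qed (use bij \<alpha> in \<open>auto simp: bij_betw_def\<close>)
qed

lemma lattice_trace_id: "lattice_over A V \<Longrightarrow> lattice_trace A V (\<lambda>x. x) = of_nat (lattice_rank A V)"
  using module_trace_id[OF lattice_overD(2)] by (simp add: lattice_rank_def)

lemma lattice_rank_iso:
  fixes A :: "('o::idom, 'a) module"
  assumes A: "assoc_algebra A" and V: "lattice_over A V" and W: "lattice_over A W"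
    and f: "module_map A V W f" and bij: "bij_betw f (carrier V) (carrier W)"
  shows "(of_nat (lattice_rank A W) :: 'o) = of_nat (lattice_rank A V)"
  using lattice_trace_iso[OF assms module_map_id, of "\<lambda>x. x"] bij
  by (simp add: lattice_trace_id V W bij_betw_def f_inv_into_f)

lemma lattice_rank_nonzero:
  assumes V: "lattice_over A V" and nz: "carrier V \<noteq> {\<zero>\<^bsub>V\<^esub>}"
  shows "lattice_rank A V \<noteq> 0"
proof
  assume 0: "lattice_rank A V = 0"
  note fr = lattice_overD(2)[OF V]
  let ?E = "some_basis (restrict_scalars A V)"
  have "finite ?E" using some_basis[OF fr] by (simp add: is_finite_basis_def)
  then have "?E = {}" using 0 by (simp add: lattice_rank_def module_rank_def)
  interpret V: left_module A V by (rule lattice_overD(1)[OF V])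
  have "v = \<zero>\<^bsub>V\<^esub>" if "v \<in> carrier V" for v
    using coordinates_sum[OF some_basis[OF fr], of v] that \<open>?E = {}\<close> by simp
  then show False using nz V.M.zero_closed by blast
qed

lemma knoerr_lattice_iso:
  fixes A :: "('o::idom, 'a) module"
  assumes A: "assoc_algebra A" and V: "knoerr_lattice A V" and W: "lattice_over A W"
    and f: "module_map A V W f" and bij: "bij_betw f (carrier V) (carrier W)"
  shows "knoerr_lattice A W"
proof -
  have latV: "lattice_over A V" and ind: "indecomposable_module A V"
    and kn: "\<And>\<alpha>. module_map A V V \<alpha> \<Longrightarrow> of_nat (lattice_rank A V) dvd lattice_trace A V \<alpha> \<and>
      (lattice_trace A V \<alpha> dvd of_nat (lattice_rank A V) \<longleftrightarrow> bij_betw \<alpha> (carrier V) (carrier V))"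
    using V unfolding knoerr_lattice_iff by blast+
  note LV = lattice_overD(1)[OF latV] and LW = lattice_overD(1)[OF W]
  let ?g = "inv_into (carrier V) f"
  have g: "module_map A W V ?g" by (rule module_map_inverse[OF LV f bij])
  have gbij: "bij_betw ?g (carrier W) (carrier V)" by (rule bij_betw_inv_into[OF bij])
  have fg: "f (?g y) = y" if "y \<in> carrier W" for y
    using bij that by (auto simp: bij_betw_def f_inv_into_f)
  have gf: "?g (f x) = x" if "x \<in> carrier V" for x
    using bij that by (auto simp: bij_betw_def)
  show ?thesis
    unfolding knoerr_lattice_iff
  proof (intro conjI W allI impI)
    show "indecomposable_module A W" by (rule indecomposable_module_iso[OF ind LW f bij])
    fix \<alpha> assume \<alpha>: "module_map A W W \<alpha>"
    let ?b = "\<lambda>x. ?g (\<alpha> (f x))"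
    have b: "module_map A V V ?b" by (rule module_map_compose[OF module_map_compose[OF f \<alpha>] g])
    have t: "lattice_trace A W \<alpha> = lattice_trace A V ?b"
      by (rule lattice_trace_iso[OF A latV W f bij b]) (simp add: fg module_map_closed[OF \<alpha>])
    have r: "(of_nat (lattice_rank A W) :: 'o) = of_nat (lattice_rank A V)"
      by (rule lattice_rank_iso[OF A latV W f bij])
    have "bij_betw ?b (carrier V) (carrier V) \<longleftrightarrow> bij_betw \<alpha> (carrier W) (carrier W)"
    proof
      assume "bij_betw \<alpha> (carrier W) (carrier W)"
      from bij_betw_trans[OF bij_betw_trans[OF bij this] gbij] show "bij_betw ?b (carrier V) (carrier V)"
        by (simp add: comp_def)
    next
      assume "bij_betw ?b (carrier V) (carrier V)"
      from bij_betw_trans[OF bij_betw_trans[OF gbij this] bij]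
      have "bij_betw (\<lambda>y. f (?g (\<alpha> (f (?g y))))) (carrier W) (carrier W)" by (simp add: comp_def)
      then show "bij_betw \<alpha> (carrier W) (carrier W)"
        by (subst bij_betw_cong[of _ _ "\<lambda>y. f (?g (\<alpha> (f (?g y))))"]) (simp_all add: fg module_map_closed[OF \<alpha>])
    qed
    then show "of_nat (lattice_rank A W) dvd lattice_trace A W \<alpha>"
      "lattice_trace A W \<alpha> dvd of_nat (lattice_rank A W) \<longleftrightarrow> bij_betw \<alpha> (carrier W) (carrier W)"
      using kn[OF b] unfolding t r by auto
  qed
qed

context equivalence_psp
begin

text \<open>
  Take \<open>\<alpha> = 1\<close> in the trace formula; the central unit \<open>u\<close> acts as an automorphism, whose trace is
  associated with the rank by hypothesis. Both Knoerr lattices and irreducible lattices over a split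
  algebra satisfy the hypothesis.
\<close>

lemma rank_image:
  assumes V: "lattice_over A V"
    and aut: "\<And>\<alpha>. \<lbrakk>module_map A V V \<alpha>; bij_betw \<alpha> (carrier V) (carrier V)\<rbrakk> \<Longrightarrow>
      of_nat (lattice_rank A V) dvd lattice_trace A V \<alpha> \<and> lattice_trace A V \<alpha> dvd of_nat (lattice_rank A V)"
  shows "lam * of_nat (lattice_rank B (Fo V)) dvd lam' * of_nat (lattice_rank A V)"
    "lam' * of_nat (lattice_rank A V) dvd lam * of_nat (lattice_rank B (Fo V))"
proof -
  note L = lattice_overD(1)[OF V]
  interpret V: left_module A V by (rule L)
  obtain u v where u: "u \<in> carrier A" "v \<in> carrier A" "u \<otimes>\<^bsub>A\<^esub> v = \<one>\<^bsub>A\<^esub>" "v \<otimes>\<^bsub>A\<^esub> u = \<one>\<^bsub>A\<^esub>"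
    "\<And>a. a \<in> carrier A \<Longrightarrow> u \<otimes>\<^bsub>A\<^esub> a = a \<otimes>\<^bsub>A\<^esub> u"
    and tr: "\<And>V \<alpha>. \<lbrakk>lattice_over A V; module_map A V V \<alpha>\<rbrakk> \<Longrightarrow>
       lam * lattice_trace B (Fo V) (F.Fmap V V \<alpha>) = lam' * lattice_trace A V (\<lambda>v. \<alpha> (u \<odot>\<^bsub>V\<^esub> v))"
    by (rule central_unit_element) (rule that)
  have um: "module_map A V V (\<lambda>x. u \<odot>\<^bsub>V\<^esub> x)" by (rule A.module_map_central[OF L u(1)]) (rule u(5))
  have ub: "bij_betw (\<lambda>x. u \<odot>\<^bsub>V\<^esub> x) (carrier V) (carrier V)"
    by (rule bij_betw_byWitness[where f' = "\<lambda>x. v \<odot>\<^bsub>V\<^esub> x"])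
      (use u(1-4) in \<open>auto simp: V.smult_assoc[symmetric] V.smult_one V.smult_closed\<close>)
  have "lattice_trace B (Fo V) (F.Fmap V V (\<lambda>x. x)) = of_nat (lattice_rank B (Fo V))"
    using module_trace_cong[OF lattice_overD(2)[OF lattice_image[OF V]], of "F.Fmap V V (\<lambda>x. x)" "\<lambda>x. x"]
      F.map_id[OF L] lattice_trace_id[OF lattice_image[OF V]] by simp
  then have eq: "lam * of_nat (lattice_rank B (Fo V)) = lam' * lattice_trace A V (\<lambda>x. u \<odot>\<^bsub>V\<^esub> x)"
    using tr[OF V module_map_id] by simp
  show "lam * of_nat (lattice_rank B (Fo V)) dvd lam' * of_nat (lattice_rank A V)"
    "lam' * of_nat (lattice_rank A V) dvd lam * of_nat (lattice_rank B (Fo V))"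
    unfolding eq using aut[OF um ub] by (auto intro: mult_dvd_mono)
qed

text \<open>
  Multiplied by \<open>lam\<close>, the rank and the traces for \<open>F V\<close> become \<open>lam'\<close> times the rank of \<open>V\<close>,
  up to a unit, and \<open>lam'\<close> times the traces of the maps \<open>\<alpha> u\<close>; so divisibility on the one side
  is divisibility on the other.
\<close>

lemma knoerr_image:
  assumes V: "knoerr_lattice A V"
  shows "knoerr_lattice B (Fo V)"
proof -
  have latV: "lattice_over A V" and ind: "indecomposable_module A V"
    and kn: "\<And>\<alpha>. module_map A V V \<alpha> \<Longrightarrow> of_nat (lattice_rank A V) dvd lattice_trace A V \<alpha> \<and>
      (lattice_trace A V \<alpha> dvd of_nat (lattice_rank A V) \<longleftrightarrow> bij_betw \<alpha> (carrier V) (carrier V))"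
    using V unfolding knoerr_lattice_iff by blast+
  note L = lattice_overD(1)[OF latV]
  interpret V: left_module A V by (rule L)
  have rk: "lam * of_nat (lattice_rank B (Fo V)) dvd lam' * of_nat (lattice_rank A V)"
    "lam' * of_nat (lattice_rank A V) dvd lam * of_nat (lattice_rank B (Fo V))"
    using rank_image[OF latV] kn by blast+
  obtain u v where u: "u \<in> carrier A" "v \<in> carrier A" "u \<otimes>\<^bsub>A\<^esub> v = \<one>\<^bsub>A\<^esub>" "v \<otimes>\<^bsub>A\<^esub> u = \<one>\<^bsub>A\<^esub>"
    "\<And>a. a \<in> carrier A \<Longrightarrow> u \<otimes>\<^bsub>A\<^esub> a = a \<otimes>\<^bsub>A\<^esub> u"
    and tr: "\<And>V \<alpha>. \<lbrakk>lattice_over A V; module_map A V V \<alpha>\<rbrakk> \<Longrightarrow>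
       lam * lattice_trace B (Fo V) (F.Fmap V V \<alpha>) = lam' * lattice_trace A V (\<lambda>v. \<alpha> (u \<odot>\<^bsub>V\<^esub> v))"
    by (rule central_unit_element) (rule that)
  have um: "module_map A V V (\<lambda>x. u \<odot>\<^bsub>V\<^esub> x)" by (rule A.module_map_central[OF L u(1)]) (rule u(5))
  have ub: "bij_betw (\<lambda>x. u \<odot>\<^bsub>V\<^esub> x) (carrier V) (carrier V)"
    and vb: "bij_betw (\<lambda>x. v \<odot>\<^bsub>V\<^esub> x) (carrier V) (carrier V)"
    by (rule bij_betw_byWitness[where f' = "\<lambda>x. v \<odot>\<^bsub>V\<^esub> x"] bij_betw_byWitness[where f' = "\<lambda>x. u \<odot>\<^bsub>V\<^esub> x"];
        use u(1-4) in \<open>auto simp: V.smult_assoc[symmetric] V.smult_one V.smult_closed\<close>)+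
  show ?thesis
    unfolding knoerr_lattice_iff
  proof (intro conjI allI impI)
    show "lattice_over B (Fo V)" by (rule lattice_image[OF latV])
    show "indecomposable_module B (Fo V)" by (rule indecomposable_image[OF ind])
    fix \<alpha>' assume \<alpha>': "module_map B (Fo V) (Fo V) \<alpha>'"
    obtain \<alpha> where \<alpha>: "module_map A V V \<alpha>" "\<And>y. y \<in> carrier (Fo V) \<Longrightarrow> F.Fmap V V \<alpha> y = \<alpha>' y"
      by (rule full[OF L L \<alpha>']) (rule that)
    have t: "lattice_trace B (Fo V) \<alpha>' = lattice_trace B (Fo V) (F.Fmap V V \<alpha>)"
      by (rule module_trace_cong[OF lattice_overD(2)[OF lattice_image[OF latV]]]) (simp add: \<alpha>(2))
    let ?\<beta> = "\<lambda>x. \<alpha> (u \<odot>\<^bsub>V\<^esub> x)"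
    have \<beta>: "module_map A V V ?\<beta>" by (rule module_map_compose[OF um \<alpha>(1)])
    have t': "lam * lattice_trace B (Fo V) \<alpha>' = lam' * lattice_trace A V ?\<beta>"
      unfolding t by (rule tr[OF latV \<alpha>(1)])
    have b: "bij_betw \<alpha>' (carrier (Fo V)) (carrier (Fo V)) \<longleftrightarrow> bij_betw ?\<beta> (carrier V) (carrier V)"
    proof -
      have "bij_betw \<alpha>' (carrier (Fo V)) (carrier (Fo V)) \<longleftrightarrow> bij_betw \<alpha> (carrier V) (carrier V)"
        using image_bij_iff[OF L \<alpha>(1)] bij_betw_cong[of "carrier (Fo V)" "F.Fmap V V \<alpha>" \<alpha>'] \<alpha>(2) by simp
      also have "\<dots> \<longleftrightarrow> bij_betw ?\<beta> (carrier V) (carrier V)"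
      proof
        assume "bij_betw \<alpha> (carrier V) (carrier V)"
        from bij_betw_trans[OF ub this] show "bij_betw ?\<beta> (carrier V) (carrier V)" by (simp add: comp_def)
      next
        assume "bij_betw ?\<beta> (carrier V) (carrier V)"
        from bij_betw_trans[OF vb this]
        have "bij_betw (\<lambda>x. \<alpha> (u \<odot>\<^bsub>V\<^esub> (v \<odot>\<^bsub>V\<^esub> x))) (carrier V) (carrier V)" by (simp add: comp_def)
        moreover have "u \<odot>\<^bsub>V\<^esub> (v \<odot>\<^bsub>V\<^esub> x) = x" if "x \<in> carrier V" for x
          using V.smult_assoc[OF u(1,2) that] u(3) that by (simp add: V.smult_one)
        ultimately show "bij_betw \<alpha> (carrier V) (carrier V)"
          using bij_betw_cong[of "carrier V" "\<lambda>x. \<alpha> (u \<odot>\<^bsub>V\<^esub> (v \<odot>\<^bsub>V\<^esub> x))" \<alpha>] by simp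
      qed
      finally show ?thesis .
    qed
    have "lam * of_nat (lattice_rank B (Fo V)) dvd lam * lattice_trace B (Fo V) \<alpha>'"
      unfolding t' using dvd_trans[OF rk(1) mult_dvd_mono[OF dvd_refl]] kn[OF \<beta>] by blast
    then show "of_nat (lattice_rank B (Fo V)) dvd lattice_trace B (Fo V) \<alpha>'"
      using lam_nz by simp
    have "lattice_trace B (Fo V) \<alpha>' dvd of_nat (lattice_rank B (Fo V)) \<longleftrightarrow>
        lam * lattice_trace B (Fo V) \<alpha>' dvd lam * of_nat (lattice_rank B (Fo V))"
      using lam_nz by simp
    also have "\<dots> \<longleftrightarrow> lam' * lattice_trace A V ?\<beta> dvd lam' * of_nat (lattice_rank A V)"
      unfolding t' using rk dvd_trans by blast
    also have "\<dots> \<longleftrightarrow> bij_betw ?\<beta> (carrier V) (carrier V)"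
      using lam'_nz kn[OF \<beta>] by simp
    finally show "lattice_trace B (Fo V) \<alpha>' dvd of_nat (lattice_rank B (Fo V)) \<longleftrightarrow>
        bij_betw \<alpha>' (carrier (Fo V)) (carrier (Fo V))"
      unfolding b .
  qed
qed

text \<open>
  The property that every nonzero endomorphism divides a nonzero scalar is visibly preserved by a linear
  equivalence.
\<close>

lemma irreducible_image:
  assumes V: "irreducible_lattice A V"
  shows "irreducible_lattice B (Fo V)"
proof -
  have latV: "lattice_over A V" using V by (simp add: irreducible_lattice_def)
  note L = lattice_overD(1)[OF latV]
  note nz = irreducible_lattice_nonzero[OF V]
  interpret V: left_module A V by (rule L)
  have FA: "frac_alg A" by (rule frac_alg.intro) (rule A.assoc_alg_axioms)
  show ?thesis
  proof (rule SB.irreducible_lattice_of_endomorphisms[OF SA.PID lam'_nz lattice_image[OF latV] image_nonzero[OF L nz]])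
    fix \<alpha>' assume \<alpha>': "module_map B (Fo V) (Fo V) \<alpha>'" and nz': "\<exists>y\<in>carrier (Fo V). \<alpha>' y \<noteq> \<zero>\<^bsub>Fo V\<^esub>"
    obtain \<alpha> where \<alpha>: "module_map A V V \<alpha>" "\<And>y. y \<in> carrier (Fo V) \<Longrightarrow> F.Fmap V V \<alpha> y = \<alpha>' y"
      by (rule full[OF L L \<alpha>']) (rule that)
    have "\<exists>v\<in>carrier V. \<alpha> v \<noteq> \<zero>\<^bsub>V\<^esub>"
    proof (rule ccontr)
      assume "\<not> (\<exists>v\<in>carrier V. \<alpha> v \<noteq> \<zero>\<^bsub>V\<^esub>)"
      then have "F.Fmap V V \<alpha> = F.Fmap V V (\<lambda>x. \<zero>\<^bsub>V\<^esub>)" by (intro F.map_cong) auto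
      then show False using nz' \<alpha>(2) F.map_zero[OF L L] by auto
    qed
    from frac_alg.irreducible_lattice_endomorphism[OF FA V \<alpha>(1) this] obtain \<gamma> d where
      \<gamma>: "module_map A V V \<gamma>" and d: "d \<noteq> 0" "\<And>v. v \<in> carrier V \<Longrightarrow> \<alpha> (\<gamma> v) = (d \<odot>\<^bsub>A\<^esub> \<one>\<^bsub>A\<^esub>) \<odot>\<^bsub>V\<^esub> v" by blast
    have "\<alpha>' (F.Fmap V V \<gamma> y) = (d \<odot>\<^bsub>B\<^esub> \<one>\<^bsub>B\<^esub>) \<odot>\<^bsub>Fo V\<^esub> y" if y: "y \<in> carrier (Fo V)" for y
    proof -
      have "\<alpha>' (F.Fmap V V \<gamma> y) = F.Fmap V V (\<lambda>x. \<alpha> (\<gamma> x)) y"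
        using F.map_compose[OF L L L \<gamma> \<alpha>(1) y] \<alpha>(2)[OF module_map_closed[OF F.map[OF L L \<gamma>] y]] by simp
      also have "F.Fmap V V (\<lambda>x. \<alpha> (\<gamma> x)) = F.Fmap V V (\<lambda>x. (d \<odot>\<^bsub>A\<^esub> \<one>\<^bsub>A\<^esub>) \<odot>\<^bsub>V\<^esub> x)"
        by (rule F.map_cong) (rule d(2))
      also have "\<dots> y = (d \<odot>\<^bsub>B\<^esub> \<one>\<^bsub>B\<^esub>) \<odot>\<^bsub>Fo V\<^esub> y"
        using F.map_smult[OF L L module_map_id y, of d] F.map_id[OF L y] by simp
      finally show ?thesis .
    qed
    then show "\<exists>\<gamma> d. module_map B (Fo V) (Fo V) \<gamma> \<and> d \<noteq> 0 \<and>
        (\<forall>v\<in>carrier (Fo V). \<alpha>' (\<gamma> v) = (d \<odot>\<^bsub>B\<^esub> \<one>\<^bsub>B\<^esub>) \<odot>\<^bsub>Fo V\<^esub> v)"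
      using F.map[OF L L \<gamma>] d(1) by blast
  qed
qed

end

text \<open>
  An automorphism and its inverse are scalars \<open>r\<close> and \<open>q\<close> of the ground ring with \<open>r q = 1\<close>, so the trace
  is the rank times a unit.
\<close>

lemma (in frac_alg) irreducible_lattice_automorphism_trace:
  assumes B: "split_semisimple (frac_algebra A)" and V: "irreducible_lattice A V"
    and \<alpha>: "module_map A V V \<alpha>" and bij: "bij_betw \<alpha> (carrier V) (carrier V)"
  shows "of_nat (lattice_rank A V) dvd lattice_trace A V \<alpha>" "lattice_trace A V \<alpha> dvd of_nat (lattice_rank A V)"
proof -
  have lat: "lattice_over A V" using V by (simp add: irreducible_lattice_def)
  note LV = lattice_overD(1)[OF lat] and fr = lattice_overD(2)[OF lat]
  interpret V: left_module A V by (rule LV)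
  let ?R = "restrict_scalars A V"
  interpret R: left_module type_ring ?R by (rule left_module_restrict_scalars[OF LV])
  let ?b = "inv_into (carrier V) \<alpha>"
  have b: "module_map A V V ?b" by (rule module_map_inverse[OF LV \<alpha> bij])
  obtain r where r: "\<And>v. v \<in> carrier V \<Longrightarrow> \<alpha> v = r \<odot>\<^bsub>?R\<^esub> v"
    using irreducible_lattice_scalar[OF B V \<alpha>] by auto
  obtain q where q: "\<And>v. v \<in> carrier V \<Longrightarrow> ?b v = q \<odot>\<^bsub>?R\<^esub> v"
    using irreducible_lattice_scalar[OF B V b] by auto
  obtain v where v: "v \<in> carrier V" "v \<noteq> \<zero>\<^bsub>V\<^esub>"
    using irreducible_lattice_nonzero[OF V] V.M.zero_closed by blast
  have "(r * q) \<odot>\<^bsub>?R\<^esub> v = \<alpha> (?b v)"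
    using r[OF module_map_closed[OF b v(1)]] q[OF v(1)] R.smult_assoc[of r q v] v(1) by simp
  also have "\<dots> = v" using bij v(1) by (auto simp: bij_betw_def f_inv_into_f)
  finally have rqv: "(r * q) \<odot>\<^bsub>?R\<^esub> v = v" .
  have "(r * q - 1) \<odot>\<^bsub>?R\<^esub> v = \<zero>\<^bsub>?R\<^esub>"
  proof -
    have "(r * q - 1) \<odot>\<^bsub>?R\<^esub> v \<oplus>\<^bsub>?R\<^esub> v = v"
      using R.smult_l_distr[of "r * q - 1" 1 v] R.smult_one[of v] v(1) rqv
      by (simp del: restrict_scalars_simps(2-4))
    then show ?thesis
      using R.smult_closed[of "r * q - 1" v] v(1) by (simp add: V.M.add.r_cancel_one)
  qed
  then have rq: "r * q = 1"
    using free_torsion_free[OF fr, of v "r * q - 1"] v by auto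
  have "lattice_trace A V \<alpha> = module_trace ?R (\<lambda>v. r \<odot>\<^bsub>?R\<^esub> v)"
    by (rule module_trace_cong[OF fr]) (use r in simp)
  also have "\<dots> = r * of_nat (lattice_rank A V)"
    using module_trace_smult[OF fr, of "\<lambda>x. x" r] lattice_trace_id[OF lat] by simp
  finally have t: "lattice_trace A V \<alpha> = r * of_nat (lattice_rank A V)" .
  then show "of_nat (lattice_rank A V) dvd lattice_trace A V \<alpha>" by simp
  have "of_nat (lattice_rank A V) = lattice_trace A V \<alpha> * q"
    unfolding t using rq by (simp add: ac_simps)
  then show "lattice_trace A V \<alpha> dvd of_nat (lattice_rank A V)" by (rule dvdI)
qed

section \<open>Heights\<close>

text \<open>
  Both sides say that \<open>n\<close> is zero in the residue field.
\<close>

lemma residue_char_dvd: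
  fixes \<pi> :: "'o::idom"
  assumes "has_char (residue_field \<pi>) p"
  shows "\<pi> dvd of_nat n \<longleftrightarrow> p dvd n"
proof -
  interpret T: cring "type_ring :: 'o ring" by (rule cring_from_type_algebra)
  have I: "ideal (PIdl\<^bsub>type_ring\<^esub> \<pi>) type_ring" by (rule T.cgenideal_ideal) simp
  interpret I: ideal "PIdl\<^bsub>type_ring\<^esub> \<pi>" "type_ring :: 'o ring" by (rule I)
  interpret Q: ring "residue_field \<pi>" unfolding residue_field_def by (rule I.quotient_is_ring)
  let ?c = "\<lambda>x :: 'o. PIdl\<^bsub>type_ring\<^esub> \<pi> +>\<^bsub>type_ring\<^esub> x"
  have hom: "ring_hom_ring type_ring (residue_field \<pi>) ?c"
    unfolding residue_field_def by (rule I.rcos_ring_hom_ring)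
  interpret h: ring_hom_ring "type_ring :: 'o ring" "residue_field \<pi>" ?c by (rule hom)
  have nat: "[n] \<cdot>\<^bsub>residue_field \<pi>\<^esub> \<one>\<^bsub>residue_field \<pi>\<^esub> = ?c (of_nat n)" for n :: nat
  proof (induction n)
    case 0
    then show ?case using h.hom_zero by (simp add: Q.add.nat_pow_0)
  next
    case (Suc n)
    have "?c (of_nat n + 1) = ?c (of_nat n) \<oplus>\<^bsub>residue_field \<pi>\<^esub> ?c 1"
      using h.hom_add[of "of_nat n" 1] by simp
    then show ?case using Suc h.hom_one by (simp add: Q.add.nat_pow_Suc add.commute)
  qed
  have "p dvd n \<longleftrightarrow> ?c (of_nat n) = \<zero>\<^bsub>residue_field \<pi>\<^esub>"
    using assms nat unfolding has_char_def by metis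
  also have "\<dots> \<longleftrightarrow> of_nat n \<in> PIdl\<^bsub>type_ring\<^esub> \<pi>"
  proof -
    have "\<zero>\<^bsub>residue_field \<pi>\<^esub> = PIdl\<^bsub>type_ring\<^esub> \<pi>"
      by (simp add: residue_field_def FactRing_def)
    then show ?thesis
      using I.rcos_const_imp_mem[of "of_nat n"] I.a_rcos_const[of "of_nat n"] by (metis UNIV_I type_ring_simps(1))
  qed
  finally show ?thesis by (simp add: type_ring_PIdl)
qed

text \<open>
  Divisibility of integers in the ground ring is controlled by \<open>p\<close> alone: an integer prime to \<open>p\<close>
  is not divisible by \<open>\<pi>\<close>.
\<close>

lemma multiplicity_le_of_dvd:
  fixes \<pi> :: "'o::idom" and m n :: nat
  assumes p: "Factorial_Ring.prime p" and \<pi>: "\<And>n. \<pi> dvd of_nat n \<longleftrightarrow> p dvd n"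
    and char0: "\<And>n::nat. of_nat n = (0::'o) \<Longrightarrow> n = 0"
    and mn: "m \<noteq> 0" "n \<noteq> 0" and dvd: "(of_nat m :: 'o) dvd of_nat n"
  shows "multiplicity p m \<le> multiplicity p n"
proof (rule ccontr)
  let ?a = "multiplicity p m" and ?b = "multiplicity p n"
  assume "\<not> ?a \<le> ?b"
  then have "p ^ Suc ?b dvd m" by (intro multiplicity_dvd') simp
  then obtain m' where m': "m = p ^ ?b * (p * m')" by (auto simp: dvd_def mult.assoc mult.left_commute)
  obtain n' where n': "n = p ^ ?b * n'" "\<not> p dvd n'"
  proof (rule multiplicity_decompose'[OF mn(2)])
    show "\<not> is_unit p" using prime_gt_1_nat[OF p] by simp
  qed (rule that)
  obtain k where k: "of_nat n = (of_nat m :: 'o) * k" using dvd by (auto simp: dvd_def)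
  have "(of_nat (p ^ ?b) :: 'o) * of_nat n' = of_nat n"
    by (rule arg_cong[where f = "of_nat :: nat \<Rightarrow> 'o", OF n'(1), unfolded of_nat_mult, symmetric])
  also have "\<dots> = of_nat m * k" by (rule k)
  also have "(of_nat m :: 'o) = of_nat (p ^ ?b) * (of_nat p * of_nat m')"
    by (rule arg_cong[where f = "of_nat :: nat \<Rightarrow> 'o", OF m', unfolded of_nat_mult])
  finally have eq: "(of_nat (p ^ ?b) :: 'o) * of_nat n' = of_nat (p ^ ?b) * (of_nat p * of_nat m' * k)"
    by (simp only: mult.assoc)
  have nz: "(of_nat (p ^ ?b) :: 'o) \<noteq> 0"
  proof -
    have "p ^ ?b \<noteq> 0" using prime_gt_0_nat[OF p] by simp
    then show ?thesis using char0[of "p ^ ?b"] by (elim contrapos_nn)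
  qed
  have "of_nat n' = (of_nat p :: 'o) * of_nat m' * k" by (rule iffD1[OF mult_left_cancel[OF nz] eq])
  moreover have "\<pi> dvd of_nat p" using \<pi> by simp
  ultimately have "\<pi> dvd of_nat n'" by simp
  then show False using \<pi> n'(2) by simp
qed

lemma multiplicity_p_part:
  assumes "Factorial_Ring.prime p"
  shows "multiplicity p (p_part p n) = multiplicity p n"
  unfolding p_part_def using assms by (intro multiplicity_same_power) (auto simp: not_prime_unit)

text \<open>
  The existence of an irreducible lattice is essential here, since the infimum of the empty set of
  natural numbers is zero by convention.
\<close>

lemma min_p_part_attained:
  fixes A :: "('o::idom, 'a) module"
  assumes p: "Factorial_Ring.prime p" and V: "irreducible_lattice A (V :: ('a, 'v) module)"
  obtains V0 :: "('a, 'v) module" where "irreducible_lattice A V0"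
    "multiplicity p (min_p_part p A TYPE('v)) = multiplicity p (lattice_rank A V0)"
    "\<And>V :: ('a, 'v) module. irreducible_lattice A V \<Longrightarrow> multiplicity p (lattice_rank A V0) \<le> multiplicity p (lattice_rank A V)"
proof -
  let ?S = "{p_part p (lattice_rank A V) | V :: ('a, 'v) module. irreducible_lattice A V}"
  have "Inf ?S \<in> ?S" by (rule Inf_nat_def1) (use V in blast)
  then obtain V0 :: "('a, 'v) module" where V0: "irreducible_lattice A V0" "Inf ?S = p_part p (lattice_rank A V0)" by auto
  show ?thesis
  proof (rule that[OF V0(1)])
    show "multiplicity p (min_p_part p A TYPE('v)) = multiplicity p (lattice_rank A V0)"
      unfolding min_p_part_def V0(2) by (rule multiplicity_p_part[OF p])
    fix V :: "('a, 'v) module" assume "irreducible_lattice A V"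
    then have "Inf ?S \<le> p_part p (lattice_rank A V)" by (intro cInf_lower) auto
    then have "p ^ multiplicity p (lattice_rank A V0) \<le> p ^ multiplicity p (lattice_rank A V)"
      unfolding V0(2) by (simp only: p_part_def)
    then show "multiplicity p (lattice_rank A V0) \<le> multiplicity p (lattice_rank A V)"
      using prime_gt_1_nat[OF p] by simp
  qed
qed

text \<open>
  Multiplying the two relations crosswise eliminates the scalars \<open>x\<close> and \<open>y\<close>, which need not be
  integers.
\<close>

lemma multiplicity_add_of_associated:
  fixes \<pi> x y :: "'o::idom" and a b c d :: nat
  assumes p: "Factorial_Ring.prime p" and \<pi>: "\<And>n. \<pi> dvd of_nat n \<longleftrightarrow> p dvd n"
    and char0: "\<And>n::nat. of_nat n = (0::'o) \<Longrightarrow> n = 0"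
    and nz: "a \<noteq> 0" "b \<noteq> 0" "c \<noteq> 0" "d \<noteq> 0" "x \<noteq> 0" "y \<noteq> 0"
    and ab: "x * of_nat a dvd y * of_nat b" "y * of_nat b dvd x * of_nat a"
    and cd: "x * of_nat c dvd y * of_nat d" "y * of_nat d dvd x * of_nat c"
  shows "multiplicity p a + multiplicity p d = multiplicity p b + multiplicity p c"
proof -
  have mult: "multiplicity p (m * n) = multiplicity p m + multiplicity p n" if "m \<noteq> 0" "n \<noteq> 0" for m n :: nat
    using that p by (intro prime_elem_multiplicity_mult_distrib) auto
  have "x * of_nat a * (y * of_nat d) dvd y * of_nat b * (x * of_nat c)"
    by (rule mult_dvd_mono[OF ab(1) cd(2)])
  then have "x * y * of_nat (a * d) dvd x * y * of_nat (b * c)" by (simp add: mult_ac)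
  then have 1: "(of_nat (a * d) :: 'o) dvd of_nat (b * c)" using nz by (simp only: dvd_mult_cancel_left) simp
  have "y * of_nat b * (x * of_nat c) dvd x * of_nat a * (y * of_nat d)"
    by (rule mult_dvd_mono[OF ab(2) cd(1)])
  then have "x * y * of_nat (b * c) dvd x * y * of_nat (a * d)" by (simp add: mult_ac)
  then have 2: "(of_nat (b * c) :: 'o) dvd of_nat (a * d)" using nz by (simp only: dvd_mult_cancel_left) simp
  have "multiplicity p (a * d) = multiplicity p (b * c)"
    using multiplicity_le_of_dvd[OF p \<pi> char0 _ _ 1] multiplicity_le_of_dvd[OF p \<pi> char0 _ _ 2] nz
    by (intro antisym) auto
  then show ?thesis using mult nz by simp
qed

lemma of_nat_inj_of_char0:
  assumes "\<And>n::nat. of_nat n = (0::'o::comm_ring_1) \<Longrightarrow> n = 0" and "(of_nat m :: 'o) = of_nat n"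
  shows "m = n"
proof -
  have "(of_nat (m - n) :: 'o) = 0" "(of_nat (n - m) :: 'o) = 0"
    using assms(2) by (cases "m \<le> n"; simp add: of_nat_diff)+
  then have "m - n = 0" "n - m = 0" using assms(1) by blast+
  then show ?thesis by simp
qed

text \<open>
  The exponents of \<open>p\<close> in the ranks of \<open>U\<close> and of all irreducible lattices are shifted by the same
  amount. For the comparison of the minima, an irreducible lattice of minimal rank over \<open>A\<close> is sent to an irreducible
  lattice over \<open>B\<close>, and one over \<open>B\<close> is sent back and then recovered up to isomorphism.
\<close>

lemma (in equivalence_psp) height_image:
  fixes \<pi> :: 'o
  assumes p: "Factorial_Ring.prime p" and \<pi>: "\<And>n. \<pi> dvd of_nat n \<longleftrightarrow> p dvd n"
    and char0: "\<And>n::nat. of_nat n = (0::'o) \<Longrightarrow> n = 0"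
    and split: "split_semisimple (frac_algebra A)" and U: "knoerr_lattice A U"
  shows "lattice_height p B (Fo U) = lattice_height p A U"
proof -
  have FA: "frac_alg A" by (rule frac_alg.intro) (rule A.assoc_alg_axioms)
  have latU: "lattice_over A U" and nzU: "carrier U \<noteq> {\<zero>\<^bsub>U\<^esub>}"
    using U by (auto simp: knoerr_lattice_def indecomposable_module_def)
  have Urk: "lam * of_nat (lattice_rank B (Fo U)) dvd lam' * of_nat (lattice_rank A U)"
    "lam' * of_nat (lattice_rank A U) dvd lam * of_nat (lattice_rank B (Fo U))"
    by (rule rank_image[OF latU]; use U in \<open>simp add: knoerr_lattice_iff\<close>)+
  have nonzero: "lattice_rank A V \<noteq> 0" "lattice_rank B (Fo V) \<noteq> 0"
    if "lattice_over A V" "carrier V \<noteq> {\<zero>\<^bsub>V\<^esub>}" for V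
    by (rule lattice_rank_nonzero[OF that])
      (rule lattice_rank_nonzero[OF lattice_image[OF that(1)] image_nonzero[OF lattice_overD(1)[OF that(1)] that(2)]])
  have shift: "multiplicity p (lattice_rank B (Fo V)) + multiplicity p (lattice_rank A U)
      = multiplicity p (lattice_rank A V) + multiplicity p (lattice_rank B (Fo U))"
    if V: "irreducible_lattice A V" for V
  proof -
    have latV: "lattice_over A V" using V by (simp add: irreducible_lattice_def)
    have aut: "of_nat (lattice_rank A V) dvd lattice_trace A V \<alpha> \<and> lattice_trace A V \<alpha> dvd of_nat (lattice_rank A V)"
      if "module_map A V V \<alpha>" "bij_betw \<alpha> (carrier V) (carrier V)" for \<alpha>
      using frac_alg.irreducible_lattice_automorphism_trace[OF FA split V that] by simp
    show ?thesis
      by (rule multiplicity_add_of_associated[OF p \<pi> char0 _ _ _ _ lam_nz lam'_nz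
            rank_image[OF latV aut] Urk])
        (use nonzero[OF latV irreducible_lattice_nonzero[OF V]] nonzero[OF latU nzU] in simp_all)
  qed
  have image: "irreducible_lattice B (Fo V)" if "irreducible_lattice A V" for V
    by (rule irreducible_image[OF that])
  \<comment> \<open>There are irreducible lattices to take the minimum over, for instance inside \<open>U\<close>.\<close>
  obtain N where N: "irreducible_lattice A (U\<lparr>carrier := N\<rparr>)"
    using frac_alg.irreducible_sublattice[OF FA SA.PID latU nzU] by blast
  obtain V0 :: "('a, 'u) module" where V0: "irreducible_lattice A V0"
      "multiplicity p (min_p_part p A TYPE('u)) = multiplicity p (lattice_rank A V0)"
      "\<And>V :: ('a, 'u) module. irreducible_lattice A V \<Longrightarrow>
        multiplicity p (lattice_rank A V0) \<le> multiplicity p (lattice_rank A V)"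
    by (rule min_p_part_attained[OF p N]) (rule that)
  obtain W0 :: "('b, 'u) module" where W0: "irreducible_lattice B W0"
      "multiplicity p (min_p_part p B TYPE('u)) = multiplicity p (lattice_rank B W0)"
      "\<And>W :: ('b, 'u) module. irreducible_lattice B W \<Longrightarrow>
        multiplicity p (lattice_rank B W0) \<le> multiplicity p (lattice_rank B W)"
    by (rule min_p_part_attained[OF p image[OF N]]) (rule that)
  interpret S: equivalence_psp B A Go Gm Fo Fm P' e' P e \<Phi>' lam' \<Phi> lam by (rule swap_psp)
  have GW0: "irreducible_lattice A (Go W0)"
    by (rule S.irreducible_image[OF W0(1)])
  have latW0: "lattice_over B W0" using W0(1) by (simp add: irreducible_lattice_def)
  have latGW0: "lattice_over B (Fo (Go W0))" by (rule lattice_image[OF S.lattice_image[OF latW0]])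
  \<comment> \<open>The counit identifies \<open>W0\<close> with \<open>F (G W0)\<close>.\<close>
  note \<theta> = S.eta_map[OF lattice_overD(1)[OF latW0]] S.eta_bij[OF lattice_overD(1)[OF latW0]]
  have eq: "(of_nat (lattice_rank B (Fo (Go W0))) :: 'o) = of_nat (lattice_rank B W0)"
    by (rule lattice_rank_iso[OF B.assoc_algebra latW0 latGW0 \<theta>])
  have rkW0: "lattice_rank B (Fo (Go W0)) = lattice_rank B W0"
    by (rule of_nat_inj_of_char0[OF _ eq]) (rule char0)
  show ?thesis
    unfolding lattice_height_def multiplicity_p_part[OF p] V0(2) W0(2)
    using shift[OF V0(1)] shift[OF GW0, unfolded rkW0] V0(3)[OF GW0] W0(3)[OF image[OF V0(1)]] by linarith
qed

section \<open>Morita invariance of Knoerr lattices and heights\<close>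

lemma psp_alg_exists:
  assumes "projective_scalar_property A"
  obtains \<Phi> lam where "psp_alg A \<Phi> lam"
proof -
  have A: "assoc_algebra A" "free_finite_rank A"
    using assms by (simp_all add: projective_scalar_property_def symmetric_algebra_def)
  obtain \<Phi> lam where \<Phi>: "dual_bimodule_iso A \<Phi>" and lam: "rel_proj_elt A (\<Phi> \<one>\<^bsub>A\<^esub>) = lam \<odot>\<^bsub>A\<^esub> \<one>\<^bsub>A\<^esub>"
    using assms by (auto simp: projective_scalar_property_def symmetrising_form_def)
  interpret symm_alg A \<Phi> by (intro symm_alg.intro symm_alg_axioms.intro assoc_alg.intro A \<Phi>)
  show ?thesis
    by (rule that[of \<Phi> lam], intro psp_alg.intro psp_alg_axioms.intro symm_alg_axioms)
      (use lam in \<open>simp add: proj_elt_def s_def\<close>)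
qed

lemma (in assoc_alg) trivial_module:
  assumes V: "left_module A V" and "carrier A = {\<zero>}"
  shows "carrier V = {\<zero>\<^bsub>V\<^esub>}"
proof -
  interpret V: left_module A V by (rule V)
  have "v = \<zero>\<^bsub>V\<^esub>" if v: "v \<in> carrier V" for v
  proof -
    have "\<one> = \<zero>" using assms(2) one_closed by blast
    then have "\<one> \<odot>\<^bsub>V\<^esub> v = \<zero> \<odot>\<^bsub>V\<^esub> v" by simp
    then show ?thesis using V.smult_one[OF v] V.smult_l_zero[OF v] by simp
  qed
  then show ?thesis using V.M.zero_closed by blast
qed

theorem theorem1p11:
  fixes p :: nat
    and \<pi> :: "'o :: idom"
    and A :: "('o, 'a) module"
    and A' :: "('o, 'b) module"
    and Fo :: "('a, 'u) module \<Rightarrow> ('b, 'u) module"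
    and Fm :: "('a, 'u) module \<Rightarrow> ('a, 'u) module \<Rightarrow> ('u \<Rightarrow> 'u) \<Rightarrow> ('u \<Rightarrow> 'u)"
    and U :: "('a, 'u) module"
    and U' :: "('b, 'u) module"
  assumes "Factorial_Ring.prime p"
    and "complete_dvr \<pi>"
    and "has_char (residue_field \<pi>) p"
    and "CHAR('o fract) = 0"
    and "symmetric_algebra A"
    and "split_semisimple (frac_algebra A)"
    and "assoc_algebra A'"
    and "carrier A \<lesssim> (UNIV :: 'u set)"
    and "carrier A' \<lesssim> (UNIV :: 'u set)"
    and "morita_equivalence A A' Fo Fm"
    and "projective_scalar_property A"
    and "projective_scalar_property A'"
    and "knoerr_lattice A U"
    and "lattice_over A' U'"
    and "module_Iso A' (Fo U) U' \<noteq> {}"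
  shows "knoerr_lattice A' U' \<and> lattice_height p A U = lattice_height p A' U'"
proof -
  note p = assms(1) and \<pi> = residue_char_dvd[OF assms(3)]
  have PID: "principal_domain (type_ring :: 'o ring)" using assms(2) by (simp add: complete_dvr_def)
  have char0: "n = 0" if "of_nat n = (0::'o)" for n :: nat
  proof -
    have "(of_nat n :: 'o fract) = Fract (of_nat n) 1" by (rule of_nat_fract)
    also have "\<dots> = 0" using that by (simp add: Zero_fract_def)
    finally show ?thesis using assms(4) by (simp add: of_nat_eq_0_iff_char_dvd)
  qed
  have A: "assoc_algebra A" using assms(5) by (simp add: symmetric_algebra_def)
  obtain \<Phi> lam where \<Phi>: "psp_alg A \<Phi> lam" by (rule psp_alg_exists[OF assms(11)]) (rule that)
  obtain \<Phi>' lam' where \<Phi>': "psp_alg A' \<Phi>' lam'" by (rule psp_alg_exists[OF assms(12)]) (rule that)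
  obtain P :: "('a, 'u) module" and e where P: "free_on A P e"
    by (rule free_on_exists[OF A assms(8)]) (rule that)
  obtain P' :: "('b, 'u) module" and e' where P': "free_on A' P' e'"
    by (rule free_on_exists[OF assms(7,9)]) (rule that)
  obtain Go Gm where G: "linear_functor A' A Go Gm"
      "naturally_iso_to_identity A (Go \<circ> Fo) (\<lambda>M N. Gm (Fo M) (Fo N) \<circ> Fm M N)"
      "naturally_iso_to_identity A' (Fo \<circ> Go) (\<lambda>M N. Fm (Go M) (Go N) \<circ> Gm M N)"
    and F: "linear_functor A A' Fo Fm"
    using assms(10) unfolding morita_equivalence_def by blast
  have eq: "equivalence A A' Fo Fm Go Gm"
    by (intro equivalence.intro equivalence_axioms.intro assoc_alg.intro lin_functor.intro A assms(7) F G)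
  interpret E: equivalence A A' Fo Fm Go Gm by (rule eq)
  interpret SA: psp_alg A \<Phi> lam by (rule \<Phi>)
  interpret SB: psp_alg A' \<Phi>' lam' by (rule \<Phi>')
  have latU: "lattice_over A U" and nzU: "carrier U \<noteq> {\<zero>\<^bsub>U\<^esub>}"
    using assms(13) by (auto simp: knoerr_lattice_def indecomposable_module_def)
  note LU = lattice_overD(1)[OF latU]
  \<comment> \<open>Neither algebra is zero, as each of them has a nonzero module.\<close>
  have "lam \<noteq> 0"
    by (rule SA.lam_nonzero[OF char0]) (use E.A.trivial_module[OF LU] nzU in blast)+
  moreover have "lam' \<noteq> 0"
    by (rule SB.lam_nonzero[OF char0]) (use E.B.trivial_module[OF E.F.ob[OF LU]] E.image_nonzero[OF LU nzU] in blast)+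
  ultimately interpret E: equivalence_psp A A' Fo Fm Go Gm P e P' e' \<Phi> lam \<Phi>' lam'
    by (intro equivalence_psp.intro equivalence_psp_axioms.intro equivalence_free.intro
        free_psp.intro free_psp_axioms.intro eq \<Phi> \<Phi>' P P' PID)
  have kn: "knoerr_lattice A' (Fo U)" by (rule E.knoerr_image[OF assms(13)])
  have latFU: "lattice_over A' (Fo U)" by (rule E.lattice_image[OF latU])
  obtain \<psi> where \<psi>: "module_map A' (Fo U) U' \<psi>" "bij_betw \<psi> (carrier (Fo U)) (carrier U')"
    using assms(15) by (auto simp: module_Iso_def module_Hom_iff)
  have kn': "knoerr_lattice A' U'" by (rule knoerr_lattice_iso[OF assms(7) kn assms(14) \<psi>])
  have rk: "(of_nat (lattice_rank A' U') :: 'o) = of_nat (lattice_rank A' (Fo U))"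
    by (rule lattice_rank_iso[OF assms(7) latFU assms(14) \<psi>])
  have "lattice_rank A' U' = lattice_rank A' (Fo U)"
    by (rule of_nat_inj_of_char0[OF _ rk]) (rule char0)
  then have "lattice_height p A' U' = lattice_height p A' (Fo U)"
    by (simp add: lattice_height_def)
  also have "\<dots> = lattice_height p A U"
    by (rule E.height_image[OF p \<pi> char0 assms(6,13)])
  finally show ?thesis using kn' by simp
qed

end
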